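(* Let $\Gamma\subset SL(2,\mathbb Z)$ be a congruence subgroup. Then \[ \sum_{N\ge 0}\dim \mathscr D^{ch}(\mathbb H,\Gamma)_N\, q^N=\sum_{m=0}^\infty \sum_{n= 0}^\infty \dim M_{2m}(\Gamma)\, q^{2n+m}\prod_{i=1}^n \frac{1}{1-q^i} \prod_{j=1}^{m+n}\frac{1}{1-q^j}, \] where $\mathscr D^{ch}(\mathbb H,\Gamma)_N$ is the conformal weight $N$ subspace of $\mathscr D^{ch}(\mathbb H,\Gamma)$.
   Context: Let $\mathbb H=\{\tau\in\mathbb C:\operatorname{Im}\tau>0\}$ and $\mathcal O(\mathbb H)$ its ring of holomorphic functions. Let $V=\mathbb C[a_{-1},a_{-2},\dots,b_0,b_{-1},b_{-2},\dots]$ be the vacuum module of the Heisenberg Lie algebra with basis $a_n,b_n$ ($n\in\mathbb Z$) and central element $C$, $[a_m,b_n]=\delta_{m,-n}C$ (with $a_m1=0$ for $m\ge0$, $b_n1=0$ for $n>0$, $C=1$); it is a vertex algebra with fields $a(z)=\sum_n a_nz^{-n-1}$, $b(z)=\sum_n b_nz^{-n}$ and conformal vector $\omega=a_{-1}b_{-1}$. The vertex algebra of chiral differential operators on $\mathbb H$ (Malikov–Schechtman–Vaintrob) is $\mathscr D^{ch}(\mathbb H)=V\otimes_{\mathbb C[b_0]}\mathcal O(\mathbb H)$, where $b_0\mapsto\tau$; write $b=b_0$. For $f\in\mathcal O(\mathbb H)$, $Y(f,z)=\sum_{i\ge0}\frac{f^{(i)}(b)}{i!}\big(\sum_{n\ne0}b_nz^{-n}\big)^i$.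 Conformal weight: $a_{-n},b_{-n}$ have weight $n$, elements of $\mathcal O(\mathbb H)$ weight $0$. For a partition $\lambda=(\lambda_{(1)}\ge\dots\ge\lambda_{(d)}\ge1)$ let $p(\lambda)=d$, $|\lambda|=\sum_i\lambda_{(i)}$, $a_{-\lambda}=a_{-\lambda_{(1)}}\cdots a_{-\lambda_{(d)}}$, similarly $b_{-\mu}$ (empty partition allowed, $a_{-\emptyset}=b_{-\emptyset}=1$). Every element of $\mathscr D^{ch}(\mathbb H)$ is uniquely a finite sum $\sum a_{-\lambda}b_{-\mu}f_{\lambda,\mu}(b)$ with $f_{\lambda,\mu}\in\mathcal O(\mathbb H)$. The group $SL(2,\mathbb R)$ acts on the right on $\mathscr D^{ch}(\mathbb H)$ by vertex algebra automorphisms $\pi(g)$ (so $\pi(g_1g_2)=\pi(g_2)\pi(g_1)$), obtained by integrating the action of the zero modes of $E=-a_{-1}$, $F=a_{-1}b_0^2+2b_{-1}$, $H=-2a_{-1}b_0$ via $\pi(e^x)=\exp(-x_{(0)})$; for $g=\begin{pmatrix}\alpha&\beta\\\gamma&\delta\end{pmatrix}$ it satisfies $\pi(g)a_{-1}=a_{-1}(\gamma b+\delta)^2+2\gamma^2b_{-1}$ and $\pi(g)f(b)=f\big(\frac{\alpha b+\beta}{\gamma b+\delta}\big)$; it preserves conformal weight. Let $\Gamma\subset SL(2,\mathbb Z)$ be a congruence subgroup. For a $\Gamma$-invariant $v$ and a cusp $c\in\mathbb Q\cup\{\infty\}$ choose $\rho\in SL(2,\mathbb Z)$ with $\rho(c)=\infty$;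 then $\pi(\rho)v=\sum a_{-\lambda}b_{-\mu}\tilde f_{\lambda,\mu}$ is fixed by $\begin{pmatrix}1&N\\0&1\end{pmatrix}$ for some integer $N>0$, so each $\tilde f_{\lambda,\mu}$ has an expansion $\sum_m\tilde u_{\lambda,\mu}(m)e^{2\pi i m\tau/N}$; $v$ is holomorphic at $c$ if $\tilde u_{\lambda,\mu}(m)=0$ for all $m<0$ and all $(\lambda,\mu)$. $\mathscr D^{ch}(\mathbb H,\Gamma)$ denotes the set of $\Gamma$-invariant elements of $\mathscr D^{ch}(\mathbb H)$ holomorphic at all cusps. $M_k(\Gamma)$ is the space of holomorphic modular forms of weight $k$ for $\Gamma$ (holomorphic at all cusps). *)

theory Defs
  imports "HOL-Complex_Analysis.Complex_Analysis" "HOL-Library.Multiset"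
    "HOL-Library.Extended_Real" "HOL-Computational_Algebra.Formal_Power_Series"
begin

definition Hp :: "complex set" where "Hp = {\<tau>. Im \<tau> > 0}"

text \<open>Functions on the upper half plane are represented by functions on C that vanish
  outside Hp (so that equality of elements is equality on Hp).\<close>
definition rH :: "(complex \<Rightarrow> complex) \<Rightarrow> complex \<Rightarrow> complex" where
  "rH f = (\<lambda>\<tau>. if Im \<tau> > 0 then f \<tau> else 0)"

text \<open>A monomial a_{-lambda} b_{-mu} is indexed by the pair of partitions (lambda, mu),
  encoded as multisets of positive naturals.  An element of D^ch(H) is
  sum a_{-lambda} b_{-mu} f_{lambda,mu}(b), encoded as the coefficient map.\<close>
type_synonym mon = "nat multiset \<times> nat multiset"
type_synonym dch = "mon \<Rightarrow> complex \<Rightarrow> complex"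

definition dzero :: dch where "dzero = (\<lambda>p \<tau>. 0)"
definition dadd :: "dch \<Rightarrow> dch \<Rightarrow> dch" where "dadd v w = (\<lambda>p \<tau>. v p \<tau> + w p \<tau>)"
definition dscale :: "complex \<Rightarrow> dch \<Rightarrow> dch" where "dscale c v = (\<lambda>p \<tau>. c * v p \<tau>)"
definition dmulf :: "(complex \<Rightarrow> complex) \<Rightarrow> dch \<Rightarrow> dch" where
  "dmulf h v = (\<lambda>p \<tau>. h \<tau> * v p \<tau>)"

text \<open>Sum of a family with only finitely many nonzero members (the infinite sums occurring
  in the action of field modes on a fixed vector are of this kind).\<close>
definition dfsum :: "('i \<Rightarrow> dch) \<Rightarrow> 'i set \<Rightarrow> dch" where
  "dfsum F S = (\<lambda>p \<tau>. \<Sum>i\<in>{i\<in>S. F i \<noteq> dzero}. F i p \<tau>)"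

definition dch_elem :: "dch \<Rightarrow> bool" where
  "dch_elem v \<longleftrightarrow> finite {p. v p \<noteq> (\<lambda>\<tau>. 0)}
     \<and> (\<forall>l m. v (l, m) \<noteq> (\<lambda>\<tau>. 0) \<longrightarrow> 0 \<notin># l \<and> 0 \<notin># m)
     \<and> (\<forall>p. v p holomorphic_on Hp)
     \<and> (\<forall>p \<tau>. Im \<tau> \<le> 0 \<longrightarrow> v p \<tau> = 0)"

definition cweight :: "mon \<Rightarrow> nat" where
  "cweight p = sum_mset (fst p) + sum_mset (snd p)"

text \<open>a_n: creation for n<0; a_0 = d/db; a_n = d/d b_{-n} for n>0 (since [a_n,b_{-n}]=1).\<close>
definition aop :: "int \<Rightarrow> dch \<Rightarrow> dch" where
  "aop n v =
    (if n < 0 then (\<lambda>(l, m). if nat (-n) \<in># l then v (l - {#nat (-n)#}, m) else (\<lambda>\<tau>. 0))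
     else if n = 0 then (\<lambda>p. rH (deriv (v p)))
     else (\<lambda>(l, m) \<tau>. of_nat (count m (nat n) + 1) * v (l, add_mset (nat n) m) \<tau>))"

text \<open>b_n: creation for n<0; b_0 = multiplication by b = tau; b_n = - d/d a_{-n} for n>0.\<close>
definition bop :: "int \<Rightarrow> dch \<Rightarrow> dch" where
  "bop n v =
    (if n < 0 then (\<lambda>(l, m). if nat (-n) \<in># m then v (l, m - {#nat (-n)#}) else (\<lambda>\<tau>. 0))
     else if n = 0 then (\<lambda>p \<tau>. \<tau> * v p \<tau>)
     else (\<lambda>(l, m) \<tau>. - of_nat (count l (nat n) + 1) * v (add_mset (nat n) l, m) \<tau>))"

text \<open>Mode j of Y(h,z) = sum_i h^(i)(b)/i! (sum_{n<>0} b_n z^{-n})^i,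
  i.e. the coefficient of z^{-j-1}.\<close>
definition fmode :: "(complex \<Rightarrow> complex) \<Rightarrow> int \<Rightarrow> dch \<Rightarrow> dch" where
  "fmode h j v = dfsum
     (\<lambda>ns. dmulf (rH (\<lambda>\<tau>. (deriv ^^ length ns) h \<tau> / of_nat (fact (length ns))))
                 (foldr bop ns v))
     {ns. (\<forall>x\<in>set ns. x \<noteq> 0) \<and> sum_list ns = j + 1}"

text \<open>Mode m of the field of a_{-1} h(b), namely :a(z) Y(h,z):.\<close>
definition mode_a :: "(complex \<Rightarrow> complex) \<Rightarrow> int \<Rightarrow> dch \<Rightarrow> dch" where
  "mode_a h m v = dfsum
     (\<lambda>k. if k < 0 then aop k (fmode h (m - k - 1) v) else fmode h (m - k - 1) (aop k v))
     UNIV"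

text \<open>Mode m of the field of b_{-1} k(b), namely (d/dz b(z)) Y(k,z).\<close>
definition mode_b :: "(complex \<Rightarrow> complex) \<Rightarrow> int \<Rightarrow> dch \<Rightarrow> dch" where
  "mode_b k m v = dfsum (\<lambda>n. dscale (- of_int n) (bop n (fmode k (m - n - 1) v))) UNIV"

type_synonym rmat = "real \<times> real \<times> real \<times> real"

definition mob :: "rmat \<Rightarrow> complex \<Rightarrow> complex" where
  "mob g \<tau> = (case g of (\<alpha>, \<beta>, \<gamma>, \<delta>) \<Rightarrow>
     (of_real \<alpha> * \<tau> + of_real \<beta>) / (of_real \<gamma> * \<tau> + of_real \<delta>))"

definition const_elem :: "(complex \<Rightarrow> complex) \<Rightarrow> dch" where
  "const_elem f = (\<lambda>p. if p = ({#}, {#}) then f else (\<lambda>\<tau>. 0))"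

text \<open>pi(g) a_{-1} = a_{-1} (gamma b + delta)^2 + 2 gamma^2 b_{-1}; its modes:\<close>
definition Amode :: "rmat \<Rightarrow> int \<Rightarrow> dch \<Rightarrow> dch" where
  "Amode g m w = (case g of (\<alpha>, \<beta>, \<gamma>, \<delta>) \<Rightarrow>
     dadd (mode_a (\<lambda>\<tau>. (of_real \<gamma> * \<tau> + of_real \<delta>)^2) m w)
          (mode_b (\<lambda>\<tau>. 2 * (of_real \<gamma>)^2) m w))"

text \<open>pi(g) b_{-1} = pi(g)(T b) = T(phi(b)) = phi'(b) b_{-1} = b_{-1}/(gamma b + delta)^2; its modes:\<close>
definition Bmode :: "rmat \<Rightarrow> int \<Rightarrow> dch \<Rightarrow> dch" where
  "Bmode g m w = (case g of (\<alpha>, \<beta>, \<gamma>, \<delta>) \<Rightarrow>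
     mode_b (\<lambda>\<tau>. 1 / (of_real \<gamma> * \<tau> + of_real \<delta>)^2) m w)"

text \<open>Since pi(g) is a vertex algebra automorphism and
  a_{-lambda} b_{-mu} f = prod_i (a_{-1})_{(-lambda_i)} prod_j (1/mu_j) (b_{-1})_{(-mu_j)} f,
  pi(g) of this monomial is obtained by replacing a_{-1}, b_{-1}, f by their images.\<close>
definition mono_image :: "rmat \<Rightarrow> mon \<Rightarrow> (complex \<Rightarrow> complex) \<Rightarrow> dch" where
  "mono_image g p f =
     foldr (\<lambda>n w. Amode g (- int n) w) (sorted_list_of_multiset (fst p))
       (foldr (\<lambda>n w. dscale (1 / of_nat n) (Bmode g (- int n) w))
          (sorted_list_of_multiset (snd p))
          (const_elem (rH (\<lambda>\<tau>. f (mob g \<tau>)))))"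

definition pi_act :: "rmat \<Rightarrow> dch \<Rightarrow> dch" where
  "pi_act g v = dfsum (\<lambda>p. mono_image g p (v p)) UNIV"

type_synonym imat = "int \<times> int \<times> int \<times> int"

definition SL2Z :: "imat set" where
  "SL2Z = {(a, b, c, d). a * d - b * c = 1}"

definition imul :: "imat \<Rightarrow> imat \<Rightarrow> imat" where
  "imul x y = (case x of (a, b, c, d) \<Rightarrow> case y of (a', b', c', d') \<Rightarrow>
      (a * a' + b * c', a * b' + b * d', c * a' + d * c', c * b' + d * d'))"

definition iinv :: "imat \<Rightarrow> imat" where
  "iinv x = (case x of (a, b, c, d) \<Rightarrow> (d, - b, - c, a))"

definition principal_cong :: "nat \<Rightarrow> imat set" where
  "principal_cong N = {(a, b, c, d) \<in> SL2Z.
      a mod int N = 1 mod int N \<and> b mod int N = 0 \<and> c mod int N = 0 \<and> d mod int N = 1 mod int N}"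

definition congruence_subgroup :: "imat set \<Rightarrow> bool" where
  "congruence_subgroup \<Gamma> \<longleftrightarrow> \<Gamma> \<subseteq> SL2Z \<and> (1, 0, 0, 1) \<in> \<Gamma>
     \<and> (\<forall>x\<in>\<Gamma>. \<forall>y\<in>\<Gamma>. imul x y \<in> \<Gamma>) \<and> (\<forall>x\<in>\<Gamma>. iinv x \<in> \<Gamma>)
     \<and> (\<exists>N>0. principal_cong N \<subseteq> \<Gamma>)"

definition to_rmat :: "imat \<Rightarrow> rmat" where
  "to_rmat x = (case x of (a, b, c, d) \<Rightarrow> (of_int a, of_int b, of_int c, of_int d))"

definition hol_expansion :: "nat \<Rightarrow> (complex \<Rightarrow> complex) \<Rightarrow> bool" where
  "hol_expansion N F \<longleftrightarrow> (\<exists>u :: int \<Rightarrow> complex. (\<forall>m<0. u m = 0) \<and>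
     (\<forall>\<tau>. Im \<tau> > 0 \<longrightarrow>
        ((\<lambda>m. u m * exp (2 * of_real pi * \<i> * of_int m * \<tau> / of_nat N)) has_sum F \<tau>) UNIV))"

text \<open>Every rho in SL(2,Z) maps exactly one cusp (rho^{-1} infinity) to infinity, so quantifying
  over all cusps c and all rho with rho(c) = infinity is quantifying over all rho in SL(2,Z).\<close>
definition dch_hol_cusps :: "dch \<Rightarrow> bool" where
  "dch_hol_cusps v \<longleftrightarrow> (\<forall>\<rho>\<in>SL2Z. \<exists>N>0.
      pi_act (1, real N, 0, 1) (pi_act (to_rmat \<rho>) v) = pi_act (to_rmat \<rho>) v
      \<and> (\<forall>p. hol_expansion N (pi_act (to_rmat \<rho>) v p)))"

definition Dch_Gamma_wt :: "imat set \<Rightarrow> nat \<Rightarrow> dch set" where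
  "Dch_Gamma_wt \<Gamma> N = {v. dch_elem v \<and> (\<forall>p. v p \<noteq> (\<lambda>\<tau>. 0) \<longrightarrow> cweight p = N)
      \<and> (\<forall>g\<in>\<Gamma>. pi_act (to_rmat g) v = v) \<and> dch_hol_cusps v}"

definition Mk :: "nat \<Rightarrow> imat set \<Rightarrow> (complex \<Rightarrow> complex) set" where
  "Mk k \<Gamma> = {f. (\<forall>\<tau>. Im \<tau> \<le> 0 \<longrightarrow> f \<tau> = 0) \<and> f holomorphic_on Hp
      \<and> (\<forall>g\<in>\<Gamma>. \<forall>\<tau>\<in>Hp. case g of (a, b, c, d) \<Rightarrow>
           f (mob (to_rmat g) \<tau>) = (of_int c * \<tau> + of_int d) ^ k * f \<tau>)
      \<and> (\<forall>\<sigma>\<in>SL2Z. \<exists>N>0. hol_expansion N (\<lambda>\<tau>. case \<sigma> of (a, b, c, d) \<Rightarrow>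
           f (mob (to_rmat \<sigma>) \<tau>) / (of_int c * \<tau> + of_int d) ^ k))}"

definition cindep :: "('x \<Rightarrow> complex) set \<Rightarrow> bool" where
  "cindep B \<longleftrightarrow> finite B \<and>
     (\<forall>c. (\<forall>x. (\<Sum>b\<in>B. c b * b x) = 0) \<longrightarrow> (\<forall>b\<in>B. c b = 0))"

definition cdim :: "('x \<Rightarrow> complex) set \<Rightarrow> enat" where
  "cdim S = Sup {enat (card B) | B. B \<subseteq> S \<and> cindep B}"

definition Gser :: "nat \<Rightarrow> nat \<Rightarrow> real fps" where
  "Gser m n = fps_X ^ (2 * n + m)
     * (\<Prod>i\<in>{1..n}. inverse (1 - fps_X ^ i))
     * (\<Prod>j\<in>{1..m + n}. inverse (1 - fps_X ^ j))"

end

theory Submission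
  imports Defs "HOL-Library.Function_Algebras" "HOL-Number_Theory.Cong"
begin

text \<open>
  Give the monomial \<open>a\<^bsub>-\<lambda>\<^esub> b\<^bsub>-\<mu>\<^esub>\<close> the degree \<open>p(\<mu>) - p(\<lambda>)\<close>. The group preserves the filtration by degree,
  and on the associated graded space the coefficient of a monomial of degree \<open>d\<close> transforms like a
  modular form of weight \<open>2 d\<close>. As there are no nonzero holomorphic modular forms of negative
  weight, peeling off monomials of lowest degree bounds the dimension from above by the sum of
  \<open>dim M\<^bsub>2d\<^esub>(\<Gamma>)\<close> over the monomials of degree \<open>d \<ge> 0\<close>.

  For the converse, every modular form has to be lifted to an invariant element with that leading
  coefficient. The weight two Eisenstein series gives a nowhere vanishing function \<open>F\<close> that
  transforms like a form of weight two up to a constant multiplier. A primitive of \<open>F\<close> is a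
  coordinate on the upper half plane on which the modular group acts by affine maps. Chiral
  differential operators are covariant under changes of coordinate, and affine maps merely rescale
  the monomials written in the new coordinate. Such a monomial times \<open>f / F\<^sup>d\<close> is therefore invariant
  if \<open>f\<close> is modular of weight \<open>2 d\<close>. Counting monomials by the sizes of the two partitions gives the
  stated generating function.
\<close>

text \<open>The action is prescribed on ordered monomials by substituting images of the generators,
  so its compatibility with all modes has to be derived. A coordinate \<open>\<phi>\<close> sends a
  to a h + q' b_{-1} with h = 1 / \<open>\<phi>\<close>'. The modes of the normally ordered product
  a h do not commute, and q' = h'^2 / (2 h) is the correction that repairs this; for a Moebius map
  it is the constant 2 \<gamma>^2 in the definition of the action. A bare product of a monomial with
  a modular form is not invariant, since derivatives of modular forms are only quasimodular. In the
  coordinate \<open>Fp\<close> all these corrections are absorbed. Nothing places the values of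
  \<open>Fp\<close> in the half plane, so the lift is written down by the same formulas and its
  behaviour is checked from the law of \<open>phi2\<close>, half the logarithmic derivative of
  \<open>Fw\<close>. A group element multiplies the lifted monomial of degree d by the d-th power of
  one constant, which division by \<open>Fw\<close>^d cancels; the same cancellation of powers of
  \<open>Fw\<close> gives holomorphy at the cusps. Dimensions are \<open>enat\<close> values, so
  both bounds argue with finite independent sets.\<close>

declare split_paired_All [simp del] split_paired_Ex [simp del]

section \<open>Finitely supported sums over the integers and relative additivity\<close>

lemma sum_fun_apply: "(sum F A) x = (\<Sum>i\<in>A. F i x)" for F :: "'i \<Rightarrow> 'a \<Rightarrow> 'b::comm_monoid_add"
  by (induction A rule: infinite_finite_induct) auto

lemma of_int_fun_apply [simp]: "(of_int k :: 'a \<Rightarrow> 'b::ring_1) x = of_int k"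
  by (cases k rule: int_cases2) (auto simp: fun_Compl_def)

text \<open>Same convention as \<open>dfsum\<close>: the sum runs over the support, so no index
  range has to be named. For infinite support the value is 0, which is why \<open>fsup\<close>
  appears as a side condition whenever sums are combined.\<close>

definition isum :: "(int \<Rightarrow> 'a::ab_group_add) \<Rightarrow> 'a" where
  "isum F = sum F {k. F k \<noteq> 0}"

definition fsup :: "(int \<Rightarrow> 'a::ab_group_add) \<Rightarrow> bool" where
  "fsup F \<longleftrightarrow> finite {k. F k \<noteq> 0}"

lemma fsupI: "(\<And>k. \<bar>k\<bar> > B \<Longrightarrow> F k = 0) \<Longrightarrow> fsup F"
  unfolding fsup_def by (rule finite_subset[of _ "{-B..B}"]) force+

lemma isum_eq: "finite A \<Longrightarrow> (\<And>k. k \<notin> A \<Longrightarrow> F k = 0) \<Longrightarrow> isum F = sum F A"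
  unfolding isum_def by (rule sum.mono_neutral_left) auto

lemma isum_cong: "(\<And>k. F k = G k) \<Longrightarrow> isum F = isum G"
  by presburger

lemma isum_0 [simp]: "isum (\<lambda>k. 0) = 0"
  by (simp add: isum_def)

lemma isum_single: "(\<And>k. k \<noteq> j \<Longrightarrow> F k = 0) \<Longrightarrow> isum F = F j"
  by (subst isum_eq[of "{j}"]) auto

lemma isum_add: assumes "fsup F" "fsup G" shows "isum (\<lambda>k. F k + G k) = isum F + isum G"
proof -
  let ?A = "{k. F k \<noteq> 0} \<union> {k. G k \<noteq> 0}"
  have f: "finite ?A" using assms by (auto simp: fsup_def)
  have "isum (\<lambda>k. F k + G k) = sum (\<lambda>k. F k + G k) ?A" by (rule isum_eq[OF f]) auto
  moreover have "isum F = sum F ?A" "isum G = sum G ?A" by (rule isum_eq[OF f]; auto)+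
  ultimately show ?thesis by (simp add: sum.distrib)
qed

lemma isum_uminus: "isum (\<lambda>k. - F k) = - isum F"
  by (simp add: isum_def sum_negf)

lemma fsup_uminus: "fsup F \<Longrightarrow> fsup (\<lambda>k. - F k)"
  by (simp add: fsup_def)

lemma fsup_add: "fsup F \<Longrightarrow> fsup G \<Longrightarrow> fsup (\<lambda>k. F k + G k)"
  unfolding fsup_def by (rule finite_subset[of _ "{k. F k \<noteq> 0} \<union> {k. G k \<noteq> 0}"]) auto

lemma isum_diff: "fsup F \<Longrightarrow> fsup G \<Longrightarrow> isum (\<lambda>k. F k - G k) = isum F - isum G"
  using isum_add[OF _ fsup_uminus, of F G] by (simp add: isum_uminus)

lemma isum_shift: "isum (\<lambda>k. F (k + c)) = isum F"
  unfolding isum_def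
  by (rule sum.reindex_bij_witness[of _ "\<lambda>k. k - c" "\<lambda>k. k + c"]) auto

lemma isum_reflect: "isum (\<lambda>k. F (c - k)) = isum F"
  unfolding isum_def
  by (rule sum.reindex_bij_witness[of _ "\<lambda>k. c - k" "\<lambda>k. c - k"]) auto

lemma isum_mult_left: "fsup F \<Longrightarrow> isum (\<lambda>k. c * F k) = c * isum F" for c :: "'a::ring"
proof -
  assume f: "fsup F"
  have "isum (\<lambda>k. c * F k) = sum (\<lambda>k. c * F k) {k. F k \<noteq> 0}"
    using f by (intro isum_eq) (auto simp: fsup_def)
  thus ?thesis by (simp add: isum_def sum_distrib_left)
qed

text \<open>A uniform box containing the support plays the role of summability; each later use
  supplies such a box from weight estimates.\<close>

lemma isum_swap:
  assumes "\<And>i j. \<bar>i\<bar> > B \<or> \<bar>j\<bar> > B \<Longrightarrow> F i j = 0"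
  shows "isum (\<lambda>i. isum (\<lambda>j. F i j)) = isum (\<lambda>j. isum (\<lambda>i. F i j))"
proof -
  let ?A = "{-B..B}"
  have 0: "i \<notin> ?A \<or> j \<notin> ?A \<Longrightarrow> F i j = 0" for i j by (rule assms) auto
  have "isum (\<lambda>j. F i j) = sum (F i) ?A" for i by (rule isum_eq) (auto intro: 0)
  moreover have "isum (\<lambda>i. F i j) = (\<Sum>i\<in>?A. F i j)" for j by (rule isum_eq) (auto intro: 0)
  moreover have "isum (\<lambda>i. sum (F i) ?A) = (\<Sum>i\<in>?A. sum (F i) ?A)"
    by (rule isum_eq) (auto intro!: sum.neutral 0)
  moreover have "isum (\<lambda>j. \<Sum>i\<in>?A. F i j) = (\<Sum>j\<in>?A. \<Sum>i\<in>?A. F i j)"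
    by (rule isum_eq) (auto intro!: sum.neutral 0)
  ultimately show ?thesis by (simp add: sum.swap[of F])
qed

lemma fsup_isum2:
  assumes "\<And>i j. \<bar>i\<bar> > B \<or> \<bar>j\<bar> > B \<Longrightarrow> F i j = 0"
  shows "fsup (\<lambda>i. isum (\<lambda>j. F i j))"
  by (rule fsupI[of B]) (simp add: assms)

definition sgp :: "'a::ab_group_add set \<Rightarrow> bool" where
  "sgp V \<longleftrightarrow> 0 \<in> V \<and> (\<forall>x\<in>V. \<forall>y\<in>V. x - y \<in> V)"

lemma sgp_add: "sgp V \<Longrightarrow> x \<in> V \<Longrightarrow> y \<in> V \<Longrightarrow> x + y \<in> V"
proof -
  assume a: "sgp V" "x \<in> V" "y \<in> V"
  hence "0 - y \<in> V" unfolding sgp_def by blast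
  hence "x - (0 - y) \<in> V" using a unfolding sgp_def by blast
  thus ?thesis by simp
qed

lemma sgp_sum: "sgp V \<Longrightarrow> (\<And>i. i \<in> A \<Longrightarrow> F i \<in> V) \<Longrightarrow> sum F A \<in> V"
  by (induction A rule: infinite_finite_induct) (auto intro: sgp_add simp: sgp_def)

lemma sgp_isum: "sgp V \<Longrightarrow> (\<And>k. F k \<in> V) \<Longrightarrow> isum F \<in> V"
  unfolding isum_def by (rule sgp_sum)

text \<open>Additivity is relative to a subgroup: \<open>deriv\<close>, hence a_0, is additive only
  on holomorphic coefficients, and the infinite sums of modes are controlled only on a fixed
  weight.\<close>

definition additive_on :: "'a::ab_group_add set \<Rightarrow> ('a \<Rightarrow> 'b::ab_group_add) \<Rightarrow> bool" where
  "additive_on V T \<longleftrightarrow> (\<forall>x\<in>V. \<forall>y\<in>V. T (x - y) = T x - T y)"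

lemma additive_on_0: "additive_on V T \<Longrightarrow> sgp V \<Longrightarrow> T 0 = 0"
  unfolding additive_on_def sgp_def by (metis diff_self)

lemma additive_on_diff: "additive_on V T \<Longrightarrow> x \<in> V \<Longrightarrow> y \<in> V \<Longrightarrow> T (x - y) = T x - T y"
  by (simp add: additive_on_def)

lemma additive_on_uminus: "additive_on V T \<Longrightarrow> sgp V \<Longrightarrow> y \<in> V \<Longrightarrow> T (- y) = - T y"
  using additive_on_diff[of V T 0 y] additive_on_0[of V T] by (simp add: sgp_def)

lemma additive_on_add:
  assumes "additive_on V T" "sgp V" "x \<in> V" "y \<in> V" shows "T (x + y) = T x + T y"
proof -
  have "- y \<in> V" using assms by (metis sgp_def diff_0)
  thus ?thesis using additive_on_diff[of V T x "-y"] additive_on_uminus[of V T y] assms by simp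
qed

lemma additive_on_sum:
  assumes "additive_on V T" "sgp V" "\<And>i. i \<in> A \<Longrightarrow> F i \<in> V"
  shows "T (sum F A) = (\<Sum>i\<in>A. T (F i))"
  using assms(3)
proof (induction A rule: infinite_finite_induct)
  case (insert x A)
  hence "sum F A \<in> V" by (intro sgp_sum) (use assms in auto)
  thus ?case using insert assms by (simp add: additive_on_add)
qed (use additive_on_0[OF assms(1,2)] in auto)

lemma additive_on_isum:
  assumes "additive_on V T" "sgp V" "\<And>k. F k \<in> V" "fsup F"
  shows "T (isum F) = isum (\<lambda>k. T (F k))"
proof -
  have "T (isum F) = (\<Sum>k\<in>{k. F k \<noteq> 0}. T (F k))"
    unfolding isum_def by (rule additive_on_sum[OF assms(1,2)]) (use assms in auto)
  also have "\<dots> = isum (\<lambda>k. T (F k))"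
    by (rule isum_eq[symmetric]) (use assms additive_on_0[OF assms(1,2)] in \<open>auto simp: fsup_def\<close>)
  finally show ?thesis .
qed

lemma fsup_hom: "additive_on V T \<Longrightarrow> sgp V \<Longrightarrow> fsup F \<Longrightarrow> fsup (\<lambda>k. T (F k))"
  unfolding fsup_def using additive_on_0[of V T] by (auto elim!: rev_finite_subset)

lemma additive_on_isum_fun:
  assumes "\<And>k. additive_on V (T k)" "sgp V" "\<And>x. x \<in> V \<Longrightarrow> fsup (\<lambda>k. T k x)"
  shows "additive_on V (\<lambda>x. isum (\<lambda>k. T k x))"
  unfolding additive_on_def
proof safe
  fix x y assume "x \<in> V" "y \<in> V"
  thus "isum (\<lambda>k. T k (x - y)) = isum (\<lambda>k. T k x) - isum (\<lambda>k. T k y)"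
    using assms by (subst isum_diff[symmetric]) (auto simp: additive_on_diff[of V])
qed

subsection \<open>Creation and annihilation operators\<close>

lemma dzero_eq: "dzero = 0" by (simp add: dzero_def zero_fun_def)
lemma dadd_eq: "dadd v w = v + w" by (simp add: dadd_def fun_eq_iff)

lemma dfsum_isum: "dfsum F UNIV = isum F"
  by (simp add: dfsum_def isum_def dzero_eq fun_eq_iff sum_fun_apply)

text \<open>Constant in the monomial index, so that the pointwise product \<open>fn h * v\<close> is
  multiplication by a function and the ring laws of function spaces apply to vectors.\<close>

definition fn :: "(complex \<Rightarrow> complex) \<Rightarrow> dch" where "fn h = (\<lambda>_. rH h)"

lemma fn_apply: "fn h p \<tau> = (if Im \<tau> > 0 then h \<tau> else 0)"
  by (simp add: fn_def rH_def)

lemma fn_cong: "(\<And>\<tau>. \<tau> \<in> Hp \<Longrightarrow> h \<tau> = k \<tau>) \<Longrightarrow> fn h = fn k"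
  by (auto simp: fn_def rH_def Hp_def fun_eq_iff)

lemma fn_mult: "fn (\<lambda>\<tau>. h \<tau> * k \<tau>) = fn h * fn k"
  by (auto simp: fn_def rH_def fun_eq_iff)

lemma fn_add: "fn (\<lambda>\<tau>. h \<tau> + k \<tau>) = fn h + fn k"
  by (auto simp: fn_def rH_def fun_eq_iff)

lemma dmulf_eq: "dmulf (rH h) v = fn h * v"
  by (simp add: dmulf_def fn_def fun_eq_iff)

lemma dscale_int: "dscale (of_int n) v = of_int n * v"
  by (simp add: dscale_def fun_eq_iff)

section \<open>Weight, degree and the bound that makes all mode sums finite\<close>

lemma Hp_iff: "\<tau> \<in> Hp \<longleftrightarrow> Im \<tau> > 0" by (simp add: Hp_def)
lemma open_Hp: "open Hp" unfolding Hp_def by (rule open_halfspace_Im_gt)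
lemma convex_Hp: "convex Hp" unfolding Hp_def by (rule convex_halfspace_Im_gt)

text \<open>Weight carried by the a part minus weight carried by the b part. In conformal weight w
  it lies between -w and w, and every b_k with k \<noteq> 0 lowers it by |k|. Hence only finitely
  many products of nonzero b modes act nontrivially on a given vector, although creation operators
  occur among them.\<close>

definition pot :: "mon \<Rightarrow> int" where "pot p = int (sum_mset (fst p)) - int (sum_mset (snd p))"

definition mdeg :: "mon \<Rightarrow> int" where "mdeg p = int (size (snd p)) - int (size (fst p))"

definition Dv :: "dch set" where
  "Dv = {v. \<forall>p. v p holomorphic_on Hp \<and> (\<forall>\<tau>. Im \<tau> \<le> 0 \<longrightarrow> v p \<tau> = 0)}"

text \<open>The bound s on \<open>pot\<close> is auxiliary. At s = w it is no restriction, so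
  \<open>D w\<close> is the full space of conformal weight w; w is an integer so that annihilation
  operators may lead to negative weight, where the space is 0.\<close>

definition S :: "int \<Rightarrow> int \<Rightarrow> dch set" where
  "S w s = {v \<in> Dv. \<forall>p. v p \<noteq> 0 \<longrightarrow>
      0 \<notin># fst p \<and> 0 \<notin># snd p \<and> int (cweight p) = w \<and> pot p \<le> s}"

abbreviation D :: "int \<Rightarrow> dch set" where "D w \<equiv> S w w"

lemma S_suppD: "v \<in> S w s \<Longrightarrow> v p \<noteq> 0 \<Longrightarrow>
    0 \<notin># fst p \<and> 0 \<notin># snd p \<and> int (cweight p) = w \<and> pot p \<le> s"
  unfolding S_def by blast

lemma S_Dv: "v \<in> S w s \<Longrightarrow> v \<in> Dv" by (simp add: S_def)

lemma S_I: "v \<in> Dv \<Longrightarrow> (\<And>p. v p \<noteq> 0 \<Longrightarrow> 0 \<notin># fst p \<and> 0 \<notin># snd p \<and> int (cweight p) = w \<and> pot p \<le> s)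
    \<Longrightarrow> v \<in> S w s"
  unfolding S_def by blast

lemma pot_bounds: "pot p \<le> int (cweight p)" "- int (cweight p) \<le> pot p"
  unfolding pot_def cweight_def by linarith+

lemma S_imp_D: assumes "v \<in> S w s" shows "v \<in> D w"
proof (rule S_I[OF S_Dv[OF assms]])
  fix p assume "v p \<noteq> 0"
  from S_suppD[OF assms this] pot_bounds(1)[of p]
  show "0 \<notin># fst p \<and> 0 \<notin># snd p \<and> int (cweight p) = w \<and> pot p \<le> w" by linarith
qed

lemma S_mono: assumes "v \<in> S w s" "s \<le> t" shows "v \<in> S w t"
proof (rule S_I[OF S_Dv[OF assms(1)]])
  fix p assume "v p \<noteq> 0"
  from S_suppD[OF assms(1) this] assms(2)
  show "0 \<notin># fst p \<and> 0 \<notin># snd p \<and> int (cweight p) = w \<and> pot p \<le> t" by linarith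
qed

lemma S_zero: assumes "v \<in> S w s" "w < 0 \<or> s < -w" shows "v = 0"
proof -
  have "v p = 0" for p
    using S_suppD[OF assms(1), of p] assms(2) pot_bounds[of p] by linarith
  thus ?thesis by (simp add: fun_eq_iff)
qed

lemma D_zero: "v \<in> D w \<Longrightarrow> w < 0 \<Longrightarrow> v = 0"
  using S_zero by blast

lemma sgp_Dv: "sgp Dv"
  by (auto simp: sgp_def Dv_def intro!: holomorphic_intros)
     (simp_all add: zero_fun_def fun_diff_def holomorphic_on_diff)

lemma sgp_S: "sgp (S w s)"
proof -
  have "(x - y) p \<noteq> 0 \<Longrightarrow> x p \<noteq> 0 \<or> y p \<noteq> 0" for x y :: dch and p by auto
  thus ?thesis using sgp_Dv unfolding sgp_def S_def by (simp, blast)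
qed

lemma S_0 [simp]: "0 \<in> S w s" using sgp_S by (simp add: sgp_def)
lemma S_diff [intro]: "x \<in> S w s \<Longrightarrow> y \<in> S w s \<Longrightarrow> x - y \<in> S w s" using sgp_S by (simp add: sgp_def)
lemma S_add [intro]: "x \<in> S w s \<Longrightarrow> y \<in> S w s \<Longrightarrow> x + y \<in> S w s" using sgp_S sgp_add by blast
lemma S_fn [intro]: "v \<in> S w s \<Longrightarrow> h holomorphic_on Hp \<Longrightarrow> fn h * v \<in> S w s"
proof -
  assume v: "v \<in> S w s" and h: "h holomorphic_on Hp"
  have "(fn h * v) p holomorphic_on Hp" for p
  proof -
    have "(\<lambda>\<tau>. h \<tau> * v p \<tau>) holomorphic_on Hp"
      using v h by (auto intro!: holomorphic_intros simp: S_def Dv_def)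
    thus ?thesis by (rule holomorphic_transform) (auto simp: fn_apply Hp_def)
  qed
  moreover have "(fn h * v) p \<noteq> 0 \<Longrightarrow> v p \<noteq> 0" for p by auto
  ultimately show ?thesis using v by (fastforce simp: S_def Dv_def)
qed

text \<open>\<open>fn\<close> vanishes outside the upper half plane while the constant
  \<open>of_int k\<close> does not; vectors in \<open>Dv\<close> vanish there too.\<close>

lemma fn_const: "v \<in> Dv \<Longrightarrow> fn (\<lambda>_. of_int k) * v = of_int k * v"
  by (auto simp: fun_eq_iff fn_apply Dv_def not_less)

lemma fn_1: "v \<in> Dv \<Longrightarrow> fn (\<lambda>_. 1) * v = v"
  using fn_const[of v 1] by simp

lemma S_of_int [intro]: "v \<in> S w s \<Longrightarrow> of_int k * v \<in> S w s"
  using S_fn[of v w s "\<lambda>_. of_int k"] fn_const[OF S_Dv, of v w s k] by simp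

lemma aop_supp:
  assumes "aop n v p \<noteq> 0"
  shows "\<exists>q. v q \<noteq> 0 \<and> (n < 0 \<longrightarrow> fst p = add_mset (nat (-n)) (fst q) \<and> snd p = snd q)
     \<and> (n = 0 \<longrightarrow> p = q) \<and> (n > 0 \<longrightarrow> fst q = fst p \<and> snd q = add_mset (nat n) (snd p))"
proof -
  consider "n < 0" | "n = 0" | "n > 0" by linarith
  thus ?thesis
  proof cases
    case 1
    thus ?thesis using assms
      by (intro exI[of _ "(fst p - {#nat (-n)#}, snd p)"])
         (auto simp: aop_def zero_fun_def split: prod.splits if_splits)
  next
    case 2
    have "deriv (\<lambda>_::complex. 0::complex) = (\<lambda>_. 0)" by auto
    hence "v p \<noteq> 0" using 2 assms by (auto simp: aop_def rH_def zero_fun_def)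
    thus ?thesis using 2 by auto
  next
    case 3
    thus ?thesis using assms
      by (intro exI[of _ "(fst p, add_mset (nat n) (snd p))"])
         (auto simp: aop_def zero_fun_def split: prod.splits if_splits)
  qed
qed

lemma bop_supp:
  assumes "bop n v p \<noteq> 0"
  shows "\<exists>q. v q \<noteq> 0 \<and> (n < 0 \<longrightarrow> snd p = add_mset (nat (-n)) (snd q) \<and> fst p = fst q)
     \<and> (n = 0 \<longrightarrow> p = q) \<and> (n > 0 \<longrightarrow> snd q = snd p \<and> fst q = add_mset (nat n) (fst p))"
proof -
  consider "n < 0" | "n = 0" | "n > 0" by linarith
  thus ?thesis
  proof cases
    case 1
    thus ?thesis using assms
      by (intro exI[of _ "(fst p, snd p - {#nat (-n)#})"])
         (auto simp: bop_def zero_fun_def split: prod.splits if_splits)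
  next
    case 2
    thus ?thesis using assms by (auto simp: bop_def zero_fun_def)
  next
    case 3
    thus ?thesis using assms
      by (intro exI[of _ "(add_mset (nat n) (fst p), snd p)"])
         (auto simp: bop_def zero_fun_def split: prod.splits if_splits)
  qed
qed

lemma Dv_hol: "v \<in> Dv \<Longrightarrow> v p holomorphic_on Hp" by (simp add: Dv_def)

lemma rH_deriv_hol: "f holomorphic_on Hp \<Longrightarrow> rH (deriv f) holomorphic_on Hp"
  by (rule holomorphic_transform[OF holomorphic_deriv[OF _ open_Hp]]) (auto simp: rH_def Hp_def)

lemma aop_Dv: "v \<in> Dv \<Longrightarrow> aop n v \<in> Dv"
  unfolding Dv_def aop_def
  by (auto intro!: holomorphic_intros split: prod.splits simp: rH_deriv_hol)
     (auto simp: rH_def)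

lemma bop_Dv: "v \<in> Dv \<Longrightarrow> bop n v \<in> Dv"
  unfolding Dv_def bop_def by (auto intro!: holomorphic_intros split: prod.splits)

lemma aop_S: assumes "v \<in> S w s" shows "aop n v \<in> S (w - n) (s + \<bar>n\<bar>)"
proof -
  have "0 \<notin># fst p \<and> 0 \<notin># snd p \<and> int (cweight p) = w - n \<and> pot p \<le> s + \<bar>n\<bar>"
    if nz: "aop n v p \<noteq> 0" for p
  proof -
    from aop_supp[OF nz] obtain q where q: "v q \<noteq> 0" and
      *: "n < 0 \<longrightarrow> fst p = add_mset (nat (-n)) (fst q) \<and> snd p = snd q"
      "n = 0 \<longrightarrow> p = q" "n > 0 \<longrightarrow> fst q = fst p \<and> snd q = add_mset (nat n) (snd p)" by blast
    have "0 \<notin># fst q \<and> 0 \<notin># snd q \<and> int (cweight q) = w \<and> pot q \<le> s"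
      by (rule S_suppD[OF assms q])
    note qq = this
    consider "n < 0" | "n = 0" | "n > 0" by linarith
    thus ?thesis
    proof cases
      case 1
      hence "fst p = add_mset (nat (-n)) (fst q)" "snd p = snd q" using *(1) by blast+
      thus ?thesis using 1 qq unfolding cweight_def pot_def by simp
    next
      case 2
      hence "p = q" using *(2) by blast
      thus ?thesis using 2 qq by simp
    next
      case 3
      hence "fst q = fst p" "snd q = add_mset (nat n) (snd p)" using *(3) by blast+
      thus ?thesis using 3 qq unfolding cweight_def pot_def by simp
    qed
  qed
  thus ?thesis using aop_Dv[OF S_Dv[OF assms]] by (intro S_I)
qed

lemma aop_D [intro]: "v \<in> D w \<Longrightarrow> aop n v \<in> D (w - n)"
  using aop_S S_imp_D by blast

text \<open>Creation adds |n| to the b part and annihilation removes |n| from the a part: either way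
  \<open>pot\<close> drops by |n|. For \<open>aop\<close> both effects are reversed.\<close>

lemma bop_S: assumes "v \<in> S w s" shows "bop n v \<in> S (w - n) (s - \<bar>n\<bar>)"
proof -
  have "0 \<notin># fst p \<and> 0 \<notin># snd p \<and> int (cweight p) = w - n \<and> pot p \<le> s - \<bar>n\<bar>"
    if nz: "bop n v p \<noteq> 0" for p
  proof -
    from bop_supp[OF nz] obtain q where q: "v q \<noteq> 0" and
      *: "n < 0 \<longrightarrow> snd p = add_mset (nat (-n)) (snd q) \<and> fst p = fst q"
      "n = 0 \<longrightarrow> p = q" "n > 0 \<longrightarrow> snd q = snd p \<and> fst q = add_mset (nat n) (fst p)" by blast
    have "0 \<notin># fst q \<and> 0 \<notin># snd q \<and> int (cweight q) = w \<and> pot q \<le> s"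
      by (rule S_suppD[OF assms q])
    note qq = this
    consider "n < 0" | "n = 0" | "n > 0" by linarith
    thus ?thesis
    proof cases
      case 1
      hence "fst p = fst q" "snd p = add_mset (nat (-n)) (snd q)" using *(1) by blast+
      thus ?thesis using 1 qq unfolding cweight_def pot_def by simp
    next
      case 2
      hence "p = q" using *(2) by blast
      thus ?thesis using 2 qq by simp
    next
      case 3
      hence "fst q = add_mset (nat n) (fst p)" "snd q = snd p" using *(3) by blast+
      thus ?thesis using 3 qq unfolding cweight_def pot_def by simp
    qed
  qed
  thus ?thesis using bop_Dv[OF S_Dv[OF assms]] by (intro S_I)
qed

lemma bop_D [intro]: "v \<in> D w \<Longrightarrow> bop n v \<in> D (w - n)"
  using bop_S S_imp_D by blast

lemma additive_aop: "additive_on Dv (aop n)"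
  unfolding additive_on_def
proof (intro ballI ext)
  fix x y :: dch and p \<tau> assume xy: "x \<in> Dv" "y \<in> Dv"
  have "deriv (x p - y p) \<tau> = deriv (x p) \<tau> - deriv (y p) \<tau>" if "Im \<tau> > 0"
    using xy that unfolding fun_diff_def
    by (intro deriv_diff holomorphic_on_imp_differentiable_at[OF Dv_hol open_Hp]) (auto simp: Hp_def)
  thus "aop n (x - y) p \<tau> = (aop n x - aop n y) p \<tau>"
    by (cases p) (auto simp: aop_def rH_def algebra_simps)
qed

lemma additive_bop: "additive_on UNIV (bop n)"
  unfolding additive_on_def
  by (auto simp: bop_def fun_eq_iff algebra_simps)

lemma sgp_UNIV: "sgp UNIV" by (simp add: sgp_def)

lemma additive_on_subset: "additive_on V T \<Longrightarrow> W \<subseteq> V \<Longrightarrow> additive_on W T"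
  by (auto simp: additive_on_def)

lemma additive_aop_S: "additive_on (S w s) (aop n)"
  by (rule additive_on_subset[OF additive_aop]) (auto simp: S_def)

lemma bop_diff: "bop n (x - y) = bop n x - bop n y"
  using additive_bop by (simp add: additive_on_def)
lemma bop_add: "bop n (x + y) = bop n x + bop n y"
  using additive_on_add[OF additive_bop sgp_UNIV] by simp
lemma bop_0 [simp]: "bop n 0 = 0"
  using additive_on_0[OF additive_bop sgp_UNIV] by simp
lemma aop_0 [simp]: "aop n 0 = 0"
  using additive_on_0[OF additive_aop sgp_Dv] by simp

lemma bop_fn: "bop n (fn h * v) = fn h * bop n v"
  by (auto simp: bop_def fun_eq_iff fn_apply)

lemma bop_of_int: "bop n (of_int k * v) = of_int k * bop n v"
  by (auto simp: bop_def fun_eq_iff algebra_simps)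

lemma aop_fn: assumes "n \<noteq> 0" shows "aop n (fn h * v) = fn h * aop n v"
  using assms by (auto simp: aop_def fun_eq_iff fn_apply)

lemma aop_0_fn:
  assumes "v \<in> Dv" "h holomorphic_on Hp"
  shows "aop 0 (fn h * v) = fn (deriv h) * v + fn h * aop 0 v"
proof (intro ext)
  fix p \<tau>
  show "aop 0 (fn h * v) p \<tau> = (fn (deriv h) * v + fn h * aop 0 v) p \<tau>"
  proof (cases "Im \<tau> > 0")
    case True
    have "deriv ((fn h * v) p) \<tau> = deriv (\<lambda>\<tau>. h \<tau> * v p \<tau>) \<tau>"
    proof (rule deriv_cong_ev)
      have "\<forall>\<^sub>F x in nhds \<tau>. x \<in> Hp" using True open_Hp by (intro eventually_nhds_in_open) (auto simp: Hp_def)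
      thus "\<forall>\<^sub>F x in nhds \<tau>. (fn h * v) p x = h x * v p x"
        by eventually_elim (auto simp: fn_apply Hp_def)
    qed simp
    also have "\<dots> = h \<tau> * deriv (v p) \<tau> + deriv h \<tau> * v p \<tau>"
      using assms True
      by (intro deriv_mult holomorphic_on_imp_differentiable_at[OF _ open_Hp]) (auto simp: Hp_iff Dv_hol)
    finally show ?thesis using True by (simp add: aop_def rH_def fn_apply)
  qed (simp add: aop_def rH_def fn_apply)
qed

lemma aop_of_int: assumes "v \<in> Dv" shows "aop n (of_int k * v) = of_int k * aop n v"
proof -
  have "deriv (\<lambda>_::complex. of_int k :: complex) = (\<lambda>_. 0)" by auto
  hence "fn (deriv (\<lambda>_. of_int k)) * v = 0" by (simp add: fn_def rH_def fun_eq_iff)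
  hence "aop n (fn (\<lambda>_. of_int k) * v) = fn (\<lambda>_. of_int k) * aop n v"
    using aop_0_fn[of v "\<lambda>_. of_int k"] aop_fn[of n] assms by (cases "n = 0") auto
  thus ?thesis using assms by (simp add: fn_const aop_Dv)
qed

lemma bop_neg: "n < 0 \<Longrightarrow> bop n v (l, m) =
    (if nat (-n) \<in># m then v (l, m - {#nat (-n)#}) else 0)"
  by (simp add: bop_def zero_fun_def)
lemma bop_zero: "bop 0 v p = (\<lambda>\<tau>. \<tau> * v p \<tau>)"
  by (simp add: bop_def)
lemma bop_pos: "n > 0 \<Longrightarrow> bop n v (l, m) =
    (\<lambda>\<tau>. - of_nat (count l (nat n) + 1) * v (add_mset (nat n) l, m) \<tau>)"
  by (simp add: bop_def)
lemma aop_neg: "n < 0 \<Longrightarrow> aop n v (l, m) =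
    (if nat (-n) \<in># l then v (l - {#nat (-n)#}, m) else 0)"
  by (simp add: aop_def zero_fun_def)
lemma aop_zero: "aop 0 v p = rH (deriv (v p))"
  by (simp add: aop_def)
lemma aop_pos: "n > 0 \<Longrightarrow> aop n v (l, m) =
    (\<lambda>\<tau>. of_nat (count m (nat n) + 1) * v (l, add_mset (nat n) m) \<tau>)"
  by (simp add: aop_def)

lemma in_remove1_neq: "a \<noteq> b \<Longrightarrow> a \<in># C - {#b#} \<longleftrightarrow> a \<in># C"
  by (simp add: in_diff_count)

lemma bop_commute_aux:
  assumes "m \<le> n" shows "bop m (bop n v) (l, u) \<tau> = bop n (bop m v) (l, u) \<tau>"
proof -
  consider "m = n" | "n < 0" "m \<noteq> n" | "n = 0" "m < 0" | "n > 0" "m < 0" | "n > 0" "m = 0" | "n > 0" "m > 0" "m \<noteq> n"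
    using assms by linarith
  thus ?thesis
  proof cases
    case 2
    thus ?thesis using assms
      by (simp add: bop_neg in_remove1_neq add_mset_commute)
  next
    case 6
    thus ?thesis using assms by (auto simp: bop_pos add_mset_commute)
  qed (auto simp: bop_neg bop_pos bop_zero)
qed

lemma bop_commute: "bop m (bop n v) = bop n (bop m v)"
proof (intro ext)
  fix p :: mon and \<tau>
  show "bop m (bop n v) p \<tau> = bop n (bop m v) p \<tau>"
    using bop_commute_aux[of m n v "fst p" "snd p" \<tau>] bop_commute_aux[of n m v "fst p" "snd p" \<tau>]
    by (cases "m \<le> n") auto
qed

lemma rH_deriv_0 [simp]: "rH (deriv 0) = 0"
proof -
  have "deriv (\<lambda>_::complex. 0::complex) = (\<lambda>_. 0)" by auto
  thus ?thesis by (simp add: rH_def zero_fun_def)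
qed

lemma rH_deriv_cmult:
  "f holomorphic_on Hp \<Longrightarrow> rH (deriv (\<lambda>\<tau>. c * f \<tau>)) = (\<lambda>\<tau>. c * rH (deriv f) \<tau>)"
  by (auto simp: rH_def fun_eq_iff Hp_def intro!: deriv_cmult holomorphic_on_imp_differentiable_at[OF _ open_Hp])

lemma aop_commute_aux:
  assumes "m \<le> n" "v \<in> Dv" shows "aop m (aop n v) (l, u) \<tau> = aop n (aop m v) (l, u) \<tau>"
proof -
  consider "m = n" | "n < 0" "m \<noteq> n" | "n = 0" "m < 0" | "n > 0" "m < 0" | "n > 0" "m = 0" | "n > 0" "m > 0" "m \<noteq> n"
    using assms by linarith
  thus ?thesis
  proof cases
    case 2
    thus ?thesis using assms
      by (simp add: aop_neg in_remove1_neq add_mset_commute)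
  next
    case 6
    thus ?thesis using assms by (auto simp: aop_pos add_mset_commute)
  qed (auto simp: aop_neg aop_pos aop_zero rH_deriv_cmult Dv_hol[OF assms(2)])
qed

lemma aop_commute: assumes "v \<in> Dv" shows "aop m (aop n v) = aop n (aop m v)"
proof (intro ext)
  fix p :: mon and \<tau>
  show "aop m (aop n v) p \<tau> = aop n (aop m v) p \<tau>"
    using aop_commute_aux[of m n v "fst p" "snd p" \<tau>] aop_commute_aux[of n m v "fst p" "snd p" \<tau>] assms
    by (cases "m \<le> n") auto
qed

text \<open>The Heisenberg relation. For m = -n \<noteq> 0 the multiplicity of a part counted before
  and after inserting it differs by one, which leaves exactly v; for m = n = 0 it is the product
  rule for \<open>\<tau> * v p \<tau>\<close>.\<close>

lemma aop_bop: assumes "v \<in> Dv" shows "aop m (bop n v) = bop n (aop m v) + (if m + n = 0 then v else 0)"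
proof (intro ext)
  fix p :: mon and \<tau> obtain l u where p: "p = (l, u)" by force
  have off: "Im \<tau> \<le> 0 \<Longrightarrow> v p \<tau> = 0" for p using assms by (auto simp: Dv_def)
  have der: "deriv (\<lambda>\<tau>. \<tau> * v p \<tau>) \<tau> = \<tau> * deriv (v p) \<tau> + v p \<tau>" if "Im \<tau> > 0"
    using assms that
    by (subst deriv_mult) (auto intro!: holomorphic_on_imp_differentiable_at[OF _ open_Hp] simp: Hp_iff Dv_hol)
  consider "n < 0" "m < 0" | "n = 0" "m < 0" | "n > 0" "m < 0" | "n < 0" "m = 0" | "n = 0" "m = 0"
    | "n > 0" "m = 0" | "n < 0" "m > 0" | "n = 0" "m > 0" | "n > 0" "m > 0"
    using linorder_less_linear[of m 0] linorder_less_linear[of n 0] by blast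
  thus "aop m (bop n v) p \<tau> = (bop n (aop m v) + (if m + n = 0 then v else 0)) p \<tau>"
  proof cases
    case 3
    show ?thesis
    proof (cases "m + n = 0")
      case True
      with 3 have m: "nat (-m) = nat n" by simp
      show ?thesis using 3 True
        by (cases "nat n \<in># l") (auto simp: p aop_neg bop_pos m not_in_iff distrib_right left_diff_distrib
            dest!: multi_member_split)
    next
      case False
      thus ?thesis using 3 by (auto simp: p aop_neg bop_pos)
    qed
  next
    case 7
    show ?thesis
    proof (cases "m + n = 0")
      case True
      with 7 have m: "nat (-n) = nat m" by simp
      show ?thesis using 7 True
        by (cases "nat m \<in># u") (auto simp: p aop_pos bop_neg m not_in_iff distrib_right
            dest!: multi_member_split)
    next
      case False
      thus ?thesis using 7 by (auto simp: p aop_pos bop_neg)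
    qed
  next
    case 5
    thus ?thesis using der off by (simp add: aop_zero bop_zero rH_def)
  next
    case 6
    thus ?thesis
      using rH_deriv_cmult[OF Dv_hol[OF assms], of "- of_nat (count l (nat n) + 1)" "(add_mset (nat n) l, u)"]
      by (simp add: p aop_zero bop_pos del: of_nat_add of_nat_Suc)
  qed (auto simp: p aop_neg bop_neg aop_zero bop_zero aop_pos bop_pos)
qed

lemmas pointwise = plus_fun_apply times_fun_apply minus_apply uminus_apply zero_fun_apply one_fun_apply
  of_int_fun_apply of_nat_fun_apply numeral_fun_apply

text \<open>Otherwise the simplifier tears eta-expanded sums and products of vectors apart.\<close>
declare pointwise [simp del]

subsection \<open>The modes of functions\<close>

lemma bop_of_nat: "bop n (of_nat k * v) = of_nat k * bop n v"
  using bop_of_int[of n "int k"] by simp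

text \<open>The coefficient of z^(-n) in the l-th power of the series of all b_k z^(-k) with k
  \<noteq> 0. This is the power that accompanies the l-th Taylor coefficient of a function in its
  field.\<close>

fun pmode :: "nat \<Rightarrow> int \<Rightarrow> dch \<Rightarrow> dch" where
  "pmode 0 n v = (if n = 0 then v else 0)"
| "pmode (Suc l) n v = isum (\<lambda>k. if k = 0 then 0 else bop k (pmode l (n - k) v))"

lemma pmode_S: "v \<in> S w s \<Longrightarrow> pmode l n v \<in> S (w - n) (s - int l)"
proof (induction l arbitrary: n)
  case (Suc l)
  have "bop k (pmode l (n - k) v) \<in> S (w - n) (s - int (Suc l))" if "k \<noteq> 0" for k
    using bop_S[OF Suc.IH[OF Suc.prems, of "n - k"], of k] that by (auto elim!: S_mono)
  thus ?case by (auto intro!: sgp_isum[OF sgp_S])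
qed auto

lemma pmode_D [intro]: "v \<in> D w \<Longrightarrow> pmode l n v \<in> D (w - n)"
  using pmode_S S_imp_D by blast

text \<open>The term has weight w - n and \<open>pot\<close> at most w - l - |k|; once this drops
  below n - w, no monomial is left.\<close>

lemma pmode_term_0:
  assumes "v \<in> D w" "\<bar>k\<bar> > 2 * \<bar>w\<bar> + \<bar>n\<bar>"
  shows "bop k (pmode l (n - k) v) = 0"
proof -
  have "bop k (pmode l (n - k) v) \<in> S (w - (n - k) - k) (w - int l - \<bar>k\<bar>)"
    by (intro bop_S pmode_S assms)
  thus ?thesis by (rule S_zero) (use assms in auto)
qed

lemma pmode_fsup:
  assumes "v \<in> D w" shows "fsup (\<lambda>k. if k = 0 then 0 else bop k (pmode l (n - k) v))"
  by (rule fsupI[of "2 * \<bar>w\<bar> + \<bar>n\<bar>"]) (auto intro: pmode_term_0[OF assms])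

lemma pmode_eq_0: "v \<in> D w \<Longrightarrow> int l > 2 * \<bar>w\<bar> + \<bar>n\<bar> \<Longrightarrow> pmode l n v = 0"
  by (rule S_zero[OF pmode_S[of v w w]]) auto

lemma pmode_eq_0': "v \<in> D w \<Longrightarrow> n > w \<Longrightarrow> pmode l n v = 0"
  by (rule S_zero[OF pmode_S[of v w w]]) auto

lemma pmode_zero [simp]: "pmode l n 0 = 0"
  by (induction l arbitrary: n) (auto simp: if_distrib cong: if_cong)

lemma additive_X: "additive_on (D w) (pmode l n)"
proof (induction l arbitrary: n)
  case (Suc l)
  show ?case unfolding pmode.simps
    by (intro additive_on_isum_fun sgp_S pmode_fsup) (use Suc in \<open>auto simp: additive_on_def bop_diff\<close>)
qed (auto simp: additive_on_def)

lemma pmode_bop: assumes "v \<in> D w" shows "pmode l n (bop m v) = bop m (pmode l n v)"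
  using assms
proof (induction l arbitrary: n)
  case (Suc l)
  have "bop m (pmode (Suc l) n v) = isum (\<lambda>k. bop m (if k = 0 then 0 else bop k (pmode l (n - k) v)))"
    unfolding pmode.simps by (rule additive_on_isum[OF additive_bop sgp_UNIV _ pmode_fsup[OF Suc.prems]]) auto
  also have "\<dots> = pmode (Suc l) n (bop m v)"
    unfolding pmode.simps by (rule isum_cong) (auto simp: Suc.IH[OF Suc.prems] bop_commute[of m])
  finally show ?case by simp
qed auto

lemma pmode_fn: assumes "v \<in> D w" "h holomorphic_on Hp" shows "pmode l n (fn h * v) = fn h * pmode l n v"
  using assms
proof (induction l arbitrary: n)
  case (Suc l)
  have "fn h * pmode (Suc l) n v = isum (\<lambda>k. fn h * (if k = 0 then 0 else bop k (pmode l (n - k) v)))"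
    unfolding pmode.simps by (rule isum_mult_left[OF pmode_fsup, symmetric]) fact
  also have "\<dots> = pmode (Suc l) n (fn h * v)"
    unfolding pmode.simps by (rule isum_cong) (auto simp: Suc.IH[OF Suc.prems] bop_fn)
  finally show ?case by simp
qed auto

lemma pmode_X: assumes "v \<in> D w" shows "pmode i m (pmode j n v) = pmode j n (pmode i m v)"
  using assms
proof (induction i arbitrary: m)
  case (Suc i)
  have "pmode j n (pmode (Suc i) m v) = isum (\<lambda>k. pmode j n (if k = 0 then 0 else bop k (pmode i (m - k) v)))"
    unfolding pmode.simps
  proof (rule additive_on_isum[OF additive_X[of "w - m"] sgp_S _ pmode_fsup[OF Suc.prems]])
    show "(if k = 0 then 0 else bop k (pmode i (m - k) v)) \<in> D (w - m)" for k
      using bop_D[OF pmode_D[OF Suc.prems, of i "m - k"], of k] by auto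
  qed
  also have "\<dots> = isum (\<lambda>k. if k = 0 then 0 else bop k (pmode i (m - k) (pmode j n v)))"
  proof (rule isum_cong)
    fix k show "pmode j n (if k = 0 then 0 else bop k (pmode i (m - k) v)) =
        (if k = 0 then 0 else bop k (pmode i (m - k) (pmode j n v)))"
      using pmode_bop[OF pmode_D[OF Suc.prems, of i "m - k"]] Suc by auto
  qed
  finally show ?case by simp
qed auto

lemma XX_0: "v \<in> D w \<Longrightarrow> m > w \<or> n > w \<Longrightarrow> pmode i m (pmode j n v) = 0"
  using pmode_eq_0'[of v w n j] pmode_eq_0'[of v w m i] pmode_X[of v w i m j n] by auto

lemma abs_shift_bound: "2 * B < \<bar>k\<bar> \<or> 2 * B < \<bar>m\<bar> \<Longrightarrow> 0 \<le> B \<Longrightarrow> B < \<bar>k\<bar> \<or> B < \<bar>m - k\<bar>" for B :: int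
  by linarith

text \<open>a_m acts as a derivation that sends b_{-m} to 1, so it removes one of the l equal
  factors and shifts the mode by m. At m = 0 nothing happens because b_0 is left out of the
  series.\<close>

lemma aop_X:
  assumes "v \<in> D w"
  shows "aop m (pmode l n v) = pmode l n (aop m v) + (if m = 0 then 0 else of_nat l * pmode (l - 1) (n + m) v)"
  using assms
proof (induction l arbitrary: n)
  case (Suc l)
  let ?G = "\<lambda>k. if k = 0 then 0 else bop k (pmode l (n - k) (aop m v))"
  let ?H = "\<lambda>k. if k = 0 \<or> m = 0 then 0 else of_nat l * bop k (pmode (l - 1) (n + m - k) v)"
  let ?J = "\<lambda>k. if k = 0 \<or> k \<noteq> -m then 0 else pmode l (n - k) v"
  have am: "aop m v \<in> D (w - m)" using Suc.prems by auto
  have "aop m (pmode (Suc l) n v) = isum (\<lambda>k. aop m (if k = 0 then 0 else bop k (pmode l (n - k) v)))"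
    unfolding pmode.simps
    by (rule additive_on_isum[OF additive_aop sgp_Dv _ pmode_fsup[OF Suc.prems]])
       (use Suc.prems in \<open>auto intro!: bop_Dv S_Dv pmode_D simp: S_Dv[OF S_0]\<close>)
  also have "\<dots> = isum (\<lambda>k. ?G k + (?H k + ?J k))"
  proof (rule isum_cong)
    fix k
    have "aop m (bop k (pmode l (n - k) v)) = bop k (aop m (pmode l (n - k) v)) + (if m + k = 0 then pmode l (n - k) v else 0)"
      using pmode_D[OF Suc.prems] by (intro aop_bop S_Dv)
    also have "aop m (pmode l (n - k) v) = pmode l (n - k) (aop m v) + (if m = 0 then 0 else of_nat l * pmode (l - 1) (n - k + m) v)"
      by (rule Suc.IH[OF Suc.prems])
    finally show "aop m (if k = 0 then 0 else bop k (pmode l (n - k) v)) = ?G k + (?H k + ?J k)"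
      by (auto simp: bop_add bop_of_nat algebra_simps)
  qed
  also have "\<dots> = isum ?G + (isum ?H + isum ?J)"
  proof (subst isum_add, goal_cases)
    case 1 show ?case by (rule pmode_fsup[OF am])
  next
    case 2
    have "fsup ?H" by (rule fsupI[of "2*\<bar>w\<bar> + \<bar>n+m\<bar>"]) (use pmode_term_0[OF Suc.prems, of "n+m"] in auto)
    moreover have "fsup ?J" by (rule fsupI[of "\<bar>m\<bar>"]) auto
    ultimately show ?case by (rule fsup_add)
  next
    case 3
    have "fsup ?H" by (rule fsupI[of "2*\<bar>w\<bar> + \<bar>n+m\<bar>"]) (use pmode_term_0[OF Suc.prems, of "n+m"] in auto)
    moreover have "fsup ?J" by (rule fsupI[of "\<bar>m\<bar>"]) auto
    ultimately show ?case by (simp add: isum_add)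
  qed
  also have "isum ?G = pmode (Suc l) n (aop m v)" by simp
  also have "isum ?J = (if m = 0 then 0 else pmode l (n + m) v)"
    by (subst isum_single[of "-m"]) auto
  also have "isum ?H = (if m = 0 then 0 else of_nat l * pmode l (n + m) v)"
  proof (cases "m = 0 \<or> l = 0")
    case False
    then obtain l' where l: "l = Suc l'" by (cases l) auto
    have "isum ?H = isum (\<lambda>k. of_nat l * (if k = 0 then 0 else bop k (pmode l' (n + m - k) v)))"
      by (rule isum_cong) (use False l in auto)
    also have "\<dots> = of_nat l * isum (\<lambda>k. if k = 0 then 0 else bop k (pmode l' (n + m - k) v))"
      by (rule isum_mult_left[OF pmode_fsup[OF Suc.prems]])
    finally show ?thesis using False l by simp
  qed (auto simp: isum_def)
  finally show ?case by (simp add: algebra_simps)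
qed auto

text \<open>Powers of the one series multiply: x^(i + j) = x^i x^j, read off coefficientwise. The
  work lies in justifying the exchange of the two sums.\<close>

lemma pmode_add:
  assumes "v \<in> D w"
  shows "pmode (i + j) n v = isum (\<lambda>m. pmode i m (pmode j (n - m) v))"
proof (induction i arbitrary: n)
  case 0
  show ?case by (subst isum_single[of 0]) auto
next
  case (Suc i)
  let ?F = "\<lambda>k m. if k = 0 then 0 else bop k (pmode i m (pmode j (n - k - m) v))"
  have z: "?F k m = 0" if "\<bar>k\<bar> > 5 * \<bar>w\<bar> + 4 * \<bar>n\<bar> \<or> \<bar>m\<bar> > 5 * \<bar>w\<bar> + 4 * \<bar>n\<bar>" for k m
  proof -
    have "pmode i m (pmode j (n - k - m) v) \<in> S (w - (n - k - m) - m) (w - int j - int i)" using assms by (intro pmode_S)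
    from bop_S[OF this, of k] have 1: "bop k (pmode i m (pmode j (n - k - m) v)) \<in> S (w - n) (w - int j - int i - \<bar>k\<bar>)"
      by simp
    show ?thesis
    proof (cases "\<bar>k\<bar> > 2 * \<bar>w\<bar> + \<bar>n\<bar>")
      case True
      have "bop k (pmode i m (pmode j (n - k - m) v)) = 0" by (rule S_zero[OF 1]) (use True in auto)
      thus ?thesis by simp
    next
      case False
      hence "n - k - m > w \<or> m > w" using that by linarith
      thus ?thesis using XX_0[OF assms, of m "n - k - m" i j] by auto
    qed
  qed
  have "pmode (Suc i + j) n v = isum (\<lambda>k. if k = 0 then 0 else bop k (pmode (i + j) (n - k) v))" by simp
  also have "\<dots> = isum (\<lambda>k. isum (\<lambda>m. ?F k m))"
  proof (rule isum_cong)
    fix k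
    have "fsup (\<lambda>m. pmode i m (pmode j (n - k - m) v))"
    proof (rule fsupI[of "2 * \<bar>w\<bar> + \<bar>n\<bar> + \<bar>k\<bar>"])
      fix m assume "\<bar>m\<bar> > 2 * \<bar>w\<bar> + \<bar>n\<bar> + \<bar>k\<bar>"
      hence "n - k - m > w \<or> m > w" by linarith
      thus "pmode i m (pmode j (n - k - m) v) = 0"
        using XX_0[OF assms, of m "n - k - m" i j] by auto
    qed
    thus "(if k = 0 then 0 else bop k (pmode (i + j) (n - k) v)) = isum (\<lambda>m. ?F k m)"
      by (auto simp: Suc additive_on_isum[OF additive_bop sgp_UNIV])
  qed
  also have "\<dots> = isum (\<lambda>k. isum (\<lambda>m. if k = 0 then 0 else bop k (pmode i (m - k) (pmode j (n - m) v))))"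
  proof (rule isum_cong)
    fix k show "isum (?F k) = isum (\<lambda>m. if k = 0 then 0 else bop k (pmode i (m - k) (pmode j (n - m) v)))"
      using isum_shift[of "?F k" "-k"] by (auto cong: if_cong)
  qed
  also have "\<dots> = isum (\<lambda>m. isum (\<lambda>k. if k = 0 then 0 else bop k (pmode i (m - k) (pmode j (n - m) v))))"
  proof (rule isum_swap[of "2 * (5 * \<bar>w\<bar> + 4 * \<bar>n\<bar>)"])
    fix k m :: int assume "2 * (5 * \<bar>w\<bar> + 4 * \<bar>n\<bar>) < \<bar>k\<bar> \<or> 2 * (5 * \<bar>w\<bar> + 4 * \<bar>n\<bar>) < \<bar>m\<bar>"
    hence "\<bar>k\<bar> > 5 * \<bar>w\<bar> + 4 * \<bar>n\<bar> \<or> \<bar>m - k\<bar> > 5 * \<bar>w\<bar> + 4 * \<bar>n\<bar>"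
      by (rule abs_shift_bound) simp
    from z[OF this] show "(if k = 0 then 0 else bop k (pmode i (m - k) (pmode j (n - m) v))) = 0" by auto
  qed
  also have "\<dots> = isum (\<lambda>m. pmode (Suc i) m (pmode j (n - m) v))" by simp
  finally show ?case .
qed

text \<open>The operator z d/dz applied to x^(l + 1) gives (l + 1) x^l (z dx/dz). The induction
  splits n = k + (n - k) between one factor and the remaining power.\<close>

lemma pmode_euler:
  assumes "v \<in> D w"
  shows "of_int n * pmode (Suc l) n v = of_nat (Suc l) * isum (\<lambda>k. of_int k * bop k (pmode l (n - k) v))"
proof (induction l arbitrary: n)
  case 0
  have "isum (\<lambda>k. of_int k * bop k (pmode 0 (n - k) v)) = of_int n * bop n v"
    by (subst isum_single[of n]) auto
  moreover have "pmode (Suc 0) n v = (if n = 0 then 0 else bop n v)"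
    unfolding pmode.simps by (subst isum_single[of n]) auto
  ultimately show ?case by simp
next
  case (Suc l)
  let ?B = "10 * \<bar>w\<bar> + 10 * \<bar>n\<bar>"
  have fs: "fsup (\<lambda>k. of_int k * bop k (pmode j (m - k) v))" for j m
    by (rule fsupI[of "2*\<bar>w\<bar> + \<bar>m\<bar>"]) (use pmode_term_0[OF assms] in auto)
  have "of_int n * pmode (Suc (Suc l)) n v =
      isum (\<lambda>k. of_int n * (if k = 0 then 0 else bop k (pmode (Suc l) (n - k) v)))"
    unfolding pmode.simps(2)[of "Suc l"] by (rule isum_mult_left[symmetric, OF pmode_fsup[OF assms]])
  also have "\<dots> = isum (\<lambda>k. of_int k * bop k (pmode (Suc l) (n - k) v) +
       (if k = 0 then 0 else bop k (of_int (n - k) * pmode (Suc l) (n - k) v)))"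
    by (rule isum_cong) (auto simp: bop_diff bop_of_int algebra_simps simp del: pmode.simps)
  also have "\<dots> = isum (\<lambda>k. of_int k * bop k (pmode (Suc l) (n - k) v)) +
       isum (\<lambda>k. if k = 0 then 0 else bop k (of_int (n - k) * pmode (Suc l) (n - k) v))"
  proof (rule isum_add[OF fs])
    show "fsup (\<lambda>k. if k = 0 then 0 else bop k (of_int (n - k) * pmode (Suc l) (n - k) v))"
      by (rule fsupI[of "2*\<bar>w\<bar> + \<bar>n\<bar>"]) (use pmode_term_0[OF assms, of n] in \<open>auto simp del: pmode.simps simp: bop_of_int simp del: of_int_diff\<close>)
  qed
  also have "isum (\<lambda>k. if k = 0 then 0 else bop k (of_int (n - k) * pmode (Suc l) (n - k) v)) =
     isum (\<lambda>k. isum (\<lambda>j. if k = 0 then 0 else of_nat (Suc l) * (of_int j * bop j (bop k (pmode l (n - k - j) v)))))"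
  proof (rule isum_cong)
    fix k
    show "(if k = 0 then 0 else bop k (of_int (n - k) * pmode (Suc l) (n - k) v)) =
       isum (\<lambda>j. if k = 0 then 0 else of_nat (Suc l) * (of_int j * bop j (bop k (pmode l (n - k - j) v))))"
    proof (cases "k = 0")
      case False
      have "bop k (of_int (n - k) * pmode (Suc l) (n - k) v) =
         bop k (of_int (int (Suc l)) * isum (\<lambda>j. of_int j * bop j (pmode l (n - k - j) v)))"
        by (subst Suc) simp
      also have "\<dots> = of_nat (Suc l) * bop k (isum (\<lambda>j. of_int j * bop j (pmode l (n - k - j) v)))"
        by (subst bop_of_int) simp
      also have "bop k (isum (\<lambda>j. of_int j * bop j (pmode l (n - k - j) v))) =
          isum (\<lambda>j. bop k (of_int j * bop j (pmode l (n - k - j) v)))"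
        by (rule additive_on_isum[OF additive_bop sgp_UNIV _ fs]) auto
      also have "\<dots> = isum (\<lambda>j. of_int j * bop j (bop k (pmode l (n - k - j) v)))"
        by (simp add: bop_of_int bop_commute)
      also have "of_nat (Suc l) * \<dots> = isum (\<lambda>j. of_nat (Suc l) * (of_int j * bop j (bop k (pmode l (n - k - j) v))))"
        by (rule isum_mult_left[symmetric])
           (use fsup_hom[OF additive_bop sgp_UNIV fs, of k l "n-k"] in \<open>simp add: bop_of_int bop_commute\<close>)
      finally show ?thesis using False by simp
    qed simp
  qed
  also have "\<dots> = isum (\<lambda>j. isum (\<lambda>k. if k = 0 then 0 else of_nat (Suc l) * (of_int j * bop j (bop k (pmode l (n - k - j) v)))))"
  proof (rule isum_swap[of "2 * \<bar>w\<bar> + \<bar>n\<bar>"])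
    fix k j :: int assume a: "2 * \<bar>w\<bar> + \<bar>n\<bar> < \<bar>k\<bar> \<or> 2 * \<bar>w\<bar> + \<bar>n\<bar> < \<bar>j\<bar>"
    have "bop j (bop k (pmode l (n - k - j) v)) \<in> S (w - (n - k - j) - k - j) (w - int l - \<bar>k\<bar> - \<bar>j\<bar>)"
      by (intro bop_S pmode_S assms)
    hence "bop j (bop k (pmode l (n - k - j) v)) = 0" by (rule S_zero) (use a in auto)
    thus "(if k = 0 then 0 else of_nat (Suc l) * (of_int j * bop j (bop k (pmode l (n - k - j) v)))) = 0" by simp
  qed
  also have "\<dots> = isum (\<lambda>j. of_nat (Suc l) * (of_int j * bop j (pmode (Suc l) (n - j) v)))"
  proof (rule isum_cong)
    fix j
    have f0: "fsup (\<lambda>k. if k = 0 then 0 else bop j (bop k (pmode l (n - j - k) v)))"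
      using fsup_hom[OF additive_bop[of j] sgp_UNIV pmode_fsup[OF assms, of l "n - j"]] by (simp add: if_distrib cong: if_cong)
    have "bop j (pmode (Suc l) (n - j) v) = isum (\<lambda>k. bop j (if k = 0 then 0 else bop k (pmode l (n - j - k) v)))"
      unfolding pmode.simps by (rule additive_on_isum[OF additive_bop sgp_UNIV _ pmode_fsup[OF assms]]) auto
    also have "\<dots> = isum (\<lambda>k. if k = 0 then 0 else bop j (bop k (pmode l (n - j - k) v)))"
      by (simp add: if_distrib cong: if_cong)
    finally have "of_nat (Suc l) * (of_int j * bop j (pmode (Suc l) (n - j) v)) =
       (of_nat (Suc l) * of_int j) * isum (\<lambda>k. if k = 0 then 0 else bop j (bop k (pmode l (n - j - k) v)))"
      by (simp add: mult.assoc)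
    also have "\<dots> = isum (\<lambda>k. of_nat (Suc l) * of_int j * (if k = 0 then 0 else bop j (bop k (pmode l (n - j - k) v))))"
      by (rule isum_mult_left[symmetric, OF f0])
    finally show "isum (\<lambda>k. if k = 0 then 0 else of_nat (Suc l) * (of_int j * bop j (bop k (pmode l (n - k - j) v)))) =
       of_nat (Suc l) * (of_int j * bop j (pmode (Suc l) (n - j) v))"
      by (simp add: if_distrib mult.assoc diff_diff_eq add.commute cong: if_cong)
  qed
  also have "\<dots> = of_nat (Suc l) * isum (\<lambda>j. of_int j * bop j (pmode (Suc l) (n - j) v))"
    by (rule isum_mult_left[OF fs])
  finally show ?case by (simp add: algebra_simps del: pmode.simps)
qed

text \<open>Index shift: \<open>hb h n\<close> is the coefficient of z^(-n) in Y(h, z), so that it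
  lowers the weight by exactly n, like b_n.\<close>

definition hb :: "(complex \<Rightarrow> complex) \<Rightarrow> int \<Rightarrow> dch \<Rightarrow> dch" where
  "hb h n v = fmode h (n - 1) v"

definition tc :: "(complex \<Rightarrow> complex) \<Rightarrow> nat \<Rightarrow> complex \<Rightarrow> complex" where
  "tc h l = (\<lambda>\<tau>. (deriv ^^ l) h \<tau> / fact l)"

text \<open>\<open>fmode\<close> sums over index lists of all lengths at once. Sorting the
  contributing lists by length l turns it into Taylor coefficients times
  \<open>pmode l\<close>.\<close>

definition Ls :: "dch \<Rightarrow> nat \<Rightarrow> int \<Rightarrow> int list set" where
  "Ls v l n = {ns. length ns = l \<and> (\<forall>x\<in>set ns. x \<noteq> 0) \<and> sum_list ns = n \<and> foldr bop ns v \<noteq> 0}"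

lemma foldr_bop_S: "v \<in> S w s \<Longrightarrow> foldr bop ns v \<in> S (w - sum_list ns) (s - (\<Sum>x\<leftarrow>ns. \<bar>x\<bar>))"
proof (induction ns)
  case (Cons k ns)
  from bop_S[OF Cons.IH[OF Cons.prems], of k] show ?case by (simp add: algebra_simps)
qed auto

lemma foldr_bop_nz:
  assumes "v \<in> D w" "foldr bop ns v \<noteq> 0"
  shows "(\<Sum>x\<leftarrow>ns. \<bar>x\<bar>) \<le> 2 * w - sum_list ns"
proof (rule ccontr)
  assume "\<not> ?thesis"
  hence "foldr bop ns v = 0" by (intro S_zero[OF foldr_bop_S[OF assms(1)]]) auto
  with assms show False by blast
qed

lemma abs_le_sum_list: "x \<in> set ns \<Longrightarrow> \<bar>x\<bar> \<le> (\<Sum>x\<leftarrow>ns. \<bar>x\<bar>)" for x :: int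
proof (induction ns)
  case (Cons a ns)
  have "0 \<le> (\<Sum>x\<leftarrow>ns. \<bar>x\<bar>)" by (rule sum_list_nonneg) auto
  thus ?case using Cons by auto
qed simp

lemma Ls_bound: assumes "v \<in> D w" "ns \<in> Ls v l n" "x \<in> set ns" shows "\<bar>x\<bar> \<le> 2 * \<bar>w\<bar> + \<bar>n\<bar>"
proof -
  have "\<bar>x\<bar> \<le> (\<Sum>x\<leftarrow>ns. \<bar>x\<bar>)" by (rule abs_le_sum_list[OF assms(3)])
  also have "\<dots> \<le> 2 * w - n" using foldr_bop_nz[OF assms(1), of ns] assms(2) by (auto simp: Ls_def)
  finally show ?thesis by linarith
qed

lemma finite_Ls: assumes "v \<in> D w" shows "finite (Ls v l n)"
proof (rule finite_subset)
  show "Ls v l n \<subseteq> {ns. set ns \<subseteq> {- (2 * \<bar>w\<bar> + \<bar>n\<bar>)..2 * \<bar>w\<bar> + \<bar>n\<bar>} \<and> length ns = l}"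
  proof
    fix ns assume ns: "ns \<in> Ls v l n"
    have "x \<in> {- (2 * \<bar>w\<bar> + \<bar>n\<bar>)..2 * \<bar>w\<bar> + \<bar>n\<bar>}" if "x \<in> set ns" for x
      using Ls_bound[OF assms ns that] by auto
    thus "ns \<in> {ns. set ns \<subseteq> {- (2 * \<bar>w\<bar> + \<bar>n\<bar>)..2 * \<bar>w\<bar> + \<bar>n\<bar>} \<and> length ns = l}"
      using ns by (auto simp: Ls_def)
  qed
qed (rule finite_lists_length_eq, simp)

lemma sum_Ls: assumes "v \<in> D w" shows "(\<Sum>ns\<in>Ls v l n. foldr bop ns v) = pmode l n v"
proof (induction l arbitrary: n)
  case 0
  have "Ls v 0 n = (if n = 0 \<and> v \<noteq> 0 then {[]} else {})" by (auto simp: Ls_def)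
  thus ?case by auto
next
  case (Suc l)
  let ?B = "2 * \<bar>w\<bar> + \<bar>n\<bar>"
  let ?K = "{-?B..?B} - {0}"
  have "pmode (Suc l) n v = (\<Sum>k\<in>?K. if k = 0 then 0 else bop k (pmode l (n - k) v))"
    unfolding pmode.simps
  proof (rule isum_eq)
    fix k assume "k \<notin> ?K"
    hence "k = 0 \<or> \<bar>k\<bar> > ?B" by auto
    thus "(if k = 0 then 0 else bop k (pmode l (n - k) v)) = 0" using pmode_term_0[OF assms] by auto
  qed simp
  also have "\<dots> = (\<Sum>k\<in>?K. \<Sum>ns\<in>Ls v l (n - k). foldr bop (k # ns) v)"
    by (intro sum.cong refl)
       (auto simp: Suc.IH[symmetric] intro!: additive_on_sum[OF additive_bop sgp_UNIV])
  also have "\<dots> = (\<Sum>(k, ns)\<in>Sigma ?K (\<lambda>k. Ls v l (n - k)). foldr bop (k # ns) v)"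
    by (rule sum.Sigma) (auto simp: finite_Ls[OF assms])
  also have "\<dots> = (\<Sum>ns\<in>(\<lambda>(k, ns). k # ns) ` Sigma ?K (\<lambda>k. Ls v l (n - k)). foldr bop ns v)"
    by (subst sum.reindex) (auto intro!: inj_onI sum.cong)
  also have "\<dots> = (\<Sum>ns\<in>Ls v (Suc l) n. foldr bop ns v)"
  proof (rule sum.mono_neutral_right)
    show "finite ((\<lambda>(k, ns). k # ns) ` Sigma ?K (\<lambda>k. Ls v l (n - k)))"
      by (intro finite_imageI finite_SigmaI finite_Ls[OF assms]) auto
    show "Ls v (Suc l) n \<subseteq> (\<lambda>(k, ns). k # ns) ` Sigma ?K (\<lambda>k. Ls v l (n - k))"
    proof
      fix ns assume ns: "ns \<in> Ls v (Suc l) n"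
      then obtain k ms where k: "ns = k # ms" by (cases ns) (auto simp: Ls_def)
      have "\<bar>k\<bar> \<le> ?B" by (rule Ls_bound[OF assms ns]) (simp add: k)
      moreover have "foldr bop ms v \<noteq> 0" using ns k by (auto simp: Ls_def)
      ultimately show "ns \<in> (\<lambda>(k, ns). k # ns) ` Sigma ?K (\<lambda>k. Ls v l (n - k))"
        using ns k by (auto simp: Ls_def image_iff intro!: bexI[of _ "(k, ms)"])
    qed
    show "\<forall>i\<in>(\<lambda>(k, ns). k # ns) ` Sigma ?K (\<lambda>k. Ls v l (n - k)) - Ls v (Suc l) n. foldr bop i v = 0"
      by (auto simp: Ls_def)
  qed
  finally show ?case by simp
qed

text \<open>The cut-off L is left free above its bound, so that modes acting on vectors of different
  weights can be written with one common L and compared term by term.\<close>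

lemma hb_eq:
  assumes v: "v \<in> D w" and L: "2 * \<bar>w\<bar> + \<bar>n\<bar> \<le> int L"
  shows "hb h n v = (\<Sum>l\<le>L. fn (tc h l) * pmode l n v)"
proof -
  let ?F = "\<lambda>ns. fn (tc h (length ns)) * foldr bop ns v"
  let ?S = "{ns. (\<forall>x\<in>set ns. x \<noteq> 0) \<and> sum_list ns = n}"
  have "hb h n v = (\<Sum>ns\<in>{ns\<in>?S. ?F ns \<noteq> 0}. ?F ns)"
    unfolding hb_def fmode_def dfsum_def
    by (simp add: dzero_eq fun_eq_iff[where 'a=mon] sum_fun_apply dmulf_eq tc_def)
       (simp add: fun_eq_iff sum_fun_apply)
  also have "\<dots> = (\<Sum>ns\<in>(\<Union>l\<le>L. Ls v l n). ?F ns)"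
  proof (rule sum.mono_neutral_left)
    show "finite (\<Union>l\<le>L. Ls v l n)" by (auto simp: finite_Ls[OF v])
    show "{ns\<in>?S. ?F ns \<noteq> 0} \<subseteq> (\<Union>l\<le>L. Ls v l n)"
    proof
      fix ns assume "ns \<in> {ns\<in>?S. ?F ns \<noteq> 0}"
      hence ns: "\<forall>x\<in>set ns. x \<noteq> 0" "sum_list ns = n" "foldr bop ns v \<noteq> 0" by auto
      have "int (length ns) \<le> (\<Sum>x\<leftarrow>ns. \<bar>x\<bar>)" using ns(1) by (induction ns) auto
      also have "\<dots> \<le> 2 * w - n" using foldr_bop_nz[OF v ns(3)] ns(2) by simp
      finally have "length ns \<le> L" using L by linarith
      thus "ns \<in> (\<Union>l\<le>L. Ls v l n)" using ns by (auto simp: Ls_def)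
    qed
  qed (auto simp: Ls_def)
  also have "\<dots> = (\<Sum>l\<le>L. \<Sum>ns\<in>Ls v l n. ?F ns)"
  proof (rule sum.UNION_disjoint)
    show "\<forall>i\<in>{..L}. \<forall>j\<in>{..L}. i \<noteq> j \<longrightarrow> Ls v i n \<inter> Ls v j n = {}" by (auto simp: Ls_def)
  qed (auto simp: finite_Ls[OF v])
  also have "\<dots> = (\<Sum>l\<le>L. \<Sum>ns\<in>Ls v l n. fn (tc h l) * foldr bop ns v)"
    by (intro sum.cong refl) (auto simp: Ls_def)
  also have "\<dots> = (\<Sum>l\<le>L. fn (tc h l) * pmode l n v)"
    by (simp add: sum_distrib_left[symmetric] sum_Ls[OF v])
  finally show ?thesis .
qed

abbreviation hol :: "(complex \<Rightarrow> complex) \<Rightarrow> bool" where "hol h \<equiv> h holomorphic_on Hp"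

lemma hol_higher_deriv: "hol h \<Longrightarrow> hol ((deriv ^^ l) h)"
  by (rule holomorphic_higher_deriv[OF _ open_Hp])

lemma hol_deriv: "hol h \<Longrightarrow> hol (deriv h)"
  by (rule holomorphic_deriv[OF _ open_Hp])

lemma hol_tc: "hol h \<Longrightarrow> hol (tc h l)"
  unfolding tc_def by (intro holomorphic_intros hol_higher_deriv) auto

lemma tc_deriv: "tc (deriv h) l = (\<lambda>\<tau>. of_nat (Suc l) * tc h (Suc l) \<tau>)"
  by (simp add: tc_def fun_eq_iff funpow_swap1 del: of_nat_Suc)

lemma deriv_tc: assumes "hol h" "\<tau> \<in> Hp" shows "deriv (tc h l) \<tau> = tc (deriv h) l \<tau>"
proof -
  have "(deriv ^^ l) h field_differentiable at \<tau>"
    by (rule holomorphic_on_imp_differentiable_at[OF hol_higher_deriv[OF assms(1)] open_Hp assms(2)])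
  hence "deriv (tc h l) \<tau> = deriv ((deriv ^^ l) h) \<tau> / fact l"
    unfolding tc_def by (simp add: deriv_cdivide_right power2_eq_square)
  thus ?thesis by (simp add: tc_def funpow_swap1)
qed

lemma tc_mult: assumes "hol h" "hol k" "\<tau> \<in> Hp"
  shows "tc (\<lambda>\<tau>. h \<tau> * k \<tau>) l \<tau> = (\<Sum>i\<le>l. tc h i \<tau> * tc k (l - i) \<tau>)"
proof -
  have "(deriv ^^ l) (\<lambda>\<tau>. h \<tau> * k \<tau>) \<tau> =
      (\<Sum>i=0..l. of_nat (l choose i) * (deriv ^^ i) h \<tau> * (deriv ^^ (l - i)) k \<tau>)"
    by (rule higher_deriv_mult[OF assms(1,2) open_Hp assms(3)])
  also have "\<dots> / fact l = (\<Sum>i\<le>l. tc h i \<tau> * tc k (l - i) \<tau>)"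
    unfolding sum_divide_distrib tc_def
    by (rule sum.cong) (auto simp: binomial_fact field_simps)
  finally show ?thesis by (simp add: tc_def)
qed

lemma tc_cong: assumes "\<And>\<tau>. \<tau> \<in> Hp \<Longrightarrow> h \<tau> = k \<tau>" "\<tau> \<in> Hp" shows "tc h l \<tau> = tc k l \<tau>"
proof -
  have "(deriv ^^ l) h \<tau> = (deriv ^^ l) k \<tau>"
    by (rule higher_deriv_cong_ev[OF _ refl], rule eventually_mono[OF eventually_nhds_in_open[OF open_Hp assms(2)] assms(1)])
  thus ?thesis by (simp add: tc_def)
qed

lemma fn_sum: "fn (\<lambda>\<tau>. \<Sum>i\<in>A. h i \<tau>) = (\<Sum>i\<in>A. fn (h i))"
  by (auto simp: fun_eq_iff sum_fun_apply fn_apply)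

lemma fn_of_nat_mult: "fn (\<lambda>\<tau>. of_nat k * h \<tau>) = of_nat k * fn h"
  by (auto simp: fun_eq_iff fn_apply pointwise)

definition Lb :: "int \<Rightarrow> int \<Rightarrow> nat" where "Lb w n = nat (2 * \<bar>w\<bar> + \<bar>n\<bar>)"

lemma hb_eq': "v \<in> D w \<Longrightarrow> Lb w n \<le> L \<Longrightarrow> hb h n v = (\<Sum>l\<le>L. fn (tc h l) * pmode l n v)"
  by (rule hb_eq[of _ w]) (auto simp: Lb_def)

lemma hb_cong: assumes "\<And>\<tau>. \<tau> \<in> Hp \<Longrightarrow> h \<tau> = k \<tau>" "v \<in> D w" shows "hb h n v = hb k n v"
  unfolding hb_eq'[OF assms(2) order_refl]
  by (intro sum.cong refl arg_cong2[where f = "(*)"] fn_cong tc_cong assms)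

lemma hb_D [intro]: assumes "v \<in> D w" "hol h" shows "hb h n v \<in> D (w - n)"
  unfolding hb_eq'[OF assms(1) order_refl]
  by (intro sgp_sum sgp_S S_fn hol_tc assms pmode_D)

lemma hb_0: "v \<in> D w \<Longrightarrow> hol h \<Longrightarrow> n > w \<Longrightarrow> hb h n v = 0"
  by (rule D_zero[OF hb_D]) auto

lemma additive_hb: "additive_on (D w) (hb h n)"
proof -
  have "pmode l n (x - y) = pmode l n x - pmode l n y" if "x \<in> D w" "y \<in> D w" for x y l
    using additive_X that by (auto simp: additive_on_def)
  thus ?thesis unfolding additive_on_def
    by (auto simp: hb_eq'[OF _ order_refl, of _ w] S_diff sum_subtractf[symmetric] right_diff_distrib)
qed

lemma hb_zero [simp]: "hb h n 0 = 0"
  using additive_on_0[OF additive_hb sgp_S] .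

lemma hb_fn: assumes "v \<in> D w" "hol f" shows "hb h n (fn f * v) = fn f * hb h n v"
  unfolding hb_eq'[OF S_fn[OF assms] order_refl] hb_eq'[OF assms(1) order_refl] pmode_fn[OF assms]
  by (simp add: sum_distrib_left mult_ac)

lemma hb_of_int: assumes "v \<in> D w" "hol h" shows "hb h n (of_int k * v) = of_int k * hb h n v"
proof -
  have "hb h n (fn (\<lambda>_. of_int k) * v) = fn (\<lambda>_. of_int k) * hb h n v" by (rule hb_fn[OF assms(1)]) auto
  thus ?thesis using assms S_Dv[OF hb_D[OF assms]] by (simp add: fn_const S_Dv)
qed

lemma hb_bop: assumes "v \<in> D w" shows "hb h n (bop m v) = bop m (hb h n v)"
proof -
  let ?L = "max (Lb (w - m) n) (Lb w n)"
  have "hb h n (bop m v) = (\<Sum>l\<le>?L. fn (tc h l) * bop m (pmode l n v))"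
    by (subst hb_eq'[OF bop_D[OF assms], of _ _ ?L]) (auto simp: pmode_bop[OF assms])
  also have "\<dots> = bop m (\<Sum>l\<le>?L. fn (tc h l) * pmode l n v)"
    by (subst additive_on_sum[OF additive_bop sgp_UNIV]) (auto simp: bop_fn)
  finally show ?thesis by (subst hb_eq'[OF assms, of _ ?L]) auto
qed

lemma hb_X: assumes "v \<in> D w" "hol h" shows "hb h n (pmode l m v) = pmode l m (hb h n v)"
proof -
  let ?L = "max (Lb (w - m) n) (Lb w n)"
  have "hb h n (pmode l m v) = (\<Sum>i\<le>?L. fn (tc h i) * pmode l m (pmode i n v))"
    by (subst hb_eq'[OF pmode_D[OF assms(1)], of _ _ ?L]) (auto simp: pmode_X[OF assms(1)])
  also have "\<dots> = (\<Sum>i\<le>?L. pmode l m (fn (tc h i) * pmode i n v))"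
    by (intro sum.cong refl pmode_fn[OF pmode_D[OF assms(1)], symmetric] hol_tc assms)
  also have "\<dots> = pmode l m (\<Sum>i\<le>?L. fn (tc h i) * pmode i n v)"
    by (rule additive_on_sum[OF additive_X[of "w - n"] sgp_S, symmetric])
       (intro S_fn pmode_D assms hol_tc)
  finally show ?thesis by (subst hb_eq'[OF assms(1), of _ ?L]) auto
qed

lemma hb_hb: assumes "v \<in> D w" "hol h" "hol k" shows "hb h m (hb k n v) = hb k n (hb h m v)"
proof -
  let ?L = "max (Lb (w - m) n) (Lb w n)"
  have "hb h m (hb k n v) = hb h m (\<Sum>i\<le>?L. fn (tc k i) * pmode i n v)"
    by (subst hb_eq'[OF assms(1), of _ ?L]) auto
  also have "\<dots> = (\<Sum>i\<le>?L. hb h m (fn (tc k i) * pmode i n v))"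
    by (rule additive_on_sum[OF additive_hb[of "w - n"] sgp_S]) (intro S_fn pmode_D assms hol_tc)
  also have "\<dots> = (\<Sum>i\<le>?L. fn (tc k i) * pmode i n (hb h m v))"
  proof (intro sum.cong refl)
    fix i show "hb h m (fn (tc k i) * pmode i n v) = fn (tc k i) * pmode i n (hb h m v)"
      using hb_fn[OF pmode_D[OF assms(1)] hol_tc[OF assms(3)]] hb_X[OF assms(1,2)] by simp
  qed
  also have "\<dots> = hb k n (hb h m v)"
    by (subst hb_eq'[OF hb_D[OF assms(1,2)], of _ _ ?L]) auto
  finally show ?thesis .
qed

text \<open>The commutator [a_m, Y(h, z)] is z^m Y(h', z). For m \<noteq> 0 it comes from
  \<open>aop_X\<close> together with l \<open>tc h l\<close> = \<open>tc (deriv h) (l - 1)\<close>;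
  for m = 0 the derivative falls on the Taylor coefficients instead.\<close>

lemma aop_hb:
  assumes "v \<in> D w" "hol h"
  shows "aop m (hb h n v) = hb h n (aop m v) + hb (deriv h) (n + m) v"
proof -
  let ?L = "Lb (w - m) n + Lb w n + Lb w (n + m)"
  have am: "aop m v \<in> D (w - m)" using assms by auto
  \<comment> \<open>One term more than the bound: removing a factor lowers the power l by one, and
    after the shift the sum must still reach order \<open>?L\<close>.\<close>
  have "aop m (hb h n v) = aop m (\<Sum>l\<le>Suc ?L. fn (tc h l) * pmode l n v)"
    by (subst hb_eq'[OF assms(1), of _ "Suc ?L"]) auto
  also have "\<dots> = (\<Sum>l\<le>Suc ?L. aop m (fn (tc h l) * pmode l n v))"
    by (rule additive_on_sum[OF additive_aop_S[of "w - n" "w - n"] sgp_S]) (intro S_fn pmode_D assms hol_tc)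
  also have "\<dots> = (\<Sum>l\<le>Suc ?L. fn (tc h l) * pmode l n (aop m v)) + hb (deriv h) (n + m) v"
  proof (cases "m = 0")
    case True
    have "aop m (fn (tc h l) * pmode l n v) = fn (tc h l) * pmode l n (aop m v) + fn (tc (deriv h) l) * pmode l n v" for l
    proof -
      have "fn (deriv (tc h l)) = fn (tc (deriv h) l)" by (rule fn_cong) (rule deriv_tc[OF assms(2)])
      thus ?thesis
        using aop_0_fn[OF S_Dv[OF pmode_D[OF assms(1)]] hol_tc[OF assms(2)]] True aop_X[OF assms(1), of m l n] by simp
    qed
    moreover have "hb (deriv h) (n + m) v = (\<Sum>l\<le>Suc ?L. fn (tc (deriv h) l) * pmode l n v)"
      using True by (subst hb_eq'[OF assms(1), of _ "Suc ?L"]) auto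
    ultimately show ?thesis by (simp add: sum.distrib del: sum.atMost_Suc)
  next
    case False
    have "aop m (fn (tc h l) * pmode l n v) = fn (tc h l) * pmode l n (aop m v) +
        of_nat l * fn (tc h l) * pmode (l - 1) (n + m) v" for l
      using False aop_X[OF assms(1), of m l n] by (simp add: aop_fn algebra_simps)
    moreover have "(\<Sum>l\<le>Suc ?L. of_nat l * fn (tc h l) * pmode (l - 1) (n + m) v) =
       (\<Sum>l\<le>?L. fn (tc (deriv h) l) * pmode l (n + m) v)"
      by (subst sum.atMost_Suc_shift) (simp add: tc_deriv fn_of_nat_mult del: of_nat_Suc)
    moreover have "hb (deriv h) (n + m) v = (\<Sum>l\<le>?L. fn (tc (deriv h) l) * pmode l (n + m) v)"
      by (subst hb_eq'[OF assms(1), of _ "?L"]) auto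
    ultimately show ?thesis by (simp add: sum.distrib del: sum.atMost_Suc)
  qed
  also have "(\<Sum>l\<le>Suc ?L. fn (tc h l) * pmode l n (aop m v)) = hb h n (aop m v)"
    by (subst hb_eq'[OF am, of _ "Suc ?L"]) auto
  finally show ?thesis .
qed

lemma hbhb_0: "v \<in> D w \<Longrightarrow> hol h \<Longrightarrow> hol k \<Longrightarrow> m > w \<or> n > w \<Longrightarrow> hb h m (hb k n v) = 0"
  using hb_0[of v w k n] hb_0[of v w h m] hb_hb[of v w h k m n] by auto

text \<open>Multiplicativity Y(h, z) Y(k, z) = Y(h k, z): the Leibniz rule for Taylor coefficients
  meets the product rule \<open>pmode_add\<close> for powers in a Cauchy product.\<close>

lemma hb_mult:
  assumes v: "v \<in> D w" and h: "hol h" "hol k"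
  shows "isum (\<lambda>i. hb h i (hb k (n - i) v)) = hb (\<lambda>\<tau>. h \<tau> * k \<tau>) n v"
proof -
  define B where "B = \<bar>n\<bar> + \<bar>w\<bar>"
  define L where "L = nat (20 * B)"
  have B1: "\<bar>n\<bar> \<le> B" "\<bar>w\<bar> \<le> B" by (auto simp: B_def)
  have Lb: "Lb w' n' \<le> L" if "\<bar>w'\<bar> \<le> 5 * B" "\<bar>n'\<bar> \<le> 5 * B" for w' n'
    using that by (auto simp: Lb_def L_def)
  have X0: "pmode l n v = 0" if "l > L" for l
    by (rule pmode_eq_0[OF v]) (use that in \<open>auto simp: L_def B_def\<close>)
  have "isum (\<lambda>i. hb h i (hb k (n - i) v)) = (\<Sum>i\<in>{-B..B}. hb h i (hb k (n - i) v))"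
  proof (rule isum_eq)
    fix i assume "i \<notin> {-B..B}"
    hence "i > w \<or> n - i > w" by (auto simp: B_def)
    thus "hb h i (hb k (n - i) v) = 0" by (rule hbhb_0[OF v h])
  qed simp
  also have "\<dots> = (\<Sum>i\<in>{-B..B}. \<Sum>l\<le>L. \<Sum>l'\<le>L. fn (tc h l) * fn (tc k l') * pmode l i (pmode l' (n - i) v))"
  proof (rule sum.cong[OF refl])
    fix i assume i: "i \<in> {-B..B}"
    hence i': "\<bar>i\<bar> \<le> B" by auto
    have "\<bar>w - (n - i)\<bar> \<le> 5 * B" "\<bar>w\<bar> \<le> 5 * B" "\<bar>i\<bar> \<le> 5 * B" "\<bar>n - i\<bar> \<le> 5 * B"
      using i' B1 by (simp_all add: abs_le_iff)
    note Ls = Lb[OF this(1,3)] Lb[OF this(2,4)]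
    have "hb h i (hb k (n - i) v) = (\<Sum>l\<le>L. fn (tc h l) * pmode l i (hb k (n - i) v))"
      by (rule hb_eq'[OF hb_D[OF v h(2)] Ls(1)])
    also have "\<dots> = (\<Sum>l\<le>L. \<Sum>l'\<le>L. fn (tc h l) * fn (tc k l') * pmode l i (pmode l' (n - i) v))"
    proof (rule sum.cong[OF refl])
      fix l
      have "pmode l i (hb k (n - i) v) = pmode l i (\<Sum>l'\<le>L. fn (tc k l') * pmode l' (n - i) v)"
        by (subst hb_eq'[OF v Ls(2)]) simp
      also have "\<dots> = (\<Sum>l'\<le>L. pmode l i (fn (tc k l') * pmode l' (n - i) v))"
        by (rule additive_on_sum[OF additive_X[of "w - (n - i)"] sgp_S]) (intro S_fn pmode_D v hol_tc h)
      also have "\<dots> = (\<Sum>l'\<le>L. fn (tc k l') * pmode l i (pmode l' (n - i) v))"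
        by (intro sum.cong refl pmode_fn[OF pmode_D[OF v]] hol_tc h)
      finally show "fn (tc h l) * pmode l i (hb k (n - i) v) =
          (\<Sum>l'\<le>L. fn (tc h l) * fn (tc k l') * pmode l i (pmode l' (n - i) v))"
        by (simp add: sum_distrib_left mult.assoc)
    qed
    finally show "hb h i (hb k (n - i) v) = (\<Sum>l\<le>L. \<Sum>l'\<le>L. fn (tc h l) * fn (tc k l') * pmode l i (pmode l' (n - i) v))" .
  qed
  also have "\<dots> = (\<Sum>l\<le>L. \<Sum>l'\<le>L. \<Sum>i\<in>{-B..B}. fn (tc h l) * fn (tc k l') * pmode l i (pmode l' (n - i) v))"
    by (simp add: sum.swap[of _ _ "{-B..B}"])
  also have "\<dots> = (\<Sum>l\<le>L. \<Sum>l'\<le>L. fn (tc h l) * fn (tc k l') * pmode (l + l') n v)"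
  proof (intro sum.cong refl)
    fix l l'
    have "pmode (l + l') n v = (\<Sum>i\<in>{-B..B}. pmode l i (pmode l' (n - i) v))"
      unfolding pmode_add[OF v]
    proof (rule isum_eq)
      fix i assume "i \<notin> {-B..B}"
      hence "i > w \<or> n - i > w" by (auto simp: B_def)
      thus "pmode l i (pmode l' (n - i) v) = 0" by (rule XX_0[OF v])
    qed simp
    thus "(\<Sum>i\<in>{-B..B}. fn (tc h l) * fn (tc k l') * pmode l i (pmode l' (n - i) v)) =
      fn (tc h l) * fn (tc k l') * pmode (l + l') n v" by (simp add: sum_distrib_left)
  qed
  also have "\<dots> = (\<Sum>(l, l')\<in>{..L} \<times> {..L}. fn (tc h l) * fn (tc k l') * pmode (l + l') n v)"
    by (rule sum.cartesian_product)
  \<comment> \<open>Above the diagonal l + l' = L the power \<open>pmode (l + l') n v\<close> is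
    already 0, so the square may be cut down to a triangle.\<close>
  also have "\<dots> = (\<Sum>(l, l')\<in>{(i, j). i + j \<le> L}. fn (tc h l) * fn (tc k l') * pmode (l + l') n v)"
    by (rule sum.mono_neutral_right) (auto simp: X0)
  also have "\<dots> = (\<Sum>s\<le>L. \<Sum>i\<le>s. fn (tc h i) * fn (tc k (s - i)) * pmode (i + (s - i)) n v)"
    by (rule sum.triangle_reindex_eq)
  also have "\<dots> = (\<Sum>s\<le>L. fn (tc (\<lambda>\<tau>. h \<tau> * k \<tau>) s) * pmode s n v)"
  proof (rule sum.cong[OF refl])
    fix s
    have "fn (tc (\<lambda>\<tau>. h \<tau> * k \<tau>) s) = fn (\<lambda>\<tau>. \<Sum>i\<le>s. tc h i \<tau> * tc k (s - i) \<tau>)"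
      by (rule fn_cong) (rule tc_mult[OF h])
    also have "\<dots> = (\<Sum>i\<le>s. fn (tc h i) * fn (tc k (s - i)))" by (simp add: fn_sum fn_mult)
    finally show "(\<Sum>i\<le>s. fn (tc h i) * fn (tc k (s - i)) * pmode (i + (s - i)) n v) =
        fn (tc (\<lambda>\<tau>. h \<tau> * k \<tau>) s) * pmode s n v"
      by (simp add: sum_distrib_right)
  qed
  also have "\<dots> = hb (\<lambda>\<tau>. h \<tau> * k \<tau>) n v"
    by (rule hb_eq'[OF v Lb, symmetric]) (auto simp: B_def)
  finally show ?thesis .
qed

lemma bop_hb_0:
  assumes v: "v \<in> D w" and h: "hol h" and "n - k > w \<or> k > w"
  shows "bop k (hb h (n - k) v) = 0"
proof -
  have "bop k v = 0" if "k > w" by (rule D_zero[OF bop_D[OF v]]) (use that in auto)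
  thus ?thesis using assms hb_bop[OF v, of h "n - k" k] hb_0[OF v h, of "n - k"] by auto
qed

text \<open>The chain rule d/dz Y(h, z) = b'(z) Y(h', z), obtained order by order from
  \<open>pmode_euler\<close>.\<close>

lemma hb_euler:
  assumes v: "v \<in> D w" and h: "hol h"
  shows "isum (\<lambda>k. of_int k * bop k (hb (deriv h) (n - k) v)) = of_int n * hb h n v"
proof -
  define B where "B = 2 * \<bar>w\<bar> + \<bar>n\<bar>"
  define L where "L = nat (20 * B)"
  have B1: "\<bar>n\<bar> \<le> B" "\<bar>w\<bar> \<le> B" by (auto simp: B_def)
  have Lb: "Lb w' n' \<le> L" if "\<bar>w'\<bar> \<le> 5 * B" "\<bar>n'\<bar> \<le> 5 * B" for w' n'
    using that by (auto simp: Lb_def L_def)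
  have "isum (\<lambda>k. of_int k * bop k (hb (deriv h) (n - k) v)) =
      (\<Sum>k\<in>{-B..B}. of_int k * bop k (hb (deriv h) (n - k) v))"
  proof (rule isum_eq)
    fix k assume "k \<notin> {-B..B}"
    hence "n - k > w \<or> k > w" by (auto simp: B_def)
    thus "of_int k * bop k (hb (deriv h) (n - k) v) = 0"
      by (simp add: bop_hb_0[OF v hol_deriv[OF h]])
  qed simp
  also have "\<dots> = (\<Sum>k\<in>{-B..B}. \<Sum>l\<le>L. fn (tc (deriv h) l) * (of_int k * bop k (pmode l (n - k) v)))"
  proof (rule sum.cong[OF refl])
    fix k assume k: "k \<in> {-B..B}"
    hence k': "\<bar>k\<bar> \<le> B" by auto
    have "\<bar>w\<bar> \<le> 5 * B" "\<bar>n - k\<bar> \<le> 5 * B"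
      using k' B1 by (simp_all add: abs_le_iff)
    note L' = Lb[OF this]
    have "bop k (hb (deriv h) (n - k) v) = bop k (\<Sum>l\<le>L. fn (tc (deriv h) l) * pmode l (n - k) v)"
      by (subst hb_eq'[OF v L']) simp
    also have "\<dots> = (\<Sum>l\<le>L. fn (tc (deriv h) l) * bop k (pmode l (n - k) v))"
      by (subst additive_on_sum[OF additive_bop sgp_UNIV]) (auto simp: bop_fn)
    finally show "of_int k * bop k (hb (deriv h) (n - k) v) =
       (\<Sum>l\<le>L. fn (tc (deriv h) l) * (of_int k * bop k (pmode l (n - k) v)))"
      by (simp add: sum_distrib_left mult_ac)
  qed
  also have "\<dots> = (\<Sum>l\<le>L. fn (tc (deriv h) l) * (\<Sum>k\<in>{-B..B}. of_int k * bop k (pmode l (n - k) v)))"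
    by (simp add: sum.swap[of _ _ "{-B..B}"] sum_distrib_left)
  also have "\<dots> = (\<Sum>l\<le>L. fn (tc h (Suc l)) * (of_int n * pmode (Suc l) n v))"
  proof (rule sum.cong[OF refl])
    fix l
    have "(\<Sum>k\<in>{-B..B}. of_int k * bop k (pmode l (n - k) v)) = isum (\<lambda>k. of_int k * bop k (pmode l (n - k) v))"
    proof (rule isum_eq[symmetric])
      fix k assume "k \<notin> {-B..B}"
      hence "\<bar>k\<bar> > 2 * \<bar>w\<bar> + \<bar>n\<bar>" by (auto simp: B_def)
      thus "of_int k * bop k (pmode l (n - k) v) = 0" using pmode_term_0[OF v] by simp
    qed simp
    thus "fn (tc (deriv h) l) * (\<Sum>k\<in>{-B..B}. of_int k * bop k (pmode l (n - k) v)) =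
       fn (tc h (Suc l)) * (of_int n * pmode (Suc l) n v)"
      by (simp add: tc_deriv fn_of_nat_mult pmode_euler[OF v] mult_ac del: of_nat_Suc pmode.simps)
  qed
  also have "\<dots> = (\<Sum>l\<le>Suc L. fn (tc h l) * (of_int n * pmode l n v))"
    by (subst sum.atMost_Suc_shift) simp
  also have "\<dots> = of_int n * (\<Sum>l\<le>Suc L. fn (tc h l) * pmode l n v)"
    by (simp add: sum_distrib_left mult_ac del: sum.atMost_Suc pmode.simps)
  also have "(\<Sum>l\<le>Suc L. fn (tc h l) * pmode l n v) = hb h n v"
    by (rule hb_eq'[OF v, symmetric], rule le_SucI, rule Lb) (auto simp: B_def)
  finally show ?thesis .
qed

lemma tc_const: "tc (\<lambda>_. c) l = (if l = 0 then (\<lambda>_. c) else (\<lambda>_. 0))"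
proof -
  have z: "(deriv ^^ l) (\<lambda>_::complex. 0 :: complex) = (\<lambda>_. 0)" for l
    by (induction l) auto
  show ?thesis by (cases l) (auto simp: tc_def funpow_swap1 z simp del: funpow.simps(2) simp add: funpow_Suc_right)
qed

lemma fn_0: "fn (\<lambda>_. 0) = 0" by (simp add: fun_eq_iff fn_apply pointwise)

lemma hb_const: assumes "v \<in> D w" shows "hb (\<lambda>_. c) n v = (if n = 0 then fn (\<lambda>_. c) * v else 0)"
proof -
  have "hb (\<lambda>_. c) n v = (\<Sum>l\<le>Lb w n. if l = 0 then fn (\<lambda>_. c) * pmode l n v else 0)"
    unfolding hb_eq'[OF assms order_refl] by (intro sum.cong refl) (auto simp: tc_const fn_0)
  thus ?thesis by (simp add: sum.delta)
qed

lemma hb_id: assumes "v \<in> D w" shows "hb (\<lambda>\<tau>. \<tau>) n v = bop n v"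
proof -
  have X1: "pmode 1 n v = (if n = 0 then 0 else bop n v)"
    unfolding One_nat_def pmode.simps(2) by (subst isum_single[of n]) auto
  have "tc (\<lambda>\<tau>. \<tau>) l = (if l = 0 then (\<lambda>\<tau>. \<tau>) else if l = 1 then (\<lambda>_. 1) else (\<lambda>_. 0))" for l
  proof (cases l)
    case (Suc m)
    have "tc (\<lambda>_::complex. 1) m = (\<lambda>\<tau>. of_nat (Suc m) * tc (\<lambda>\<tau>. \<tau>) (Suc m) \<tau>)"
      using tc_deriv[of "\<lambda>\<tau>. \<tau>" m] by simp
    hence "of_nat (Suc m) * tc (\<lambda>\<tau>. \<tau>) (Suc m) \<tau> = tc (\<lambda>_::complex. 1) m \<tau>" for \<tau> by metis
    hence e: "of_nat (Suc m) * tc (\<lambda>\<tau>. \<tau>) (Suc m) \<tau> = (if m = 0 then 1 else 0)" for \<tau>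
      by (simp add: tc_const del: of_nat_Suc)
    have "tc (\<lambda>\<tau>. \<tau>) (Suc m) \<tau> = (if m = 0 then 1 else 0)" for \<tau>
      using e[of \<tau>] by (cases "m = 0") (simp_all del: of_nat_Suc add: of_nat_1[unfolded One_nat_def])
    thus ?thesis using Suc by (auto simp: fun_eq_iff)
  qed (simp add: tc_def)
  hence "hb (\<lambda>\<tau>. \<tau>) n v = (\<Sum>l\<le>Suc (Lb w n). (if l = 0 then fn (\<lambda>\<tau>. \<tau>) * pmode l n v else 0) +
       (if l = 1 then fn (\<lambda>_. 1) * pmode l n v else 0))"
    by (subst hb_eq'[OF assms, of _ "Suc (Lb w n)"]) (auto intro!: sum.cong simp: fn_0 simp del: pmode.simps sum.atMost_Suc)
  also have "\<dots> = fn (\<lambda>\<tau>. \<tau>) * pmode 0 n v + fn (\<lambda>_. 1) * pmode 1 n v"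
    by (simp add: sum.distrib sum.delta del: pmode.simps sum.atMost_Suc)
  also have "\<dots> = bop n v"
  proof (cases "n = 0")
    case True
    have "fn (\<lambda>\<tau>. \<tau>) * v = bop 0 v"
      using S_Dv[OF assms] by (auto simp: fun_eq_iff fn_apply pointwise bop_zero Dv_def not_less)
    thus ?thesis using True X1 by (simp del: pmode.simps(2) One_nat_def)
  next
    case False
    thus ?thesis using S_Dv[OF assms] by (simp add: X1 fn_1 bop_Dv del: pmode.simps(2) One_nat_def)
  qed
  finally show ?thesis .
qed

lemma hb_add: assumes "v \<in> D w" "hol h" "hol k"
  shows "hb (\<lambda>\<tau>. h \<tau> + k \<tau>) n v = hb h n v + hb k n v"
proof -
  have "fn (tc (\<lambda>\<tau>. h \<tau> + k \<tau>) l) = fn (tc h l) + fn (tc k l)" for l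
    unfolding fn_add[symmetric]
    by (rule fn_cong) (simp add: tc_def higher_deriv_add[OF assms(2,3) open_Hp] add_divide_distrib)
  thus ?thesis unfolding hb_eq'[OF assms(1) order_refl] by (simp add: sum.distrib distrib_right)
qed

lemma hb_cmult: assumes "v \<in> D w" "hol h"
  shows "hb (\<lambda>\<tau>. c * h \<tau>) n v = fn (\<lambda>_. c) * hb h n v"
proof -
  have "hb (\<lambda>\<tau>. c * h \<tau>) n v = isum (\<lambda>i. hb (\<lambda>_. c) i (hb h (n - i) v))"
    by (rule hb_mult[symmetric]) (use assms in auto)
  also have "\<dots> = isum (\<lambda>i. if i = 0 then fn (\<lambda>_. c) * hb h n v else 0)"
    by (rule isum_cong) (use hb_const[OF hb_D[OF assms]] in auto)
  finally show ?thesis by (subst (asm) isum_single[of 0]) auto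
qed

subsection \<open>Normally ordered products\<close>

text \<open>The coefficient of z^(-m-1) of the normally ordered product of a(z) and Y(h, z): modes
  a_k with k < 0 stand on the left. Likewise \<open>be\<close> gives the coefficients of b'(z) Y(k,
  z), where all factors commute and no ordering is required.\<close>

definition ah :: "(complex \<Rightarrow> complex) \<Rightarrow> int \<Rightarrow> dch \<Rightarrow> dch" where
  "ah h m v = isum (\<lambda>k. if k < 0 then aop k (hb h (m - k) v) else hb h (m - k) (aop k v))"

definition be :: "(complex \<Rightarrow> complex) \<Rightarrow> int \<Rightarrow> dch \<Rightarrow> dch" where
  "be k m v = isum (\<lambda>n. of_int (- n) * bop n (hb k (m - n) v))"

lemma mode_a_eq: "mode_a h m v = ah h m v"
  by (simp add: mode_a_def ah_def hb_def dfsum_isum cong: if_cong)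

lemma mode_b_eq: "mode_b k m v = be k m v"
proof -
  have "dscale (- of_int n) x = of_int (- n) * x" for n x using dscale_int[of "- n" x] by simp
  thus ?thesis by (simp only: mode_b_def be_def hb_def dfsum_isum)
qed

lemma D_cong: "v \<in> D a \<Longrightarrow> a = b \<Longrightarrow> v \<in> D b" by simp

lemma hb_plus: "x \<in> D w \<Longrightarrow> y \<in> D w \<Longrightarrow> hb h n (x + y) = hb h n x + hb h n y"
  by (rule additive_on_add[OF additive_hb sgp_S])
lemma hb_minus: "x \<in> D w \<Longrightarrow> y \<in> D w \<Longrightarrow> hb h n (x - y) = hb h n x - hb h n y"
  by (rule additive_on_diff[OF additive_hb])
lemma aop_plus: "x \<in> D w \<Longrightarrow> y \<in> D w \<Longrightarrow> aop n (x + y) = aop n x + aop n y"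
  by (rule additive_on_add[OF additive_aop_S sgp_S])
lemma aop_minus: "x \<in> D w \<Longrightarrow> y \<in> D w \<Longrightarrow> aop n (x - y) = aop n x - aop n y"
  by (rule additive_on_diff[OF additive_aop_S])

lemma aop_eq_0: "v \<in> D w \<Longrightarrow> k > w \<Longrightarrow> aop k v = 0"
  by (rule D_zero[OF aop_D]) auto

context
  fixes v :: dch and w :: int and h :: "complex \<Rightarrow> complex"
  assumes v: "v \<in> D w" and h: "hol h"
begin

lemma ah_term_D: "(if k < 0 then aop k (hb h (m - k) v) else hb h (m - k) (aop k v)) \<in> D (w - m)"
proof -
  have "aop k (hb h (m - k) v) \<in> D (w - (m - k) - k)" using v h by (intro aop_D hb_D)
  moreover have "hb h (m - k) (aop k v) \<in> D (w - k - (m - k))" using v h by (intro aop_D hb_D)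
  ultimately show ?thesis by simp
qed

lemma ah_term_0:
  assumes "\<bar>k\<bar> > \<bar>m\<bar> + \<bar>w\<bar>"
  shows "(if k < 0 then aop k (hb h (m - k) v) else hb h (m - k) (aop k v)) = 0"
  using assms hb_0[OF v h, of "m - k"] aop_eq_0[OF v, of k] by auto

lemma ah_fsup: "fsup (\<lambda>k. if k < 0 then aop k (hb h (m - k) v) else hb h (m - k) (aop k v))"
  by (rule fsupI) (rule ah_term_0)

lemma ah_D [intro]: "ah h m v \<in> D (w - m)"
  unfolding ah_def by (rule sgp_isum[OF sgp_S]) (rule ah_term_D)

lemma be_term_D: "of_int (- n) * bop n (hb h (m - n) v) \<in> D (w - m)"
proof -
  have "of_int (- n) * bop n (hb h (m - n) v) \<in> D (w - (m - n) - n)" using v h by (intro S_of_int bop_D hb_D)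
  thus ?thesis by simp
qed

lemma be_fsup: "fsup (\<lambda>n. of_int (- n) * bop n (hb h (m - n) v))"
proof (rule fsupI[of "\<bar>m\<bar> + \<bar>w\<bar>"])
  fix k assume "\<bar>k\<bar> > \<bar>m\<bar> + \<bar>w\<bar>"
  hence "m - k > w \<or> k > w" by auto
  thus "of_int (- k) * bop k (hb h (m - k) v) = 0" using bop_hb_0[OF v h, of m k] by simp
qed

lemma be_D [intro]: "be h m v \<in> D (w - m)"
  unfolding be_def by (rule sgp_isum[OF sgp_S]) (rule be_term_D)

end

lemma additive_ah: assumes "hol h" shows "additive_on (D w) (ah h m)"
  unfolding ah_def
proof (rule additive_on_isum_fun[OF _ sgp_S])
  fix k show "additive_on (D w) (\<lambda>x. if k < 0 then aop k (hb h (m - k) x) else hb h (m - k) (aop k x))"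
    unfolding additive_on_def
    using assms by (auto simp: hb_minus[of _ w] aop_minus[of _ w] hb_D
        aop_minus[of _ "w - (m - k)"] hb_minus[of _ "w - k"] aop_D)
qed (rule ah_fsup[OF _ assms])

lemma additive_be: assumes "hol h" shows "additive_on (D w) (be h m)"
  unfolding be_def
proof (rule additive_on_isum_fun[OF _ sgp_S])
  fix k show "additive_on (D w) (\<lambda>x. of_int (- k) * bop k (hb h (m - k) x))"
    unfolding additive_on_def
    using assms by (auto simp: hb_minus[of _ w] bop_diff algebra_simps)
qed (rule be_fsup[OF _ assms])

lemma be_deriv: "v \<in> D w \<Longrightarrow> hol q \<Longrightarrow> be (deriv q) n v = of_int (- n) * hb q n v"
  unfolding be_def using hb_euler[of v w q n] isum_uminus[of "\<lambda>k. of_int k * bop k (hb (deriv q) (n - k) v)"]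
  by simp

text \<open>In fields: (d/dz Y(q, z)) Y(K, z) = b'(z) Y(q' K, z), by the chain rule and then
  multiplicativity. Every correction term produced by normal ordering takes this shape.\<close>

lemma hb_mult_conv:
  assumes "v \<in> D w" "hol q" "hol K"
  shows "isum (\<lambda>j. of_int (- j) * hb q j (hb K (n - j) v)) = be (\<lambda>\<tau>. deriv q \<tau> * K \<tau>) n v"
proof -
  let ?F = "\<lambda>j i. of_int (- i) * bop i (hb (deriv q) (j - i) (hb K (n - j) v))"
  note q' = hol_deriv[OF assms(2)]
  have z: "bop i (hb (deriv q) (j - i) (hb K (n - j) v)) = 0"
    if "\<bar>j\<bar> > 2 * \<bar>n\<bar> + 3 * \<bar>w\<bar> \<or> \<bar>i\<bar> > 2 * \<bar>n\<bar> + 3 * \<bar>w\<bar>" for i j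
  proof -
    have "n - j > w \<or> j - i > w \<or> i > w" using that by linarith
    moreover have "bop i (hb (deriv q) (j - i) (hb K (n - j) v)) = hb (deriv q) (j - i) (hb K (n - j) (bop i v))"
      using hb_bop[OF hb_D[OF assms(1,3)]] hb_bop[OF assms(1)] by simp
    moreover have "i > w \<Longrightarrow> bop i v = 0" by (rule D_zero[OF bop_D[OF assms(1)]]) auto
    ultimately show ?thesis using hbhb_0[OF assms(1) q' assms(3), of "j - i" "n - j"] by auto
  qed
  have "isum (\<lambda>j. of_int (- j) * hb q j (hb K (n - j) v)) = isum (\<lambda>j. isum (\<lambda>i. ?F j i))"
    by (rule isum_cong) (use be_deriv[OF hb_D[OF assms(1,3)] assms(2)] in \<open>simp add: be_def\<close>)
  also have "\<dots> = isum (\<lambda>i. isum (\<lambda>j. ?F j i))"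
    by (rule isum_swap[of "2 * \<bar>n\<bar> + 3 * \<bar>w\<bar>"]) (simp only: z mult_zero_right)
  also have "\<dots> = be (\<lambda>\<tau>. deriv q \<tau> * K \<tau>) n v"
    unfolding be_def
  proof (rule isum_cong)
    fix i
    have fs: "fsup (\<lambda>j. hb (deriv q) (j - i) (hb K (n - j) v))"
      by (rule fsupI[of "\<bar>n\<bar> + \<bar>w\<bar> + \<bar>i\<bar>"], rule hbhb_0[OF assms(1) q' assms(3)]) linarith
    have "isum (\<lambda>j. ?F j i) = of_int (- i) * bop i (isum (\<lambda>j. hb (deriv q) (j - i) (hb K (n - j) v)))"
      by (subst additive_on_isum[OF additive_bop sgp_UNIV _ fs], simp,
          rule isum_mult_left[OF fsup_hom[OF additive_bop sgp_UNIV fs]])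
    also have "isum (\<lambda>j. hb (deriv q) (j - i) (hb K (n - j) v)) = hb (\<lambda>\<tau>. deriv q \<tau> * K \<tau>) (n - i) v"
      using hb_mult[OF assms(1) q' assms(3), of "n - i"]
        isum_shift[of "\<lambda>j. hb (deriv q) j (hb K (n - i - j) v)" "- i"] by (simp add: algebra_simps)
    finally show "isum (\<lambda>j. ?F j i) = of_int (- i) * bop i (hb (\<lambda>\<tau>. deriv q \<tau> * K \<tau>) (n - i) v)" .
  qed
  finally show ?thesis .
qed

section \<open>Commutators of currents and the failure of associativity of normal ordering\<close>

lemma ah_hb:
  assumes v: "v \<in> D w" and h: "hol h" "hol k"
  shows "ah h m (hb k n v) = hb k n (ah h m v) + hb (\<lambda>\<tau>. h \<tau> * deriv k \<tau>) (m + n) v"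
proof -
  note k' = hol_deriv[OF h(2)]
  let ?t = "\<lambda>j. if j < 0 then aop j (hb h (m - j) v) else hb h (m - j) (aop j v)"
  let ?F = "\<lambda>i. hb h i (hb (deriv k) (m + n - i) v)"
  have "ah h m (hb k n v) = isum (\<lambda>j. hb k n (?t j) + ?F (m - j))"
    unfolding ah_def
  proof (rule isum_cong)
    fix j
    have 1: "aop j (hb h (m - j) (hb k n v)) = hb k n (aop j (hb h (m - j) v)) + ?F (m - j)"
      using aop_hb[OF hb_D[OF v h(1), of "m - j"] h(2), of j n] hb_hb[OF v h] hb_hb[OF v h(1) k', of "m - j" "n + j"]
      by (simp add: algebra_simps)
    have a: "hb k n (aop j v) \<in> D (w - j - n)" using v h by (intro hb_D aop_D)
    have b: "hb (deriv k) (n + j) v \<in> D (w - j - n)" using hb_D[OF v k', of "n + j"] by (simp add: algebra_simps)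
    have 2: "hb h (m - j) (aop j (hb k n v)) = hb k n (hb h (m - j) (aop j v)) + ?F (m - j)"
      unfolding aop_hb[OF v h(2)] hb_plus[OF a b] hb_hb[OF aop_D[OF v] h]
      by (simp add: algebra_simps)
    show "(if j < 0 then aop j (hb h (m - j) (hb k n v)) else hb h (m - j) (aop j (hb k n v))) =
      hb k n (?t j) + ?F (m - j)" using 1 2 by auto
  qed
  also have "\<dots> = isum (\<lambda>j. hb k n (?t j)) + isum (\<lambda>j. ?F (m - j))"
  proof (rule isum_add)
    show "fsup (\<lambda>j. hb k n (?t j))" by (rule fsup_hom[OF additive_hb sgp_S ah_fsup[OF v h(1)]])
    show "fsup (\<lambda>j. ?F (m - j))"
      by (rule fsupI[of "\<bar>m\<bar> + \<bar>n\<bar> + \<bar>w\<bar>"], rule hbhb_0[OF v h(1) k']) linarith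
  qed
  also have "isum (\<lambda>j. hb k n (?t j)) = hb k n (ah h m v)"
    unfolding ah_def
    by (rule additive_on_isum[OF additive_hb sgp_S ah_term_D[OF v h(1)] ah_fsup[OF v h(1)], symmetric])
  also have "isum (\<lambda>j. ?F (m - j)) = hb (\<lambda>\<tau>. h \<tau> * deriv k \<tau>) (m + n) v"
    by (subst isum_reflect[of ?F m]) (rule hb_mult[OF v h(1) k'])
  finally show ?thesis .
qed

lemma ah_aop:
  assumes v: "v \<in> D w" and h: "hol h"
  shows "ah h m (aop n v) = aop n (ah h m v) - ah (deriv h) (m + n) v"
proof -
  note h' = hol_deriv[OF h]
  let ?t = "\<lambda>j. if j < 0 then aop j (hb h (m - j) v) else hb h (m - j) (aop j v)"
  let ?t' = "\<lambda>j. if j < 0 then aop j (hb (deriv h) (m + n - j) v) else hb (deriv h) (m + n - j) (aop j v)"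
  have sw: "hb h i (aop n u) = aop n (hb h i u) - hb (deriv h) (i + n) u" if "u \<in> D w'" for u w' i
    using aop_hb[OF that h, of n i] by simp
  have "ah h m (aop n v) = isum (\<lambda>j. aop n (?t j) - ?t' j)"
    unfolding ah_def
  proof (rule isum_cong)
    fix j
    have a: "aop n (hb h (m - j) v) \<in> D (w - (m - j) - n)" using v h by (intro hb_D aop_D)
    have b: "hb (deriv h) (m - j + n) v \<in> D (w - (m - j) - n)" using hb_D[OF v h', of "m - j + n"] by (simp add: algebra_simps)
    have 1: "aop j (hb h (m - j) (aop n v)) = aop n (aop j (hb h (m - j) v)) - aop j (hb (deriv h) (m + n - j) v)"
      unfolding sw[OF v] aop_minus[OF a b] aop_commute[OF S_Dv[OF hb_D[OF v h]], of j n] by (simp add: algebra_simps)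
    have 2: "hb h (m - j) (aop j (aop n v)) = aop n (hb h (m - j) (aop j v)) - hb (deriv h) (m + n - j) (aop j v)"
      using sw[OF aop_D[OF v], of "m - j" j] aop_commute[OF S_Dv[OF v], of j n] by (simp add: algebra_simps)
    show "(if j < 0 then aop j (hb h (m - j) (aop n v)) else hb h (m - j) (aop j (aop n v))) =
      aop n (?t j) - ?t' j" using 1 2 by auto
  qed
  also have "\<dots> = isum (\<lambda>j. aop n (?t j)) - isum ?t'"
    by (rule isum_diff[OF fsup_hom[OF additive_aop_S sgp_S ah_fsup[OF v h]] ah_fsup[OF v h']])
  also have "isum (\<lambda>j. aop n (?t j)) = aop n (ah h m v)"
    unfolding ah_def
    by (rule additive_on_isum[OF additive_aop_S sgp_S ah_term_D[OF v h] ah_fsup[OF v h], symmetric])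
  finally show ?thesis unfolding ah_def .
qed

text \<open>Two ways of ordering are compared: by the sign of the index i of a, and by the sign of
  the index j of the composite current a h. \<open>cc\<close> is nonzero exactly where the signs
  disagree, and records the sign of the commutator to be paid there.\<close>

definition cc :: "int \<Rightarrow> int \<Rightarrow> int" where
  "cc i j = (if i \<ge> 0 \<and> j < 0 then 1 else 0) - (if i < 0 \<and> j \<ge> 0 then 1 else 0)"

text \<open>For a fixed difference s = j - i there are |s| indices at which the signs disagree, all
  with the same sign.\<close>

lemma isum_cc: "isum (\<lambda>i. of_int (cc i (s + i)) * x) = of_int (- s) * x" for x :: "'a::ring_1"
proof (cases "s < 0")
  case True
  have "isum (\<lambda>i. of_int (cc i (s + i)) * x) = (\<Sum>i\<in>{0..<-s}. of_int (cc i (s + i)) * x)"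
    by (rule isum_eq) (use True in \<open>auto simp: cc_def\<close>)
  also have "\<dots> = (\<Sum>i\<in>{0..<-s}. x)" by (rule sum.cong) (auto simp: cc_def)
  also have "\<dots> = of_int (- s) * x" using True by (simp add: of_nat_nat)
  finally show ?thesis .
next
  case False
  have "isum (\<lambda>i. of_int (cc i (s + i)) * x) = (\<Sum>i\<in>{-s..<0}. of_int (cc i (s + i)) * x)"
    by (rule isum_eq) (use False in \<open>auto simp: cc_def\<close>)
  also have "\<dots> = (\<Sum>i\<in>{-s..<0}. - x)" by (rule sum.cong) (auto simp: cc_def)
  also have "\<dots> = of_int (- s) * x" using False by (simp add: of_nat_nat)
  finally show ?thesis .
qed

text \<open>At m = 0 this is a coefficient of the nested product in which the current a h is
  normally ordered with K. A general m moves the place where the order is cut; this form arises in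
  the commutator of two currents.\<close>

definition ne :: "(complex \<Rightarrow> complex) \<Rightarrow> (complex \<Rightarrow> complex) \<Rightarrow> int \<Rightarrow> int \<Rightarrow> dch \<Rightarrow> dch" where
  "ne h K m n v = isum (\<lambda>j. if j < 0 then ah h (m + j) (hb K (n - j) v) else hb K (n - j) (ah h (m + j) v))"

lemma ne_term_0:
  assumes v: "v \<in> D w" and h: "hol h" "hol K" and j: "\<bar>j\<bar> > \<bar>m\<bar> + \<bar>n\<bar> + \<bar>w\<bar>"
  shows "(if j < 0 then ah h (m + j) (hb K (n - j) v) else hb K (n - j) (ah h (m + j) v)) = 0"
proof (cases "j < 0")
  case True
  have "hb K (n - j) v = 0" by (rule hb_0[OF v h(2)]) (use True j in linarith)
  thus ?thesis using additive_on_0[OF additive_ah[OF h(1)] sgp_S] True by simp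
next
  case False
  have "ah h (m + j) v = 0" by (rule D_zero[OF ah_D[OF v h(1)]]) (use False j in linarith)
  thus ?thesis using False by simp
qed

lemma ne_fsup:
  assumes "v \<in> D w" "hol h" "hol K"
  shows "fsup (\<lambda>j. if j < 0 then ah h (m + j) (hb K (n - j) v) else hb K (n - j) (ah h (m + j) v))"
  by (rule fsupI) (rule ne_term_0[OF assms])

text \<open>Normal ordering is not associative. Wherever the orderings by i and by j disagree, one
  commutator [a_i, K] = K' appears; it depends on i and j only through s = j - i, so summing along
  each s produces the weight -s.\<close>

lemma ne_eq:
  assumes v: "v \<in> D w" and h: "hol h" "hol K"
  shows "ne h K m n v = ah (\<lambda>\<tau>. h \<tau> * K \<tau>) (m + n) v +
      isum (\<lambda>s. of_int (- s) * hb h (m + s) (hb (deriv K) (n - s) v))"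
proof -
  note K' = hol_deriv[OF h(2)]
  define f where "f s = hb h (m + s) (hb (deriv K) (n - s) v)" for s
  define B where "B = 3 * \<bar>m\<bar> + 3 * \<bar>n\<bar> + 3 * \<bar>w\<bar>"
  let ?P = "\<lambda>j i. if i < 0 then aop i (hb h (m + j - i) (hb K (n - j) v))
      else hb h (m + j - i) (hb K (n - j) (aop i v))"
  have f0: "f s = 0" if "\<bar>s\<bar> > \<bar>m\<bar> + \<bar>n\<bar> + \<bar>w\<bar>" for s
    unfolding f_def by (rule hbhb_0[OF v h(1) K']) (use that in linarith)
  have P0: "?P j i = 0" if "\<bar>j\<bar> > B \<or> \<bar>i\<bar> > B" for j i
  proof (cases "i < 0")
    case True
    hence "m + j - i > w \<or> n - j > w" using that unfolding B_def by linarith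
    thus ?thesis using True hbhb_0[OF v h] by simp
  next
    case False
    hence "m + j - i > w - i \<or> n - j > w - i \<or> i > w" using that unfolding B_def by linarith
    thus ?thesis using False hbhb_0[OF aop_D[OF v, of i] h, of "m + j - i" "n - j"] aop_eq_0[OF v, of i] by auto
  qed
  have c0: "of_int (cc i j) * f (j - i) = 0" if "\<bar>j\<bar> > B \<or> \<bar>i\<bar> > B" for j i
  proof (cases "cc i j = 0")
    case False
    hence "i \<ge> 0 \<and> j < 0 \<or> i < 0 \<and> j \<ge> 0" by (auto simp: cc_def split: if_splits)
    hence "\<bar>j - i\<bar> > \<bar>m\<bar> + \<bar>n\<bar> + \<bar>w\<bar>" using that unfolding B_def by linarith
    thus ?thesis by (simp add: f0)
  qed simp
  have E: "(if j < 0 then ah h (m + j) (hb K (n - j) v) else hb K (n - j) (ah h (m + j) v)) =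
      isum (\<lambda>i. ?P j i + of_int (cc i j) * f (j - i))" for j
  proof (cases "j < 0")
    case True
    have "ah h (m + j) (hb K (n - j) v) = isum (\<lambda>i. ?P j i + of_int (cc i j) * f (j - i))"
      unfolding ah_def
    proof (rule isum_cong)
      fix i
      have a: "hb K (n - j) (aop i v) \<in> D (w - i - (n - j))" using v h by (intro hb_D aop_D)
      have b: "hb (deriv K) (n - j + i) v \<in> D (w - i - (n - j))" using hb_D[OF v K', of "n - j + i"] by (simp add: algebra_simps)
      have "hb h (m + j - i) (aop i (hb K (n - j) v)) = hb h (m + j - i) (hb K (n - j) (aop i v)) + f (j - i)"
        unfolding aop_hb[OF v h(2)] hb_plus[OF a b] f_def by (simp add: algebra_simps)
      thus "(if i < 0 then aop i (hb h (m + j - i) (hb K (n - j) v)) else hb h (m + j - i) (aop i (hb K (n - j) v))) =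
         ?P j i + of_int (cc i j) * f (j - i)"
        using True by (auto simp: cc_def)
    qed
    thus ?thesis using True by simp
  next
    case False
    have "hb K (n - j) (ah h (m + j) v) = isum (\<lambda>i. hb K (n - j) (if i < 0 then aop i (hb h (m + j - i) v) else hb h (m + j - i) (aop i v)))"
      unfolding ah_def by (rule additive_on_isum[OF additive_hb sgp_S ah_term_D[OF v h(1)] ah_fsup[OF v h(1)]])
    also have "\<dots> = isum (\<lambda>i. ?P j i + of_int (cc i j) * f (j - i))"
    proof (rule isum_cong)
      fix i
      have "aop i (hb h (m + j - i) (hb K (n - j) v)) = aop i (hb K (n - j) (hb h (m + j - i) v))"
        by (simp add: hb_hb[OF v h])
      also have "\<dots> = hb K (n - j) (aop i (hb h (m + j - i) v)) + hb (deriv K) (n - j + i) (hb h (m + j - i) v)"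
        by (rule aop_hb[OF hb_D[OF v h(1)] h(2)])
      also have "hb (deriv K) (n - j + i) (hb h (m + j - i) v) = f (j - i)"
        unfolding hb_hb[OF v K' h(1)] f_def by (simp add: algebra_simps)
      finally have 1: "hb K (n - j) (aop i (hb h (m + j - i) v)) = aop i (hb h (m + j - i) (hb K (n - j) v)) - f (j - i)"
        by simp
      have 2: "hb K (n - j) (hb h (m + j - i) (aop i v)) = hb h (m + j - i) (hb K (n - j) (aop i v))"
        by (rule hb_hb[OF aop_D[OF v] h(2,1)])
      show "hb K (n - j) (if i < 0 then aop i (hb h (m + j - i) v) else hb h (m + j - i) (aop i v)) =
         ?P j i + of_int (cc i j) * f (j - i)"
        using False 1 2 by (auto simp: cc_def)
    qed
    finally show ?thesis using False by simp
  qed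
  have "ne h K m n v = isum (\<lambda>j. isum (\<lambda>i. ?P j i + of_int (cc i j) * f (j - i)))"
    unfolding ne_def by (rule isum_cong) (rule E)
  also have "\<dots> = isum (\<lambda>j. isum (\<lambda>i. ?P j i) + isum (\<lambda>i. of_int (cc i j) * f (j - i)))"
  proof (rule isum_cong, rule isum_add)
    show "fsup (?P j)" for j by (rule fsupI[of B], rule P0) simp
    show "fsup (\<lambda>i. of_int (cc i j) * f (j - i))" for j by (rule fsupI[of B], rule c0) simp
  qed
  also have "\<dots> = isum (\<lambda>j. isum (\<lambda>i. ?P j i)) + isum (\<lambda>j. isum (\<lambda>i. of_int (cc i j) * f (j - i)))"
  proof (rule isum_add)
    show "fsup (\<lambda>j. isum (\<lambda>i. ?P j i))" by (rule fsup_isum2[of B]) (rule P0)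
    show "fsup (\<lambda>j. isum (\<lambda>i. of_int (cc i j) * f (j - i)))" by (rule fsup_isum2[of B]) (rule c0)
  qed
  also have "isum (\<lambda>j. isum (\<lambda>i. ?P j i)) = isum (\<lambda>i. isum (\<lambda>j. ?P j i))"
    by (rule isum_swap[of B]) (rule P0)
  also have "\<dots> = ah (\<lambda>\<tau>. h \<tau> * K \<tau>) (m + n) v"
    unfolding ah_def
  proof (rule isum_cong)
    fix i
    have sh: "isum (\<lambda>j. hb h (m + j - i) (hb K (n - j) u)) = hb (\<lambda>\<tau>. h \<tau> * K \<tau>) (m + n - i) u"
      if "u \<in> D w'" for u w'
      using hb_mult[OF that h, of "m + n - i"]
        isum_shift[of "\<lambda>j. hb h j (hb K (m + n - i - j) u)" "m - i"] by (simp add: algebra_simps)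
    show "isum (\<lambda>j. ?P j i) = (if i < 0 then aop i (hb (\<lambda>\<tau>. h \<tau> * K \<tau>) (m + n - i) v)
        else hb (\<lambda>\<tau>. h \<tau> * K \<tau>) (m + n - i) (aop i v))"
    proof (cases "i < 0")
      case True
      have "aop i (isum (\<lambda>j. hb h (m + j - i) (hb K (n - j) v))) = isum (\<lambda>j. aop i (hb h (m + j - i) (hb K (n - j) v)))"
      proof (rule additive_on_isum[OF additive_aop_S sgp_S])
        show "hb h (m + j - i) (hb K (n - j) v) \<in> D (w - (m + n - i))" for j
          by (rule D_cong[OF hb_D[OF hb_D[OF v h(2)] h(1)]]) simp
        show "fsup (\<lambda>j. hb h (m + j - i) (hb K (n - j) v))"
          by (rule fsupI[of "\<bar>m\<bar> + \<bar>n\<bar> + \<bar>w\<bar> + \<bar>i\<bar>"], rule hbhb_0[OF v h]) linarith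
      qed
      thus ?thesis using True sh[OF v] by simp
    next
      case False
      thus ?thesis using sh[OF aop_D[OF v]] by simp
    qed
  qed
  also have "isum (\<lambda>j. isum (\<lambda>i. of_int (cc i j) * f (j - i))) = isum (\<lambda>i. isum (\<lambda>j. of_int (cc i j) * f (j - i)))"
    by (rule isum_swap[of B]) (rule c0)
  also have "\<dots> = isum (\<lambda>i. isum (\<lambda>s. of_int (cc i (s + i)) * f s))"
  proof (rule isum_cong)
    fix i show "isum (\<lambda>j. of_int (cc i j) * f (j - i)) = isum (\<lambda>s. of_int (cc i (s + i)) * f s)"
      using isum_shift[of "\<lambda>j. of_int (cc i j) * f (j - i)" i] by simp
  qed
  also have "\<dots> = isum (\<lambda>s. isum (\<lambda>i. of_int (cc i (s + i)) * f s))"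
  proof (rule isum_swap[of "2 * B"])
    fix i s :: int assume a: "2 * B < \<bar>i\<bar> \<or> 2 * B < \<bar>s\<bar>"
    have "B \<ge> 0" by (simp add: B_def)
    with a have "B < \<bar>s + i\<bar> \<or> B < \<bar>i\<bar>" by linarith
    from c0[OF this] show "of_int (cc i (s + i)) * f s = 0" by simp
  qed
  also have "\<dots> = isum (\<lambda>s. of_int (- s) * f s)" by (simp only: isum_cc)
  finally show ?thesis by (simp add: f_def)
qed

text \<open>Commuting the current past every a_j and every mode of k in \<open>ah k n v\<close>. The
  term from [current, a_j] keeps the current of h' on the side of a_j, which is why the nested
  product \<open>ne\<close> appears here.\<close>

lemma ah_ah:
  assumes v: "v \<in> D w" and h: "hol h" "hol k"
  shows "ah h m (ah k n v) = ah k n (ah h m v) + ah (\<lambda>\<tau>. h \<tau> * deriv k \<tau>) (m + n) v - ne (deriv h) k m n v"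
proof -
  note h' = hol_deriv[OF h(1)]
  have hk': "hol (\<lambda>\<tau>. h \<tau> * deriv k \<tau>)" using h by (intro holomorphic_intros hol_deriv)
  let ?hk = "\<lambda>\<tau>. h \<tau> * deriv k \<tau>"
  let ?t = "\<lambda>v j. if j < 0 then aop j (hb k (n - j) v) else hb k (n - j) (aop j v)"
  let ?s = "\<lambda>j. if j < 0 then aop j (hb ?hk (m + n - j) v) else hb ?hk (m + n - j) (aop j v)"
  let ?r = "\<lambda>j. if j < 0 then ah (deriv h) (m + j) (hb k (n - j) v) else hb k (n - j) (ah (deriv h) (m + j) v)"
  have "ah h m (ah k n v) = isum (\<lambda>j. ah h m (?t v j))"
    unfolding ah_def[of k n v]
    by (rule additive_on_isum[OF additive_ah[OF h(1)] sgp_S ah_term_D[OF v h(2)] ah_fsup[OF v h(2)]])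
  also have "\<dots> = isum (\<lambda>j. (?t (ah h m v) j + ?s j) - ?r j)"
  proof (rule isum_cong)
    fix j
    have a: "hb k (n - j) (ah h m v) \<in> D (w - m - (n - j))" using v h by (intro hb_D ah_D)
    have b: "hb ?hk (m + (n - j)) v \<in> D (w - m - (n - j))"
      using hb_D[OF v hk', of "m + (n - j)"] by (simp add: algebra_simps)
    have 1: "ah h m (aop j (hb k (n - j) v)) =
       aop j (hb k (n - j) (ah h m v)) + aop j (hb ?hk (m + n - j) v) - ah (deriv h) (m + j) (hb k (n - j) v)"
      unfolding ah_aop[OF hb_D[OF v h(2)] h(1)] ah_hb[OF v h] aop_plus[OF a b] by (simp add: algebra_simps)
    have c: "aop j (ah h m v) \<in> D (w - m - j)" using v h by (intro aop_D ah_D)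
    have d: "ah (deriv h) (m + j) v \<in> D (w - m - j)" using ah_D[OF v h', of "m + j"] by (simp add: algebra_simps)
    have 2: "ah h m (hb k (n - j) (aop j v)) = hb k (n - j) (aop j (ah h m v)) + hb ?hk (m + n - j) (aop j v)
        - hb k (n - j) (ah (deriv h) (m + j) v)"
      unfolding ah_hb[OF aop_D[OF v] h] ah_aop[OF v h(1)] hb_minus[OF c d] by (simp add: algebra_simps)
    show "ah h m (?t v j) = (?t (ah h m v) j + ?s j) - ?r j" using 1 2 by auto
  qed
  also have "\<dots> = (isum (?t (ah h m v)) + isum ?s) - isum ?r"
    using ah_fsup[OF ah_D[OF v h(1)] h(2), of n] ah_fsup[OF v hk', of "m + n"] ne_fsup[OF v h' h(2), of m n]
    by (simp add: isum_diff isum_add fsup_add)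
  finally show ?thesis unfolding ah_def[of k n "ah h m v"] ah_def[of ?hk] ne_def .
qed

subsection \<open>Monomials\<close>

definition single :: "mon \<Rightarrow> (complex \<Rightarrow> complex) \<Rightarrow> dch" where
  "single p f = (\<lambda>p'. if p' = p then f else 0)"

text \<open>The indices of a basis of the weight w part over functions. This set is finite, so every
  sum over monomials can be taken over it.\<close>

definition mons :: "int \<Rightarrow> mon set" where
  "mons w = {p. 0 \<notin># fst p \<and> 0 \<notin># snd p \<and> int (cweight p) = w}"

definition Of :: "(complex \<Rightarrow> complex) set" where
  "Of = {f. hol f \<and> (\<forall>\<tau>. Im \<tau> \<le> 0 \<longrightarrow> f \<tau> = 0)}"

lemma rH_Of: "hol f \<Longrightarrow> rH f \<in> Of"
  by (auto simp: Of_def rH_def Hp_def intro: holomorphic_transform)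

lemma Of_rH: "f \<in> Of \<Longrightarrow> rH f = f"
  by (auto simp: Of_def rH_def fun_eq_iff not_less)

lemma Of_0: "0 \<in> Of"
  by (auto simp: Of_def zero_fun_def)

lemma size_le_sum_mset: "0 \<notin># M \<Longrightarrow> size M \<le> sum_mset M" for M :: "nat multiset"
  by (induction M) (auto simp: Suc_le_eq add_less_le_mono)

lemma finite_msets_le: "finite {M :: nat multiset. 0 \<notin># M \<and> sum_mset M \<le> N}"
proof (rule finite_subset)
  show "{M :: nat multiset. 0 \<notin># M \<and> sum_mset M \<le> N} \<subseteq> mset ` {xs. set xs \<subseteq> {..N} \<and> length xs \<le> N}"
  proof
    fix M :: "nat multiset" assume M: "M \<in> {M. 0 \<notin># M \<and> sum_mset M \<le> N}"
    obtain xs where xs: "mset xs = M" using ex_mset by blast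
    have "x \<le> N" if "x \<in># M" for x
      using M multi_member_split[OF that] by auto
    moreover have "length xs \<le> N" using size_le_sum_mset[of M] M xs by (metis (mono_tags, lifting) mem_Collect_eq order_trans size_mset)
    ultimately show "M \<in> mset ` {xs. set xs \<subseteq> {..N} \<and> length xs \<le> N}" using xs by (auto simp: set_mset_mset[symmetric] simp del: set_mset_mset)
  qed
qed (intro finite_imageI finite_lists_length_le, simp)

lemma finite_mons: "finite (mons w)"
proof (rule finite_subset)
  let ?A = "{M :: nat multiset. 0 \<notin># M \<and> sum_mset M \<le> nat w}"
  show "mons w \<subseteq> ?A \<times> ?A"
  proof
    fix p assume "p \<in> mons w"
    hence p: "0 \<notin># fst p" "0 \<notin># snd p" "int (sum_mset (fst p) + sum_mset (snd p)) = w"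
      unfolding mons_def cweight_def by blast+
    have "sum_mset (fst p) \<le> nat w" "sum_mset (snd p) \<le> nat w" using p(3) by linarith+
    thus "p \<in> ?A \<times> ?A" using p(1,2) by (cases p) auto
  qed
  show "finite (?A \<times> ?A)" using finite_msets_le by blast
qed

lemma D_supp: "v \<in> D w \<Longrightarrow> v p \<noteq> 0 \<Longrightarrow> p \<in> mons w"
  using S_suppD[of v w w p] by (auto simp: mons_def)

lemma D_coeff: "v \<in> D w \<Longrightarrow> v p \<in> Of"
  by (auto simp: S_def Dv_def Of_def)

lemma D_I: "(\<And>p. v p \<in> Of) \<Longrightarrow> (\<And>p. v p \<noteq> 0 \<Longrightarrow> p \<in> mons w) \<Longrightarrow> v \<in> D w"
  using pot_bounds(1) by (intro S_I) (fastforce simp: Dv_def Of_def mons_def)+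

lemma single_D: "f \<in> Of \<Longrightarrow> p \<in> mons w \<Longrightarrow> single p f \<in> D w"
  by (rule D_I) (auto simp: single_def Of_0 split: if_splits)

lemma D_decomp: assumes "v \<in> D w" shows "v = (\<Sum>p\<in>mons w. single p (v p))"
proof (rule ext)
  fix p
  have "(\<Sum>q\<in>mons w. single q (v q)) p = (\<Sum>q\<in>mons w. if p = q then v q else 0)"
    unfolding sum_fun_apply[where 'a = mon] by (rule sum.cong) (auto simp: single_def)
  also have "\<dots> = v p" using D_supp[OF assms, of p] by (subst sum.delta'[OF finite_mons]) auto
  finally show "v p = (\<Sum>p\<in>mons w. single p (v p)) p" by simp
qed

lemma aop_single: assumes "n > 0" shows "aop (- int n) (single (l, u) f) = single (add_mset n l, u) f"
proof (rule ext)
  fix p show "aop (- int n) (single (l, u) f) p = single (add_mset n l, u) f p"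
    using assms by (cases p) (auto simp: aop_neg single_def dest!: multi_member_split)
qed

lemma bop_single: assumes "n > 0" shows "bop (- int n) (single (l, u) f) = single (l, add_mset n u) f"
proof (rule ext)
  fix p show "bop (- int n) (single (l, u) f) p = single (l, add_mset n u) f p"
    using assms by (cases p) (auto simp: bop_neg single_def dest!: multi_member_split)
qed

definition cst :: "(complex \<Rightarrow> complex) \<Rightarrow> dch" where "cst f = single ({#}, {#}) (rH f)"

lemma const_elem_eq: "const_elem (rH f) = cst f"
  by (auto simp: const_elem_def cst_def single_def fun_eq_iff pointwise)

lemma cst_D: "hol f \<Longrightarrow> cst f \<in> D 0"
  unfolding cst_def by (rule single_D[OF rH_Of]) (auto simp: mons_def cweight_def)

lemma cst_cong: "(\<And>\<tau>. \<tau> \<in> Hp \<Longrightarrow> f \<tau> = g \<tau>) \<Longrightarrow> cst f = cst g"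
  unfolding cst_def by (rule arg_cong[where f = "single _"]) (auto simp: rH_def fun_eq_iff Hp_def)

lemma fn_cst: "fn h * cst f = cst (\<lambda>\<tau>. h \<tau> * f \<tau>)"
  by (auto simp: fun_eq_iff cst_def single_def fn_apply rH_def pointwise)

lemma aop_0_cst: assumes "hol f" shows "aop 0 (cst f) = cst (deriv f)"
proof (rule ext)
  fix p
  have "rH (deriv (rH f)) = rH (deriv f)"
    unfolding rH_def
  proof (rule ext, rule if_cong[OF refl _ refl])
    fix \<tau> assume t: "0 < Im \<tau>"
    show "deriv (\<lambda>\<tau>. if 0 < Im \<tau> then f \<tau> else 0) \<tau> = deriv f \<tau>"
    proof (rule deriv_cong_ev)
      have "\<forall>\<^sub>F x in nhds \<tau>. x \<in> Hp" using t by (intro eventually_nhds_in_open open_Hp) (simp add: Hp_iff)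
      thus "\<forall>\<^sub>F x in nhds \<tau>. (if 0 < Im x then f x else 0) = f x" by eventually_elim (simp add: Hp_iff)
    qed simp
  qed
  thus "aop 0 (cst f) p = cst (deriv f) p" by (auto simp: aop_zero cst_def single_def)
qed

text \<open>The module is generated from functions by creation operators. An identity of operators
  therefore only has to hold on \<open>cst f\<close> and be compatible with a_{-n} and b_{-n} for n
  > 0.\<close>

lemma D_induct [consumes 1, case_names add zero cst a b]:
  assumes "v \<in> D w"
    and add: "\<And>w x y. x \<in> D w \<Longrightarrow> y \<in> D w \<Longrightarrow> P w x \<Longrightarrow> P w y \<Longrightarrow> P w (x + y)"
    and zero: "\<And>w. P w 0"
    and cst: "\<And>f. hol f \<Longrightarrow> P 0 (cst f)"
    and a: "\<And>w v n. n > 0 \<Longrightarrow> v \<in> D w \<Longrightarrow> P w v \<Longrightarrow> P (w + int n) (aop (- int n) v)"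
    and b: "\<And>w v n. n > 0 \<Longrightarrow> v \<in> D w \<Longrightarrow> P w v \<Longrightarrow> P (w + int n) (bop (- int n) v)"
  shows "P w v"
proof -
  have B: "0 \<notin># u \<Longrightarrow> P (int (sum_mset u)) (single ({#}, u) f)" if f: "f \<in> Of" for f u
  proof (induction u)
    case empty
    show ?case using cst[of f] f by (simp add: cst_def Of_rH) (auto simp: Of_def)
  next
    case (add n u)
    have "single ({#}, u) f \<in> D (int (sum_mset u))"
      by (rule single_D[OF f]) (use add in \<open>auto simp: mons_def cweight_def\<close>)
    from b[OF _ this, of n] add show ?case by (auto simp: bop_single add.commute)
  qed
  have A: "0 \<notin># l \<Longrightarrow> 0 \<notin># u \<Longrightarrow> P (int (sum_mset l + sum_mset u)) (single (l, u) f)" if f: "f \<in> Of" for f l u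
  proof (induction l)
    case empty
    thus ?case using B[OF f] by simp
  next
    case (add n l)
    have "single (l, u) f \<in> D (int (sum_mset l + sum_mset u))"
      by (rule single_D[OF f]) (use add in \<open>auto simp: mons_def cweight_def\<close>)
    from a[OF _ this, of n] add show ?case by (auto simp: aop_single algebra_simps)
  qed
  have sg: "P w (single p (v p))" if "p \<in> mons w" for p
    using A[OF D_coeff[OF assms(1)], of "fst p" "snd p"] that by (auto simp: mons_def cweight_def)
  have "P w (\<Sum>p\<in>Q. single p (v p)) \<and> (\<Sum>p\<in>Q. single p (v p)) \<in> D w" if "finite Q" "Q \<subseteq> mons w" for Q
    using that
  proof (induction Q rule: finite_induct)
    case (insert p Q)
    have "single p (v p) \<in> D w" using insert by (intro single_D D_coeff[OF assms(1)]) auto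
    thus ?case using insert sg[of p] by (auto intro!: add)
  qed (auto intro: zero)
  thus ?thesis using D_decomp[OF assms(1)] finite_mons by (metis order_refl)
qed

section \<open>Coordinate changes acting by vertex algebra homomorphisms\<close>

lemma hb_D0: assumes "v \<in> D 0" shows "hb k 0 v = fn k * v"
proof -
  have "pmode l 0 v = 0" if "l > 0" for l
    by (rule S_zero[OF pmode_S[OF assms]]) (use that in auto)
  hence "hb k 0 v = (\<Sum>l\<le>Lb 0 0. if l = 0 then fn (tc k l) * v else 0)"
    unfolding hb_eq'[OF assms order_refl] by (intro sum.cong refl) auto
  thus ?thesis by (simp add: sum.delta tc_def)
qed

lemma ah_D0: assumes "v \<in> D 0" "hol h" shows "ah h 0 v = fn h * aop 0 v"
proof -
  have "ah h 0 v = hb h 0 (aop 0 v)"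
    unfolding ah_def
    by (subst isum_single[of 0]) (use hb_0[OF assms] aop_eq_0[OF assms(1)] in auto)
  thus ?thesis using hb_D0[of "aop 0 v"] aop_D[OF assms(1), of 0] by simp
qed

lemma be_cong: assumes "\<And>\<tau>. \<tau> \<in> Hp \<Longrightarrow> h \<tau> = k \<tau>" "v \<in> D w" shows "be h n v = be k n v"
  unfolding be_def by (simp only: hb_cong[OF assms])

lemma ah_cong: assumes "\<And>\<tau>. \<tau> \<in> Hp \<Longrightarrow> h \<tau> = k \<tau>" "v \<in> D w" shows "ah h n v = ah k n v"
  unfolding ah_def by (simp only: hb_cong[OF assms] hb_cong[OF assms(1) aop_D[OF assms(2)]])

lemma be_add: assumes "v \<in> D w" "hol h" "hol k"
  shows "be (\<lambda>\<tau>. h \<tau> + k \<tau>) n v = be h n v + be k n v"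
  unfolding be_def
  by (subst isum_add[symmetric, OF be_fsup[OF assms(1,2)] be_fsup[OF assms(1,3)]], rule isum_cong)
     (simp add: hb_add[OF assms] bop_add distrib_left del: of_int_minus)

text \<open>\<open>h\<close> is the factor by which d/db changes in the coordinate
  \<open>\<phi>\<close>. The last condition, q' = h'^2 / (2 h), is exactly what makes the modes of a
  h + q' b_{-1} commute. The primitive \<open>q\<close> rather than q' is the parameter because the
  modes of q' b_{-1} are those of d/dz Y(q, z), a multiple of \<open>hb q\<close> in each
  mode.\<close>

locale coordinate_change =
  fixes h q \<phi> :: "complex \<Rightarrow> complex"
  assumes hol_h: "hol h" and hol_q: "hol q" and hol_phi: "hol \<phi>"
    and phi_Hp: "\<tau> \<in> Hp \<Longrightarrow> \<phi> \<tau> \<in> Hp"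
    and h_phi: "\<tau> \<in> Hp \<Longrightarrow> h \<tau> * deriv \<phi> \<tau> = 1"
    and h_q: "\<tau> \<in> Hp \<Longrightarrow> 2 * (h \<tau> * deriv q \<tau>) = deriv h \<tau> * deriv h \<tau>"
begin

definition Am :: "int \<Rightarrow> dch \<Rightarrow> dch" where "Am m v = ah h m v + be (deriv q) m v"

lemma Am_eq: "v \<in> D w \<Longrightarrow> Am m v = ah h m v + of_int (- m) * hb q m v"
  by (simp only: Am_def be_deriv[OF _ hol_q])

lemma Am_D [intro]: "v \<in> D w \<Longrightarrow> Am m v \<in> D (w - m)"
  unfolding Am_def by (intro S_add ah_D be_D hol_h hol_deriv hol_q)

lemma additive_Am: "additive_on (D w) (Am m)"
  using additive_ah[OF hol_h, of w m] additive_be[OF hol_deriv[OF hol_q], of w m]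
  unfolding additive_on_def Am_def by (simp add: algebra_simps)

lemma Am_plus: "x \<in> D w \<Longrightarrow> y \<in> D w \<Longrightarrow> Am m (x + y) = Am m x + Am m y"
  by (rule additive_on_add[OF additive_Am sgp_S])

lemma Am_hb:
  assumes v: "v \<in> D w" and k: "hol k"
  shows "Am m (hb k n v) = hb k n (Am m v) + hb (\<lambda>\<tau>. h \<tau> * deriv k \<tau>) (m + n) v"
proof -
  have "hb k n (of_int (- m) * hb q m v) = of_int (- m) * hb q m (hb k n v)"
    by (simp only: hb_of_int[OF hb_D[OF v hol_q] k] hb_hb[OF v k hol_q])
  moreover have "of_int (- m) * hb q m v \<in> D (w - m)" using v hol_q by (intro S_of_int hb_D)
  ultimately have "hb k n (Am m v) = hb k n (ah h m v) + of_int (- m) * hb q m (hb k n v)"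
    unfolding Am_eq[OF v] by (simp only: hb_plus[OF ah_D[OF v hol_h]])
  thus ?thesis unfolding Am_eq[OF hb_D[OF v k]] ah_hb[OF v hol_h k] by (simp add: algebra_simps)
qed

lemma Am_hb_phi:
  assumes v: "v \<in> D w"
  shows "Am m (hb \<phi> n v) = hb \<phi> n (Am m v) + (if m + n = 0 then v else 0)"
proof -
  have "hb (\<lambda>\<tau>. h \<tau> * deriv \<phi> \<tau>) (m + n) v = hb (\<lambda>\<tau>. 1) (m + n) v"
    by (rule hb_cong[OF _ v]) (rule h_phi)
  thus ?thesis unfolding Am_hb[OF v hol_phi] using hb_const[OF v] fn_1[OF S_Dv[OF v]] by simp
qed

text \<open>The currents a h alone have commutator T, the sum of s h'_{m+s} h'_{n-s}; the
  corrections with q contribute m - n times the modes of h q'. Both are evaluated as multiples of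
  the same field, and 2 h q' = h'^2 makes them cancel.\<close>

lemma Am_Am: assumes v: "v \<in> D w" shows "Am m (Am n v) = Am n (Am m v)"
proof -
  note h' = hol_deriv[OF hol_h] and q' = hol_deriv[OF hol_q]
  define f where "f s = hb (deriv h) (m + s) (hb (deriv h) (n - s) v)" for s
  define Q where "Q = hb (\<lambda>\<tau>. h \<tau> * deriv q \<tau>) (m + n) v"
  have hq: "hol (\<lambda>\<tau>. h \<tau> * deriv q \<tau>)" by (intro holomorphic_intros hol_h q')
  have f0: "f s = 0" if "\<bar>s\<bar> > \<bar>m\<bar> + \<bar>n\<bar> + \<bar>w\<bar>" for s
    unfolding f_def by (rule hbhb_0[OF v h' h']) (use that in linarith)
  have fs: "fsup f" by (rule fsupI) (rule f0)
  have fs': "fsup (\<lambda>s. of_int s * f s)" by (rule fsupI[of "\<bar>m\<bar> + \<bar>n\<bar> + \<bar>w\<bar>"]) (simp add: f0)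
  have fr: "f (n - m - s) = f s" for s
    unfolding f_def using hb_hb[OF v h' h', of "n - s" "m + s"] by (simp add: algebra_simps)
  have "isum f = hb (\<lambda>\<tau>. deriv h \<tau> * deriv h \<tau>) (m + n) v"
    using hb_mult[OF v h' h', of "m + n"] isum_shift[of "\<lambda>j. hb (deriv h) j (hb (deriv h) (m + n - j) v)" m]
    by (simp add: f_def[abs_def] algebra_simps)
  also have "\<dots> = hb (\<lambda>\<tau>. h \<tau> * deriv q \<tau> + h \<tau> * deriv q \<tau>) (m + n) v"
  proof (rule hb_cong[OF _ v])
    fix \<tau> assume "\<tau> \<in> Hp"
    from h_q[OF this] show "deriv h \<tau> * deriv h \<tau> = h \<tau> * deriv q \<tau> + h \<tau> * deriv q \<tau>"
      by (metis mult_2)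
  qed
  also have "\<dots> = Q + Q" unfolding Q_def by (rule hb_add[OF v hq hq])
  finally have sf: "isum f = Q + Q" .
  define T where "T = isum (\<lambda>s. of_int s * f s)"
  \<comment> \<open>The reflection s to n - m - s exchanges the two equal factors h', so T is half
    of (n - m) times the plain sum of the f s.\<close>
  have "T = isum (\<lambda>s. of_int (n - m - s) * f (n - m - s))"
    unfolding T_def by (rule isum_reflect[of "\<lambda>s. of_int s * f s", symmetric])
  also have "\<dots> = isum (\<lambda>s. of_int (n - m) * f s - of_int s * f s)"
    by (rule isum_cong) (simp only: fr of_int_diff left_diff_distrib)
  also have "\<dots> = of_int (n - m) * isum f - T"
    unfolding T_def isum_mult_left[OF fs, symmetric]
    by (rule isum_diff[OF _ fs'], rule fsupI[of "\<bar>m\<bar> + \<bar>n\<bar> + \<bar>w\<bar>"]) (simp add: f0)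
  finally have "T + T = of_int (n - m) * Q + of_int (n - m) * Q" by (simp add: sf algebra_simps)
  hence "2 * T p \<tau> = 2 * (of_int (n - m) * Q) p \<tau>" for p \<tau>
    by (simp add: fun_eq_iff pointwise)
  hence TQ: "T = of_int (n - m) * Q" by (simp add: fun_eq_iff)
  have hh: "ah h m (ah h n v) = ah h n (ah h m v) + T"
  proof -
    have "isum (\<lambda>s. of_int (- s) * f s) = - T"
      unfolding T_def isum_uminus[symmetric] by (rule isum_cong) simp
    moreover have "ah (\<lambda>\<tau>. h \<tau> * deriv h \<tau>) (m + n) v = ah (\<lambda>\<tau>. deriv h \<tau> * h \<tau>) (m + n) v"
      by (rule ah_cong[OF _ v]) simp
    ultimately show ?thesis
      using ah_ah[OF v hol_h hol_h, of m n] ne_eq[OF v h' hol_h, of m n] by (simp add: f_def)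
  qed
  have ex: "Am m' (Am n' v) = ah h m' (ah h n' v) + of_int (- n') * ah h m' (hb q n' v)
      + of_int (- m') * hb q m' (ah h n' v) + of_int (- m') * (of_int (- n') * hb q m' (hb q n' v))" for m' n'
  proof -
    have a: "of_int (- n') * hb q n' v \<in> D (w - n')" using v hol_q by (intro S_of_int hb_D)
    have b: "ah h n' v \<in> D (w - n')" using v hol_h by (rule ah_D)
    have c: "ah h m' (of_int (- n') * hb q n' v) = of_int (- n') * ah h m' (hb q n' v)"
    proof -
      have "ah h m' (of_int k * u) = of_int k * ah h m' u" if u: "u \<in> D w'" for k u w'
        unfolding ah_def
        by (subst isum_mult_left[symmetric, OF ah_fsup[OF u hol_h]], rule isum_cong)
           (simp add: hb_of_int[OF u hol_h] hb_of_int[OF aop_D[OF u] hol_h] aop_of_int S_Dv[OF hb_D[OF u hol_h]] S_Dv[OF u])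
      thus ?thesis using hb_D[OF v hol_q] by blast
    qed
    have d: "ah h m' (ah h n' v + of_int (- n') * hb q n' v) = ah h m' (ah h n' v) + ah h m' (of_int (- n') * hb q n' v)"
      by (rule additive_on_add[OF additive_ah[OF hol_h] sgp_S b a])
    show ?thesis
      unfolding Am_eq[OF Am_D[OF v]] unfolding Am_eq[OF v] d c hb_plus[OF b a] hb_of_int[OF hb_D[OF v hol_q] hol_q]
      by (simp only: distrib_left add.assoc)
  qed
  have 1: "ah h m (hb q n v) = hb q n (ah h m v) + Q" and 2: "ah h n (hb q m v) = hb q m (ah h n v) + Q"
    unfolding Q_def using ah_hb[OF v hol_h hol_q, of m n] ah_hb[OF v hol_h hol_q, of n m] by (simp_all add: add.commute)
  show ?thesis unfolding ex hh 1 2 TQ hb_hb[OF v hol_q hol_q, of m n] by (simp add: algebra_simps)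
qed

text \<open>b_{-n} is the coefficient of z^n in the field of the function b, so it is replaced by
  the same coefficient of Y(\<open>\<phi>\<close>, z).\<close>

definition Bs :: "mon \<Rightarrow> (complex \<Rightarrow> complex) \<Rightarrow> dch" where
  "Bs p f = foldr (\<lambda>n. hb \<phi> (- int n)) (sorted_list_of_multiset (snd p)) (cst (\<lambda>\<tau>. f (\<phi> \<tau>)))"

definition mi :: "mon \<Rightarrow> (complex \<Rightarrow> complex) \<Rightarrow> dch" where
  "mi p f = foldr (\<lambda>n. Am (- int n)) (sorted_list_of_multiset (fst p)) (Bs p f)"

definition PI :: "dch \<Rightarrow> dch" where "PI v = (\<Sum>p\<in>{p. v p \<noteq> 0}. mi p (v p))"

lemma hol_comp: "hol f \<Longrightarrow> hol (\<lambda>\<tau>. f (\<phi> \<tau>))"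
  using holomorphic_on_compose_gen[OF hol_phi, of f Hp] phi_Hp by (auto simp: o_def)

lemma foldr_Am_D: "v \<in> D w \<Longrightarrow> foldr (\<lambda>n. Am (- int n)) xs v \<in> D (w + int (sum_list xs))"
proof (induction xs)
  case (Cons x xs)
  from Am_D[OF Cons.IH[OF Cons.prems], of "- int x"] show ?case by (simp add: algebra_simps)
qed simp

lemma foldr_hb_D: "v \<in> D w \<Longrightarrow> foldr (\<lambda>n. hb \<phi> (- int n)) xs v \<in> D (w + int (sum_list xs))"
proof (induction xs)
  case (Cons x xs)
  from hb_D[OF Cons.IH[OF Cons.prems] hol_phi, of "- int x"] show ?case by (simp add: algebra_simps)
qed simp

lemma sum_list_sorted: "sum_list (sorted_list_of_multiset M) = sum_mset M"
  by (metis mset_sorted_list_of_multiset sum_mset_sum_list)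

lemma Bs_D: "hol f \<Longrightarrow> Bs p f \<in> D (int (sum_mset (snd p)))"
  using foldr_hb_D[OF cst_D[OF hol_comp[of f]], of "sorted_list_of_multiset (snd p)"]
  by (simp add: Bs_def sum_list_sorted del: of_nat_sum_mset)

lemma mi_D: "hol f \<Longrightarrow> mi p f \<in> D (int (cweight p))"
  using foldr_Am_D[OF Bs_D] unfolding mi_def cweight_def
  by (metis (no_types, lifting) add.commute of_nat_add sum_list_sorted)

lemma additive_foldr:
  assumes "\<And>n w. additive_on (D w) (T n)" "\<And>n w v. v \<in> D w \<Longrightarrow> T n v \<in> D (w + int n)"
  shows "additive_on (D w) (foldr T xs) \<and> (\<forall>v\<in>D w. foldr T xs v \<in> D (w + int (sum_list xs)))"
proof (induction xs)
  case (Cons x xs)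
  hence 1: "foldr T xs v \<in> D (w + int (sum_list xs))" if "v \<in> D w" for v using that by blast
  have "T x (foldr T xs v) \<in> D (w + int (sum_list (x # xs)))" if "v \<in> D w" for v
    using assms(2)[OF 1[OF that], of x] by (simp add: algebra_simps)
  moreover have "additive_on (D w) (foldr T (x # xs))"
    using Cons assms(1)[of "w + int (sum_list xs)" x] 1 unfolding additive_on_def by simp
  ultimately show ?case by (auto simp: o_def)
qed (auto simp: additive_on_def)

lemma cst_diff: "cst (\<lambda>\<tau>. f \<tau> - g \<tau>) = cst f - cst g"
  by (auto simp: cst_def single_def fun_eq_iff rH_def pointwise)

lemma additive_mi: "additive_on Of (mi p)"
proof -
  have A: "additive_on (D w) (foldr (\<lambda>n. Am (- int n)) xs)" for w xs
  proof (rule conjunct1, rule additive_foldr[OF additive_Am])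
    show "v \<in> D w \<Longrightarrow> Am (- int n) v \<in> D (w + int n)" for n w v using Am_D[of v w "- int n"] by simp
  qed
  have B: "additive_on (D w) (foldr (\<lambda>n. hb \<phi> (- int n)) xs)" for w xs
  proof (rule conjunct1, rule additive_foldr[OF additive_hb])
    show "v \<in> D w \<Longrightarrow> hb \<phi> (- int n) v \<in> D (w + int n)" for n w v
      using hb_D[OF _ hol_phi, of v w "- int n"] by simp
  qed
  show ?thesis unfolding additive_on_def
  proof (intro ballI)
    fix f g assume fg: "f \<in> Of" "g \<in> Of"
    hence hf: "hol f" "hol g" by (auto simp: Of_def)
    have "Bs p (f - g) = Bs p f - Bs p g"
      using additive_on_diff[OF B cst_D[OF hol_comp[OF hf(1)]] cst_D[OF hol_comp[OF hf(2)]]]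
      unfolding Bs_def by (simp add: cst_diff minus_apply)
    thus "mi p (f - g) = mi p f - mi p g"
      unfolding mi_def using additive_on_diff[OF A Bs_D[OF hf(1)] Bs_D[OF hf(2)]] by simp
  qed
qed

lemma sgp_Of: "sgp Of"
  using Of_0 by (auto simp: sgp_def Of_def pointwise fun_diff_def intro!: holomorphic_intros)

lemma mi_0: "mi p 0 = 0"
  by (rule additive_on_0[OF additive_mi sgp_Of])

lemma PI_eq: assumes "v \<in> D w" shows "PI v = (\<Sum>p\<in>mons w. mi p (v p))"
  unfolding PI_def by (rule sum.mono_neutral_left) (use D_supp[OF assms] finite_mons mi_0 in auto)

lemma PI_D [intro]: assumes "v \<in> D w" shows "PI v \<in> D w"
  unfolding PI_eq[OF assms]
proof (rule sgp_sum[OF sgp_S])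
  fix p assume "p \<in> mons w"
  moreover have "hol (v p)" using D_coeff[OF assms] by (auto simp: Of_def)
  ultimately show "mi p (v p) \<in> D w" using mi_D[of "v p" p] by (auto simp: mons_def)
qed

lemma additive_PI: "additive_on (D w) PI"
  unfolding additive_on_def
proof (intro ballI)
  fix x y assume xy: "x \<in> D w" "y \<in> D w"
  have "PI (x - y) = (\<Sum>p\<in>mons w. mi p (x p - y p))"
    using PI_eq[OF S_diff[OF xy]] by (simp add: minus_apply)
  also have "\<dots> = (\<Sum>p\<in>mons w. mi p (x p) - mi p (y p))"
    using xy D_coeff by (intro sum.cong refl additive_on_diff[OF additive_mi]) auto
  finally show "PI (x - y) = PI x - PI y" by (simp add: PI_eq[OF xy(1)] PI_eq[OF xy(2)] sum_subtractf)
qed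

lemma PI_0: "PI 0 = 0" by (simp add: PI_def zero_fun_apply)

lemma PI_plus: "x \<in> D w \<Longrightarrow> y \<in> D w \<Longrightarrow> PI (x + y) = PI x + PI y"
  by (rule additive_on_add[OF additive_PI sgp_S])

lemma PI_single: "PI (single p f) = mi p f"
proof (cases "f = 0")
  case True
  hence "single p f = 0" by (auto simp: single_def fun_eq_iff pointwise)
  thus ?thesis using True by (simp add: PI_0 mi_0)
next
  case False
  hence "{q. single p f q \<noteq> 0} = {p}" by (auto simp: single_def)
  thus ?thesis by (simp add: PI_def single_def)
qed

lemma PI_cst: "hol f \<Longrightarrow> PI (cst f) = cst (\<lambda>\<tau>. f (\<phi> \<tau>))"
  unfolding cst_def PI_single mi_def Bs_def using phi_Hp
  by (simp, intro arg_cong[where f = "single _"]) (auto simp: rH_def fun_eq_iff Hp_iff)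

text \<open>The sorted order of the factors in \<open>mi\<close> is an arbitrary choice;
  commutativity of the new modes makes it harmless, so that adding one part to a partition is one
  more operator in front.\<close>

lemma foldr_Am_insort:
  assumes "v \<in> D w"
  shows "foldr (\<lambda>n. Am (- int n)) (insort x xs) v = Am (- int x) (foldr (\<lambda>n. Am (- int n)) xs v)"
  by (induction xs) (auto simp: Am_Am[OF foldr_Am_D[OF assms]])

lemma foldr_hb_insort:
  assumes "v \<in> D w"
  shows "foldr (\<lambda>n. hb \<phi> (- int n)) (insort x xs) v = hb \<phi> (- int x) (foldr (\<lambda>n. hb \<phi> (- int n)) xs v)"
  by (induction xs) (auto simp: hb_hb[OF foldr_hb_D[OF assms] hol_phi hol_phi])

lemma foldr_Am_hb:
  assumes "v \<in> D w" "x > 0"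
  shows "foldr (\<lambda>n. Am (- int n)) xs (hb \<phi> (- int x) v) = hb \<phi> (- int x) (foldr (\<lambda>n. Am (- int n)) xs v)"
  using assms by (induction xs) (auto simp: Am_hb_phi[OF foldr_Am_D[OF assms(1)]])

lemma mi_a: "hol f \<Longrightarrow> mi (add_mset n l, u) f = Am (- int n) (mi (l, u) f)"
  using foldr_Am_insort[OF Bs_D[of f "(l, u)"]] by (simp add: mi_def Bs_def)

lemma mi_b: "hol f \<Longrightarrow> n > 0 \<Longrightarrow> mi (l, add_mset n u) f = hb \<phi> (- int n) (mi (l, u) f)"
  using foldr_hb_insort[OF cst_D[OF hol_comp[of f]]] foldr_Am_hb[OF Bs_D[of f "(l, u)"]] by (simp add: mi_def Bs_def)

lemma PI_a: assumes "v \<in> D w" "n > 0" shows "PI (aop (- int n) v) = Am (- int n) (PI v)"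
proof -
  have m: "(add_mset n (fst p), snd p) \<in> mons (w + int n)" if "p \<in> mons w" for p
    using that assms(2) by (auto simp: mons_def cweight_def)
  have hv: "hol (v p)" for p using D_coeff[OF assms(1)] by (auto simp: Of_def)
  have "aop (- int n) v = aop (- int n) (\<Sum>p\<in>mons w. single p (v p))" using D_decomp[OF assms(1)] by simp
  also have "\<dots> = (\<Sum>p\<in>mons w. aop (- int n) (single p (v p)))"
    by (rule additive_on_sum[OF additive_aop_S sgp_S]) (use D_coeff[OF assms(1)] in \<open>auto intro: single_D\<close>)
  also have "\<dots> = (\<Sum>p\<in>mons w. single (add_mset n (fst p), snd p) (v p))"
    by (rule sum.cong[OF refl]) (use aop_single[OF assms(2)] in \<open>metis prod.collapse\<close>)
  finally have "PI (aop (- int n) v) = PI (\<Sum>p\<in>mons w. single (add_mset n (fst p), snd p) (v p))" by simp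
  also have "\<dots> = (\<Sum>p\<in>mons w. PI (single (add_mset n (fst p), snd p) (v p)))"
    by (rule additive_on_sum[OF additive_PI[of "w + int n"] sgp_S]) (use m D_coeff[OF assms(1)] in \<open>auto intro: single_D\<close>)
  also have "\<dots> = (\<Sum>p\<in>mons w. Am (- int n) (mi p (v p)))"
    by (simp add: PI_single mi_a[OF hv])
  also have "\<dots> = Am (- int n) (PI v)"
    unfolding PI_eq[OF assms(1)]
    by (rule additive_on_sum[OF additive_Am[of w] sgp_S, symmetric]) (use mi_D[OF hv] in \<open>force simp: mons_def\<close>)
  finally show ?thesis .
qed

lemma PI_b: assumes "v \<in> D w" "n > 0" shows "PI (bop (- int n) v) = hb \<phi> (- int n) (PI v)"
proof -
  have m: "(fst p, add_mset n (snd p)) \<in> mons (w + int n)" if "p \<in> mons w" for p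
    using that assms(2) by (auto simp: mons_def cweight_def)
  have hv: "hol (v p)" for p using D_coeff[OF assms(1)] by (auto simp: Of_def)
  have "bop (- int n) v = bop (- int n) (\<Sum>p\<in>mons w. single p (v p))" using D_decomp[OF assms(1)] by simp
  also have "\<dots> = (\<Sum>p\<in>mons w. bop (- int n) (single p (v p)))"
    by (rule additive_on_sum[OF additive_bop sgp_UNIV]) auto
  also have "\<dots> = (\<Sum>p\<in>mons w. single (fst p, add_mset n (snd p)) (v p))"
    by (rule sum.cong[OF refl]) (use bop_single[OF assms(2)] in \<open>metis prod.collapse\<close>)
  finally have "PI (bop (- int n) v) = PI (\<Sum>p\<in>mons w. single (fst p, add_mset n (snd p)) (v p))" by simp
  also have "\<dots> = (\<Sum>p\<in>mons w. PI (single (fst p, add_mset n (snd p)) (v p)))"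
    by (rule additive_on_sum[OF additive_PI[of "w + int n"] sgp_S]) (use m D_coeff[OF assms(1)] in \<open>auto intro: single_D\<close>)
  also have "\<dots> = (\<Sum>p\<in>mons w. hb \<phi> (- int n) (mi p (v p)))"
    by (simp add: PI_single mi_b[OF hv assms(2)])
  also have "\<dots> = hb \<phi> (- int n) (PI v)"
    unfolding PI_eq[OF assms(1)]
    by (rule additive_on_sum[OF additive_hb[of w] sgp_S, symmetric]) (use mi_D[OF hv] in \<open>force simp: mons_def\<close>)
  finally show ?thesis .
qed

lemma deriv_comp: assumes "hol f" "\<tau> \<in> Hp" shows "deriv (\<lambda>\<tau>. f (\<phi> \<tau>)) \<tau> = deriv f (\<phi> \<tau>) * deriv \<phi> \<tau>"
  using deriv_chain[of \<phi> \<tau> f] assms phi_Hp hol_phi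
  by (simp add: o_def holomorphic_on_imp_differentiable_at[OF _ open_Hp])

text \<open>By construction this holds for creation operators. The remaining modes follow because
  \<open>Am\<close> and \<open>hb \<phi>\<close> satisfy the same relations as a and b, and because
  on functions h d/d\<tau> undoes the factor \<open>\<phi>\<close>' of the chain rule.\<close>

lemma PI_aop: assumes "v \<in> D w" shows "PI (aop n v) = Am n (PI v)"
  using assms
proof (induction arbitrary: n rule: D_induct)
  case (add w x y)
  thus ?case by (simp add: aop_plus PI_plus[OF aop_D aop_D] PI_plus Am_plus[OF PI_D PI_D])
next
  case (zero w)
  show ?case using additive_on_0[OF additive_Am sgp_S] by (simp add: PI_0)
next
  case (cst f)
  note c = cst_D[OF cst] and c' = cst_D[OF hol_comp[OF cst]]
  consider "n < 0" | "n = 0" | "n > 0" by linarith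
  thus ?case
  proof cases
    case 1
    thus ?thesis using PI_a[OF c, of "nat (- n)"] by simp
  next
    case 2
    have "Am 0 (cst (\<lambda>\<tau>. f (\<phi> \<tau>))) = ah h 0 (cst (\<lambda>\<tau>. f (\<phi> \<tau>)))" by (simp add: Am_eq[OF c'])
    also have "\<dots> = cst (\<lambda>\<tau>. h \<tau> * deriv (\<lambda>\<tau>. f (\<phi> \<tau>)) \<tau>)"
      by (simp add: ah_D0[OF c' hol_h] aop_0_cst[OF hol_comp[OF cst]] fn_cst)
    also have "\<dots> = cst (\<lambda>\<tau>. deriv f (\<phi> \<tau>))"
    proof (rule cst_cong)
      fix \<tau> assume "\<tau> \<in> Hp"
      thus "h \<tau> * deriv (\<lambda>\<tau>. f (\<phi> \<tau>)) \<tau> = deriv f (\<phi> \<tau>)"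
        using h_phi[of \<tau>] deriv_comp[OF cst, of \<tau>] by (metis mult.commute mult.left_commute mult_1)
    qed
    finally show ?thesis using 2 PI_cst[OF cst] PI_cst[OF hol_deriv[OF cst]] by (simp add: aop_0_cst[OF cst])
  next
    case 3
    have "Am n (PI (cst f)) = 0" using Am_D[OF PI_D[OF c], of n] D_zero 3 by force
    thus ?thesis using aop_eq_0[OF c 3] by (simp add: PI_0)
  qed
next
  case (a w v k)
  have "PI (aop n (aop (- int k) v)) = PI (aop (- int k) (aop n v))" using aop_commute[OF S_Dv[OF a(2)]] by simp
  also have "\<dots> = Am (- int k) (Am n (PI v))" using PI_a[OF aop_D[OF a(2)] a(1)] a(3) by simp
  also have "\<dots> = Am n (PI (aop (- int k) v))" using Am_Am[OF PI_D[OF a(2)]] PI_a[OF a(2,1)] by simp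
  finally show ?case .
next
  case (b w v k)
  have "PI (aop n (bop (- int k) v)) = PI (bop (- int k) (aop n v) + (if n - int k = 0 then v else 0))"
    using aop_bop[OF S_Dv[OF b(2)], of n "- int k"] by simp
  also have "\<dots> = PI (bop (- int k) (aop n v)) + PI (if n - int k = 0 then v else 0)"
    by (rule PI_plus[of _ "w - n + int k"]) (use bop_D[OF aop_D[OF b(2)], of "- int k" n] b(2) in auto)
  also have "\<dots> = hb \<phi> (- int k) (Am n (PI v)) + (if n - int k = 0 then PI v else 0)"
    using PI_b[OF aop_D[OF b(2)] b(1)] b(3) by (auto simp: PI_0)
  also have "\<dots> = Am n (PI (bop (- int k) v))"
    using Am_hb_phi[OF PI_D[OF b(2)], of n "- int k"] PI_b[OF b(2,1)] by simp
  finally show ?case .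
qed

text \<open>Substituting \<open>\<phi>\<close> into a field of a function cannot be read off its
  Taylor expansion, since the expansion points differ. Instead the chain rule
  \<open>hb_euler\<close> expresses n times the coefficient of z^n through lower coefficients for
  k', which allows induction on n.\<close>

lemma PI_hb_cst:
  assumes "hol f" "hol k"
  shows "PI (hb k (- int n) (cst f)) = hb (\<lambda>\<tau>. k (\<phi> \<tau>)) (- int n) (cst (\<lambda>\<tau>. f (\<phi> \<tau>)))"
  using assms(2)
proof (induction n arbitrary: k rule: less_induct)
  case (less n)
  note k = less.prems
  note c = cst_D[OF assms(1)] and c' = cst_D[OF hol_comp[OF assms(1)]]
  show ?case
  proof (cases "n = 0")
    case True
    thus ?thesis
      using PI_cst[of "\<lambda>\<tau>. k \<tau> * f \<tau>"] k assms(1)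
      by (simp add: hb_D0[OF c] hb_D0[OF c'] fn_cst holomorphic_intros)
  next
    case False
    let ?c = "cst f" and ?c' = "cst (\<lambda>\<tau>. f (\<phi> \<tau>))"
    let ?kp = "\<lambda>\<tau>. k (\<phi> \<tau>)"
    note k' = hol_deriv[OF k]
    have kp': "hol (\<lambda>\<tau>. deriv k (\<phi> \<tau>))" by (rule hol_comp[OF k'])
    have "PI (of_int (- int n) * hb k (- int n) ?c) = PI (isum (\<lambda>j. of_int j * bop j (hb (deriv k) (- int n - j) ?c)))"
      by (simp only: hb_euler[OF c k])
    also have "\<dots> = isum (\<lambda>j. PI (of_int j * bop j (hb (deriv k) (- int n - j) ?c)))"
    proof (rule additive_on_isum[OF additive_PI[of "int n"] sgp_S])
      show "of_int j * bop j (hb (deriv k) (- int n - j) ?c) \<in> D (int n)" for j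
        by (rule D_cong[OF S_of_int[OF bop_D[OF hb_D[OF c k']]]]) simp
      show "fsup (\<lambda>j. of_int j * bop j (hb (deriv k) (- int n - j) ?c))"
        using fsup_uminus[OF be_fsup[OF c k', of "- int n"]] by simp
    qed
    also have "\<dots> = isum (\<lambda>j. of_int j * hb \<phi> j (hb (\<lambda>\<tau>. deriv k (\<phi> \<tau>)) (- int n - j) ?c'))"
    proof (rule isum_cong)
      fix j
      let ?u = "hb (deriv k) (- int n - j) ?c"
      \<comment> \<open>Both sides vanish unless -n \<le> j \<le> 0, and the factor j kills j = 0.
        What is left uses the induction hypothesis at n + j < n.\<close>
      consider "j > 0 \<or> - int n - j > 0" | "j = 0" | "j < 0" "- int n - j \<le> 0" by linarith
      thus "PI (of_int j * bop j ?u) = of_int j * hb \<phi> j (hb (\<lambda>\<tau>. deriv k (\<phi> \<tau>)) (- int n - j) ?c')"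
      proof cases
        case 1
        have "bop j ?u = 0" by (rule bop_hb_0[OF c k']) (use 1 in auto)
        moreover have "hb \<phi> j (hb (\<lambda>\<tau>. deriv k (\<phi> \<tau>)) (- int n - j) ?c') = 0"
          by (rule hbhb_0[OF c' hol_phi kp']) (use 1 in auto)
        ultimately show ?thesis by (simp add: PI_0)
      next
        case 2
        thus ?thesis by (simp add: PI_0)
      next
        case 3
        define m where "m = nat (int n + j)"
        have m: "m < n" "- int n - j = - int m" using 3 by (auto simp: m_def)
        have j: "j = - int (nat (- j))" "nat (- j) > 0" using 3 by auto
        have IH: "PI ?u = hb (\<lambda>\<tau>. deriv k (\<phi> \<tau>)) (- int n - j) ?c'" using less.IH[OF m(1) k'] m(2) by simp
        have uD: "?u \<in> D (int n + j)" using hb_D[OF c k', of "- int n - j"] by (simp add: add.commute)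
        have bD: "bop j ?u \<in> D (int n)" using bop_D[OF uD, of j] by simp
        have sc: "PI (of_int i * x) = of_int i * PI x" if x: "x \<in> D w'" for i x w'
        proof -
          have nat: "PI (of_nat i * x) = of_nat i * PI x" for i
          proof (induction i)
            case (Suc i)
            have "of_nat i * x \<in> D w'" using S_of_int[OF x, of "int i"] by simp
            thus ?case using Suc PI_plus[OF x] by (simp add: distrib_right)
          qed (simp add: PI_0)
          have xD: "of_nat i * x \<in> D w'" for i using S_of_int[OF x, of "int i"] by simp
          show ?thesis
            by (cases i rule: int_cases2) (use nat additive_on_uminus[OF additive_PI sgp_S xD] in auto)
        qed
        have "PI (bop j ?u) = hb \<phi> j (PI ?u)" using PI_b[OF uD j(2)] j(1) by simp
        thus ?thesis using sc[OF bD] IH by simp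
      qed
    qed
    also have "\<dots> = - isum (\<lambda>j. of_int (- j) * hb \<phi> j (hb (\<lambda>\<tau>. deriv k (\<phi> \<tau>)) (- int n - j) ?c'))"
      unfolding isum_uminus[symmetric] by (rule isum_cong) simp
    also have "\<dots> = - be (\<lambda>\<tau>. deriv \<phi> \<tau> * deriv k (\<phi> \<tau>)) (- int n) ?c'"
      by (simp only: hb_mult_conv[OF c' hol_phi kp'])
    also have "be (\<lambda>\<tau>. deriv \<phi> \<tau> * deriv k (\<phi> \<tau>)) (- int n) ?c' = be (deriv ?kp) (- int n) ?c'"
      by (rule be_cong[OF _ c']) (simp add: deriv_comp[OF k] mult.commute)
    also have "- be (deriv ?kp) (- int n) ?c' = of_int (- int n) * hb ?kp (- int n) ?c'"
      by (simp add: be_deriv[OF c' hol_comp[OF k]])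
    finally have eq: "PI (of_int (- int n) * hb k (- int n) ?c) = of_int (- int n) * hb ?kp (- int n) ?c'" .
    have hD: "hb k (- int n) ?c \<in> D (int n)" using hb_D[OF c k, of "- int n"] by simp
    have nat: "PI (of_nat i * hb k (- int n) ?c) = of_nat i * PI (hb k (- int n) ?c)" for i
    proof (induction i)
      case (Suc i)
      have "of_nat i * hb k (- int n) ?c \<in> D (int n)" using S_of_int[OF hD, of "int i"] by simp
      thus ?case using Suc PI_plus[OF hD] by (simp add: distrib_right)
    qed (simp add: PI_0)
    have "PI (of_int (- int n) * hb k (- int n) ?c) = - (of_nat n * PI (hb k (- int n) ?c))"
      using nat additive_on_uminus[OF additive_PI sgp_S S_of_int[OF hD, of "int n"]] by simp
    with eq have "of_nat n * PI (hb k (- int n) ?c) = of_nat n * hb ?kp (- int n) ?c'" by simp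
    thus ?thesis using False by (simp add: fun_eq_iff pointwise)
  qed
qed

text \<open>Moving a creation operator a_{-j} out of the field of k leaves a field of k', so the
  induction keeps k arbitrary; h d/d\<tau> of k composed with \<open>\<phi>\<close> is k' composed
  with \<open>\<phi>\<close>.\<close>

lemma PI_hb: assumes "v \<in> D w" "hol k" shows "PI (hb k n v) = hb (\<lambda>\<tau>. k (\<phi> \<tau>)) n (PI v)"
  using assms
proof (induction arbitrary: n k rule: D_induct)
  case (add w x y)
  thus ?case by (simp add: hb_plus[of _ w] PI_plus[OF hb_D hb_D] PI_plus[of _ w] hb_plus[OF PI_D PI_D])
next
  case (zero w)
  show ?case by (simp add: PI_0)
next
  case (cst f)
  show ?case
  proof (cases "n > 0")
    case True
    thus ?thesis using hb_0[OF cst_D[OF cst(1)] cst(2)] hb_0[OF PI_D[OF cst_D[OF cst(1)]] hol_comp[OF cst(2)]]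
      by (simp add: PI_0)
  next
    case False
    thus ?thesis using PI_hb_cst[OF cst, of "nat (- n)"] PI_cst[OF cst(1)] by simp
  qed
next
  case (a w v j)
  note k' = hol_deriv[OF a(4)]
  have kp: "hol (\<lambda>\<tau>. k (\<phi> \<tau>))" by (rule hol_comp[OF a(4)])
  have D1: "aop (- int j) (hb k n v) \<in> D (w - n + int j)" using aop_D[OF hb_D[OF a(2,4)], of "- int j"] by simp
  have D2: "hb (deriv k) (n - int j) v \<in> D (w - n + int j)" using hb_D[OF a(2) k', of "n - int j"] by (simp add: algebra_simps)
  have "hb k n (aop (- int j) v) = aop (- int j) (hb k n v) - hb (deriv k) (n - int j) v"
    using aop_hb[OF a(2,4), of "- int j" n] by simp
  hence "PI (hb k n (aop (- int j) v)) = PI (aop (- int j) (hb k n v)) - PI (hb (deriv k) (n - int j) v)"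
    using additive_on_diff[OF additive_PI D1 D2] by simp
  also have "\<dots> = Am (- int j) (hb (\<lambda>\<tau>. k (\<phi> \<tau>)) n (PI v)) - hb (\<lambda>\<tau>. deriv k (\<phi> \<tau>)) (n - int j) (PI v)"
    using PI_a[OF hb_D[OF a(2,4)] a(1)] a(3)[OF a(4)] a(3)[OF k'] by simp
  also have "hb (\<lambda>\<tau>. deriv k (\<phi> \<tau>)) (n - int j) (PI v) = hb (\<lambda>\<tau>. h \<tau> * deriv (\<lambda>\<tau>. k (\<phi> \<tau>)) \<tau>) (n - int j) (PI v)"
  proof (rule hb_cong[OF _ PI_D[OF a(2)]])
    fix \<tau> assume "\<tau> \<in> Hp"
    thus "deriv k (\<phi> \<tau>) = h \<tau> * deriv (\<lambda>\<tau>. k (\<phi> \<tau>)) \<tau>"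
      using h_phi[of \<tau>] deriv_comp[OF a(4), of \<tau>] by (metis mult.commute mult.left_commute mult_1)
  qed
  also have "Am (- int j) (hb (\<lambda>\<tau>. k (\<phi> \<tau>)) n (PI v)) - \<dots> = hb (\<lambda>\<tau>. k (\<phi> \<tau>)) n (Am (- int j) (PI v))"
    using Am_hb[OF PI_D[OF a(2)] kp, of "- int j" n] by simp
  finally show ?case using PI_a[OF a(2,1)] by simp
next
  case (b w v j)
  show ?case
    using b PI_b[OF b(2,1)] PI_b[OF hb_D[OF b(2,4)] b(1)] hb_bop[OF b(2)]
      hb_hb[OF PI_D[OF b(2)] hol_phi hol_comp[OF b(4)]] by simp
qed

lemma PI_of_int: assumes "v \<in> D w" shows "PI (of_int k * v) = of_int k * PI v"
proof -
  have "PI (hb (\<lambda>_. of_int k) 0 v) = hb (\<lambda>_. of_int k) 0 (PI v)" using PI_hb[OF assms, of "\<lambda>_. of_int k" 0] by simp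
  thus ?thesis by (simp add: hb_const[OF assms] hb_const[OF PI_D[OF assms]] fn_const S_Dv[OF assms] S_Dv[OF PI_D[OF assms]])
qed

lemma PI_bop: assumes "v \<in> D w" shows "PI (bop n v) = hb \<phi> n (PI v)"
  using PI_hb[OF assms, of "\<lambda>\<tau>. \<tau>" n] hb_id[OF assms, of n] by simp

lemma PI_be:
  assumes v: "v \<in> D w" and k: "hol k"
  shows "PI (be k n v) = be (\<lambda>\<tau>. deriv \<phi> \<tau> * k (\<phi> \<tau>)) n (PI v)"
proof -
  have "PI (be k n v) = isum (\<lambda>j. PI (of_int (- j) * bop j (hb k (n - j) v)))"
    unfolding be_def by (rule additive_on_isum[OF additive_PI sgp_S be_term_D[OF v k] be_fsup[OF v k]])
  also have "\<dots> = isum (\<lambda>j. of_int (- j) * hb \<phi> j (hb (\<lambda>\<tau>. k (\<phi> \<tau>)) (n - j) (PI v)))"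
    by (rule isum_cong) (simp only: PI_of_int[OF bop_D[OF hb_D[OF v k]]] PI_bop[OF hb_D[OF v k]] PI_hb[OF v k])
  also have "\<dots> = be (\<lambda>\<tau>. deriv \<phi> \<tau> * k (\<phi> \<tau>)) n (PI v)"
    by (rule hb_mult_conv[OF PI_D[OF v] hol_phi hol_comp[OF k]])
  finally show ?thesis .
qed

text \<open>The image of a normally ordered product is a nested one. Reassociating it by
  \<open>ne_eq\<close> costs the term h' K' b_{-1}, in addition to the correction q' K b_{-1}
  carried by the image of a.\<close>

lemma PI_ah:
  assumes v: "v \<in> D w" and G: "hol G"
  defines "K \<equiv> (\<lambda>\<tau>. G (\<phi> \<tau>))"
  shows "PI (ah G n v) = ah (\<lambda>\<tau>. h \<tau> * K \<tau>) n (PI v) + be (\<lambda>\<tau>. deriv h \<tau> * deriv K \<tau>) n (PI v)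
     + be (\<lambda>\<tau>. deriv q \<tau> * K \<tau>) n (PI v)"
proof -
  define u where "u = PI v"
  have u: "u \<in> D w" unfolding u_def using v by (rule PI_D)
  have K: "hol K" unfolding K_def by (rule hol_comp[OF G])
  let ?N = "\<lambda>j. if j < 0 then ah h (0 + j) (hb K (n - j) u) else hb K (n - j) (ah h (0 + j) u)"
  let ?Q = "\<lambda>j. of_int (- j) * hb q j (hb K (n - j) u)"
  have "PI (ah G n v) = isum (\<lambda>j. PI (if j < 0 then aop j (hb G (n - j) v) else hb G (n - j) (aop j v)))"
    unfolding ah_def by (rule additive_on_isum[OF additive_PI sgp_S ah_term_D[OF v G] ah_fsup[OF v G]])
  also have "\<dots> = isum (\<lambda>j. ?N j + ?Q j)"
  proof (rule isum_cong)
    fix j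
    have "PI (aop j (hb G (n - j) v)) = Am j (hb K (n - j) u)"
      using PI_aop[OF hb_D[OF v G]] PI_hb[OF v G] by (simp add: u_def K_def)
    hence 1: "PI (aop j (hb G (n - j) v)) = ah h j (hb K (n - j) u) + ?Q j"
      by (simp only: Am_eq[OF hb_D[OF u K]])
    have qD: "of_int (- j) * hb q j u \<in> D (w - j)" using u hol_q by (intro S_of_int hb_D)
    have "PI (hb G (n - j) (aop j v)) = hb K (n - j) (Am j u)"
      using PI_aop[OF v] PI_hb[OF aop_D[OF v] G] by (simp add: u_def K_def)
    also have "\<dots> = hb K (n - j) (ah h j u) + hb K (n - j) (of_int (- j) * hb q j u)"
      unfolding Am_eq[OF u] by (rule hb_plus[OF ah_D[OF u hol_h] qD])
    also have "hb K (n - j) (of_int (- j) * hb q j u) = ?Q j"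
      by (simp only: hb_of_int[OF hb_D[OF u hol_q] K] hb_hb[OF u K hol_q])
    finally have 2: "PI (hb G (n - j) (aop j v)) = hb K (n - j) (ah h j u) + ?Q j" .
    show "PI (if j < 0 then aop j (hb G (n - j) v) else hb G (n - j) (aop j v)) = ?N j + ?Q j"
      using 1 2 by auto
  qed
  also have "\<dots> = ne h K 0 n u + isum ?Q"
    unfolding ne_def
  proof (rule isum_add[OF ne_fsup[OF u hol_h K]])
    show "fsup ?Q"
    proof (rule fsupI[of "\<bar>n\<bar> + \<bar>w\<bar>"])
      fix j assume "\<bar>j\<bar> > \<bar>n\<bar> + \<bar>w\<bar>"
      hence "j > w \<or> n - j > w" by linarith
      thus "?Q j = 0" using hbhb_0[OF u hol_q K] by simp
    qed
  qed
  also have "ne h K 0 n u = ah (\<lambda>\<tau>. h \<tau> * K \<tau>) n u + be (\<lambda>\<tau>. deriv h \<tau> * deriv K \<tau>) n u"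
    using ne_eq[OF u hol_h K, of 0 n] hb_mult_conv[OF u hol_h hol_deriv[OF K], of n] by simp
  also have "isum ?Q = be (\<lambda>\<tau>. deriv q \<tau> * K \<tau>) n u" by (rule hb_mult_conv[OF u hol_q K])
  finally show ?thesis by (simp add: u_def)
qed

end

subsection \<open>Leading terms\<close>

text \<open>The decreasing filtration by degree. Each a mode lowers the degree by at most one, each
  b_k with k \<noteq> 0 raises it by one, and functions preserve it.\<close>

definition FD :: "int \<Rightarrow> int \<Rightarrow> dch set" where
  "FD w d = {v \<in> D w. \<forall>p. v p \<noteq> 0 \<longrightarrow> mdeg p \<ge> d}"

lemma FD_D: "v \<in> FD w d \<Longrightarrow> v \<in> D w" by (simp add: FD_def)

lemma FD_deg: "v \<in> FD w d \<Longrightarrow> v p \<noteq> 0 \<Longrightarrow> mdeg p \<ge> d" unfolding FD_def by blast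

lemma FD_I: "v \<in> D w \<Longrightarrow> (\<And>p. v p \<noteq> 0 \<Longrightarrow> mdeg p \<ge> d) \<Longrightarrow> v \<in> FD w d" unfolding FD_def by blast

lemma FD_mono: assumes "v \<in> FD w d" "e \<le> d" shows "v \<in> FD w e"
  by (rule FD_I[OF FD_D[OF assms(1)]]) (use FD_deg[OF assms(1)] assms(2) in \<open>blast intro: order_trans\<close>)

lemma sgp_FD: "sgp (FD w d)"
  unfolding sgp_def
proof (intro conjI ballI)
  show "0 \<in> FD w d" by (rule FD_I) (auto simp: pointwise)
  fix x y assume xy: "x \<in> FD w d" "y \<in> FD w d"
  show "x - y \<in> FD w d"
  proof (rule FD_I)
    show "x - y \<in> D w" using xy by (intro S_diff FD_D)
    fix p assume "(x - y) p \<noteq> 0"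
    hence "x p \<noteq> 0 \<or> y p \<noteq> 0" by (auto simp: pointwise)
    thus "mdeg p \<ge> d" using FD_deg xy by blast
  qed
qed

lemma FD_add: "x \<in> FD w d \<Longrightarrow> y \<in> FD w d \<Longrightarrow> x + y \<in> FD w d"
  by (rule sgp_add[OF sgp_FD])
lemma FD_0: "0 \<in> FD w d" using sgp_FD by (simp add: sgp_def)

lemma FD_fn: assumes "v \<in> FD w d" "hol h" shows "fn h * v \<in> FD w d"
proof (rule FD_I)
  show "fn h * v \<in> D w" using assms by (intro S_fn FD_D)
  fix p assume "(fn h * v) p \<noteq> 0"
  hence "v p \<noteq> 0" by (auto simp: pointwise)
  thus "mdeg p \<ge> d" using FD_deg assms by blast
qed

lemma FD_of_int: assumes "v \<in> FD w d" shows "of_int k * v \<in> FD w d"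
  using FD_fn[OF assms, of "\<lambda>_. of_int k"] fn_const[OF S_Dv[OF FD_D[OF assms]]] by simp

lemma FD_aop: assumes "v \<in> FD w d" shows "aop n v \<in> FD (w - n) (d - 1)"
proof (rule FD_I)
  show "aop n v \<in> D (w - n)" using assms by (intro aop_D FD_D)
  fix p assume "aop n v p \<noteq> 0"
  from aop_supp[OF this] obtain r where r: "v r \<noteq> 0" and
    *: "n < 0 \<longrightarrow> fst p = add_mset (nat (-n)) (fst r) \<and> snd p = snd r"
    "n = 0 \<longrightarrow> p = r" "n > 0 \<longrightarrow> fst r = fst p \<and> snd r = add_mset (nat n) (snd p)" by blast
  have "mdeg r \<ge> d" by (rule FD_deg[OF assms r])
  moreover have "mdeg p \<ge> mdeg r - 1"
  proof (cases n "0::int" rule: linorder_cases)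
    case less
    hence "fst p = add_mset (nat (-n)) (fst r)" "snd p = snd r" using *(1) by blast+
    thus ?thesis by (simp add: mdeg_def)
  next
    case equal
    hence "p = r" using *(2) by blast
    thus ?thesis by simp
  next
    case greater
    hence "fst r = fst p" "snd r = add_mset (nat n) (snd p)" using *(3) by blast+
    thus ?thesis by (simp add: mdeg_def)
  qed
  ultimately show "mdeg p \<ge> d - 1" by linarith
qed

lemma FD_bop: assumes "v \<in> FD w d" "n \<noteq> 0" shows "bop n v \<in> FD (w - n) (d + 1)"
proof (rule FD_I)
  show "bop n v \<in> D (w - n)" using assms by (intro bop_D FD_D)
  fix p assume "bop n v p \<noteq> 0"
  from bop_supp[OF this] obtain r where r: "v r \<noteq> 0" and
    *: "n < 0 \<longrightarrow> snd p = add_mset (nat (-n)) (snd r) \<and> fst p = fst r"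
    "n > 0 \<longrightarrow> snd r = snd p \<and> fst r = add_mset (nat n) (fst p)" by blast
  have "mdeg r \<ge> d" by (rule FD_deg[OF assms(1) r])
  moreover have "mdeg p = mdeg r + 1"
  proof (cases "n < 0")
    case True
    hence "snd p = add_mset (nat (-n)) (snd r)" "fst p = fst r" using *(1) by blast+
    thus ?thesis by (simp add: mdeg_def)
  next
    case False
    with assms(2) have "n > 0" by linarith
    hence "snd r = snd p" "fst r = add_mset (nat n) (fst p)" using *(2) by blast+
    thus ?thesis by (simp add: mdeg_def)
  qed
  ultimately show "mdeg p \<ge> d + 1" by linarith
qed

lemma FD_X: "v \<in> FD w d \<Longrightarrow> pmode l n v \<in> FD (w - n) (d + int l)"
proof (induction l arbitrary: n)
  case 0
  thus ?case by (auto intro: FD_0)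
next
  case (Suc l)
  have "bop k (pmode l (n - k) v) \<in> FD (w - n) (d + int (Suc l))" if "k \<noteq> 0" for k
    using FD_bop[OF Suc.IH[OF Suc.prems, of "n - k"] that] by (simp add: algebra_simps)
  thus ?case by (auto intro!: sgp_isum[OF sgp_FD] FD_0)
qed

text \<open>The l-th Taylor term contains l nonzero b modes and so gains l degrees. Only l = 0
  counts to lowest order, and for n \<noteq> 0 the lowest possible order is l = 1, treated in
  \<open>hb_lead1\<close>.\<close>

lemma hb_lead0: assumes "v \<in> FD w d" "hol h"
  shows "hb h n v - (if n = 0 then fn h * v else 0) \<in> FD (w - n) (d + 1)"
proof -
  note v = FD_D[OF assms(1)]
  have "hb h n v = (\<Sum>l\<le>Lb w n. fn (tc h l) * pmode l n v)" by (rule hb_eq'[OF v order_refl])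
  also have "\<dots> = (\<Sum>l\<le>Lb w n. (if l = 0 then (if n = 0 then fn h * v else 0) else 0) +
      (if l = 0 then 0 else fn (tc h l) * pmode l n v))"
    by (rule sum.cong[OF refl]) (auto simp: tc_def)
  also have "\<dots> = (if n = 0 then fn h * v else 0) + (\<Sum>l\<le>Lb w n. if l = 0 then 0 else fn (tc h l) * pmode l n v)"
    by (simp add: sum.distrib sum.delta)
  finally have "hb h n v - (if n = 0 then fn h * v else 0) = (\<Sum>l\<le>Lb w n. if l = 0 then 0 else fn (tc h l) * pmode l n v)"
    by simp
  moreover have "(if l = 0 then 0 else fn (tc h l) * pmode l n v) \<in> FD (w - n) (d + 1)" for l
    by (auto intro!: FD_0 FD_fn hol_tc assms(2) FD_mono[OF FD_X[OF assms(1)]])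
  ultimately show ?thesis by (simp only: sgp_sum[OF sgp_FD])
qed

lemma FD_hb: assumes "v \<in> FD w d" "hol h" shows "hb h n v \<in> FD (w - n) d"
proof -
  have "(if n = 0 then fn h * v else 0) \<in> FD (w - n) d" using FD_fn[OF assms] by (auto intro: FD_0)
  from FD_add[OF FD_mono[OF hb_lead0[OF assms, of n]] this] show ?thesis by simp
qed

lemma FD_hb1: assumes "v \<in> FD w d" "hol h" "n \<noteq> 0" shows "hb h n v \<in> FD (w - n) (d + 1)"
  using hb_lead0[OF assms(1,2), of n] assms(3) by simp

lemma pmode_1: "pmode (Suc 0) n v = (if n = 0 then 0 else bop n v)"
  unfolding pmode.simps(2) by (subst isum_single[of n]) auto

lemma hb_lead1: assumes "v \<in> FD w d" "hol h" "n \<noteq> 0"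
  shows "hb h n v - fn (deriv h) * bop n v \<in> FD (w - n) (d + 2)"
proof -
  note v = FD_D[OF assms(1)]
  have "hb h n v = (\<Sum>l\<le>Suc (Lb w n). fn (tc h l) * pmode l n v)" by (rule hb_eq'[OF v]) simp
  also have "\<dots> = (\<Sum>l\<le>Suc (Lb w n). (if l = 1 then fn (deriv h) * bop n v else 0) +
      (if l \<le> 1 then 0 else fn (tc h l) * pmode l n v))"
  proof (rule sum.cong[OF refl])
    fix l :: nat
    consider "l = 0" | "l = 1" | "l > 1" by linarith
    thus "fn (tc h l) * pmode l n v = (if l = 1 then fn (deriv h) * bop n v else 0) +
      (if l \<le> 1 then 0 else fn (tc h l) * pmode l n v)"
      by cases (use assms(3) in \<open>auto simp: tc_def pmode_1 simp del: pmode.simps(2)\<close>)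
  qed
  also have "\<dots> = fn (deriv h) * bop n v + (\<Sum>l\<le>Suc (Lb w n). if l \<le> 1 then 0 else fn (tc h l) * pmode l n v)"
    by (simp add: sum.distrib sum.delta del: sum.atMost_Suc)
  finally have "hb h n v - fn (deriv h) * bop n v = (\<Sum>l\<le>Suc (Lb w n). if l \<le> 1 then 0 else fn (tc h l) * pmode l n v)"
    by simp
  moreover have "(if l \<le> 1 then 0 else fn (tc h l) * pmode l n v) \<in> FD (w - n) (d + 2)" for l
    by (auto intro!: FD_0 FD_fn hol_tc assms(2) FD_mono[OF FD_X[OF assms(1)]])
  ultimately show ?thesis by (simp only: sgp_sum[OF sgp_FD])
qed

lemma isum_remove: "fsup F \<Longrightarrow> isum F - F m = isum (\<lambda>k. if k = m then 0 else F k)"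
proof -
  assume f: "fsup F"
  have "isum (\<lambda>k. if k = m then F k else 0) = F m" by (subst isum_single[of m]) auto
  moreover have "isum (\<lambda>k. F k - (if k = m then F k else 0)) = isum F - isum (\<lambda>k. if k = m then F k else 0)"
    by (rule isum_diff[OF f]) (rule fsupI[of "\<bar>m\<bar>"], auto)
  moreover have "isum (\<lambda>k. F k - (if k = m then F k else 0)) = isum (\<lambda>k. if k = m then 0 else F k)"
    by (rule isum_cong) auto
  ultimately show ?thesis by simp
qed

text \<open>In the terms with k \<noteq> m the function contributes a nonzero mode, whose gain of
  one degree compensates the loss caused by a_k.\<close>

lemma ah_lead: assumes "v \<in> FD w d" "hol h" "m < 0"
  shows "ah h m v - fn h * aop m v \<in> FD (w - m) d"
proof -
  note v = FD_D[OF assms(1)]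
  let ?t = "\<lambda>k. if k < 0 then aop k (hb h (m - k) v) else hb h (m - k) (aop k v)"
  have "ah h m v - ?t m = isum (\<lambda>k. if k = m then 0 else ?t k)"
    unfolding ah_def by (rule isum_remove[OF ah_fsup[OF v assms(2)]])
  moreover have "(if k = m then 0 else ?t k) \<in> FD (w - m) d" for k
  proof (cases "k = m")
    case False
    have "aop k (hb h (m - k) v) \<in> FD (w - m) d"
      using FD_aop[OF FD_hb1[OF assms(1,2), of "m - k"], of k] False by simp
    moreover have "hb h (m - k) (aop k v) \<in> FD (w - m) d"
      using FD_hb1[OF FD_aop[OF assms(1)] assms(2), of "m - k" k] False by simp
    ultimately show ?thesis using False by auto
  qed (simp add: FD_0)
  ultimately have 1: "ah h m v - ?t m \<in> FD (w - m) d" by (simp only: sgp_isum[OF sgp_FD])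
  have vD: "v \<in> FD (w - 0) d" using assms(1) by simp
  have "aop m (hb h 0 v - fn h * v) = aop m (hb h 0 v) - aop m (fn h * v)"
    using hb_D[OF v assms(2), of 0] S_fn[OF v assms(2)] by (intro aop_minus[of _ w]) auto
  hence "?t m - fn h * aop m v = aop m (hb h 0 v - fn h * v)"
    using assms(3) by (simp add: aop_fn)
  also have "\<dots> \<in> FD (w - m) d"
    using FD_aop[OF hb_lead0[OF assms(1,2), of 0], of m] by simp
  finally show ?thesis using FD_add[OF 1] by fastforce
qed

lemma FD_be: assumes "v \<in> FD w d" "hol c" shows "be c m v \<in> FD (w - m) (d + 1)"
  unfolding be_def
proof (rule sgp_isum[OF sgp_FD])
  fix n show "of_int (- n) * bop n (hb c (m - n) v) \<in> FD (w - m) (d + 1)"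
  proof (cases "n = 0")
    case False
    thus ?thesis using FD_of_int[OF FD_bop[OF FD_hb[OF assms, of "m - n"] False], of "- n"] by simp
  qed (simp add: FD_0)
qed

text \<open>The common shape of two constructions: the action of a Moebius map, with c = q', and the
  lift of a modular form, with \<open>Gw\<close>, \<open>Pw\<close> and \<open>Fp\<close>. Their
  leading terms are computed once for both.\<close>

definition lift_op :: "(complex \<Rightarrow> complex) \<Rightarrow> (complex \<Rightarrow> complex) \<Rightarrow> (complex \<Rightarrow> complex) \<Rightarrow> mon \<Rightarrow> (complex \<Rightarrow> complex) \<Rightarrow> dch" where
  "lift_op h c \<phi> p f = foldr (\<lambda>n v. ah h (- int n) v + be c (- int n) v) (sorted_list_of_multiset (fst p))
     (foldr (\<lambda>n. hb \<phi> (- int n)) (sorted_list_of_multiset (snd p)) (cst f))"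

context
  fixes h c \<phi> :: "complex \<Rightarrow> complex"
  assumes hol_hc: "hol h" "hol c" "hol \<phi>"
begin

lemma lift_lead_b:
  assumes "hol f" "\<forall>y\<in>set ys. y > 0"
  shows "foldr (\<lambda>n. hb \<phi> (- int n)) ys (cst f) \<in> FD (int (sum_list ys)) (int (length ys)) \<and>
    foldr (\<lambda>n. hb \<phi> (- int n)) ys (cst f) - single ({#}, mset ys) (rH (\<lambda>\<tau>. deriv \<phi> \<tau> ^ length ys * f \<tau>))
      \<in> FD (int (sum_list ys)) (int (length ys) + 1)"
  using assms(2)
proof (induction ys)
  case Nil
  have "cst f \<in> FD 0 0"
    by (rule FD_I[OF cst_D[OF assms(1)]]) (auto simp: cst_def single_def mdeg_def split: if_splits)
  thus ?case by (auto simp: cst_def FD_0)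
next
  case (Cons y ys)
  let ?v = "foldr (\<lambda>n. hb \<phi> (- int n)) ys (cst f)"
  let ?g = "\<lambda>\<tau>. deriv \<phi> \<tau> ^ length ys * f \<tau>"
  let ?s = "single ({#}, mset ys) (rH ?g)"
  have y: "y > 0" using Cons by simp
  have IH: "?v \<in> FD (int (sum_list ys)) (int (length ys))" "?v - ?s \<in> FD (int (sum_list ys)) (int (length ys) + 1)"
    using Cons by auto
  have 1: "hb \<phi> (- int y) ?v \<in> FD (int (sum_list (y # ys))) (int (length (y # ys)))"
    using FD_hb1[OF IH(1) hol_hc(3), of "- int y"] y by (simp add: algebra_simps)
  have 2: "hb \<phi> (- int y) ?v - fn (deriv \<phi>) * bop (- int y) ?v \<in> FD (int (sum_list (y # ys))) (int (length (y # ys)) + 1)"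
    using hb_lead1[OF IH(1) hol_hc(3), of "- int y"] y by (simp add: algebra_simps)
  have 3: "fn (deriv \<phi>) * bop (- int y) (?v - ?s) \<in> FD (int (sum_list (y # ys))) (int (length (y # ys)) + 1)"
    using FD_fn[OF FD_bop[OF IH(2), of "- int y"] hol_deriv[OF hol_hc(3)]] y by (simp add: algebra_simps)
  have 4: "fn (deriv \<phi>) * bop (- int y) ?s = single ({#}, mset (y # ys)) (rH (\<lambda>\<tau>. deriv \<phi> \<tau> ^ length (y # ys) * f \<tau>))"
    using bop_single[OF y, of "{#}" "mset ys"] by (auto simp: single_def fun_eq_iff fn_apply rH_def pointwise)
  have eq: "hb \<phi> (- int y) ?v - single ({#}, mset (y # ys)) (rH (\<lambda>\<tau>. deriv \<phi> \<tau> ^ length (y # ys) * f \<tau>)) =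
     (hb \<phi> (- int y) ?v - fn (deriv \<phi>) * bop (- int y) ?v) + fn (deriv \<phi>) * bop (- int y) (?v - ?s)"
    unfolding 4[symmetric] by (simp add: bop_diff right_diff_distrib)
  have "hb \<phi> (- int y) ?v - single ({#}, mset (y # ys)) (rH (\<lambda>\<tau>. deriv \<phi> \<tau> ^ length (y # ys) * f \<tau>))
      \<in> FD (int (sum_list (y # ys))) (int (length (y # ys)) + 1)"
    unfolding eq by (rule FD_add[OF 2 3])
  with 1 show ?case by simp
qed

lemma lift_lead_a:
  assumes "v \<in> FD w d" "v - single (l, u) (rH g) \<in> FD w (d + 1)" "\<forall>x\<in>set xs. x > 0"
  shows "foldr (\<lambda>n v. ah h (- int n) v + be c (- int n) v) xs v \<in> FD (w + int (sum_list xs)) (d - int (length xs)) \<and>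
    foldr (\<lambda>n v. ah h (- int n) v + be c (- int n) v) xs v - single (mset xs + l, u) (rH (\<lambda>\<tau>. h \<tau> ^ length xs * g \<tau>))
      \<in> FD (w + int (sum_list xs)) (d - int (length xs) + 1)"
  using assms(3)
proof (induction xs)
  case Nil
  thus ?case using assms by simp
next
  case (Cons x xs)
  let ?T = "\<lambda>n v. ah h (- int n) v + be c (- int n) v"
  let ?v = "foldr ?T xs v"
  let ?g = "\<lambda>\<tau>. h \<tau> ^ length xs * g \<tau>"
  let ?s = "single (mset xs + l, u) (rH ?g)"
  let ?w = "w + int (sum_list xs)" and ?d = "d - int (length xs)"
  let ?w' = "w + int (sum_list (x # xs))" and ?d' = "d - int (length (x # xs))"
  have x: "x > 0" using Cons by simp
  have IH: "?v \<in> FD ?w ?d" "?v - ?s \<in> FD ?w (?d + 1)" using Cons by auto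
  have sD: "?s \<in> D ?w" using S_diff[OF FD_D[OF IH(1)] FD_D[OF IH(2)]] by simp
  have 2: "ah h (- int x) ?v - fn h * aop (- int x) ?v \<in> FD ?w' (?d' + 1)"
    using ah_lead[OF IH(1) hol_hc(1), of "- int x"] x by (simp add: algebra_simps)
  have 3: "fn h * aop (- int x) (?v - ?s) \<in> FD ?w' (?d' + 1)"
    using FD_fn[OF FD_aop[OF IH(2), of "- int x"] hol_hc(1)] by (simp add: algebra_simps)
  have 4: "fn h * aop (- int x) ?s = single (mset (x # xs) + l, u) (rH (\<lambda>\<tau>. h \<tau> ^ length (x # xs) * g \<tau>))"
    using aop_single[OF x, of "mset xs + l" u] by (auto simp: single_def fun_eq_iff fn_apply rH_def pointwise)
  have 5: "be c (- int x) ?v \<in> FD ?w' (?d' + 1)"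
    using FD_mono[OF FD_be[OF IH(1) hol_hc(2), of "- int x"], of "?d' + 1"] by (simp add: algebra_simps)
  have am: "aop (- int x) (?v - ?s) = aop (- int x) ?v - aop (- int x) ?s"
    by (rule aop_minus[OF FD_D[OF IH(1)] sD])
  have eq: "?T x ?v - single (mset (x # xs) + l, u) (rH (\<lambda>\<tau>. h \<tau> ^ length (x # xs) * g \<tau>)) =
     ((ah h (- int x) ?v - fn h * aop (- int x) ?v) + fn h * aop (- int x) (?v - ?s)) + be c (- int x) ?v"
    unfolding 4[symmetric] am by (simp add: right_diff_distrib)
  have R: "?T x ?v - single (mset (x # xs) + l, u) (rH (\<lambda>\<tau>. h \<tau> ^ length (x # xs) * g \<tau>)) \<in> FD ?w' (?d' + 1)"
    unfolding eq by (rule FD_add[OF FD_add[OF 2 3] 5])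
  have "fn h * aop (- int x) ?v \<in> FD ?w' ?d'"
    using FD_fn[OF FD_aop[OF IH(1), of "- int x"] hol_hc(1)] by (simp add: algebra_simps)
  moreover have "?T x ?v = ((ah h (- int x) ?v - fn h * aop (- int x) ?v) + be c (- int x) ?v) + fn h * aop (- int x) ?v"
    by simp
  ultimately have "?T x ?v \<in> FD ?w' ?d'"
    using FD_add[OF FD_mono[OF FD_add[OF 2 5], of ?d']] by fastforce
  with R show ?case by simp
qed

lemma lift_lead:
  assumes "hol f" "p \<in> mons w"
  shows "lift_op h c \<phi> p f - single p (rH (\<lambda>\<tau>. h \<tau> ^ size (fst p) * (deriv \<phi> \<tau> ^ size (snd p) * f \<tau>))) \<in> FD w (mdeg p + 1)"
    and "lift_op h c \<phi> p f \<in> FD w (mdeg p)"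
proof -
  let ?xs = "sorted_list_of_multiset (fst p)" and ?ys = "sorted_list_of_multiset (snd p)"
  have len: "length ?xs = size (fst p)" "length ?ys = size (snd p)"
    by (metis mset_sorted_list_of_multiset size_mset)+
  have pos: "\<forall>x\<in>set ?xs. x > 0" "\<forall>y\<in>set ?ys. y > 0" using assms(2) by (auto simp: mons_def intro!: gr0I)
  have sl: "sum_list (sorted_list_of_multiset M) = sum_mset M" for M :: "nat multiset"
    by (metis mset_sorted_list_of_multiset sum_mset_sum_list)
  have w: "int (sum_mset (snd p)) + int (sum_mset (fst p)) = w"
  proof -
    have "int (cweight p) = w" using assms(2) unfolding mons_def by blast
    thus ?thesis unfolding cweight_def by linarith
  qed
  note B = lift_lead_b[OF assms(1) pos(2)]
  note A = lift_lead_a[OF conjunct1[OF B] conjunct2[OF B] pos(1)]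
  show "lift_op h c \<phi> p f - single p (rH (\<lambda>\<tau>. h \<tau> ^ size (fst p) * (deriv \<phi> \<tau> ^ size (snd p) * f \<tau>))) \<in> FD w (mdeg p + 1)"
    using conjunct2[OF A] unfolding lift_op_def len sl w mdeg_def by simp
  show "lift_op h c \<phi> p f \<in> FD w (mdeg p)"
    using conjunct1[OF A] unfolding lift_op_def len sl w mdeg_def by simp
qed

end

context coordinate_change
begin

lemma mi_eq: "mi p f = lift_op h (deriv q) \<phi> p (\<lambda>\<tau>. f (\<phi> \<tau>))"
  by (simp add: mi_def Bs_def lift_op_def Am_def[abs_def])

text \<open>On the associated graded space each a contributes the factor h and each b the factor
  \<open>\<phi>\<close>'; everything else has gained degree.\<close>

lemma PI_lead:
  assumes v: "v \<in> FD w d" and p: "p \<in> mons w" "mdeg p = d"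
  shows "PI v p = rH (\<lambda>\<tau>. h \<tau> ^ size (fst p) * (deriv \<phi> \<tau> ^ size (snd p) * v p (\<phi> \<tau>)))"
proof -
  let ?L = "\<lambda>p. rH (\<lambda>\<tau>. h \<tau> ^ size (fst p) * (deriv \<phi> \<tau> ^ size (snd p) * v p (\<phi> \<tau>)))"
  have hv: "hol (v p)" for p using D_coeff[OF FD_D[OF v]] by (auto simp: Of_def)
  have "PI v - (\<Sum>p\<in>mons w. single p (?L p)) = (\<Sum>p\<in>mons w. mi p (v p) - single p (?L p))"
    by (simp add: PI_eq[OF FD_D[OF v]] sum_subtractf)
  also have "\<dots> \<in> FD w (d + 1)"
  proof (rule sgp_sum[OF sgp_FD])
    fix p assume pm: "p \<in> mons w"
    show "mi p (v p) - single p (?L p) \<in> FD w (d + 1)"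
    proof (cases "v p = 0")
      case True
      have "mi p (v p) = 0" using True mi_0 by simp
      moreover have "single p (?L p) = 0" using True by (auto simp: single_def rH_def fun_eq_iff pointwise)
      ultimately show ?thesis by (simp add: FD_0)
    next
      case False
      hence "d \<le> mdeg p" using FD_deg[OF v] by blast
      thus ?thesis using lift_lead(1)[OF hol_h hol_deriv[OF hol_q] hol_phi hol_comp[OF hv] pm, of p]
        unfolding mi_eq by (auto elim!: FD_mono)
    qed
  qed
  finally have "(PI v - (\<Sum>p\<in>mons w. single p (?L p))) p = 0"
    using FD_deg p(2) by fastforce
  hence "PI v p = (\<Sum>r\<in>mons w. single r (?L r)) p" by (simp add: pointwise)
  also have "\<dots> = (\<Sum>r\<in>mons w. if p = r then ?L r else 0)"
    unfolding sum_fun_apply[where 'a = mon] by (rule sum.cong) (auto simp: single_def)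
  also have "\<dots> = ?L p" using p(1) by (subst sum.delta'[OF finite_mons]) auto
  finally show ?thesis .
qed

end

subsection \<open>The action of the modular group\<close>

definition jf :: "rmat \<Rightarrow> complex \<Rightarrow> complex" where
  "jf g \<tau> = (case g of (\<alpha>, \<beta>, \<gamma>, \<delta>) \<Rightarrow> of_real \<gamma> * \<tau> + of_real \<delta>)"

definition sl2 :: "rmat \<Rightarrow> bool" where
  "sl2 g \<longleftrightarrow> (case g of (\<alpha>, \<beta>, \<gamma>, \<delta>) \<Rightarrow> \<alpha> * \<delta> - \<beta> * \<gamma> = 1)"

definition hg :: "rmat \<Rightarrow> complex \<Rightarrow> complex" where "hg g \<tau> = (jf g \<tau>)\<^sup>2"

text \<open>A primitive of the constant 2 \<gamma>^2 prescribed for the image of a_{-1}, in the form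
  asked for by \<open>coordinate_change\<close>.\<close>

definition qg :: "rmat \<Rightarrow> complex \<Rightarrow> complex" where
  "qg g \<tau> = (case g of (\<alpha>, \<beta>, \<gamma>, \<delta>) \<Rightarrow> 2 * (of_real \<gamma>)\<^sup>2 * \<tau>)"

lemma jf_nz: assumes "sl2 g" "\<tau> \<in> Hp" shows "jf g \<tau> \<noteq> 0"
proof
  obtain \<alpha> \<beta> \<gamma> \<delta> where g: "g = (\<alpha>, \<beta>, \<gamma>, \<delta>)" by (cases g)
  assume "jf g \<tau> = 0"
  hence e: "of_real \<gamma> * \<tau> + of_real \<delta> = 0" by (simp add: g jf_def)
  hence "Im (of_real \<gamma> * \<tau> + of_real \<delta>) = 0" by simp
  hence "\<gamma> = 0" using assms(2) by (simp add: Hp_iff)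
  moreover from this e have "\<delta> = 0" by simp
  ultimately show False using assms(1) by (simp add: sl2_def g)
qed

lemma hol_jf: "hol (jf g)"
  unfolding jf_def[abs_def] by (cases g) (auto intro!: holomorphic_intros)

lemma DERIV_jf: "(jf (\<alpha>, \<beta>, \<gamma>, \<delta>) has_field_derivative of_real \<gamma>) (at \<tau>)"
  unfolding jf_def[abs_def] by (auto intro!: derivative_eq_intros)

lemma DERIV_mob:
  assumes "sl2 g" "\<tau> \<in> Hp" shows "(mob g has_field_derivative 1 / (jf g \<tau>)\<^sup>2) (at \<tau>)"
proof -
  obtain \<alpha> \<beta> \<gamma> \<delta> where g: "g = (\<alpha>, \<beta>, \<gamma>, \<delta>)" by (cases g)
  have nz: "of_real \<gamma> * \<tau> + of_real \<delta> \<noteq> 0" using jf_nz[OF assms] by (simp add: g jf_def)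
  have "of_real (\<alpha> * \<delta> - \<beta> * \<gamma>) = (1::complex)" using assms(1) by (simp add: sl2_def g)
  hence "of_real \<alpha> * of_real \<delta> - of_real \<beta> * of_real \<gamma> = (1::complex)" by simp
  hence "of_real \<alpha> * (of_real \<gamma> * \<tau> + of_real \<delta>) - (of_real \<alpha> * \<tau> + of_real \<beta>) * of_real \<gamma> = 1"
    by (simp add: algebra_simps)
  thus ?thesis unfolding mob_def[abs_def] g jf_def prod.case
    using nz by (auto intro!: derivative_eq_intros simp: power2_eq_square)
qed

lemma deriv_mob: "sl2 g \<Longrightarrow> \<tau> \<in> Hp \<Longrightarrow> deriv (mob g) \<tau> = 1 / hg g \<tau>"
  using DERIV_imp_deriv[OF DERIV_mob] by (simp add: hg_def)

lemma hol_mob: "sl2 g \<Longrightarrow> hol (mob g)"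
  using DERIV_mob by (meson holomorphic_onI field_differentiable_at_within field_differentiable_def)

lemma Im_mob: assumes "sl2 g" "\<tau> \<in> Hp" shows "Im (mob g \<tau>) = Im \<tau> / (norm (jf g \<tau>))\<^sup>2"
proof -
  obtain \<alpha> \<beta> \<gamma> \<delta> where g: "g = (\<alpha>, \<beta>, \<gamma>, \<delta>)" by (cases g)
  have d: "\<alpha> * \<delta> - \<beta> * \<gamma> = 1" using assms(1) by (simp add: sl2_def g)
  have "Im (mob g \<tau>) = (\<alpha> * Im \<tau> * (\<gamma> * Re \<tau> + \<delta>) - (\<alpha> * Re \<tau> + \<beta>) * (\<gamma> * Im \<tau>)) / (norm (jf g \<tau>))\<^sup>2"
    by (simp add: g mob_def jf_def Im_divide cmod_power2)
  also have "\<alpha> * Im \<tau> * (\<gamma> * Re \<tau> + \<delta>) - (\<alpha> * Re \<tau> + \<beta>) * (\<gamma> * Im \<tau>) = (\<alpha> * \<delta> - \<beta> * \<gamma>) * Im \<tau>"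
    by (simp add: algebra_simps)
  finally show ?thesis by (simp add: d)
qed

lemma mob_Hp: "sl2 g \<Longrightarrow> \<tau> \<in> Hp \<Longrightarrow> mob g \<tau> \<in> Hp"
  using Im_mob[of g \<tau>] jf_nz[of g \<tau>] by (simp add: Hp_iff)

lemma hol_hg: "hol (hg g)" unfolding hg_def[abs_def] by (intro holomorphic_intros hol_jf)

lemma deriv_hg: "deriv (hg (\<alpha>, \<beta>, \<gamma>, \<delta>)) \<tau> = 2 * of_real \<gamma> * jf (\<alpha>, \<beta>, \<gamma>, \<delta>) \<tau>"
  unfolding hg_def[abs_def]
  by (rule DERIV_imp_deriv) (auto intro!: derivative_eq_intros DERIV_jf)

lemma deriv_qg: "deriv (qg (\<alpha>, \<beta>, \<gamma>, \<delta>)) = (\<lambda>\<tau>. 2 * (of_real \<gamma>)\<^sup>2)"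
  unfolding qg_def[abs_def] prod.case
  by (rule ext, rule DERIV_imp_deriv) (auto intro!: derivative_eq_intros)

lemma coordinate_change_mob: assumes "sl2 g" shows "coordinate_change (hg g) (qg g) (mob g)"
proof
  obtain \<alpha> \<beta> \<gamma> \<delta> where g: "g = (\<alpha>, \<beta>, \<gamma>, \<delta>)" by (cases g)
  show "hol (hg g)" by (rule hol_hg)
  show "hol (qg g)" unfolding qg_def[abs_def] g prod.case by (intro holomorphic_intros)
  show "hol (mob g)" by (rule hol_mob[OF assms])
  fix \<tau> assume t: "\<tau> \<in> Hp"
  show "mob g \<tau> \<in> Hp" by (rule mob_Hp[OF assms t])
  show "hg g \<tau> * deriv (mob g) \<tau> = 1"
    using jf_nz[OF assms t] by (simp add: deriv_mob[OF assms t] hg_def)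
  show "2 * (hg g \<tau> * deriv (qg g) \<tau>) = deriv (hg g) \<tau> * deriv (hg g) \<tau>"
    by (simp add: g deriv_qg deriv_hg hg_def power2_eq_square)
qed

definition PIg :: "rmat \<Rightarrow> dch \<Rightarrow> dch" where "PIg g = coordinate_change.PI (hg g) (qg g) (mob g)"

lemma Amode_eq: "Amode g m v = ah (hg g) m v + be (deriv (qg g)) m v"
  by (cases g) (simp add: Amode_def mode_a_eq mode_b_eq dadd_eq deriv_qg hg_def[abs_def] jf_def)

text \<open>The modes of b_{-1} are those of the derivative b'(z), and differentiation multiplies
  the coefficient of z^n by n; the scalar 1/n in the action undoes this.\<close>

lemma Bmode_eq: assumes "sl2 g" "v \<in> D w" "n > 0"
  shows "dscale (1 / of_nat n) (Bmode g (- int n) v) = hb (mob g) (- int n) v"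
proof -
  have "Bmode g (- int n) v = be (\<lambda>\<tau>. 1 / hg g \<tau>) (- int n) v"
    by (cases g) (simp add: Bmode_def mode_b_eq hg_def[abs_def] jf_def)
  also have "\<dots> = be (deriv (mob g)) (- int n) v"
    by (rule be_cong[OF _ assms(2)]) (simp add: deriv_mob[OF assms(1)])
  also have "\<dots> = of_int (- (- int n)) * hb (mob g) (- int n) v"
    by (rule be_deriv[OF assms(2) hol_mob[OF assms(1)]])
  finally show ?thesis using assms(3) by (simp add: dscale_def fun_eq_iff pointwise)
qed

lemma ah_arg_0: "ah h m 0 = 0" by (simp add: ah_def cong: if_cong)
lemma be_arg_0: "be h m 0 = 0" by (simp add: be_def)

lemma mono_image_0: "mono_image g p 0 = 0"
proof -
  have "foldr (\<lambda>n w. dscale (1 / of_nat n) (Bmode g (- int n) w)) xs 0 = (0 :: dch)" for xs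
  proof (induction xs)
    case (Cons n xs)
    have "Bmode g (- int n) 0 = 0" by (cases g) (simp add: Bmode_def mode_b_eq be_arg_0)
    moreover have "dscale c 0 = 0" for c by (simp add: dscale_def fun_eq_iff pointwise)
    ultimately show ?case using Cons by simp
  qed simp
  moreover have "foldr (\<lambda>n w. Amode g (- int n) w) xs 0 = (0 :: dch)" for xs
    by (induction xs) (auto simp: Amode_eq ah_arg_0 be_arg_0)
  moreover have "const_elem (rH (\<lambda>\<tau>. (0::complex \<Rightarrow> complex) (mob g \<tau>))) = 0"
    by (auto simp: const_elem_def rH_def fun_eq_iff pointwise)
  ultimately show ?thesis unfolding mono_image_def by simp
qed

lemma mono_image_eq: assumes "sl2 g" "hol f" "p \<in> mons w"
  shows "mono_image g p f = coordinate_change.mi (hg g) (qg g) (mob g) p f"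
proof -
  interpret coordinate_change "hg g" "qg g" "mob g" by (rule coordinate_change_mob[OF assms(1)])
  have "foldr (\<lambda>n w. dscale (1 / of_nat n) (Bmode g (- int n) w)) ys v = foldr (\<lambda>n. hb (mob g) (- int n)) ys v"
    if "v \<in> D w'" "\<forall>y\<in>set ys. y > 0" for v w' ys
    using that(2)
  proof (induction ys)
    case (Cons y ys)
    thus ?case using Bmode_eq[OF assms(1) foldr_hb_D[OF that(1)], of y ys] by simp
  qed simp
  moreover have "\<forall>y\<in>set (sorted_list_of_multiset (snd p)). y > 0"
    using assms(3) by (auto simp: mons_def intro!: gr0I)
  ultimately show ?thesis
    unfolding mono_image_def mi_def Bs_def const_elem_eq Amode_eq Am_def
    using cst_D[OF hol_comp[OF assms(2)]] by (simp add: Am_def[abs_def])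
qed

lemma pi_act_eq: assumes "sl2 g" "v \<in> D w" shows "pi_act g v = PIg g v"
proof -
  interpret coordinate_change "hg g" "qg g" "mob g" by (rule coordinate_change_mob[OF assms(1)])
  have hv: "hol (v p)" for p using D_coeff[OF assms(2)] by (auto simp: Of_def)
  have "pi_act g v = (\<Sum>p\<in>{p. mono_image g p (v p) \<noteq> 0}. mono_image g p (v p))"
    by (simp add: pi_act_def dfsum_def dzero_eq fun_eq_iff[where 'a = mon] sum_fun_apply)
       (simp add: fun_eq_iff sum_fun_apply)
  also have "\<dots> = (\<Sum>p\<in>mons w. mono_image g p (v p))"
  proof (rule sum.mono_neutral_left[OF finite_mons])
    show "{p. mono_image g p (v p) \<noteq> 0} \<subseteq> mons w"
    proof
      fix p assume "p \<in> {p. mono_image g p (v p) \<noteq> 0}"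
      hence nz: "mono_image g p (v p) \<noteq> 0" by blast
      have "v p \<noteq> 0"
      proof
        assume "v p = 0"
        hence "mono_image g p (v p) = 0" by (simp only: mono_image_0)
        with nz show False by blast
      qed
      thus "p \<in> mons w" by (rule D_supp[OF assms(2)])
    qed
  qed blast
  also have "\<dots> = (\<Sum>p\<in>mons w. mi p (v p))"
    by (rule sum.cong[OF refl]) (rule mono_image_eq[OF assms(1) hv])
  finally show ?thesis by (simp add: PIg_def PI_eq[OF assms(2)])
qed

text \<open>Each a gives the square of the automorphy factor and each b its inverse square, whence
  weight twice the degree.\<close>

lemma PIg_lead:
  assumes g: "sl2 g" and v: "v \<in> FD w d" and p: "p \<in> mons w" "mdeg p = d" and t: "\<tau> \<in> Hp"
  shows "PIg g v p \<tau> = v p (mob g \<tau>) * jf g \<tau> powi (- 2 * d)"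
proof -
  interpret coordinate_change "hg g" "qg g" "mob g" by (rule coordinate_change_mob[OF g])
  have nz: "jf g \<tau> \<noteq> 0" by (rule jf_nz[OF g t])
  have pw: "hg g \<tau> ^ n = jf g \<tau> powi (2 * int n)" for n
    unfolding hg_def power_mult[symmetric] by (metis of_nat_mult of_nat_numeral power_int_of_nat)
  have "PIg g v p \<tau> = hg g \<tau> ^ size (fst p) * ((1 / hg g \<tau>) ^ size (snd p) * v p (mob g \<tau>))"
    using PI_lead[OF v p] t by (simp add: PIg_def rH_def Hp_iff deriv_mob[OF g t])
  also have "hg g \<tau> ^ size (fst p) = jf g \<tau> powi (2 * int (size (fst p)))" by (rule pw)
  also have "(1 / hg g \<tau>) ^ size (snd p) = jf g \<tau> powi (- 2 * int (size (snd p)))"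
    unfolding mult_minus_left power_int_minus pw[symmetric]
    by (simp only: power_one_over inverse_eq_divide)
  also have "jf g \<tau> powi (2 * int (size (fst p))) * (jf g \<tau> powi (- 2 * int (size (snd p))) * v p (mob g \<tau>)) =
     v p (mob g \<tau>) * (jf g \<tau> powi (2 * int (size (fst p)) + - 2 * int (size (snd p))))"
    unfolding power_int_add[OF disjI1[OF nz]] by (simp only: mult_ac)
  also have "2 * int (size (fst p)) + - 2 * int (size (snd p)) = - 2 * d"
    using p(2) by (simp add: mdeg_def)
  finally show ?thesis .
qed

subsection \<open>Fourier expansions\<close>

definition qe :: "nat \<Rightarrow> complex \<Rightarrow> complex" where
  "qe N \<tau> = exp (2 * of_real pi * \<i> * \<tau> / of_nat N)"

text \<open>An expansion without negative exponents, repackaged as a holomorphic function of exp(2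
  pi i \<tau> / N) on the open unit disc. Sums, products and derivatives are immediate in this form,
  and the value at the cusp is included as the centre of the disc.\<close>

definition RN :: "nat \<Rightarrow> (complex \<Rightarrow> complex) \<Rightarrow> bool" where
  "RN N f \<longleftrightarrow> (\<exists>P. P holomorphic_on ball 0 1 \<and> (\<forall>\<tau>\<in>Hp. f \<tau> = P (qe N \<tau>)))"

lemma norm_qe: "norm (qe N \<tau>) = exp (- 2 * pi * Im \<tau> / real N)"
proof -
  have e: "2 * of_real pi * \<i> * \<tau> / of_nat N = of_real (2 * pi / real N) * (\<i> * \<tau>)" by simp
  have "norm (qe N \<tau>) = exp (Re (of_real (2 * pi / real N) * (\<i> * \<tau>)))"
    unfolding qe_def e by (rule norm_exp_eq_Re)
  thus ?thesis by simp
qed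

lemma qe_ball: "N > 0 \<Longrightarrow> \<tau> \<in> Hp \<Longrightarrow> qe N \<tau> \<in> ball 0 1"
  by (simp add: norm_qe Hp_iff)

lemma qe_surj: assumes "N > 0" "z \<noteq> 0" "norm z < 1" obtains \<tau> where "\<tau> \<in> Hp" "qe N \<tau> = z"
proof
  define \<tau> where "\<tau> = of_nat N * Ln z / (2 * of_real pi * \<i>)"
  have "2 * of_real pi * \<i> * \<tau> / of_nat N = Ln z" using assms(1) by (simp add: \<tau>_def)
  thus q: "qe N \<tau> = z" using assms(2) by (simp add: qe_def)
  have "exp (- 2 * pi * Im \<tau> / real N) < 1" using norm_qe[of N \<tau>] q assms(3) by simp
  thus "\<tau> \<in> Hp" using assms(1) by (simp add: Hp_iff field_simps zero_less_mult_iff)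
qed

lemma DERIV_qe: "(qe N has_field_derivative (2 * of_real pi * \<i> / of_nat N) * qe N \<tau>) (at \<tau>)"
  unfolding qe_def[abs_def] by (cases "N = 0") (auto intro!: derivative_eq_intros)

lemma hol_qe: "hol (qe N)" unfolding qe_def[abs_def] by (cases "N = 0") (auto intro!: holomorphic_intros)

lemma RN_cong: "(\<And>\<tau>. \<tau> \<in> Hp \<Longrightarrow> f \<tau> = g \<tau>) \<Longrightarrow> RN N f \<Longrightarrow> RN N g"
  unfolding RN_def by (elim exE, intro exI) auto

lemma RN_hol: assumes "RN N f" "N > 0" shows "hol f"
proof -
  from assms obtain P where P: "P holomorphic_on ball 0 1" "\<And>\<tau>. \<tau> \<in> Hp \<Longrightarrow> f \<tau> = P (qe N \<tau>)"
    by (auto simp: RN_def)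
  have "(P \<circ> qe N) holomorphic_on Hp"
    by (rule holomorphic_on_compose_gen[OF hol_qe P(1)]) (use qe_ball[OF assms(2)] in auto)
  thus ?thesis by (rule holomorphic_transform) (simp add: P(2))
qed

lemma RN_const: "RN N (\<lambda>_. c)"
  unfolding RN_def by (rule exI[of _ "\<lambda>_. c"]) auto

lemma RN_add: "RN N f \<Longrightarrow> RN N g \<Longrightarrow> RN N (\<lambda>\<tau>. f \<tau> + g \<tau>)"
  unfolding RN_def by (elim exE, rule_tac x = "\<lambda>z. P z + Pa z" in exI) (auto intro: holomorphic_intros)

lemma RN_mult: "RN N f \<Longrightarrow> RN N g \<Longrightarrow> RN N (\<lambda>\<tau>. f \<tau> * g \<tau>)"
  unfolding RN_def by (elim exE, rule_tac x = "\<lambda>z. P z * Pa z" in exI) (auto intro: holomorphic_intros)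

lemma RN_deriv: assumes "RN N f" "N > 0" shows "RN N (deriv f)"
proof -
  from assms obtain P where P: "P holomorphic_on ball 0 1" "\<And>\<tau>. \<tau> \<in> Hp \<Longrightarrow> f \<tau> = P (qe N \<tau>)"
    by (auto simp: RN_def)
  have "deriv f \<tau> = deriv P (qe N \<tau>) * ((2 * of_real pi * \<i> / of_nat N) * qe N \<tau>)" if t: "\<tau> \<in> Hp" for \<tau>
  proof -
    have "(P has_field_derivative deriv P (qe N \<tau>)) (at (qe N \<tau>))"
      using holomorphic_derivI[OF P(1) open_ball qe_ball[OF assms(2) t]] .
    from DERIV_chain2[OF this DERIV_qe]
    have "((\<lambda>\<tau>. P (qe N \<tau>)) has_field_derivative deriv P (qe N \<tau>) * ((2 * of_real pi * \<i> / of_nat N) * qe N \<tau>)) (at \<tau>)" .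
    hence "(f has_field_derivative deriv P (qe N \<tau>) * ((2 * of_real pi * \<i> / of_nat N) * qe N \<tau>)) (at \<tau>)"
      by (rule has_field_derivative_transform_within_open[OF _ open_Hp t]) (simp add: P(2))
    thus ?thesis by (rule DERIV_imp_deriv)
  qed
  thus ?thesis unfolding RN_def
    by (intro exI[of _ "\<lambda>z. deriv P z * ((2 * of_real pi * \<i> / of_nat N) * z)"])
       (auto intro!: holomorphic_intros holomorphic_deriv P(1))
qed

lemma qe_power: "M > 0 \<Longrightarrow> qe (N * M) \<tau> ^ M = qe N \<tau>"
  unfolding qe_def exp_of_nat_mult[symmetric] by simp

text \<open>The substitution z to z^M turns the parameter of period N M into that of period N; it
  brings two expansions to a common period.\<close>

lemma RN_scale: assumes "RN N f" "M > 0" shows "RN (N * M) f"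
proof -
  from assms obtain P where P: "P holomorphic_on ball 0 1" "\<And>\<tau>. \<tau> \<in> Hp \<Longrightarrow> f \<tau> = P (qe N \<tau>)"
    by (auto simp: RN_def)
  have "(P \<circ> (\<lambda>z. z ^ M)) holomorphic_on ball 0 1"
  proof (rule holomorphic_on_compose_gen[OF _ P(1)])
    show "(\<lambda>z. z ^ M) ` ball 0 1 \<subseteq> ball (0::complex) 1"
      using assms(2) by (auto simp: norm_power power_less_one_iff)
  qed (intro holomorphic_intros)
  moreover have "f \<tau> = (P \<circ> (\<lambda>z. z ^ M)) (qe (N * M) \<tau>)" if "\<tau> \<in> Hp" for \<tau>
    using qe_power[OF assms(2), of N \<tau>] P(2)[OF that] by simp
  ultimately show ?thesis unfolding RN_def by blast
qed

lemma RN_scale': "RN N f \<Longrightarrow> M > 0 \<Longrightarrow> RN (M * N) f"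
  using RN_scale[of N f M] by (simp add: mult.commute)

lemma qe_shift: assumes "N > 0" shows "qe N (\<tau> + of_nat N) = qe N \<tau>"
proof -
  have "2 * of_real pi * \<i> * (\<tau> + of_nat N) / of_nat N = 2 * of_real pi * \<i> * \<tau> / of_nat N + 2 * of_real pi * \<i>"
    using assms by (simp add: field_simps)
  thus ?thesis by (simp add: qe_def exp_add)
qed

lemma RN_periodic: assumes "RN N f" "N > 0" "\<tau> \<in> Hp" shows "f (\<tau> + of_nat N) = f \<tau>"
proof -
  have "\<tau> + of_nat N \<in> Hp" using assms(3) by (simp add: Hp_iff)
  thus ?thesis using assms qe_shift[OF assms(2)] by (auto simp: RN_def)
qed

lemma qe_nat: "exp (2 * of_real pi * \<i> * of_int (int n) * \<tau> / of_nat N) = qe N \<tau> ^ n"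
  unfolding qe_def exp_of_nat_mult[symmetric] by (simp add: algebra_simps)

lemma hol_expansion_iff: assumes "N > 0" shows "hol_expansion N f \<longleftrightarrow> RN N f"
proof
  assume "hol_expansion N f"
  then obtain u where u: "\<And>m. m < 0 \<Longrightarrow> u m = 0"
    "\<And>\<tau>. \<tau> \<in> Hp \<Longrightarrow> ((\<lambda>m::int. u m * exp (2 * of_real pi * \<i> * of_int m * \<tau> / of_nat N)) has_sum f \<tau>) UNIV"
    unfolding hol_expansion_def Hp_iff by blast
  have s: "(\<lambda>n. u (int n) * qe N \<tau> ^ n) sums f \<tau>" if t: "\<tau> \<in> Hp" for \<tau>
  proof -
    let ?g = "\<lambda>m::int. u m * exp (2 * of_real pi * \<i> * of_int m * \<tau> / of_nat N)"
    have "(?g has_sum f \<tau>) {0..}"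
      using u(2)[OF t] by (rule iffD1[OF has_sum_cong_neutral, rotated -1]) (auto simp: u(1))
    hence "((\<lambda>n. ?g (int n)) has_sum f \<tau>) UNIV"
      by (subst has_sum_reindex_bij_betw[of int UNIV "{0..}"])
         (auto simp: bij_betw_def image_def intro!: inj_onI, metis nonneg_int_cases)
    hence "(\<lambda>n. ?g (int n)) sums f \<tau>" by (rule has_sum_imp_sums)
    thus ?thesis by (simp only: qe_nat)
  qed
  define P where "P z = (\<Sum>n. u (int n) * z ^ n)" for z
  have "P holomorphic_on ball 0 1"
  proof (rule power_series_holomorphic[where a = "\<lambda>n. u (int n)"])
    fix w :: complex assume w: "w \<in> ball 0 1"
    have "summable (\<lambda>n. u (int n) * w ^ n)"
    proof (cases "w = 0")
      case False
      with w obtain \<tau> where "\<tau> \<in> Hp" "qe N \<tau> = w" using qe_surj[OF assms, of w] by auto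
      thus ?thesis using s sums_summable by blast
    qed simp
    thus "(\<lambda>n. u (int n) * (w - 0) ^ n) sums P w" by (simp add: P_def summable_sums)
  qed
  moreover have "f \<tau> = P (qe N \<tau>)" if "\<tau> \<in> Hp" for \<tau> using s[OF that] by (simp add: P_def sums_iff)
  ultimately show "RN N f" unfolding RN_def by blast
next
  assume "RN N f"
  then obtain P where P: "P holomorphic_on ball 0 1" "\<And>\<tau>. \<tau> \<in> Hp \<Longrightarrow> f \<tau> = P (qe N \<tau>)"
    by (auto simp: RN_def)
  define c where "c n = (deriv ^^ n) P 0 / fact n" for n
  have ps: "(\<lambda>n. c n * z ^ n) sums P z" if "norm z < 1" for z
    using holomorphic_power_series[OF P(1), of z] that by (simp add: c_def)
  define u where "u m = (if m < 0 then 0 else c (nat m))" for m :: int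
  have "((\<lambda>m. u m * exp (2 * of_real pi * \<i> * of_int m * \<tau> / of_nat N)) has_sum f \<tau>) UNIV" if t: "\<tau> \<in> Hp" for \<tau>
  proof -
    let ?g = "\<lambda>m::int. u m * exp (2 * of_real pi * \<i> * of_int m * \<tau> / of_nat N)"
    have q: "norm (qe N \<tau>) < 1" using qe_ball[OF assms t] by simp
    \<comment> \<open>Unordered summation needs absolute convergence, which follows from convergence
      at a slightly larger radius.\<close>
    obtain r where r: "norm (qe N \<tau>) < r" "r < 1" using dense[OF q] by blast
    have "r > 0" using r(1) norm_ge_zero[of "qe N \<tau>"] by linarith
    hence "summable (\<lambda>n. c n * (of_real r) ^ n)" using ps[of "of_real r"] r(2) by (auto simp: sums_iff)
    hence "summable (\<lambda>n. norm (c n * qe N \<tau> ^ n))"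
      by (rule powser_insidea) (use r \<open>r > 0\<close> in simp)
    hence "((\<lambda>n. c n * qe N \<tau> ^ n) has_sum f \<tau>) UNIV"
      using norm_summable_imp_has_sum ps[OF q] P(2)[OF t] by metis
    hence "((\<lambda>n. ?g (int n)) has_sum f \<tau>) UNIV" by (simp only: qe_nat) (simp add: u_def)
    hence "(?g has_sum f \<tau>) {0..}"
      by (subst (asm) has_sum_reindex_bij_betw[of int UNIV "{0..}"])
         (auto simp: bij_betw_def image_def intro!: inj_onI, metis nonneg_int_cases)
    thus ?thesis by (rule iffD1[OF has_sum_cong_neutral, rotated -1]) (auto simp: u_def)
  qed
  moreover have "\<forall>m<0. u m = 0" by (simp add: u_def)
  ultimately show "hol_expansion N f" unfolding hol_expansion_def Hp_iff by blast
qed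

subsection \<open>The quasimodular Eisenstein series of weight two\<close>

text \<open>The value of the sum of 1 / (z + n)^2 over all integers n, that is, of one row of the
  weight two Eisenstein series.\<close>

definition Sz :: "complex \<Rightarrow> complex" where "Sz z = (of_real pi)\<^sup>2 / (sin (of_real pi * z))\<^sup>2"

lemma sin_pi_nz: "z \<notin> \<int> \<Longrightarrow> sin (of_real pi * z) \<noteq> (0::complex)"
proof
  assume z: "z \<notin> \<int>" and "sin (of_real pi * z) = 0"
  then obtain n :: int where "of_real pi * z = of_real (real_of_int n * pi)" by (auto simp: Complex_Transcendental.sin_eq_0)
  hence "z = of_int n" by simp
  thus False using z by simp
qed

lemma not_nonpos_Int: "z \<notin> \<int> \<Longrightarrow> z \<notin> \<int>\<^sub>\<le>\<^sub>0" "z \<notin> \<int> \<Longrightarrow> 1 - z \<notin> \<int>\<^sub>\<le>\<^sub>0" for z :: complex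
  by (auto dest!: nonpos_Ints_Int)

lemma notin_Ints_add_nz: assumes "z \<notin> \<int>" shows "z + of_int k \<noteq> (0::complex)"
proof
  assume "z + of_int k = 0"
  hence "z = of_int (- k)" by (simp add: eq_neg_iff_add_eq_0)
  thus False using assms Ints_of_int by blast
qed

text \<open>The logarithmic derivative of rGamma(z) rGamma(1 - z) = sin(pi z) / pi. Differentiating
  once more yields the reflection formula for the trigamma function.\<close>

lemma Digamma_reflection:
  fixes z :: complex assumes "z \<notin> \<int>"
  shows "Digamma (1 - z) - Digamma z = of_real pi * cot (of_real pi * z)"
proof -
  have "((\<lambda>z. rGamma z * rGamma (1 - z)) has_field_derivative
      rGamma z * rGamma (1 - z) * (Digamma (1 - z) - Digamma z)) (at z)"
    using not_nonpos_Int[OF assms] by (auto intro!: derivative_eq_intros simp: algebra_simps)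
  moreover have "((\<lambda>z. rGamma z * rGamma (1 - z)) has_field_derivative cos (of_real pi * z)) (at z)"
    unfolding rGamma_reflection_complex by (auto intro!: derivative_eq_intros)
  ultimately have "rGamma z * rGamma (1 - z) * (Digamma (1 - z) - Digamma z) = cos (of_real pi * z)"
    by (rule DERIV_unique)
  thus ?thesis unfolding rGamma_reflection_complex using sin_pi_nz[OF assms]
    by (simp add: cot_def field_simps)
qed

lemma open_compl_Ints: "open (- \<int> :: complex set)"
  using closed_Ints by (simp add: open_Compl)

lemma Polygamma_1_reflection:
  fixes z :: complex assumes "z \<notin> \<int>"
  shows "Polygamma 1 z + Polygamma 1 (1 - z) = Sz z"
proof -
  have s: "sin (of_real pi * z) \<noteq> 0" by (rule sin_pi_nz[OF assms])
  have "((\<lambda>z. Digamma (1 - z) - Digamma z) has_field_derivative - Polygamma 1 (1 - z) - Polygamma 1 z) (at z)"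
    using not_nonpos_Int[OF assms] by (auto intro!: derivative_eq_intros)
  hence "((\<lambda>z. of_real pi * cot (of_real pi * z)) has_field_derivative - Polygamma 1 (1 - z) - Polygamma 1 z) (at z)"
    by (rule has_field_derivative_transform_within_open[OF _ open_compl_Ints]) (use assms Digamma_reflection in auto)
  moreover have "((\<lambda>z. of_real pi * cot (of_real pi * z)) has_field_derivative - Sz z) (at z)"
  proof -
    have e: "cos w * cos w + sin w * sin w = (1::complex)" for w using sin_cos_squared_add2[of w] by (simp add: power2_eq_square add.commute)
    have f: "- s * p * s - c * (c * p) = - p * (c * c + s * s)" for s p c :: complex by (simp add: algebra_simps)
    have "((\<lambda>z. of_real pi * (cos (of_real pi * z) / sin (of_real pi * z))) has_field_derivative
       of_real pi * ((- sin (of_real pi * z) * of_real pi * sin (of_real pi * z) - cos (of_real pi * z) * (cos (of_real pi * z) * of_real pi)) / (sin (of_real pi * z) * sin (of_real pi * z)))) (at z)"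
      using s by (auto intro!: derivative_eq_intros simp: algebra_simps)
    also have "- sin (of_real pi * z) * of_real pi * sin (of_real pi * z) - cos (of_real pi * z) * (cos (of_real pi * z) * of_real pi) = - of_real pi * (cos (of_real pi * z) * cos (of_real pi * z) + sin (of_real pi * z) * sin (of_real pi * z))"
      by (rule f)
    finally show ?thesis by (simp add: cot_def[abs_def] e Sz_def power2_eq_square)
  qed
  ultimately have "- Polygamma 1 (1 - z) - Polygamma 1 z = - Sz z" by (rule DERIV_unique)
  thus ?thesis by (simp add: algebra_simps)
qed

lemma sum_sym_int:
  fixes f :: "int \<Rightarrow> 'a::comm_monoid_add"
  shows "(\<Sum>n\<in>{-int M..int M} - {0}. f n) = (\<Sum>k<M. f (int (Suc k)) + f (- int (Suc k)))"
proof (induction M)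
  case (Suc M)
  have "{-int (Suc M)..int (Suc M)} - {0} = insert (int (Suc M)) (insert (- int (Suc M)) ({-int M..int M} - {0}))"
    by auto
  hence "(\<Sum>n\<in>{-int (Suc M)..int (Suc M)} - {0}. f n) = f (int (Suc M)) + (f (- int (Suc M)) + (\<Sum>n\<in>{-int M..int M} - {0}. f n))"
    by simp
  thus ?case using Suc by (simp add: ac_simps)
qed simp

lemma sum_sym_int0:
  fixes f :: "int \<Rightarrow> 'a::comm_monoid_add"
  shows "(\<Sum>n\<in>{-int M..int M}. f n) = f 0 + (\<Sum>k<M. f (int (Suc k)) + f (- int (Suc k)))"
  unfolding sum_sym_int[symmetric] by (rule sum.remove) auto

text \<open>The trigamma series at z and at 1 - z together run over all integer translates of z; the
  term for translate 0 is split off.\<close>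

lemma Sz_LIMSEQ:
  assumes "z \<notin> \<int>"
  shows "(\<lambda>M. \<Sum>k<M. 1 / (z + of_int (int (Suc k)))\<^sup>2 + 1 / (z + of_int (- int (Suc k)))\<^sup>2) \<longlonglongrightarrow> Sz z - 1 / z\<^sup>2"
proof -
  have z0: "z \<noteq> 0" "1 - z \<noteq> 0" using assms by auto
  have 1: "(\<lambda>k. inverse ((z + of_nat k)\<^sup>2)) sums Polygamma 1 z"
    using Polygamma_LIMSEQ[OF z0(1), of 1] by (simp add: numeral_2_eq_2)
  have "(\<lambda>k. inverse ((z + of_nat (Suc k))\<^sup>2)) sums (Polygamma 1 z - inverse (z\<^sup>2))"
    using sums_Suc_iff[of "\<lambda>k. inverse ((z + of_nat k)\<^sup>2)"] 1 by simp
  moreover have "(\<lambda>k. inverse ((1 - z + of_nat k)\<^sup>2)) sums Polygamma 1 (1 - z)"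
    using Polygamma_LIMSEQ[OF z0(2), of 1] by (simp add: numeral_2_eq_2)
  ultimately have "(\<lambda>k. inverse ((z + of_nat (Suc k))\<^sup>2) + inverse ((1 - z + of_nat k)\<^sup>2)) sums
     (Polygamma 1 z - inverse (z\<^sup>2) + Polygamma 1 (1 - z))" by (rule sums_add)
  moreover have "(1 - z + of_nat k)\<^sup>2 = (z + of_int (- int (Suc k)))\<^sup>2" for k
    by (simp add: power2_eq_square algebra_simps)
  ultimately show ?thesis
    using Polygamma_1_reflection[OF assms] by (simp add: sums_def inverse_eq_divide algebra_simps)
qed

lemma tendsto_inverse_of_nat_shift: "(\<lambda>k. 1 / (z + of_nat k)) \<longlonglongrightarrow> (0::complex)"
proof -
  have "filterlim (\<lambda>k. z + of_nat k) at_infinity sequentially"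
    by (rule tendsto_add_filterlim_at_infinity[OF tendsto_const tendsto_of_nat])
  thus ?thesis by (intro tendsto_divide_0[OF tendsto_const])
qed

text \<open>The partial fractions of the cotangent. The two digamma series pair z + k with z - (k +
  1), so their partial sums differ from symmetric ones by 1/z and a boundary term 1/(z + M) that
  tends to 0.\<close>

lemma cot_LIMSEQ:
  fixes z :: complex assumes "z \<notin> \<int>"
  shows "(\<lambda>M. \<Sum>k<M. 1 / (z + of_int (int (Suc k))) + 1 / (z + of_int (- int (Suc k))))
     \<longlonglongrightarrow> of_real pi * cot (of_real pi * z) - 1 / z"
proof -
  have z0: "z \<noteq> 0" "1 - z \<noteq> 0" using assms by auto
  have "(\<lambda>k. (inverse (of_nat (Suc k)) - inverse (1 - z + of_nat k)) - (inverse (of_nat (Suc k)) - inverse (z + of_nat k)))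
     sums ((Digamma (1 - z) + euler_mascheroni) - (Digamma z + euler_mascheroni))"
    using summable_Digamma[OF z0(2)] summable_Digamma[OF z0(1)]
    by (intro sums_diff) (simp_all add: Digamma_def summable_sums)
  hence 1: "(\<lambda>k. inverse (z + of_nat k) - inverse (1 - z + of_nat k)) sums (of_real pi * cot (of_real pi * z))"
    using Digamma_reflection[OF assms] by simp
  have "(\<Sum>k<M. inverse (z + of_nat k) - inverse (1 - z + of_nat k)) =
     1 / z - 1 / (z + of_nat M) + (\<Sum>k<M. 1 / (z + of_int (int (Suc k))) + 1 / (z + of_int (- int (Suc k))))" for M
  proof (induction M)
    case (Suc M)
    have "inverse (1 - z + of_nat M) = - 1 / (z - of_nat (Suc M))"
    proof -
      have "1 - z + of_nat M = - (z - of_nat (Suc M))" by simp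
      thus ?thesis by (simp only: inverse_eq_divide divide_minus_left divide_minus_right)
    qed
    thus ?case using Suc by (simp add: inverse_eq_divide algebra_simps)
  qed simp
  hence "(\<lambda>M. 1 / z - 1 / (z + of_nat M) + (\<Sum>k<M. 1 / (z + of_int (int (Suc k))) + 1 / (z + of_int (- int (Suc k)))))
     \<longlonglongrightarrow> of_real pi * cot (of_real pi * z)"
    using 1 by (simp add: sums_def)
  from tendsto_diff[OF this tendsto_diff[OF tendsto_const[of "1 / z"] tendsto_inverse_of_nat_shift[of z]]]
  show ?thesis by simp
qed

lemma cot_limit_neg:
  assumes "Im w < 0"
  shows "(\<lambda>M. cot (of_real pi * (of_nat M * w))) \<longlonglongrightarrow> \<i>"
proof -
  define e where "e = exp (- 2 * \<i> * of_real pi * w)"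
  have "Re (- 2 * \<i> * of_real pi * w) = 2 * pi * Im w" by simp
  hence ne: "norm e < 1" using assms by (simp add: e_def mult_pos_neg)
  have c: "cot (of_real pi * (of_nat M * w)) = \<i> * (1 + e ^ M) / (1 - e ^ M)" if "M > 0" for M
  proof -
    let ?a = "of_real pi * (of_nat M * w)"
    have eM: "e ^ M = exp (- (\<i> * ?a)) * exp (- (\<i> * ?a))"
      unfolding e_def exp_of_nat_mult[symmetric] exp_add[symmetric] by (simp add: algebra_simps)
    have E: "exp (\<i> * ?a) * exp (- (\<i> * ?a)) = 1" by (simp add: exp_minus)
    have x0: "exp (\<i> * ?a) \<noteq> 0" by simp
    have xy: "((x + y) / 2) / ((x - y) / (2 * \<i>)) = \<i> * (x + y) / (x - y)" for x y :: complex
      by (cases "x = y") (auto simp: field_simps)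
    have "cot ?a = ((exp (\<i> * ?a) + exp (- (\<i> * ?a))) / 2) / ((exp (\<i> * ?a) - exp (- (\<i> * ?a))) / (2 * \<i>))"
      by (simp add: cot_def sin_exp_eq cos_exp_eq)
    also have "\<dots> = \<i> * (exp (\<i> * ?a) + exp (- (\<i> * ?a))) / (exp (\<i> * ?a) - exp (- (\<i> * ?a)))"
      by (rule xy)
    also have "exp (\<i> * ?a) + exp (- (\<i> * ?a)) = exp (\<i> * ?a) * (1 + e ^ M)"
      unfolding eM using E by (simp add: algebra_simps)
    also have "exp (\<i> * ?a) - exp (- (\<i> * ?a)) = exp (\<i> * ?a) * (1 - e ^ M)"
      unfolding eM using E by (simp add: algebra_simps)
    finally show ?thesis using x0 by simp
  qed
  have "(\<lambda>M. e ^ M) \<longlonglongrightarrow> 0" using ne by (rule LIMSEQ_power_zero)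
  hence "(\<lambda>M. \<i> * (1 + e ^ M) / (1 - e ^ M)) \<longlonglongrightarrow> \<i> * (1 + 0) / (1 - 0)"
    by (intro tendsto_divide tendsto_mult tendsto_add tendsto_diff tendsto_const) auto
  hence "(\<lambda>M. \<i> * (1 + e ^ M) / (1 - e ^ M)) \<longlonglongrightarrow> \<i>" by simp
  thus ?thesis
    by (rule Lim_transform_eventually) (auto intro!: eventually_sequentiallyI[of 1] simp: c)
qed

lemma filterlim_sym_int: "filterlim (\<lambda>M. {-int M..int M}) (finite_subsets_at_top UNIV) sequentially"
  unfolding filterlim_finite_subsets_at_top
proof (intro allI impI)
  fix pmode :: "int set" assume pmode: "finite pmode \<and> pmode \<subseteq> UNIV"
  define B where "B = nat (Max (insert 0 (abs ` pmode)))"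
  have "pmode \<subseteq> {-int M..int M}" if "M \<ge> B" for M
  proof
    fix x assume "x \<in> pmode"
    hence "\<bar>x\<bar> \<le> Max (insert 0 (abs ` pmode))" using pmode by (intro Max_ge) auto
    thus "x \<in> {-int M..int M}" using that by (auto simp: B_def)
  qed
  thus "\<forall>\<^sub>F M in sequentially. finite {-int M..int M} \<and> pmode \<subseteq> {-int M..int M} \<and> {-int M..int M} \<subseteq> UNIV"
    by (auto intro!: eventually_sequentiallyI[of B])
qed

lemma filterlim_sym_int': "filterlim (\<lambda>M. {-int M..int M} - {0}) (finite_subsets_at_top (- {0})) sequentially"
  unfolding filterlim_finite_subsets_at_top
proof (intro allI impI)
  fix pmode :: "int set" assume pmode: "finite pmode \<and> pmode \<subseteq> - {0}"
  have "\<forall>\<^sub>F M in sequentially. pmode \<subseteq> {-int M..int M}"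
    using filterlim_sym_int pmode unfolding filterlim_finite_subsets_at_top by (auto elim!: allE[of _ pmode] eventually_mono)
  thus "\<forall>\<^sub>F M in sequentially. finite ({-int M..int M} - {0}) \<and> pmode \<subseteq> {-int M..int M} - {0} \<and> {-int M..int M} - {0} \<subseteq> - {0}"
    by eventually_elim (use pmode in auto)
qed

lemma has_sum_int_limit:
  fixes f :: "int \<Rightarrow> complex"
  shows "(f has_sum x) UNIV \<Longrightarrow> (\<lambda>M. f 0 + (\<Sum>k<M. f (int (Suc k)) + f (- int (Suc k)))) \<longlonglongrightarrow> x"
    and "(f has_sum x) (- {0}) \<Longrightarrow> (\<lambda>M. \<Sum>k<M. f (int (Suc k)) + f (- int (Suc k))) \<longlonglongrightarrow> x"
proof -
  assume "(f has_sum x) UNIV"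
  thus "(\<lambda>M. f 0 + (\<Sum>k<M. f (int (Suc k)) + f (- int (Suc k)))) \<longlonglongrightarrow> x"
    unfolding has_sum_def sum_sym_int0[symmetric] by (rule filterlim_compose[OF _ filterlim_sym_int])
next
  assume "(f has_sum x) (- {0})"
  thus "(\<lambda>M. \<Sum>k<M. f (int (Suc k)) + f (- int (Suc k))) \<longlonglongrightarrow> x"
    unfolding has_sum_def sum_sym_int[symmetric] by (rule filterlim_compose[OF _ filterlim_sym_int'])
qed

lemma has_sum_int_from_limit:
  fixes f :: "int \<Rightarrow> complex"
  shows "f summable_on UNIV \<Longrightarrow> (\<lambda>M. f 0 + (\<Sum>k<M. f (int (Suc k)) + f (- int (Suc k)))) \<longlonglongrightarrow> x \<Longrightarrow> (f has_sum x) UNIV"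
    and "f summable_on (- {0}) \<Longrightarrow> (\<lambda>M. \<Sum>k<M. f (int (Suc k)) + f (- int (Suc k))) \<longlonglongrightarrow> x \<Longrightarrow> (f has_sum x) (- {0})"
  unfolding summable_on_def
  by (metis has_sum_int_limit(1) LIMSEQ_unique, metis has_sum_int_limit(2) LIMSEQ_unique)

section \<open>An absolutely convergent double series over the lattice\<close>

lemma summable_int_powr: "(\<lambda>n::int. (1 + \<bar>real_of_int n\<bar>) powr (- 3 / 2)) summable_on UNIV"
proof -
  have s: "summable (\<lambda>n. (1 + real n) powr (- 3 / 2))"
    using summable_Suc_iff[of "\<lambda>n. real n powr (- 3 / 2)"] summable_real_powr_iff[of "- 3 / 2"] by (simp add: add.commute)
  hence nat: "(\<lambda>n::nat. (1 + real n) powr (- 3 / 2)) summable_on UNIV"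
    by (intro norm_summable_imp_summable_on) simp
  have 1: "(\<lambda>n::int. (1 + \<bar>real_of_int n\<bar>) powr (- 3 / 2)) summable_on {0..}"
    using nat by (subst summable_on_reindex_bij_betw[of int UNIV "{0..}", symmetric])
      (auto simp: bij_betw_def image_def intro!: inj_onI, metis nonneg_int_cases)
  have 2: "(\<lambda>n::int. (1 + \<bar>real_of_int n\<bar>) powr (- 3 / 2)) summable_on {..0}"
    using nat by (subst summable_on_reindex_bij_betw[of "\<lambda>n. - int n" UNIV "{..0}", symmetric])
      (auto simp: bij_betw_def image_def intro!: inj_onI, metis nonpos_int_cases)
  have "(\<lambda>n::int. (1 + \<bar>real_of_int n\<bar>) powr (- 3 / 2)) summable_on ({0..} \<union> {..0})"
    using 1 2 by (rule summable_on_union)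
  moreover have "{0..} \<union> {..0} = (UNIV :: int set)" by auto
  ultimately show ?thesis by simp
qed

lemma powr_3_2: "x > 0 \<Longrightarrow> x powr (- 3 / 2) = 1 / sqrt x ^ 3"
proof -
  assume x: "x > 0"
  have "x powr (3 / 2) = (x powr (1 / 2)) powr 3" using x by (simp add: powr_powr)
  also have "\<dots> = sqrt x ^ 3" using x by (simp add: powr_half_sqrt powr_numeral)
  finally show ?thesis using x by (simp add: powr_minus_divide)
qed

text \<open>The imaginary part of m \<tau> + n controls |m|, and then the triangle inequality
  controls |n|; m \<noteq> 0 absorbs the summand 1.\<close>

lemma lattice_bound:
  assumes "\<tau> \<in> Hp"
  obtains a where "a > 0" "\<And>m n :: int. m \<noteq> 0 \<Longrightarrow> norm (of_int m * \<tau> + of_int n) \<ge> a * (1 + \<bar>real_of_int m\<bar>)"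
    "\<And>m n :: int. m \<noteq> 0 \<Longrightarrow> norm (of_int m * \<tau> + of_int n) \<ge> a * (1 + \<bar>real_of_int n\<bar>)"
proof -
  have y: "Im \<tau> > 0" using assms by (simp add: Hp_iff)
  define b where "b = 2 / Im \<tau> + 1 + norm \<tau> / Im \<tau>"
  have b: "b > 0" using y by (simp add: b_def add_pos_nonneg)
  have 1: "\<bar>real_of_int m\<bar> \<le> norm (of_int m * \<tau> + of_int n) / Im \<tau>" for m n :: int
    using abs_Im_le_cmod[of "of_int m * \<tau> + of_int n"] y by (simp add: field_simps abs_mult)
  have m1: "1 \<le> \<bar>real_of_int m\<bar>" if "m \<noteq> 0" for m :: int using that by linarith
  have A: "1 + \<bar>real_of_int m\<bar> \<le> b * norm (of_int m * \<tau> + of_int n)" if "m \<noteq> 0" for m n :: int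
  proof -
    have "1 + \<bar>real_of_int m\<bar> \<le> 2 / Im \<tau> * norm (of_int m * \<tau> + of_int n)"
      using 1[of m n] m1[OF that] by (simp add: field_simps)
    also have "\<dots> \<le> b * norm (of_int m * \<tau> + of_int n)"
      using y by (intro mult_right_mono) (auto simp: b_def)
    finally show ?thesis .
  qed
  have B: "1 + \<bar>real_of_int n\<bar> \<le> b * norm (of_int m * \<tau> + of_int n)" if "m \<noteq> 0" for m n :: int
  proof -
    let ?x = "norm (of_int m * \<tau> + of_int n)"
    have "\<bar>real_of_int n\<bar> = norm ((of_int m * \<tau> + of_int n) - of_int m * \<tau>)" by simp
    also have "\<dots> \<le> ?x + norm (of_int m * \<tau>)" by (rule norm_triangle_ineq4)
    also have "norm (of_int m * \<tau>) = \<bar>real_of_int m\<bar> * norm \<tau>" by (simp add: norm_mult)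
    also have "\<dots> \<le> ?x / Im \<tau> * norm \<tau>" by (rule mult_right_mono[OF 1]) simp
    finally have n: "\<bar>real_of_int n\<bar> \<le> ?x + ?x / Im \<tau> * norm \<tau>" by simp
    have "1 \<le> ?x / Im \<tau>" using 1[of m n] m1[OF that] by linarith
    moreover have "0 \<le> ?x / Im \<tau>" using y by simp
    ultimately have "1 + \<bar>real_of_int n\<bar> \<le> 2 * (?x / Im \<tau>) + ?x + ?x / Im \<tau> * norm \<tau>" using n by linarith
    also have "\<dots> = b * ?x" by (simp add: b_def algebra_simps)
    finally show ?thesis .
  qed
  show ?thesis by (rule that[of "1 / b"]) (use b A B in \<open>auto simp: field_simps\<close>)
qed

text \<open>Equals 1/x^2 - (1/x - 1/(x + 1)) at x = m \<tau> + n. Subtracting a telescoping term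
  from the conditionally summable 1/x^2 gives cubic decay, so rows and columns may be exchanged; the
  anomaly of the weight two series is then visible as a boundary term of the telescoping
  sum.\<close>

definition dd :: "complex \<Rightarrow> int \<times> int \<Rightarrow> complex" where
  "dd \<tau> = (\<lambda>(m, n). 1 / ((of_int m * \<tau> + of_int n)\<^sup>2 * (of_int m * \<tau> + of_int n + 1)))"

lemma dd_summable: assumes "\<tau> \<in> Hp" shows "dd \<tau> summable_on ((- {0}) \<times> UNIV)"
proof -
  obtain a where a: "a > 0" "\<And>m n :: int. m \<noteq> 0 \<Longrightarrow> norm (of_int m * \<tau> + of_int n) \<ge> a * (1 + \<bar>real_of_int m\<bar>)"
    "\<And>m n :: int. m \<noteq> 0 \<Longrightarrow> norm (of_int m * \<tau> + of_int n) \<ge> a * (1 + \<bar>real_of_int n\<bar>)"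
    using lattice_bound[OF assms] by blast
  define U where "U n = (1 + \<bar>real_of_int n\<bar>) powr (- 3 / 2)" for n
  define b where "b = a / 2"
  have b: "b > 0" using a by (simp add: b_def)
  have bd: "norm (dd \<tau> (m, n)) \<le> (1 / b ^ 3) * (U m * U n)" if m: "m \<noteq> 0" for m n
  proof -
    let ?u = "1 + \<bar>real_of_int m\<bar>" and ?N = "1 + \<bar>real_of_int n\<bar>"
    \<comment> \<open>The geometric mean of the two lattice bounds: each of the three factors of the
      denominator is at least of order sqrt((1 + |m|)(1 + |n|)), which produces the exponent 3/2 in
      each variable.\<close>
    have key: "b * sqrt (?u * ?N) \<le> norm (of_int m * \<tau> + of_int k)" if k: "?N \<le> 2 * (1 + \<bar>real_of_int k\<bar>)" for k
    proof -
      let ?x = "norm (of_int m * \<tau> + of_int k)"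
      have "b * ?u \<le> a * ?u" using a(1) by (intro mult_right_mono) (auto simp: b_def)
      hence 1: "b * ?u \<le> ?x" using a(2)[OF m, of k] by linarith
      have "b * ?N \<le> b * (2 * (1 + \<bar>real_of_int k\<bar>))" using k b by (intro mult_left_mono) auto
      moreover have "b * (2 * (1 + \<bar>real_of_int k\<bar>)) = a * (1 + \<bar>real_of_int k\<bar>)" by (simp add: b_def)
      ultimately have 2: "b * ?N \<le> ?x" using a(3)[OF m, of k] by linarith
      have "(b * ?u) * (b * ?N) \<le> ?x * ?x" using b by (intro mult_mono 1 2) auto
      hence "b\<^sup>2 * (?u * ?N) \<le> ?x\<^sup>2" by (simp add: power2_eq_square mult_ac)
      hence "sqrt (b\<^sup>2 * (?u * ?N)) \<le> sqrt (?x\<^sup>2)" by (rule real_sqrt_le_mono)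
      thus ?thesis using b by (simp add: real_sqrt_mult)
    qed
    have k1: "b * sqrt (?u * ?N) \<le> norm (of_int m * \<tau> + of_int n)" by (rule key) simp
    have gen: "x \<le> y + 1 \<Longrightarrow> 0 \<le> y \<Longrightarrow> 1 + x \<le> 2 * (1 + y)" for x y :: real by (simp add: algebra_simps)
    have k2: "b * sqrt (?u * ?N) \<le> norm (of_int m * \<tau> + of_int (n + 1))"
      by (intro key gen) auto
    have s: "sqrt (?u * ?N) > 0" by simp
    have "(b * sqrt (?u * ?N)) ^ 2 * (b * sqrt (?u * ?N)) \<le>
       norm (of_int m * \<tau> + of_int n) ^ 2 * norm (of_int m * \<tau> + of_int (n + 1))"
      using b s k1 k2 by (intro mult_mono power_mono) (auto intro!: mult_nonneg_nonneg)
    hence le: "b ^ 3 * sqrt (?u * ?N) ^ 3 \<le> norm ((of_int m * \<tau> + of_int n)\<^sup>2 * (of_int m * \<tau> + of_int n + 1))"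
      by (simp add: norm_mult norm_power power2_eq_square power3_eq_cube mult_ac add.assoc)
    have "norm (dd \<tau> (m, n)) = 1 / norm ((of_int m * \<tau> + of_int n)\<^sup>2 * (of_int m * \<tau> + of_int n + 1))"
      by (simp add: dd_def norm_divide)
    also have "\<dots> \<le> 1 / (b ^ 3 * sqrt (?u * ?N) ^ 3)"
      by (rule frac_le[OF _ _ _ le]) (use b s in \<open>auto intro!: mult_pos_pos zero_less_power\<close>)
    also have "\<dots> = (1 / b ^ 3) * (U m * U n)"
    proof -
      have "U i = 1 / sqrt (1 + \<bar>real_of_int i\<bar>) ^ 3" for i unfolding U_def by (rule powr_3_2) simp
      thus ?thesis by (simp add: real_sqrt_mult power_mult_distrib)
    qed
    finally show ?thesis .
  qed
  have U: "U summable_on UNIV" using summable_int_powr by (simp add: U_def[abs_def])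
  have "(\<lambda>(m, n). U m * U n) summable_on (UNIV \<times> UNIV)"
  proof (rule summable_on_SigmaI[where g = "\<lambda>m. U m * infsum U UNIV"])
    show "((\<lambda>y. case (x, y) of (m, n) \<Rightarrow> U m * U n) has_sum U x * infsum U UNIV) UNIV" for x
      using has_sum_cmult_right[OF has_sum_infsum[OF U], of "U x"] by simp
    show "(\<lambda>m. U m * infsum U UNIV) summable_on UNIV" by (rule summable_on_cmult_left[OF U])
  qed (auto simp: U_def)
  hence "(\<lambda>x. (1 / b ^ 3) * (case x of (m, n) \<Rightarrow> U m * U n)) summable_on (UNIV \<times> UNIV)"
    by (rule summable_on_cmult_right)
  hence "(\<lambda>x. (1 / b ^ 3) * (case x of (m, n) \<Rightarrow> U m * U n)) summable_on ((- {0}) \<times> UNIV)"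
    by (rule summable_on_subset_banach) auto
  hence "(\<lambda>x. norm (dd \<tau> x)) summable_on ((- {0}) \<times> UNIV)"
    by (rule summable_on_comparison_test) (use bd in auto)
  thus ?thesis by (rule abs_summable_summable)
qed

lemma inverse_square_telescope:
  fixes x :: complex assumes "x \<noteq> 0" "x + 1 \<noteq> 0"
  shows "1 / (x\<^sup>2 * (x + 1)) = 1 / x\<^sup>2 - (1 / x - 1 / (x + 1))"
proof -
  have "1 / x - 1 / (x + 1) = 1 / (x * (x + 1))" using assms by (simp add: field_simps)
  also have "\<dots> = x / (x\<^sup>2 * (x + 1))" using assms by (simp add: power2_eq_square)
  finally have A: "1 / x - 1 / (x + 1) = x / (x\<^sup>2 * (x + 1))" .
  have B: "1 / x\<^sup>2 = (x + 1) / (x\<^sup>2 * (x + 1))" using assms by simp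
  show ?thesis by (simp only: A B diff_divide_distrib[symmetric] add_diff_cancel_left')
qed

lemma Im_nz_notin_Ints: "Im z \<noteq> 0 \<Longrightarrow> z \<notin> \<int>"
  by (auto elim!: Ints_cases)

lemma Sz_minus: "Sz (- z) = Sz z" by (simp add: Sz_def)

text \<open>Along a row the telescoping part has boundary terms tending to 0, so only the sum of
  1/x^2 remains.\<close>

lemma dd_row:
  assumes "\<tau> \<in> Hp" "m \<noteq> 0"
  shows "((\<lambda>n. dd \<tau> (m, n)) has_sum Sz (of_int m * \<tau>)) UNIV"
proof (rule has_sum_int_from_limit(1))
  show "(\<lambda>n. dd \<tau> (m, n)) summable_on UNIV"
    using summable_on_SigmaD1[of "\<lambda>m n. dd \<tau> (m, n)" "- {0}" "\<lambda>_. UNIV" m] dd_summable[OF assms(1)] assms(2) by simp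
  let ?z = "of_int m * \<tau>"
  have z: "?z \<notin> \<int>" using assms by (intro Im_nz_notin_Ints) (auto simp: Hp_iff)
  have nz: "?z + of_int n \<noteq> 0" for n
    by (rule notin_Ints_add_nz[OF z])
  have d: "dd \<tau> (m, n) = 1 / (?z + of_int n)\<^sup>2 - (1 / (?z + of_int n) - 1 / (?z + of_int (n + 1)))" for n
  proof -
    show ?thesis using inverse_square_telescope[OF nz[of n]] nz[of "n + 1"] by (simp add: dd_def add.assoc)
  qed
  have "dd \<tau> (m, 0) + (\<Sum>k<M. dd \<tau> (m, int (Suc k)) + dd \<tau> (m, - int (Suc k))) =
     1 / ?z\<^sup>2 + (\<Sum>k<M. 1 / (?z + of_int (int (Suc k)))\<^sup>2 + 1 / (?z + of_int (- int (Suc k)))\<^sup>2)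
      - (1 / (?z + of_int (- int M)) - 1 / (?z + of_int (int M + 1)))" for M
  proof (induction M)
    case 0
    show ?case by (simp add: d)
  next
    case (Suc M)
    have e: "- int (Suc M) + 1 = - int M" "int (Suc M) = int M + 1" by simp_all
    show ?case unfolding sum.lessThan_Suc add.assoc[symmetric] Suc unfolding d e by (simp add: algebra_simps)
  qed
  moreover have "(\<lambda>M. 1 / ?z\<^sup>2 + (\<Sum>k<M. 1 / (?z + of_int (int (Suc k)))\<^sup>2 + 1 / (?z + of_int (- int (Suc k)))\<^sup>2)
      - (1 / (?z + of_int (- int M)) - 1 / (?z + of_int (int M + 1)))) \<longlonglongrightarrow> 1 / ?z\<^sup>2 + (Sz ?z - 1 / ?z\<^sup>2) - (0 - 0)"
  proof (intro tendsto_intros Sz_LIMSEQ[OF z])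
    have "(\<lambda>M. - (1 / (- ?z + of_nat M))) \<longlonglongrightarrow> - 0" by (intro tendsto_minus tendsto_inverse_of_nat_shift)
    moreover have "- (1 / (- ?z + of_nat M)) = 1 / (?z + of_int (- int M))" for M
    proof -
      have "- ?z + of_nat M = - (?z + of_int (- int M))" by simp
      thus ?thesis by (simp only: divide_minus_right minus_minus)
    qed
    ultimately show "(\<lambda>M. 1 / (?z + of_int (- int M))) \<longlonglongrightarrow> 0" by simp
    show "(\<lambda>M. 1 / (?z + of_int (int M + 1))) \<longlonglongrightarrow> 0"
      using tendsto_inverse_of_nat_shift[of "?z + 1"] by (simp add: add_ac)
  qed
  ultimately show "(\<lambda>M. dd \<tau> (m, 0) + (\<Sum>k<M. dd \<tau> (m, int (Suc k)) + dd \<tau> (m, - int (Suc k)))) \<longlonglongrightarrow> Sz ?z"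
    by simp
qed

text \<open>The sum of 1/(m \<tau> + n)^2 over m \<noteq> 0. Dividing by \<tau>^2 turns a column
  into a row for n / \<tau>; for n = 0 the value is twice zeta(2) over \<tau>^2.\<close>

definition cN :: "complex \<Rightarrow> int \<Rightarrow> complex" where
  "cN \<tau> n = (if n = 0 then of_real (pi\<^sup>2 / 3) / \<tau>\<^sup>2 else (Sz (of_int n / \<tau>) - 1 / (of_int n / \<tau>)\<^sup>2) / \<tau>\<^sup>2)"

text \<open>The symmetric sum of 1/(m \<tau> + n) over m \<noteq> 0. It is odd in n, and its limits
  for n to plus and minus infinity differ, which is the source of the anomaly.\<close>

definition tN :: "complex \<Rightarrow> int \<Rightarrow> complex" where
  "tN \<tau> n = (if n = 0 then 0 else (of_real pi * cot (of_real pi * (of_int n / \<tau>)) - 1 / (of_int n / \<tau>)) / \<tau>)"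

lemma quot_notin_Ints: assumes "\<tau> \<in> Hp" "n \<noteq> 0" shows "of_int n / \<tau> \<notin> \<int>"
proof (rule Im_nz_notin_Ints)
  have "Im (of_int n / \<tau>) = - of_int n * Im \<tau> / (norm \<tau>)\<^sup>2" by (simp add: Im_divide cmod_power2)
  thus "Im (of_int n / \<tau>) \<noteq> 0" using assms by (auto simp: Hp_iff)
qed

lemma cN_limit: assumes "\<tau> \<in> Hp"
  shows "(\<lambda>M. \<Sum>k<M. 1 / (of_int (int (Suc k)) * \<tau> + of_int n)\<^sup>2 + 1 / (of_int (- int (Suc k)) * \<tau> + of_int n)\<^sup>2) \<longlonglongrightarrow> cN \<tau> n"
proof -
  have t: "\<tau> \<noteq> 0" using assms by (auto simp: Hp_iff)
  show ?thesis
  proof (cases "n = 0")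
    case True
    have "(\<lambda>k. complex_of_real (1 / (real k + 1)\<^sup>2)) sums of_real (pi\<^sup>2 / 6)"
      using sums_of_real[OF inverse_squares_sums, where 'a = complex] by (simp add: add.commute)
    from sums_mult[OF this, of "2 / \<tau>\<^sup>2"]
    have "(\<lambda>k. 2 / \<tau>\<^sup>2 * complex_of_real (1 / (real k + 1)\<^sup>2)) sums (2 / \<tau>\<^sup>2 * of_real (pi\<^sup>2 / 6))" .
    moreover have "2 / \<tau>\<^sup>2 * complex_of_real (1 / (real k + 1)\<^sup>2) = 1 / (of_int (int (Suc k)) * \<tau> + of_int n)\<^sup>2 + 1 / (of_int (- int (Suc k)) * \<tau> + of_int n)\<^sup>2" for k
    proof -
      define K where "K = (of_nat (Suc k) :: complex)"
      have "complex_of_real (1 / (real k + 1)\<^sup>2) = 1 / K\<^sup>2" by (simp add: K_def add.commute)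
      moreover have "of_int (int (Suc k)) = K" "of_int (- int (Suc k)) = - K"
        unfolding K_def by (simp_all only: of_int_minus of_int_of_nat_eq)
      ultimately show ?thesis using True by (simp add: power_mult_distrib mult.commute)
    qed
    ultimately show ?thesis using True by (simp add: cN_def sums_def)
  next
    case False
    have "1 / (of_int k * \<tau> + of_int n)\<^sup>2 = 1 / (of_int n / \<tau> + of_int k)\<^sup>2 / \<tau>\<^sup>2" for k
    proof -
      have "of_int k * \<tau> + of_int n = (of_int n / \<tau> + of_int k) * \<tau>" using t by (simp add: field_simps)
      thus ?thesis by (simp add: power_mult_distrib)
    qed
    hence "(\<Sum>k<M. 1 / (of_int (int (Suc k)) * \<tau> + of_int n)\<^sup>2 + 1 / (of_int (- int (Suc k)) * \<tau> + of_int n)\<^sup>2) =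
      (\<Sum>k<M. 1 / (of_int n / \<tau> + of_int (int (Suc k)))\<^sup>2 + 1 / (of_int n / \<tau> + of_int (- int (Suc k)))\<^sup>2) / \<tau>\<^sup>2" for M
      by (simp only: sum_divide_distrib add_divide_distrib)
    thus ?thesis using tendsto_divide[OF Sz_LIMSEQ[OF quot_notin_Ints[OF assms False]] tendsto_const[of "\<tau>\<^sup>2"]] t False
      by (simp only: cN_def if_False power_eq_0_iff) simp
  qed
qed

lemma tN_limit: assumes "\<tau> \<in> Hp"
  shows "(\<lambda>M. \<Sum>k<M. 1 / (of_int (int (Suc k)) * \<tau> + of_int n) + 1 / (of_int (- int (Suc k)) * \<tau> + of_int n)) \<longlonglongrightarrow> tN \<tau> n"
proof -
  have t: "\<tau> \<noteq> 0" using assms by (auto simp: Hp_iff)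
  show ?thesis
  proof (cases "n = 0")
    case True
    have "1 / (of_int (int (Suc k)) * \<tau> + of_int n) + 1 / (of_int (- int (Suc k)) * \<tau> + of_int n) = 0" for k
    proof -
      have "of_int (- int (Suc k)) * \<tau> = - (of_int (int (Suc k)) * \<tau>)" by (simp add: algebra_simps)
      thus ?thesis using True by (simp only: of_int_0 add_0_right divide_minus_right) simp
    qed
    thus ?thesis using True by (simp add: tN_def)
  next
    case False
    have "1 / (of_int k * \<tau> + of_int n) = 1 / (of_int n / \<tau> + of_int k) / \<tau>" for k
    proof -
      have "of_int k * \<tau> + of_int n = (of_int n / \<tau> + of_int k) * \<tau>" using t by (simp add: field_simps)
      thus ?thesis by simp
    qed
    hence "(\<Sum>k<M. 1 / (of_int (int (Suc k)) * \<tau> + of_int n) + 1 / (of_int (- int (Suc k)) * \<tau> + of_int n)) =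
      (\<Sum>k<M. 1 / (of_int n / \<tau> + of_int (int (Suc k))) + 1 / (of_int n / \<tau> + of_int (- int (Suc k)))) / \<tau>" for M
      by (simp only: sum_divide_distrib add_divide_distrib)
    thus ?thesis using tendsto_divide[OF cot_LIMSEQ[OF quot_notin_Ints[OF assms False]] tendsto_const[of "\<tau>"]] t False
      by (simp only: tN_def if_False) simp
  qed
qed

lemma dd_col:
  assumes "\<tau> \<in> Hp"
  shows "((\<lambda>m. dd \<tau> (m, n)) has_sum (cN \<tau> n - (tN \<tau> n - tN \<tau> (n + 1)))) (- {0})"
proof (rule has_sum_int_from_limit(2))
  have "(\<lambda>(n, m). dd \<tau> (m, n)) summable_on (UNIV \<times> (- {0}))"
    using dd_summable[OF assms] has_sum_swap[where f = "dd \<tau>" and A = "- {0}" and B = UNIV] unfolding summable_on_def by blast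
  thus "(\<lambda>m. dd \<tau> (m, n)) summable_on - {0}"
    using summable_on_SigmaD1[of "\<lambda>n m. dd \<tau> (m, n)" UNIV "\<lambda>_. - {0}" n] by simp
  have d: "dd \<tau> (m, n) = 1 / (of_int m * \<tau> + of_int n)\<^sup>2 - (1 / (of_int m * \<tau> + of_int n) - 1 / (of_int m * \<tau> + of_int (n + 1)))"
    if "m \<noteq> 0" for m
  proof -
    have nz: "of_int m * \<tau> + of_int n \<noteq> 0" for n
    proof -
      have "Im (of_int m * \<tau> + of_int n) \<noteq> 0" using that assms by (simp add: Hp_iff)
      thus ?thesis by force
    qed
    show ?thesis using inverse_square_telescope[OF nz[of n]] nz[of "n + 1"] by (simp add: dd_def add.assoc)
  qed
  let ?c = "\<lambda>M. \<Sum>k<M. 1 / (of_int (int (Suc k)) * \<tau> + of_int n)\<^sup>2 + 1 / (of_int (- int (Suc k)) * \<tau> + of_int n)\<^sup>2"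
  let ?t = "\<lambda>n M. \<Sum>k<M. 1 / (of_int (int (Suc k)) * \<tau> + of_int n) + 1 / (of_int (- int (Suc k)) * \<tau> + of_int n)"
  have "(\<Sum>k<M. dd \<tau> (int (Suc k), n) + dd \<tau> (- int (Suc k), n)) = ?c M - (?t n M - ?t (n + 1) M)" for M
  proof -
    have nz: "int (Suc k) \<noteq> 0" "- int (Suc k) \<noteq> 0" for k by auto
    show ?thesis
      unfolding sum_subtractf[symmetric] by (rule sum.cong[OF refl]) (simp only: d[OF nz(1)] d[OF nz(2)], simp)
  qed
  moreover have "(\<lambda>M. ?c M - (?t n M - ?t (n + 1) M)) \<longlonglongrightarrow> cN \<tau> n - (tN \<tau> n - tN \<tau> (n + 1))"
    by (intro tendsto_diff cN_limit tN_limit assms)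
  ultimately show "(\<lambda>M. \<Sum>k<M. dd \<tau> (int (Suc k), n) + dd \<tau> (- int (Suc k), n)) \<longlonglongrightarrow> cN \<tau> n - (tN \<tau> n - tN \<tau> (n + 1))"
    by simp
qed

section \<open>The Eisenstein series of weight two and its inversion formula\<close>

lemma Sz_qe: assumes "z \<in> Hp" shows "Sz z = - 4 * (of_real pi)\<^sup>2 * (qe 1 z / (1 - qe 1 z)\<^sup>2)"
proof -
  let ?w = "of_real pi * z"
  define E where "E = exp (\<i> * ?w)"
  have E0: "E \<noteq> 0" by (simp add: E_def)
  have q: "qe 1 z = E\<^sup>2" unfolding E_def qe_def power2_eq_square exp_add[symmetric] by (simp add: algebra_simps)
  have q1: "1 - E\<^sup>2 \<noteq> 0" using qe_ball[of 1 z] assms q by auto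
  have "exp (- (\<i> * ?w)) = 1 / E" by (simp add: E_def exp_minus inverse_eq_divide)
  hence "sin ?w = (E - 1 / E) / (2 * \<i>)" by (simp add: sin_exp_eq E_def)
  hence "(sin ?w)\<^sup>2 = - ((E - 1 / E)\<^sup>2 / 4)" by (simp add: power_divide power_mult_distrib)
  also have "E - 1 / E = - (1 - E\<^sup>2) / E" using E0 by (simp add: field_simps power2_eq_square)
  finally have "(sin ?w)\<^sup>2 = - ((1 - E\<^sup>2)\<^sup>2 / (4 * E\<^sup>2))"
    by (simp add: power_divide power2_commute[of "E\<^sup>2" 1] mult.commute)
  moreover have "p / (- (a / (4 * b))) = - 4 * p * (b / a)" if "a \<noteq> 0" "b \<noteq> 0" for p a b :: complex
    using that by (simp add: field_simps)
  ultimately show ?thesis unfolding Sz_def q using E0 q1 by simp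
qed

text \<open>The Lambert series form of the sum of sigma_1(n) q^n.\<close>

definition P0 :: "complex \<Rightarrow> complex" where "P0 q = (\<Sum>m. q ^ Suc m / (1 - q ^ Suc m)\<^sup>2)"

lemma P0_bound:
  fixes q :: complex assumes "norm q \<le> r" "r < 1"
  shows "norm (q ^ Suc m / (1 - q ^ Suc m)\<^sup>2) \<le> r ^ Suc m / (1 - r)\<^sup>2"
proof -
  have r0: "0 \<le> r" using assms(1) norm_ge_zero[of q] by linarith
  have 1: "norm (q ^ Suc m) \<le> r ^ Suc m" unfolding norm_power using assms r0 by (intro power_mono) auto
  have "r ^ Suc m \<le> r" using r0 assms(2) power_le_one[of r m] by (simp add: mult_left_le)
  hence "1 - r \<le> 1 - norm (q ^ Suc m)" using 1 by linarith
  also have "\<dots> \<le> norm (1 - q ^ Suc m)" using norm_triangle_ineq2[of 1 "q ^ Suc m"] by simp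
  finally have 2: "(1 - r)\<^sup>2 \<le> norm ((1 - q ^ Suc m)\<^sup>2)" unfolding norm_power using assms(2) by (intro power_mono) auto
  show ?thesis unfolding norm_divide using 1 2 assms(2) r0 by (intro frac_le) auto
qed

lemma P0_sums: fixes q :: complex assumes "norm q < 1" shows "(\<lambda>m. q ^ Suc m / (1 - q ^ Suc m)\<^sup>2) sums P0 q"
proof -
  have "summable (\<lambda>m. norm q ^ Suc m / (1 - norm q)\<^sup>2)"
    by (intro summable_divide iffD2[OF summable_Suc_iff] summable_geometric) (use assms in simp)
  hence "summable (\<lambda>m. q ^ Suc m / (1 - q ^ Suc m)\<^sup>2)"
    by (rule summable_comparison_test'[of _ 0]) (rule P0_bound, use assms in auto)
  thus ?thesis unfolding P0_def by (rule summable_sums)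
qed

lemma P0_holomorphic: "P0 holomorphic_on ball 0 1"
proof (rule holomorphic_uniform_sequence[OF open_ball])
  show "(\<lambda>q. \<Sum>m<n. q ^ Suc m / (1 - q ^ Suc m)\<^sup>2) holomorphic_on ball 0 1" for n :: nat
  proof (intro holomorphic_intros)
    fix q :: complex and m assume "q \<in> ball 0 1"
    hence "norm (q ^ Suc m) < 1" unfolding norm_power by (simp add: power_less_one_iff del: power_Suc)
    thus "(1 - q ^ Suc m)\<^sup>2 \<noteq> 0" by auto
  qed
  fix x :: complex assume x: "x \<in> ball 0 1"
  define d where "d = (1 - norm x) / 2"
  define r where "r = (1 + norm x) / 2"
  have d: "d > 0" and r: "r < 1" "0 \<le> r" using x by (auto simp: d_def r_def)
  have in_r: "norm q \<le> r" if "q \<in> cball x d" for q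
  proof -
    have "norm q \<le> norm x + norm (q - x)" by (metis norm_triangle_sub)
    also have "norm (q - x) \<le> d" using that by (simp add: dist_norm norm_minus_commute)
    finally show ?thesis by (simp add: d_def r_def field_simps)
  qed
  have "uniform_limit (cball x d) (\<lambda>n q. \<Sum>m<n. q ^ Suc m / (1 - q ^ Suc m)\<^sup>2) (\<lambda>q. suminf (\<lambda>m. q ^ Suc m / (1 - q ^ Suc m)\<^sup>2)) sequentially"
  proof (rule Weierstrass_m_test)
    show "norm (q ^ Suc m / (1 - q ^ Suc m)\<^sup>2) \<le> r ^ Suc m / (1 - r)\<^sup>2" if "q \<in> cball x d" for m q
      by (rule P0_bound[OF in_r[OF that] r(1)])
    show "summable (\<lambda>m. r ^ Suc m / (1 - r)\<^sup>2)"
      by (intro summable_divide iffD2[OF summable_Suc_iff] summable_geometric) (use r in simp)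
  qed
  moreover have "cball x d \<subseteq> ball 0 1" using in_r r(1) by fastforce
  ultimately show "\<exists>d>0. cball x d \<subseteq> ball 0 1 \<and> uniform_limit (cball x d) (\<lambda>n q. \<Sum>m<n. q ^ Suc m / (1 - q ^ Suc m)\<^sup>2) P0 sequentially"
    using d by (intro exI[of _ d]) (auto simp: P0_def[abs_def])
qed

text \<open>The Eisenstein series summed row by row: 2 zeta(2) = pi^2 / 3 for m = 0, and twice the
  sum of the rows \<open>Sz (m \<tau>)\<close> for m > 0.\<close>

definition G2 :: "complex \<Rightarrow> complex" where
  "G2 \<tau> = of_real (pi\<^sup>2 / 3) - 8 * (of_real pi)\<^sup>2 * P0 (qe 1 \<tau>)"

lemma qe_mult: "qe 1 (of_nat m * \<tau>) = qe 1 \<tau> ^ m"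
  unfolding qe_def exp_of_nat_mult[symmetric] by (simp add: algebra_simps)

lemma sum_Sz: assumes "\<tau> \<in> Hp"
  shows "(\<lambda>k. 2 * Sz (of_nat (Suc k) * \<tau>)) sums (G2 \<tau> - of_real (pi\<^sup>2 / 3))"
proof -
  have q: "norm (qe 1 \<tau>) < 1" using qe_ball[of 1 \<tau>] assms by simp
  have "Sz (of_nat (Suc k) * \<tau>) = - 4 * (of_real pi)\<^sup>2 * (qe 1 \<tau> ^ Suc k / (1 - qe 1 \<tau> ^ Suc k)\<^sup>2)" for k
  proof -
    have "Im (of_nat (Suc k) * \<tau>) > 0" using assms by (simp add: Hp_iff add_pos_nonneg)
    hence "of_nat (Suc k) * \<tau> \<in> Hp" by (simp only: Hp_iff)
    from Sz_qe[OF this] show ?thesis by (simp only: qe_mult)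
  qed
  thus ?thesis using sums_mult[OF P0_sums[OF q], of "- 8 * (of_real pi)\<^sup>2"] by (simp add: G2_def mult.assoc)
qed

text \<open>The total of \<open>dd\<close> is evaluated by rows, giving \<open>G2 \<tau>\<close>
  without its constant term, and by columns, giving \<open>G2 (- 1 / \<tau>) / \<tau>^2\<close>
  without the same constant plus the boundary terms of the telescoping sum of
  \<open>tN\<close>.\<close>

lemma G2_S: assumes t: "\<tau> \<in> Hp" shows "G2 \<tau> = G2 (- 1 / \<tau>) / \<tau>\<^sup>2 + 2 * of_real pi * \<i> / \<tau>"
proof -
  have t0: "\<tau> \<noteq> 0" using t by (auto simp: Hp_iff)
  have Im': "Im (1 / \<tau>) < 0" using t t0 by (simp add: Im_divide Hp_iff sum_power2_gt_zero_iff complex_eq_iff)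
  have t': "- 1 / \<tau> \<in> Hp" using Im' by (simp add: Hp_iff minus_divide_left[symmetric])
  obtain T where T: "(dd \<tau> has_sum T) ((- {0}) \<times> UNIV)" using dd_summable[OF t] by (auto simp: summable_on_def)
  have "((\<lambda>m. Sz (of_int m * \<tau>)) has_sum T) (- {0})"
    by (rule has_sum_SigmaD[OF T]) (use dd_row[OF t] in auto)
  from has_sum_int_limit(2)[OF this]
  have "(\<lambda>M. \<Sum>k<M. 2 * Sz (of_nat (Suc k) * \<tau>)) \<longlonglongrightarrow> T"
  proof -
    have "Sz (of_int (- int (Suc k)) * \<tau>) = Sz (of_nat (Suc k) * \<tau>)" for k
      by (simp only: of_int_minus of_int_of_nat_eq mult_minus_left Sz_minus)
    moreover have "Sz (of_int (int (Suc k)) * \<tau>) = Sz (of_nat (Suc k) * \<tau>)" for k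
      by (simp only: of_int_of_nat_eq)
    ultimately show ?thesis using has_sum_int_limit(2)[OF \<open>((\<lambda>m. Sz (of_int m * \<tau>)) has_sum T) (- {0})\<close>]
      by (simp only: mult_2)
  qed
  hence T1: "T = G2 \<tau> - of_real (pi\<^sup>2 / 3)" using sum_Sz[OF t] LIMSEQ_unique unfolding sums_def by blast
  define C where "C n = cN \<tau> n - (tN \<tau> n - tN \<tau> (n + 1))" for n
  have "((\<lambda>(n, m). dd \<tau> (m, n)) has_sum T) (UNIV \<times> (- {0}))"
    using T has_sum_swap[where f = "dd \<tau>" and A = "- {0}" and B = UNIV] by blast
  hence "(C has_sum T) UNIV"
    by (rule has_sum_SigmaD) (use dd_col[OF t] in \<open>auto simp: C_def\<close>)
  from has_sum_int_limit(1)[OF this]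
  have "(\<lambda>M. C 0 + (\<Sum>k<M. C (int (Suc k)) + C (- int (Suc k)))) \<longlonglongrightarrow> T" .
  moreover have "C 0 + (\<Sum>k<M. C (int (Suc k)) + C (- int (Suc k))) =
     cN \<tau> 0 + (\<Sum>k<M. cN \<tau> (int (Suc k)) + cN \<tau> (- int (Suc k))) - (tN \<tau> (- int M) - tN \<tau> (int M + 1))" for M
  proof (induction M)
    case 0
    show ?case by (simp add: C_def)
  next
    case (Suc M)
    have e: "- int (Suc M) + 1 = - int M" "int (Suc M) = int M + 1" by simp_all
    show ?case unfolding sum.lessThan_Suc add.assoc[symmetric] Suc unfolding C_def e by (simp add: algebra_simps)
  qed
  ultimately have L1: "(\<lambda>M. cN \<tau> 0 + (\<Sum>k<M. cN \<tau> (int (Suc k)) + cN \<tau> (- int (Suc k))) - (tN \<tau> (- int M) - tN \<tau> (int M + 1))) \<longlonglongrightarrow> T"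
    by simp
  have cs: "cN \<tau> (int (Suc k)) + cN \<tau> (- int (Suc k)) =
     2 * Sz (of_nat (Suc k) * (- 1 / \<tau>)) / \<tau>\<^sup>2 - 2 * complex_of_real (1 / (real k + 1)\<^sup>2)" for k
  proof -
    have a: "Sz (of_int (- int (Suc k)) / \<tau>) = Sz (of_nat (Suc k) * (- 1 / \<tau>))"
      by (simp only: of_int_minus of_int_of_nat_eq) (simp del: of_nat_Suc)
    have b: "Sz (of_int (int (Suc k)) / \<tau>) = Sz (of_nat (Suc k) * (- 1 / \<tau>))"
      using Sz_minus[of "of_nat (Suc k) / \<tau>"] by (simp only: of_int_of_nat_eq) (simp del: of_nat_Suc)
    have c: "1 / (of_int j / \<tau>)\<^sup>2 / \<tau>\<^sup>2 = 1 / (of_int j)\<^sup>2" for j using t0 by (simp add: power_divide)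
    have d: "(of_int (- int (Suc k)) :: complex)\<^sup>2 = (of_nat (Suc k))\<^sup>2" "(of_int (int (Suc k)) :: complex)\<^sup>2 = (of_nat (Suc k))\<^sup>2"
      by (simp_all add: power2_eq_square algebra_simps)
    have nz: "int (Suc k) \<noteq> 0" "- int (Suc k) \<noteq> 0" by auto
    have r: "1 / (of_nat (Suc k))\<^sup>2 = complex_of_real (1 / (real k + 1)\<^sup>2)" by (simp add: add.commute)
    show ?thesis unfolding cN_def if_not_P[OF nz(1)] if_not_P[OF nz(2)] a b diff_divide_distrib c d r by simp
  qed
  have s1: "(\<lambda>k. 2 * Sz (of_nat (Suc k) * (- 1 / \<tau>)) / \<tau>\<^sup>2) sums ((G2 (- 1 / \<tau>) - of_real (pi\<^sup>2 / 3)) / \<tau>\<^sup>2)"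
    by (rule sums_divide[OF sum_Sz[OF t']])
  have s2: "(\<lambda>k. 2 * complex_of_real (1 / (real k + 1)\<^sup>2)) sums (2 * of_real (pi\<^sup>2 / 6))"
    using sums_mult[OF sums_of_real[OF inverse_squares_sums, where 'a = complex], of 2] by (simp add: add.commute)
  have L2: "(\<lambda>M. \<Sum>k<M. cN \<tau> (int (Suc k)) + cN \<tau> (- int (Suc k))) \<longlonglongrightarrow>
      (G2 (- 1 / \<tau>) - of_real (pi\<^sup>2 / 3)) / \<tau>\<^sup>2 - 2 * of_real (pi\<^sup>2 / 6)"
    using sums_diff[OF s1 s2] unfolding cs sums_def .
  \<comment> \<open>The cotangent tends to i because 1/\<tau> lies in the lower half plane. Each end
    of the telescoping sum thus contributes pi i / \<tau>, together 2 pi i / \<tau>.\<close>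
  have tl: "(\<lambda>M. tN \<tau> (int M + 1)) \<longlonglongrightarrow> of_real pi * \<i> / \<tau>"
  proof -
    have "(\<lambda>M. (of_real pi * cot (of_real pi * (of_nat (Suc M) * (1 / \<tau>)))) / \<tau> - 1 / (0 + of_nat (Suc M))) \<longlonglongrightarrow> of_real pi * \<i> / \<tau> - 0"
      by (intro tendsto_intros LIMSEQ_Suc[OF cot_limit_neg[OF Im']] LIMSEQ_Suc[OF tendsto_inverse_of_nat_shift[of 0]] t0)
    moreover have "tN \<tau> (int M + 1) = (of_real pi * cot (of_real pi * (of_nat (Suc M) * (1 / \<tau>)))) / \<tau> - 1 / (0 + of_nat (Suc M))" for M
      using t0 by (simp add: tN_def diff_divide_distrib add.commute)
    ultimately show ?thesis by simp
  qed
  have tl': "(\<lambda>M. tN \<tau> (- int M)) \<longlonglongrightarrow> - (of_real pi * \<i> / \<tau>)"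
  proof -
    have g: "(p * cot (p * - x) - 1 / (- x)) / \<tau> = - ((p * cot (p * x) - 1 / x) / \<tau>)" for p x :: complex
      by (simp add: diff_divide_distrib add_divide_distrib)
    have "tN \<tau> (- int M) = - tN \<tau> (int M)" for M
      using g[of "of_real pi" "of_int (int M) / \<tau>"] by (simp add: tN_def)
    moreover have "(\<lambda>M. tN \<tau> (int M)) \<longlonglongrightarrow> of_real pi * \<i> / \<tau>"
      by (rule LIMSEQ_imp_Suc) (use tl in \<open>simp add: add.commute\<close>)
    ultimately show ?thesis using tendsto_minus by simp
  qed
  have "(\<lambda>M. cN \<tau> 0 + (\<Sum>k<M. cN \<tau> (int (Suc k)) + cN \<tau> (- int (Suc k))) - (tN \<tau> (- int M) - tN \<tau> (int M + 1))) \<longlonglongrightarrow>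
     cN \<tau> 0 + ((G2 (- 1 / \<tau>) - of_real (pi\<^sup>2 / 3)) / \<tau>\<^sup>2 - 2 * of_real (pi\<^sup>2 / 6)) - (- (of_real pi * \<i> / \<tau>) - of_real pi * \<i> / \<tau>)"
    by (intro tendsto_intros L2 tl tl')
  from LIMSEQ_unique[OF L1 this] T1
  show ?thesis by (simp add: cN_def diff_divide_distrib)
qed

text \<open>Normalised so that the anomaly under a matrix with bottom row (c, d) is exactly c (c
  \<tau> + d), without a factor of pi.\<close>

definition phi2 :: "complex \<Rightarrow> complex" where "phi2 \<tau> = \<i> / (2 * of_real pi) * G2 \<tau>"

lemma RN_phi2: "RN 1 phi2"
  unfolding RN_def phi2_def G2_def
  by (rule exI[of _ "\<lambda>q. \<i> / (2 * of_real pi) * (of_real (pi\<^sup>2 / 3) - 8 * (of_real pi)\<^sup>2 * P0 q)"])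
     (auto intro!: holomorphic_intros P0_holomorphic)

lemma RN_phi2': "N > 0 \<Longrightarrow> RN N phi2" using RN_scale[OF RN_phi2, of N] by simp

lemma hol_phi2: "hol phi2" using RN_hol[OF RN_phi2] by simp

section \<open>The law of \<open>phi2\<close> under the full modular group\<close>

lemma sl2_to_rmat: "g \<in> SL2Z \<Longrightarrow> sl2 (to_rmat g)"
  by (cases g) (simp add: SL2Z_def sl2_def to_rmat_def flip: of_int_mult of_int_diff)

lemma imul_SL2Z: assumes "x \<in> SL2Z" "y \<in> SL2Z" shows "imul x y \<in> SL2Z"
proof -
  obtain a b c d a' b' c' d' where xy: "x = (a, b, c, d)" "y = (a', b', c', d')" by (metis prod_cases4)
  have "(a * a' + b * c') * (c * b' + d * d') - (a * b' + b * d') * (c * a' + d * c') = (a * d - b * c) * (a' * d' - b' * c')"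
    by (simp add: algebra_simps)
  thus ?thesis using assms by (simp add: SL2Z_def imul_def xy)
qed

lemma jf_imul: assumes "y \<in> SL2Z" "\<tau> \<in> Hp"
  shows "jf (to_rmat (imul x y)) \<tau> = jf (to_rmat x) (mob (to_rmat y) \<tau>) * jf (to_rmat y) \<tau>"
proof -
  obtain a b c d a' b' c' d' where xy: "x = (a, b, c, d)" "y = (a', b', c', d')" by (metis prod_cases4)
  have nz: "of_int c' * \<tau> + of_int d' \<noteq> 0"
    using jf_nz[OF sl2_to_rmat[OF assms(1)] assms(2)] by (simp add: xy jf_def to_rmat_def)
  have "(of_int c * ((of_int a' * \<tau> + of_int b') / (of_int c' * \<tau> + of_int d')) + of_int d) * (of_int c' * \<tau> + of_int d') =
     of_int c * (of_int a' * \<tau> + of_int b') + of_int d * (of_int c' * \<tau> + of_int d')"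
    using nz by (simp add: distrib_right)
  thus ?thesis by (simp add: xy jf_def to_rmat_def imul_def mob_def algebra_simps)
qed

lemma mob_imul: assumes "x \<in> SL2Z" "y \<in> SL2Z" "\<tau> \<in> Hp"
  shows "mob (to_rmat (imul x y)) \<tau> = mob (to_rmat x) (mob (to_rmat y) \<tau>)"
proof -
  obtain a b c d a' b' c' d' where xy: "x = (a, b, c, d)" "y = (a', b', c', d')" by (metis prod_cases4)
  let ?j = "of_int c' * \<tau> + of_int d'" and ?z = "mob (to_rmat y) \<tau>"
  have nz: "?j \<noteq> 0"
    using jf_nz[OF sl2_to_rmat[OF assms(2)] assms(3)] by (simp add: xy jf_def to_rmat_def)
  have z: "?z = (of_int a' * \<tau> + of_int b') / ?j" by (simp add: xy mob_def to_rmat_def)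
  have "mob (to_rmat x) ?z = ((of_int a * ?z + of_int b) * ?j) / ((of_int c * ?z + of_int d) * ?j)"
    using nz by (simp add: xy(1) mob_def to_rmat_def)
  also have "(of_int a * ?z + of_int b) * ?j = of_int a * (of_int a' * \<tau> + of_int b') + of_int b * ?j"
    unfolding z using nz by (simp add: distrib_right)
  also have "(of_int c * ?z + of_int d) * ?j = of_int c * (of_int a' * \<tau> + of_int b') + of_int d * ?j"
    unfolding z using nz by (simp add: distrib_right)
  finally show ?thesis by (simp add: xy mob_def to_rmat_def imul_def algebra_simps)
qed

definition cent :: "imat \<Rightarrow> complex" where "cent g = (case g of (a, b, c, d) \<Rightarrow> of_int c)"

definition QM :: "imat \<Rightarrow> bool" where
  "QM g \<longleftrightarrow> (\<forall>\<tau>\<in>Hp. phi2 (mob (to_rmat g) \<tau>) =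
     (jf (to_rmat g) \<tau>)\<^sup>2 * phi2 \<tau> + cent g * jf (to_rmat g) \<tau>)"

text \<open>The anomaly is a cocycle: it is half the derivative of the square of the automorphy
  factor, and automorphy factors multiply along compositions.\<close>

lemma QM_imul: assumes "x \<in> SL2Z" "y \<in> SL2Z" "QM x" "QM y" shows "QM (imul x y)"
  unfolding QM_def
proof
  fix \<tau> assume t: "\<tau> \<in> Hp"
  obtain a b c d a' b' c' d' where xy: "x = (a, b, c, d)" "y = (a', b', c', d')" by (metis prod_cases4)
  let ?z = "mob (to_rmat y) \<tau>" and ?jx = "jf (to_rmat x) (mob (to_rmat y) \<tau>)" and ?jy = "jf (to_rmat y) \<tau>"
  have z: "?z \<in> Hp" by (rule mob_Hp[OF sl2_to_rmat[OF assms(2)] t])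
  have "of_int (a' * d' - b' * c') = (1::complex)" using assms(2) by (simp add: SL2Z_def xy)
  hence dt: "of_int a' * of_int d' - of_int b' * of_int c' = (1::complex)" by simp
  have J: "?jx * ?jy = (of_int c * of_int a' + of_int d * of_int c') * \<tau> + (of_int c * of_int b' + of_int d * of_int d')"
    unfolding jf_imul[OF assms(2) t, symmetric] by (simp add: xy jf_def to_rmat_def imul_def)
  have jy: "?jy = of_int c' * \<tau> + of_int d'" by (simp add: xy jf_def to_rmat_def)
  \<comment> \<open>The cocycle identity for lower left entries. The determinant of y is spelled out
    so that it can be replaced by 1 afterwards.\<close>
  have "?jx * ?jy * of_int c' + of_int c * (of_int a' * of_int d' - of_int b' * of_int c') =
      (of_int c * of_int a' + of_int d * of_int c') * ?jy"
    unfolding J unfolding jy by (simp add: algebra_simps)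
  hence key: "?jx * ?jy * cent y + cent x = cent (imul x y) * ?jy"
    unfolding dt by (simp add: xy cent_def imul_def)
  have "phi2 (mob (to_rmat (imul x y)) \<tau>) = ?jx\<^sup>2 * (?jy\<^sup>2 * phi2 \<tau> + cent y * ?jy) + cent x * ?jx"
    using assms(3,4) t z by (simp add: mob_imul[OF assms(1,2) t] QM_def)
  also have "\<dots> = (?jx * ?jy)\<^sup>2 * phi2 \<tau> + ?jx * (?jx * ?jy * cent y + cent x)"
    by (simp add: power2_eq_square algebra_simps)
  also have "\<dots> = (?jx * ?jy)\<^sup>2 * phi2 \<tau> + cent (imul x y) * (?jx * ?jy)"
    unfolding key by (simp add: algebra_simps)
  finally show "phi2 (mob (to_rmat (imul x y)) \<tau>) = (jf (to_rmat (imul x y)) \<tau>)\<^sup>2 * phi2 \<tau> + cent (imul x y) * jf (to_rmat (imul x y)) \<tau>"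
    unfolding jf_imul[OF assms(2) t] .
qed

lemma phi2_shift_nat: "\<tau> \<in> Hp \<Longrightarrow> phi2 (\<tau> + of_nat k) = phi2 \<tau>"
proof (induction k)
  case (Suc k)
  have "\<tau> + of_nat k \<in> Hp" using Suc.prems by (simp add: Hp_iff)
  from RN_periodic[OF RN_phi2 _ this] show ?case using Suc by (simp add: add_ac)
qed simp

lemma phi2_shift: assumes "\<tau> \<in> Hp" shows "phi2 (\<tau> + of_int k) = phi2 \<tau>"
proof (cases "k \<ge> 0")
  case True
  thus ?thesis using phi2_shift_nat[OF assms, of "nat k"] by simp
next
  case False
  have "\<tau> + of_int k \<in> Hp" using assms by (simp add: Hp_iff)
  from phi2_shift_nat[OF this, of "nat (- k)"] show ?thesis using False by simp
qed

lemma QM_0: assumes "(a, b, 0, d) \<in> SL2Z" shows "QM (a, b, 0, d)"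
proof -
  have "a * d = 1" using assms by (simp add: SL2Z_def)
  hence "a = 1 \<and> d = 1 \<or> a = -1 \<and> d = -1" by (rule zmult_eq_1_iff[THEN iffD1])
  thus ?thesis unfolding QM_def
    using phi2_shift[of _ b] phi2_shift[of _ "- b"] by (auto simp: mob_def jf_def to_rmat_def cent_def)
qed

lemma QM_S: "QM (0, -1, 1, 0)"
  unfolding QM_def
proof
  fix \<tau> assume t: "\<tau> \<in> Hp"
  hence t0: "\<tau> \<noteq> 0" by (auto simp: Hp_iff)
  have "G2 (- 1 / \<tau>) = \<tau>\<^sup>2 * G2 \<tau> - 2 * of_real pi * \<i> * \<tau>"
    using G2_S[OF t] t0 by (simp add: field_simps power2_eq_square)
  hence "phi2 (- 1 / \<tau>) = \<tau>\<^sup>2 * phi2 \<tau> + \<tau>"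
    by (simp add: phi2_def right_diff_distrib mult_ac)
  thus "phi2 (mob (to_rmat (0, - 1, 1, 0)) \<tau>) =
     (jf (to_rmat (0, - 1, 1, 0)) \<tau>)\<^sup>2 * phi2 \<tau> + cent (0, - 1, 1, 0) * jf (to_rmat (0, - 1, 1, 0)) \<tau>"
    by (simp add: mob_def jf_def to_rmat_def cent_def)
qed

text \<open>The Euclidean algorithm on the bottom row: factoring off a translation by d div c, the
  inversion and -1 replaces c by d mod c, of smaller absolute value.\<close>

lemma QM_SL2Z: "(a, b, c, d) \<in> SL2Z \<Longrightarrow> QM (a, b, c, d)"
proof (induction "nat \<bar>c\<bar>" arbitrary: a b c d rule: less_induct)
  case less
  show ?case
  proof (cases "c = 0")
    case True
    thus ?thesis using QM_0 less.prems by simp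
  next
    case False
    define k where "k = d div c"
    define B where "B = b - a * k"
    have dk: "d - c * k = d mod c" by (simp add: k_def minus_mult_div_eq_mod)
    have lt: "nat \<bar>d mod c\<bar> < nat \<bar>c\<bar>" using abs_mod_less[OF False, of d] by simp
    have det: "a * d - b * c = 1" using less.prems by (simp add: SL2Z_def)
    have "B * (- c) - (- a) * (d mod c) = a * d - b * c" unfolding dk[symmetric] B_def by (simp add: algebra_simps)
    hence g': "(B, - a, d mod c, - c) \<in> SL2Z" by (simp add: SL2Z_def det)
    have Q: "QM (B, - a, d mod c, - c)" by (rule less.hyps[OF lt g'])
    have S: "(0, -1, 1, 0) \<in> SL2Z" and I: "(-1, 0, 0, -1) \<in> SL2Z" and T: "(1, k, 0, 1) \<in> SL2Z" by (auto simp: SL2Z_def)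
    have "QM (imul (imul (imul (B, - a, d mod c, - c) (0, -1, 1, 0)) (-1, 0, 0, -1)) (1, k, 0, 1))"
      by (intro QM_imul imul_SL2Z g' S I T Q QM_S QM_0)
    moreover have "imul (imul (imul (B, - a, d mod c, - c) (0, -1, 1, 0)) (-1, 0, 0, -1)) (1, k, 0, 1) = (a, b, c, d)"
      unfolding dk[symmetric] B_def by (simp add: imul_def algebra_simps)
    ultimately show ?thesis by simp
  qed
qed

lemma phi2_mob: assumes "g \<in> SL2Z" "\<tau> \<in> Hp"
  shows "phi2 (mob (to_rmat g) \<tau>) = (jf (to_rmat g) \<tau>)\<^sup>2 * phi2 \<tau> + cent g * jf (to_rmat g) \<tau>"
  using QM_SL2Z assms unfolding QM_def by (cases g) blast

subsection \<open>Lifting modular forms\<close>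

text \<open>\<open>Fw\<close> behaves like the fourth power of the eta function: a nowhere vanishing form of weight two with a
  multiplier. Its primitive \<open>Fp\<close> serves as a new coordinate on the upper half plane in which the modular
  group acts by affine maps.\<close>

definition Fw :: "complex \<Rightarrow> complex" where
  "Fw = (SOME F. \<forall>\<tau>\<in>Hp. F \<tau> \<noteq> 0 \<and> (F has_field_derivative 2 * phi2 \<tau> * F \<tau>) (at \<tau>))"

lemma Fw: "\<tau> \<in> Hp \<Longrightarrow> Fw \<tau> \<noteq> 0" "\<tau> \<in> Hp \<Longrightarrow> (Fw has_field_derivative 2 * phi2 \<tau> * Fw \<tau>) (at \<tau>)"
proof -
  have "hol (\<lambda>\<tau>. 2 * phi2 \<tau>)" by (intro holomorphic_intros hol_phi2)
  from holomorphic_convex_primitive'[OF convex_Hp open_Hp this]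
  obtain g where g: "\<And>\<tau>. \<tau> \<in> Hp \<Longrightarrow> (g has_field_derivative 2 * phi2 \<tau>) (at \<tau> within Hp)" by blast
  have "((\<lambda>\<tau>. exp (g \<tau>)) has_field_derivative 2 * phi2 \<tau> * exp (g \<tau>)) (at \<tau>)" if "\<tau> \<in> Hp" for \<tau>
  proof -
    have "(g has_field_derivative 2 * phi2 \<tau>) (at \<tau>)" using g[OF that] at_within_open[OF that open_Hp] by simp
    thus ?thesis by (auto intro!: derivative_eq_intros)
  qed
  hence "\<exists>F. \<forall>\<tau>\<in>Hp. F \<tau> \<noteq> 0 \<and> (F has_field_derivative 2 * phi2 \<tau> * F \<tau>) (at \<tau>)"
    by (intro exI[of _ "\<lambda>\<tau>. exp (g \<tau>)"]) auto
  from someI_ex[OF this]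
  have "\<forall>\<tau>\<in>Hp. Fw \<tau> \<noteq> 0 \<and> (Fw has_field_derivative 2 * phi2 \<tau> * Fw \<tau>) (at \<tau>)" unfolding Fw_def .
  thus "\<tau> \<in> Hp \<Longrightarrow> Fw \<tau> \<noteq> 0" "\<tau> \<in> Hp \<Longrightarrow> (Fw has_field_derivative 2 * phi2 \<tau> * Fw \<tau>) (at \<tau>)" by blast+
qed

lemma hol_Fw: "hol Fw"
  using Fw(2) by (meson holomorphic_onI field_differentiable_at_within field_differentiable_def)

definition Fp :: "complex \<Rightarrow> complex" where
  "Fp = (SOME P. \<forall>\<tau>\<in>Hp. (P has_field_derivative Fw \<tau>) (at \<tau>))"

lemma Fp: "\<tau> \<in> Hp \<Longrightarrow> (Fp has_field_derivative Fw \<tau>) (at \<tau>)"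
proof -
  from holomorphic_convex_primitive'[OF convex_Hp open_Hp hol_Fw]
  obtain g where g: "\<And>\<tau>. \<tau> \<in> Hp \<Longrightarrow> (g has_field_derivative Fw \<tau>) (at \<tau> within Hp)" by blast
  hence "\<exists>P. \<forall>\<tau>\<in>Hp. (P has_field_derivative Fw \<tau>) (at \<tau>)"
    using at_within_open[OF _ open_Hp] by (intro exI[of _ g]) auto
  from someI_ex[OF this] show "\<tau> \<in> Hp \<Longrightarrow> (Fp has_field_derivative Fw \<tau>) (at \<tau>)"
    unfolding Fp_def by blast
qed

lemma hol_Fp: "hol Fp"
  using Fp by (meson holomorphic_onI field_differentiable_at_within field_differentiable_def)

lemma deriv_Fp: "\<tau> \<in> Hp \<Longrightarrow> deriv Fp \<tau> = Fw \<tau>" by (rule DERIV_imp_deriv[OF Fp])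

definition Gw :: "complex \<Rightarrow> complex" where "Gw \<tau> = 1 / Fw \<tau>"
text \<open>The correction h'^2 / (2 h) of a coordinate change for h = \<open>Gw\<close>, whose
  logarithmic derivative is -2 \<open>phi2\<close>.\<close>

definition Pw :: "complex \<Rightarrow> complex" where "Pw \<tau> = 2 * (phi2 \<tau>)\<^sup>2 * Gw \<tau>"

lemma hol_Gw: "hol Gw" unfolding Gw_def[abs_def] by (intro holomorphic_intros hol_Fw Fw(1))
lemma hol_Pw: "hol Pw" unfolding Pw_def[abs_def] by (intro holomorphic_intros hol_phi2 hol_Gw)

lemma DERIV_Gw: "\<tau> \<in> Hp \<Longrightarrow> (Gw has_field_derivative - 2 * phi2 \<tau> * Gw \<tau>) (at \<tau>)"
  unfolding Gw_def[abs_def] by (rule derivative_eq_intros Fw(2) refl | simp add: Fw(1))+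

text \<open>The quotient of both sides has derivative 0: the anomaly of \<open>phi2\<close> is
  precisely half the logarithmic derivative of the squared automorphy factor, up to the derivative
  of the Moebius map. Convexity of the half plane makes the quotient constant.\<close>

lemma Fw_mob: assumes g: "g \<in> SL2Z"
  obtains \<kappa> where "\<kappa> \<noteq> 0" "\<And>\<tau>. \<tau> \<in> Hp \<Longrightarrow> Fw (mob (to_rmat g) \<tau>) = \<kappa> * Fw \<tau> * hg (to_rmat g) \<tau>"
proof -
  let ?g = "to_rmat g"
  note s = sl2_to_rmat[OF g]
  define r where "r \<tau> = Fw (mob ?g \<tau>) / (Fw \<tau> * (jf ?g \<tau>)\<^sup>2)" for \<tau>
  have jD: "(jf ?g has_field_derivative cent g) (at \<tau>)" for \<tau>
    by (cases g) (simp add: to_rmat_def cent_def DERIV_jf[of _ _ "of_int _", simplified])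
  have "(r has_field_derivative 0) (at \<tau> within Hp)" if t: "\<tau> \<in> Hp" for \<tau>
  proof -
    define M where "M = mob ?g \<tau>"
    define j where "j = jf ?g \<tau>"
    have j0: "j \<noteq> 0" unfolding j_def by (rule jf_nz[OF s t])
    have F0: "Fw \<tau> \<noteq> 0" by (rule Fw(1)[OF t])
    have M: "M \<in> Hp" unfolding M_def by (rule mob_Hp[OF s t])
    have 1: "((\<lambda>\<tau>. Fw (mob ?g \<tau>)) has_field_derivative (2 * phi2 M * Fw M) * (1 / j\<^sup>2)) (at \<tau>)"
      using DERIV_chain2[OF Fw(2)[OF M[unfolded M_def]] DERIV_mob[OF s t]] by (simp add: M_def j_def)
    have 2: "((\<lambda>\<tau>. Fw \<tau> * (jf ?g \<tau>)\<^sup>2) has_field_derivative (2 * phi2 \<tau> * Fw \<tau>) * j\<^sup>2 + (2 * cent g * j) * Fw \<tau>) (at \<tau>)"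
      using DERIV_mult[OF Fw(2)[OF t] DERIV_power[OF jD, of 2]] by (simp add: j_def mult_ac)
    have p: "phi2 M = j\<^sup>2 * phi2 \<tau> + cent g * j" unfolding M_def j_def by (rule phi2_mob[OF g t])
    have "(r has_field_derivative (((2 * phi2 M * Fw M) * (1 / j\<^sup>2)) * (Fw \<tau> * (jf ?g \<tau>)\<^sup>2) -
       Fw (mob ?g \<tau>) * ((2 * phi2 \<tau> * Fw \<tau>) * j\<^sup>2 + (2 * cent g * j) * Fw \<tau>)) /
        ((Fw \<tau> * (jf ?g \<tau>)\<^sup>2) * (Fw \<tau> * (jf ?g \<tau>)\<^sup>2))) (at \<tau>)"
      unfolding r_def[abs_def] using j0 F0 by (intro DERIV_divide 1 2) (auto simp: j_def)
    moreover have "((2 * phi2 M * Fw M) * (1 / j\<^sup>2)) * (Fw \<tau> * (jf ?g \<tau>)\<^sup>2) -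
       Fw (mob ?g \<tau>) * ((2 * phi2 \<tau> * Fw \<tau>) * j\<^sup>2 + (2 * cent g * j) * Fw \<tau>) = 0"
    proof -
      have "((2 * phi2 M * Fw M) * (1 / j\<^sup>2)) * (Fw \<tau> * (jf ?g \<tau>)\<^sup>2) = 2 * phi2 M * Fw M * Fw \<tau>"
        using j0 by (simp add: j_def)
      thus ?thesis unfolding p by (simp add: M_def algebra_simps)
    qed
    ultimately show ?thesis by (simp add: has_field_derivative_at_within)
  qed
  from has_field_derivative_zero_constant[OF convex_Hp this]
  obtain \<kappa> where c: "\<And>\<tau>. \<tau> \<in> Hp \<Longrightarrow> r \<tau> = \<kappa>" by blast
  have i: "\<i> \<in> Hp" by (simp add: Hp_iff)
  have "r \<i> \<noteq> 0" unfolding r_def using Fw(1)[OF i] Fw(1)[OF mob_Hp[OF s i]] jf_nz[OF s i] by simp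
  hence "\<kappa> \<noteq> 0" using c[OF i] by simp
  moreover have "Fw (mob ?g \<tau>) = \<kappa> * Fw \<tau> * hg ?g \<tau>" if t: "\<tau> \<in> Hp" for \<tau>
    using c[OF t] Fw(1)[OF t] jf_nz[OF s t] by (simp add: r_def hg_def field_simps)
  ultimately show ?thesis by (rule that)
qed

section \<open>Monomials in the affine coordinate and their transformation\<close>

lemma ah_cmult: assumes "v \<in> D w" "hol h" shows "ah (\<lambda>\<tau>. c * h \<tau>) n v = fn (\<lambda>_. c) * ah h n v"
proof -
  have a: "aop k (fn (\<lambda>_. c) * u) = fn (\<lambda>_. c) * aop k u" if "u \<in> Dv" for u k
  proof (cases "k = 0")
    case True
    have "fn (deriv (\<lambda>_. c)) * u = 0" by (simp add: fn_0)
    thus ?thesis using aop_0_fn[OF that, of "\<lambda>_. c"] True by simp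
  qed (rule aop_fn)
  show ?thesis
    unfolding ah_def isum_mult_left[OF ah_fsup[OF assms], symmetric]
    by (rule isum_cong) (simp add: hb_cmult[OF assms] hb_cmult[OF aop_D[OF assms(1)] assms(2)] a[OF S_Dv[OF hb_D[OF assms]]])
qed

lemma be_cmult: assumes "v \<in> D w" "hol h" shows "be (\<lambda>\<tau>. c * h \<tau>) n v = fn (\<lambda>_. c) * be h n v"
  unfolding be_def isum_mult_left[OF be_fsup[OF assms], symmetric]
  by (rule isum_cong) (simp add: hb_cmult[OF assms] bop_fn mult_ac)

lemma ah_scalar: assumes "v \<in> D w" "hol h" shows "ah h n (fn (\<lambda>_. c) * v) = fn (\<lambda>_. c) * ah h n v"
proof -
  have a: "aop k (fn (\<lambda>_. c) * u) = fn (\<lambda>_. c) * aop k u" if "u \<in> Dv" for u k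
  proof (cases "k = 0")
    case True
    have "fn (deriv (\<lambda>_. c)) * u = 0" by (simp add: fn_0)
    thus ?thesis using aop_0_fn[OF that, of "\<lambda>_. c"] True by simp
  qed (rule aop_fn)
  show ?thesis
    unfolding ah_def isum_mult_left[OF ah_fsup[OF assms], symmetric]
    by (rule isum_cong) (simp add: hb_fn[OF assms(1)] hb_fn[OF aop_D[OF assms(1)]] a[OF S_Dv[OF hb_D[OF assms]]] a[OF S_Dv[OF assms(1)]])
qed

lemma be_scalar: assumes "v \<in> D w" "hol h" shows "be h n (fn (\<lambda>_. c) * v) = fn (\<lambda>_. c) * be h n v"
  unfolding be_def isum_mult_left[OF be_fsup[OF assms], symmetric]
  by (rule isum_cong, subst hb_fn[OF assms(1)]) (simp_all add: bop_fn mult_ac)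

text \<open>What \<open>Am\<close> would be for the coordinate \<open>Fp\<close>. It is not an
  instance of \<open>coordinate_change\<close>, which asks for a map of the half plane into
  itself.\<close>

definition Aw :: "int \<Rightarrow> dch \<Rightarrow> dch" where "Aw n v = ah Gw n v + be Pw n v"

lemma Aw_D: "v \<in> D w \<Longrightarrow> Aw n v \<in> D (w - n)"
  unfolding Aw_def by (intro S_add ah_D be_D hol_Gw hol_Pw)

lemma Aw_scalar: "v \<in> D w \<Longrightarrow> Aw n (fn (\<lambda>_. c) * v) = fn (\<lambda>_. c) * Aw n v"
  by (simp add: Aw_def ah_scalar[OF _ hol_Gw] be_scalar[OF _ hol_Pw] distrib_left)

definition Lw :: "mon \<Rightarrow> (complex \<Rightarrow> complex) \<Rightarrow> dch" where "Lw p f = lift_op Gw Pw Fp p f"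

lemma fn_scalar_mult: "fn (\<lambda>_. a) * (fn (\<lambda>_. b) * v) = fn (\<lambda>_. a * b) * v"
  by (simp add: fn_mult[of "\<lambda>_. a" "\<lambda>_. b"] mult.assoc)

context
  fixes g :: imat and \<kappa> :: complex
  assumes g: "g \<in> SL2Z" and chi: "\<kappa> \<noteq> 0"
    and Fg: "\<And>\<tau>. \<tau> \<in> Hp \<Longrightarrow> Fw (mob (to_rmat g) \<tau>) = \<kappa> * Fw \<tau> * hg (to_rmat g) \<tau>"
begin

interpretation cg: coordinate_change "hg (to_rmat g)" "qg (to_rmat g)" "mob (to_rmat g)"
  by (rule coordinate_change_mob[OF sl2_to_rmat[OF g]])

text \<open>Covariance of a under composition of coordinates: \<open>Fp\<close> composed with the
  Moebius map is affine in \<open>Fp\<close>, so the new a can only be rescaled. The current part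
  follows from the weight of \<open>Gw\<close>; the b_{-1} part is the identity
  \<open>total\<close>.\<close>

lemma PI_Aw: assumes v: "v \<in> D w" shows "cg.PI (Aw n v) = fn (\<lambda>_. 1 / \<kappa>) * Aw n (cg.PI v)"
proof -
  let ?g = "to_rmat g" and ?u = "cg.PI v"
  let ?K = "\<lambda>\<tau>. Gw (mob ?g \<tau>)"
  note s = sl2_to_rmat[OF g]
  note u = cg.PI_D[OF v]
  have K: "hol ?K" by (rule cg.hol_comp[OF hol_Gw])
  have jD: "(jf ?g has_field_derivative cent g) (at \<tau>)" for \<tau>
    by (cases g) (simp add: to_rmat_def cent_def DERIV_jf[of _ _ "of_int _", simplified])
  have K_eq: "?K \<tau> = 1 / \<kappa> * Gw \<tau> / (jf ?g \<tau>)\<^sup>2" if "\<tau> \<in> Hp" for \<tau>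
    using Fg[OF that] by (simp add: Gw_def hg_def)
  have hK: "hg ?g \<tau> * ?K \<tau> = 1 / \<kappa> * Gw \<tau>" if "\<tau> \<in> Hp" for \<tau>
    using K_eq[OF that] jf_nz[OF s that] by (simp add: hg_def)
  have K': "deriv ?K \<tau> = 1 / \<kappa> * Gw \<tau> * (- 2 * phi2 \<tau> / (jf ?g \<tau>)\<^sup>2 - 2 * cent g / (jf ?g \<tau>) ^ 3)" if t: "\<tau> \<in> Hp" for \<tau>
  proof (rule DERIV_imp_deriv)
    have j0: "jf ?g \<tau> \<noteq> 0" by (rule jf_nz[OF s t])
    have "((\<lambda>\<tau>. 1 / \<kappa> * Gw \<tau> / (jf ?g \<tau>)\<^sup>2) has_field_derivative
       ((1 / \<kappa> * (- 2 * phi2 \<tau> * Gw \<tau>)) * (jf ?g \<tau>)\<^sup>2 - (1 / \<kappa> * Gw \<tau>) * (2 * (jf ?g \<tau> * cent g))) / ((jf ?g \<tau>)\<^sup>2 * (jf ?g \<tau>)\<^sup>2)) (at \<tau>)"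
      using j0 DERIV_power[OF jD, of 2 \<tau>] by (intro DERIV_divide DERIV_cmult DERIV_Gw t) (auto simp: mult_ac)
    also have "((1 / \<kappa> * (- 2 * phi2 \<tau> * Gw \<tau>)) * (jf ?g \<tau>)\<^sup>2 - (1 / \<kappa> * Gw \<tau>) * (2 * (jf ?g \<tau> * cent g))) / ((jf ?g \<tau>)\<^sup>2 * (jf ?g \<tau>)\<^sup>2) =
       1 / \<kappa> * Gw \<tau> * (- 2 * phi2 \<tau> / (jf ?g \<tau>)\<^sup>2 - 2 * cent g / (jf ?g \<tau>) ^ 3)"
    proof -
      have "(x * (- 2 * p * G) * j\<^sup>2 - x * G * (2 * (j * c))) / (j\<^sup>2 * j\<^sup>2) = x * G * (- 2 * p / j\<^sup>2 - 2 * c / j ^ 3)" if "j \<noteq> 0" for x p G j c :: complex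
        using that by (simp add: field_simps power2_eq_square power3_eq_cube)
      thus ?thesis using j0 by blast
    qed
    finally show "(?K has_field_derivative 1 / \<kappa> * Gw \<tau> * (- 2 * phi2 \<tau> / (jf ?g \<tau>)\<^sup>2 - 2 * cent g / (jf ?g \<tau>) ^ 3)) (at \<tau>)"
      by (rule has_field_derivative_transform_within_open[OF _ open_Hp t]) (simp add: K_eq)
  qed
  have dh: "deriv (hg ?g) \<tau> = 2 * cent g * jf ?g \<tau>" for \<tau>
    by (cases g) (simp add: to_rmat_def cent_def deriv_hg)
  have dq: "deriv (qg ?g) \<tau> = 2 * (cent g)\<^sup>2" for \<tau>
    by (cases g) (simp add: to_rmat_def cent_def deriv_qg)
  \<comment> \<open>Three corrections meet: from reassociating, from the image of a, and from
    transforming \<open>Pw\<close>. With p for \<open>phi2\<close>, j for \<open>jf\<close> and c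
    the lower left entry, they are proportional to -4 c p / j - 4 c^2 / j^2, to 2 c^2 / j^2 and to 2
    (p + c / j)^2, with sum 2 p^2.\<close>
  have total: "deriv (hg ?g) \<tau> * deriv ?K \<tau> + deriv (qg ?g) \<tau> * ?K \<tau> + deriv (mob ?g) \<tau> * Pw (mob ?g \<tau>) = 1 / \<kappa> * Pw \<tau>"
    if t: "\<tau> \<in> Hp" for \<tau>
  proof -
    have j0: "jf ?g \<tau> \<noteq> 0" by (rule jf_nz[OF s t])
    have al: "2 * c * j * (pmode * (- 2 * p / j\<^sup>2 - 2 * c / j ^ 3)) + 2 * c\<^sup>2 * (pmode / j\<^sup>2) + 1 / j\<^sup>2 * (2 * (j\<^sup>2 * p + c * j)\<^sup>2 * (pmode / j\<^sup>2)) = pmode * (2 * p\<^sup>2)"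
      if "j \<noteq> 0" for c j pmode p :: complex
    proof -
      define i where "i = 1 / j"
      have ij: "i * j = 1" "j * i = 1" using that by (simp_all add: i_def)
      have e1: "- 2 * p / j\<^sup>2 - 2 * c / j ^ 3 = - 2 * p * i\<^sup>2 - 2 * c * i ^ 3" by (simp add: i_def power_divide)
      have e2: "pmode / j\<^sup>2 = pmode * i\<^sup>2" "1 / j\<^sup>2 = i\<^sup>2" by (simp_all add: i_def power_divide)
      have e3: "2 * c * j * (pmode * (- 2 * p * i\<^sup>2 - 2 * c * i ^ 3)) = (i * j) * pmode * (- 4 * c * p * i - 4 * c\<^sup>2 * i\<^sup>2)"
        by (simp add: algebra_simps power2_eq_square power3_eq_cube)
      have e4: "i\<^sup>2 * (2 * (j\<^sup>2 * p + c * j)\<^sup>2 * (pmode * i\<^sup>2)) = 2 * pmode * ((i * j) * (i * j) * p + c * i * (i * j))\<^sup>2"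
        by (simp add: algebra_simps power2_eq_square)
      show ?thesis unfolding e1 e2 e3 e4 ij by (simp add: algebra_simps power2_eq_square)
    qed
    have "Pw (mob ?g \<tau>) = 2 * ((jf ?g \<tau>)\<^sup>2 * phi2 \<tau> + cent g * jf ?g \<tau>)\<^sup>2 * (1 / \<kappa> * Gw \<tau> / (jf ?g \<tau>)\<^sup>2)"
      unfolding Pw_def phi2_mob[OF g t] K_eq[OF t] ..
    thus ?thesis
      unfolding dh dq K'[OF t] K_eq[OF t] deriv_mob[OF s t] hg_def
      using al[OF j0, of "cent g" "1 / \<kappa> * Gw \<tau>" "phi2 \<tau>"] by (simp only:) (simp add: Pw_def)
  qed
  have h1: "hol (\<lambda>\<tau>. deriv (hg ?g) \<tau> * deriv ?K \<tau>)" by (intro holomorphic_intros hol_deriv K hol_hg)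
  have h2: "hol (\<lambda>\<tau>. deriv (qg ?g) \<tau> * ?K \<tau>)" by (intro holomorphic_intros hol_deriv K cg.hol_q)
  have h3: "hol (\<lambda>\<tau>. deriv (mob ?g) \<tau> * Pw (mob ?g \<tau>))"
    by (intro holomorphic_intros hol_deriv cg.hol_phi cg.hol_comp[OF hol_Pw])
  have h12: "hol (\<lambda>\<tau>. deriv (hg ?g) \<tau> * deriv ?K \<tau> + deriv (qg ?g) \<tau> * ?K \<tau>)" by (intro holomorphic_intros h1 h2)
  have "cg.PI (Aw n v) = cg.PI (ah Gw n v) + cg.PI (be Pw n v)"
    unfolding Aw_def by (rule cg.PI_plus[OF ah_D[OF v hol_Gw] be_D[OF v hol_Pw]])
  also have "\<dots> = ah (\<lambda>\<tau>. hg ?g \<tau> * ?K \<tau>) n ?u + (be (\<lambda>\<tau>. deriv (hg ?g) \<tau> * deriv ?K \<tau>) n ?u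
     + be (\<lambda>\<tau>. deriv (qg ?g) \<tau> * ?K \<tau>) n ?u + be (\<lambda>\<tau>. deriv (mob ?g) \<tau> * Pw (mob ?g \<tau>)) n ?u)"
    by (simp only: cg.PI_ah[OF v hol_Gw] cg.PI_be[OF v hol_Pw] add.assoc)
  also have "\<dots> = ah (\<lambda>\<tau>. 1 / \<kappa> * Gw \<tau>) n ?u + be (\<lambda>\<tau>. 1 / \<kappa> * Pw \<tau>) n ?u"
  proof (rule arg_cong2[where f = "(+)"])
    show "ah (\<lambda>\<tau>. hg ?g \<tau> * ?K \<tau>) n ?u = ah (\<lambda>\<tau>. 1 / \<kappa> * Gw \<tau>) n ?u"
      by (rule ah_cong[OF _ u]) (rule hK)
    show "be (\<lambda>\<tau>. deriv (hg ?g) \<tau> * deriv ?K \<tau>) n ?u + be (\<lambda>\<tau>. deriv (qg ?g) \<tau> * ?K \<tau>) n ?u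
       + be (\<lambda>\<tau>. deriv (mob ?g) \<tau> * Pw (mob ?g \<tau>)) n ?u = be (\<lambda>\<tau>. 1 / \<kappa> * Pw \<tau>) n ?u"
      unfolding be_add[OF u h1 h2, symmetric] be_add[OF u h12 h3, symmetric]
      by (rule be_cong[OF _ u]) (rule total)
  qed
  also have "\<dots> = fn (\<lambda>_. 1 / \<kappa>) * Aw n ?u"
    by (simp only: ah_cmult[OF u hol_Gw] be_cmult[OF u hol_Pw] Aw_def distrib_left)
  finally show ?thesis .
qed

text \<open>\<open>Fp\<close> composed with the Moebius map is \<open>\<kappa>\<close>
  \<open>Fp\<close> + c by comparing derivatives. A constant function has no nonzero modes, so c
  disappears.\<close>

lemma PI_hb_Fp: assumes v: "v \<in> D w" and n: "n \<noteq> 0"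
  shows "cg.PI (hb Fp n v) = fn (\<lambda>_. \<kappa>) * hb Fp n (cg.PI v)"
proof -
  let ?g = "to_rmat g" and ?u = "cg.PI v"
  note s = sl2_to_rmat[OF g] and u = cg.PI_D[OF v]
  have "((\<lambda>\<tau>. Fp (mob ?g \<tau>) - \<kappa> * Fp \<tau>) has_field_derivative 0) (at \<tau> within Hp)" if t: "\<tau> \<in> Hp" for \<tau>
  proof -
    have j0: "jf ?g \<tau> \<noteq> 0" by (rule jf_nz[OF s t])
    have "((\<lambda>\<tau>. Fp (mob ?g \<tau>) - \<kappa> * Fp \<tau>) has_field_derivative Fw (mob ?g \<tau>) * (1 / (jf ?g \<tau>)\<^sup>2) - \<kappa> * Fw \<tau>) (at \<tau>)"
      by (intro DERIV_diff DERIV_cmult Fp[OF t] DERIV_chain2[OF Fp[OF mob_Hp[OF s t]] DERIV_mob[OF s t]])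
    moreover have "Fw (mob ?g \<tau>) * (1 / (jf ?g \<tau>)\<^sup>2) - \<kappa> * Fw \<tau> = 0"
      unfolding Fg[OF t] hg_def using j0 by simp
    ultimately show ?thesis by (simp add: has_field_derivative_at_within)
  qed
  from has_field_derivative_zero_constant[OF convex_Hp this]
  obtain c where c: "\<And>\<tau>. \<tau> \<in> Hp \<Longrightarrow> Fp (mob ?g \<tau>) - \<kappa> * Fp \<tau> = c" by blast
  have "cg.PI (hb Fp n v) = hb (\<lambda>\<tau>. Fp (mob ?g \<tau>)) n ?u" by (rule cg.PI_hb[OF v hol_Fp])
  also have "\<dots> = hb (\<lambda>\<tau>. \<kappa> * Fp \<tau> + c) n ?u"
    by (rule hb_cong[OF _ u]) (use c in \<open>auto simp: algebra_simps\<close>)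
  also have "\<dots> = hb (\<lambda>\<tau>. \<kappa> * Fp \<tau>) n ?u + hb (\<lambda>_. c) n ?u"
    by (rule hb_add[OF u]) (auto intro!: holomorphic_intros hol_Fp)
  also have "\<dots> = fn (\<lambda>_. \<kappa>) * hb Fp n ?u" using n by (simp add: hb_cmult[OF u hol_Fp] hb_const[OF u])
  finally show ?thesis .
qed

lemma PI_foldr_Fp:
  assumes f: "hol f" and "\<forall>y\<in>set ys. y > 0"
  shows "foldr (\<lambda>n. hb Fp (- int n)) ys (cst f) \<in> D (int (sum_list ys)) \<and>
    cg.PI (foldr (\<lambda>n. hb Fp (- int n)) ys (cst f)) =
    fn (\<lambda>_. \<kappa> ^ length ys) * foldr (\<lambda>n. hb Fp (- int n)) ys (cst (\<lambda>\<tau>. f (mob (to_rmat g) \<tau>)))"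
  using assms(2)
proof (induction ys)
  case Nil
  show ?case using cst_D[OF f] cg.PI_cst[OF f] fn_1[OF S_Dv[OF cst_D[OF cg.hol_comp[OF f]]]] by simp
next
  case (Cons y ys)
  let ?v = "foldr (\<lambda>n. hb Fp (- int n)) ys (cst f)"
  let ?u = "foldr (\<lambda>n. hb Fp (- int n)) ys (cst (\<lambda>\<tau>. f (mob (to_rmat g) \<tau>)))"
  have IH: "?v \<in> D (int (sum_list ys))" "cg.PI ?v = fn (\<lambda>_. \<kappa> ^ length ys) * ?u" using Cons by auto
  have uD: "?u \<in> D (int (sum_list ys))"
    using FD_D[OF conjunct1[OF lift_lead_b[OF hol_Gw hol_Pw hol_Fp cg.hol_comp[OF f], of ys]]] Cons.prems by simp
  have 1: "hb Fp (- int y) ?v \<in> D (int (sum_list (y # ys)))"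
    using hb_D[OF IH(1) hol_Fp, of "- int y"] by (simp add: add.commute)
  have "cg.PI (hb Fp (- int y) ?v) = fn (\<lambda>_. \<kappa>) * hb Fp (- int y) (cg.PI ?v)"
    using Cons.prems by (intro PI_hb_Fp[OF IH(1)]) auto
  also have "hb Fp (- int y) (cg.PI ?v) = fn (\<lambda>_. \<kappa> ^ length ys) * hb Fp (- int y) ?u"
    unfolding IH(2) by (rule hb_fn[OF uD]) auto
  finally show ?case using 1 by (simp add: fn_scalar_mult)
qed

lemma PI_foldr_Aw:
  assumes v: "v \<in> D w" "u \<in> D w" "cg.PI v = fn (\<lambda>_. c) * u"
  shows "foldr (\<lambda>n. Aw (- int n)) xs v \<in> D (w + int (sum_list xs)) \<and>
    foldr (\<lambda>n. Aw (- int n)) xs u \<in> D (w + int (sum_list xs)) \<and>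
    cg.PI (foldr (\<lambda>n. Aw (- int n)) xs v) = fn (\<lambda>_. c / \<kappa> ^ length xs) * foldr (\<lambda>n. Aw (- int n)) xs u"
proof (induction xs)
  case Nil
  thus ?case using v by simp
next
  case (Cons x xs)
  let ?v = "foldr (\<lambda>n. Aw (- int n)) xs v" and ?u = "foldr (\<lambda>n. Aw (- int n)) xs u"
  have D: "Aw (- int x) ?v \<in> D (w + int (sum_list (x # xs)))" "Aw (- int x) ?u \<in> D (w + int (sum_list (x # xs)))"
    using Aw_D[OF conjunct1[OF Cons], of "- int x"] Aw_D[OF conjunct1[OF conjunct2[OF Cons]], of "- int x"]
    by (simp_all add: algebra_simps)
  have "cg.PI (Aw (- int x) ?v) = fn (\<lambda>_. 1 / \<kappa>) * Aw (- int x) (cg.PI ?v)"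
    using PI_Aw[of ?v] Cons by blast
  also have "cg.PI ?v = fn (\<lambda>_. c / \<kappa> ^ length xs) * ?u" using Cons by blast
  also have "Aw (- int x) (fn (\<lambda>_. c / \<kappa> ^ length xs) * ?u) = fn (\<lambda>_. c / \<kappa> ^ length xs) * Aw (- int x) ?u"
    using Aw_scalar[of ?u] Cons by blast
  finally show ?case using D by (simp add: fn_scalar_mult)
qed

lemma PI_Lw:
  assumes f: "hol f" and p: "p \<in> mons w"
  shows "cg.PI (Lw p f) = fn (\<lambda>_. \<kappa> ^ size (snd p) / \<kappa> ^ size (fst p)) * Lw p (\<lambda>\<tau>. f (mob (to_rmat g) \<tau>))"
proof -
  let ?xs = "sorted_list_of_multiset (fst p)" and ?ys = "sorted_list_of_multiset (snd p)"
  have len: "length ?xs = size (fst p)" "length ?ys = size (snd p)"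
    by (metis mset_sorted_list_of_multiset size_mset)+
  have pos: "\<forall>y\<in>set ?ys. y > 0" using p by (auto simp: mons_def intro!: gr0I)
  note B = PI_foldr_Fp[OF f pos]
  have uD: "foldr (\<lambda>n. hb Fp (- int n)) ?ys (cst (\<lambda>\<tau>. f (mob (to_rmat g) \<tau>))) \<in> D (int (sum_list ?ys))"
    using FD_D[OF conjunct1[OF lift_lead_b[OF hol_Gw hol_Pw hol_Fp cg.hol_comp[OF f] pos]]] .
  from PI_foldr_Aw[OF conjunct1[OF B] uD conjunct2[OF B], of ?xs]
  show ?thesis unfolding Lw_def lift_op_def Aw_def[abs_def] len by (simp add: len)
qed

end

lemma Lw_cong: "(\<And>\<tau>. \<tau> \<in> Hp \<Longrightarrow> f \<tau> = k \<tau>) \<Longrightarrow> Lw p f = Lw p k"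
  unfolding Lw_def lift_op_def using cst_cong[of f k] by simp

lemma Lw_scalar: assumes f: "hol f" and p: "p \<in> mons w"
  shows "Lw p (\<lambda>\<tau>. c * f \<tau>) = fn (\<lambda>_. c) * Lw p f"
proof -
  let ?xs = "sorted_list_of_multiset (fst p)" and ?ys = "sorted_list_of_multiset (snd p)"
  have pos: "\<forall>y\<in>set ?ys. y > 0" using p by (auto simp: mons_def intro!: gr0I)
  have B: "foldr (\<lambda>n. hb Fp (- int n)) ys (fn (\<lambda>_. c) * v) = fn (\<lambda>_. c) * foldr (\<lambda>n. hb Fp (- int n)) ys v
     \<and> foldr (\<lambda>n. hb Fp (- int n)) ys v \<in> D (w' + int (sum_list ys))" if "v \<in> D w'" for v w' ys
  proof (induction ys)
    case (Cons y ys)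
    let ?v = "foldr (\<lambda>n. hb Fp (- int n)) ys v"
    have "hb Fp (- int y) (fn (\<lambda>_. c) * ?v) = fn (\<lambda>_. c) * hb Fp (- int y) ?v"
      using Cons by (intro hb_fn) auto
    moreover have "hb Fp (- int y) ?v \<in> D (w' + int (sum_list (y # ys)))"
      using hb_D[OF conjunct2[OF Cons] hol_Fp, of "- int y"] by (simp add: algebra_simps)
    ultimately show ?case using Cons by simp
  qed (use that in simp)
  have A: "foldr (\<lambda>n. Aw (- int n)) xs (fn (\<lambda>_. c) * v) = fn (\<lambda>_. c) * foldr (\<lambda>n. Aw (- int n)) xs v
     \<and> foldr (\<lambda>n. Aw (- int n)) xs v \<in> D (w' + int (sum_list xs))" if "v \<in> D w'" for v w' xs
  proof (induction xs)
    case (Cons x xs)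
    let ?v = "foldr (\<lambda>n. Aw (- int n)) xs v"
    have "Aw (- int x) (fn (\<lambda>_. c) * ?v) = fn (\<lambda>_. c) * Aw (- int x) ?v"
      using Cons by (intro Aw_scalar) auto
    moreover have "Aw (- int x) ?v \<in> D (w' + int (sum_list (x # xs)))"
      using Aw_D[OF conjunct2[OF Cons], of "- int x"] by (simp add: algebra_simps)
    ultimately show ?case using Cons by simp
  qed (use that in simp)
  have Lw: "Lw p k = foldr (\<lambda>n. Aw (- int n)) ?xs (foldr (\<lambda>n. hb Fp (- int n)) ?ys (cst k))" for k
    by (simp add: Lw_def lift_op_def Aw_def[abs_def])
  note B' = B[OF cst_D[OF f], of ?ys]
  have "Lw p (\<lambda>\<tau>. c * f \<tau>) = foldr (\<lambda>n. Aw (- int n)) ?xs (fn (\<lambda>_. c) * foldr (\<lambda>n. hb Fp (- int n)) ?ys (cst f))"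
    unfolding Lw conjunct1[OF B', symmetric] fn_cst ..
  also have "\<dots> = fn (\<lambda>_. c) * Lw p f" unfolding Lw by (rule conjunct1[OF A[OF conjunct2[OF B']]])
  finally show ?thesis .
qed

text \<open>Each b factor of the monomial gains \<open>\<kappa>\<close> and each a factor
  \<open>1 / \<kappa>\<close>, in total the d-th power of \<open>\<kappa>\<close>; dividing f by the
  d-th power of \<open>Fw\<close> cancels it and accounts for weight 2 d.\<close>

definition Lift :: "mon \<Rightarrow> nat \<Rightarrow> (complex \<Rightarrow> complex) \<Rightarrow> dch" where
  "Lift p d f = Lw p (\<lambda>\<tau>. f \<tau> / Fw \<tau> ^ d)"

lemma hol_div_Fw: "hol f \<Longrightarrow> hol (\<lambda>\<tau>. f \<tau> / Fw \<tau> ^ d)"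
  by (intro holomorphic_intros hol_Fw) (auto simp: Fw(1))

text \<open>Stated for every holomorphic f: the action on lifts is the slash action of weight 2 d on
  functions. Invariance and the behaviour at all cusps are both read off from this.\<close>

lemma PIg_Lift:
  assumes g: "g \<in> SL2Z" and f: "hol f" and p: "p \<in> mons w" "mdeg p = int d"
  shows "PIg (to_rmat g) (Lift p d f) = Lift p d (\<lambda>\<tau>. f (mob (to_rmat g) \<tau>) / jf (to_rmat g) \<tau> ^ (2 * d))"
proof -
  let ?g = "to_rmat g"
  obtain \<kappa> where chi: "\<kappa> \<noteq> 0" "\<And>\<tau>. \<tau> \<in> Hp \<Longrightarrow> Fw (mob ?g \<tau>) = \<kappa> * Fw \<tau> * hg ?g \<tau>"
    using Fw_mob[OF g] by blast
  let ?f = "\<lambda>\<tau>. f (mob ?g \<tau>) / jf ?g \<tau> ^ (2 * d)"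
  let ?c = "\<kappa> ^ size (snd p) / \<kappa> ^ size (fst p)"
  have sz: "size (snd p) = d + size (fst p)" using p(2) by (simp add: mdeg_def)
  have s: "sl2 ?g" by (rule sl2_to_rmat[OF g])
  interpret cg: coordinate_change "hg ?g" "qg ?g" "mob ?g" by (rule coordinate_change_mob[OF s])
  have hf: "hol ?f" using jf_nz[OF s] by (intro holomorphic_intros hol_jf cg.hol_comp[OF f]) auto
  have "PIg ?g (Lift p d f) = fn (\<lambda>_. ?c) * Lw p (\<lambda>\<tau>. f (mob ?g \<tau>) / Fw (mob ?g \<tau>) ^ d)"
    unfolding PIg_def Lift_def by (rule PI_Lw[OF g chi hol_div_Fw[OF f] p(1)])
  also have "Lw p (\<lambda>\<tau>. f (mob ?g \<tau>) / Fw (mob ?g \<tau>) ^ d) = Lw p (\<lambda>\<tau>. 1 / \<kappa> ^ d * (?f \<tau> / Fw \<tau> ^ d))"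
    by (rule Lw_cong) (simp add: chi(2) hg_def power_mult_distrib power_mult)
  also have "\<dots> = fn (\<lambda>_. 1 / \<kappa> ^ d) * Lift p d ?f"
    unfolding Lift_def by (rule Lw_scalar[OF hol_div_Fw[OF hf] p(1)])
  also have "fn (\<lambda>_. ?c) * (fn (\<lambda>_. 1 / \<kappa> ^ d) * Lift p d ?f) = fn (\<lambda>_. 1) * Lift p d ?f"
  proof -
    have "?c * (1 / \<kappa> ^ d) = 1" using chi(1) by (simp add: sz power_add)
    thus ?thesis by (simp only: fn_scalar_mult)
  qed
  also have "\<dots> = Lift p d ?f"
    unfolding Lift_def Lw_def
    by (rule fn_1[OF S_Dv[OF FD_D[OF lift_lead(2)[OF hol_Gw hol_Pw hol_Fp hol_div_Fw[OF hf] p(1)]]]])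
  finally show ?thesis .
qed

text \<open>\<open>Fw\<close> carries a multiplier, so coefficients are tracked as a power of
  \<open>Fw\<close> times a function with a holomorphic expansion of period N. Differentiation
  preserves the class with the same exponent k, because the logarithmic derivative 2
  \<open>phi2\<close> of \<open>Fw\<close> has such an expansion.\<close>

definition FR :: "nat \<Rightarrow> int \<Rightarrow> (complex \<Rightarrow> complex) \<Rightarrow> bool" where
  "FR N k h \<longleftrightarrow> (\<exists>r. RN N r \<and> (\<forall>\<tau>\<in>Hp. h \<tau> = Fw \<tau> powi k * r \<tau>))"

definition CR :: "nat \<Rightarrow> int \<Rightarrow> dch \<Rightarrow> bool" where "CR N k v \<longleftrightarrow> (\<forall>p. FR N k (v p))"

lemma FR_I: "RN N r \<Longrightarrow> (\<And>\<tau>. \<tau> \<in> Hp \<Longrightarrow> h \<tau> = Fw \<tau> powi k * r \<tau>) \<Longrightarrow> FR N k h"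
  by (auto simp: FR_def)

lemma FR_cong: "(\<And>\<tau>. \<tau> \<in> Hp \<Longrightarrow> f \<tau> = g \<tau>) \<Longrightarrow> FR N k f \<Longrightarrow> FR N k g"
  by (auto simp: FR_def)

lemma FR_add: assumes "FR N k f" "FR N k g" shows "FR N k (\<lambda>\<tau>. f \<tau> + g \<tau>)"
proof -
  from assms obtain r s where r: "RN N r" "\<And>\<tau>. \<tau> \<in> Hp \<Longrightarrow> f \<tau> = Fw \<tau> powi k * r \<tau>"
    and s: "RN N s" "\<And>\<tau>. \<tau> \<in> Hp \<Longrightarrow> g \<tau> = Fw \<tau> powi k * s \<tau>" unfolding FR_def by blast
  show ?thesis by (rule FR_I[OF RN_add[OF r(1) s(1)]]) (simp add: r s distrib_left)
qed

lemma FR_mult: assumes "FR N k f" "FR N i g" shows "FR N (k + i) (\<lambda>\<tau>. f \<tau> * g \<tau>)"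
proof -
  from assms obtain r s where r: "RN N r" "\<And>\<tau>. \<tau> \<in> Hp \<Longrightarrow> f \<tau> = Fw \<tau> powi k * r \<tau>"
    and s: "RN N s" "\<And>\<tau>. \<tau> \<in> Hp \<Longrightarrow> g \<tau> = Fw \<tau> powi i * s \<tau>" unfolding FR_def by blast
  show ?thesis by (rule FR_I[OF RN_mult[OF r(1) s(1)]]) (simp add: r s power_int_add Fw(1))
qed

lemma FR_RN: "RN N r \<Longrightarrow> FR N 0 r" by (rule FR_I) auto

lemma FR_cmult: "FR N k f \<Longrightarrow> FR N k (\<lambda>\<tau>. c * f \<tau>)"
  using FR_mult[OF FR_RN[OF RN_const], of N k f c] by simp

lemma FR_0: "FR N k (\<lambda>_. 0)" by (rule FR_I[OF RN_const[of N 0]]) simp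

lemma FR_deriv: assumes "FR N k h" "N > 0" shows "FR N k (deriv h)"
proof -
  from assms obtain r where r: "RN N r" "\<And>\<tau>. \<tau> \<in> Hp \<Longrightarrow> h \<tau> = Fw \<tau> powi k * r \<tau>" unfolding FR_def by blast
  have hr: "hol r" by (rule RN_hol[OF r(1) assms(2)])
  have "deriv h \<tau> = Fw \<tau> powi k * ((2 * of_int k) * (phi2 \<tau> * r \<tau>) + deriv r \<tau>)" if t: "\<tau> \<in> Hp" for \<tau>
  proof (rule DERIV_imp_deriv)
    have "(r has_field_derivative deriv r \<tau>) (at \<tau>)" by (rule holomorphic_derivI[OF hr open_Hp t])
    from DERIV_mult[OF DERIV_power_int[OF Fw(2)[OF t] disjI2[OF Fw(1)[OF t]], of k] this]
    have "((\<lambda>\<tau>. Fw \<tau> powi k * r \<tau>) has_field_derivative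
      (of_int k * Fw \<tau> powi (k - 1) * (2 * phi2 \<tau> * Fw \<tau>)) * r \<tau> + deriv r \<tau> * Fw \<tau> powi k) (at \<tau>)" .
    also have "of_int k * Fw \<tau> powi (k - 1) * (2 * phi2 \<tau> * Fw \<tau>) = of_int k * (2 * phi2 \<tau>) * Fw \<tau> powi k"
      using Fw(1)[OF t] by (simp add: power_int_diff)
    finally have "((\<lambda>\<tau>. Fw \<tau> powi k * r \<tau>) has_field_derivative
      Fw \<tau> powi k * ((2 * of_int k) * (phi2 \<tau> * r \<tau>) + deriv r \<tau>)) (at \<tau>)" by (simp add: algebra_simps)
    thus "(h has_field_derivative Fw \<tau> powi k * ((2 * of_int k) * (phi2 \<tau> * r \<tau>) + deriv r \<tau>)) (at \<tau>)"
      by (rule has_field_derivative_transform_within_open[OF _ open_Hp t]) (simp add: r(2))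
  qed
  moreover have "RN N (\<lambda>\<tau>. (2 * of_int k) * (phi2 \<tau> * r \<tau>) + deriv r \<tau>)"
    by (intro RN_add RN_mult RN_const RN_phi2' RN_deriv r assms(2))
  ultimately show ?thesis by (intro FR_I) auto
qed

lemma FR_tc: assumes "FR N k h" "N > 0" shows "FR N k (tc h l)"
proof -
  have "FR N k ((deriv ^^ l) h)" using assms by (induction l) (auto intro: FR_deriv)
  from FR_cmult[OF this, of "1 / fact l"] show ?thesis by (simp add: tc_def)
qed

lemma CR_0: "CR N k 0" by (simp add: CR_def zero_fun_def FR_0)

lemma CR_add: "CR N k v \<Longrightarrow> CR N k u \<Longrightarrow> CR N k (v + u)"
  unfolding CR_def by (auto intro: FR_cong[OF _ FR_add] simp: pointwise)

lemma CR_fn: "FR N i h \<Longrightarrow> CR N k v \<Longrightarrow> CR N (k + i) (fn h * v)"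
  unfolding CR_def
  by (intro allI FR_cong[OF _ FR_mult[of N k _ i h]]) (auto simp: pointwise fn_apply Hp_iff)

lemma CR_of_int: "CR N k v \<Longrightarrow> CR N k (of_int i * v)"
  unfolding CR_def
proof
  fix p assume "\<forall>p. FR N k (v p)"
  hence "FR N k (\<lambda>\<tau>. of_int i * v p \<tau>)" by (intro FR_cmult) blast
  thus "FR N k ((of_int i * v) p)" by (rule FR_cong[rotated]) (simp add: pointwise)
qed

lemma CR_sum: "(\<And>i. i \<in> A \<Longrightarrow> CR N k (G i)) \<Longrightarrow> CR N k (sum G A)"
  by (induction A rule: infinite_finite_induct) (auto intro: CR_0 CR_add)

lemma CR_isum: "(\<And>i. CR N k (G i)) \<Longrightarrow> CR N k (isum G)"
  unfolding isum_def by (rule CR_sum)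

lemma CR_bop: assumes "CR N k v" "n \<noteq> 0" shows "CR N k (bop n v)"
  unfolding CR_def
proof
  fix p :: mon obtain l u where p: "p = (l, u)" by force
  show "FR N k (bop n v p)"
  proof (cases "n < 0")
    case True
    thus ?thesis using assms FR_0 by (auto simp: p bop_neg CR_def zero_fun_def)
  next
    case False
    hence n: "n > 0" using assms(2) by simp
    show ?thesis unfolding p bop_pos[OF n] using assms(1) by (intro FR_cmult) (simp add: CR_def)
  qed
qed

lemma CR_aop: assumes "CR N k v" "N > 0" shows "CR N k (aop n v)"
  unfolding CR_def
proof
  fix p :: mon obtain l u where p: "p = (l, u)" by force
  consider "n < 0" | "n = 0" | "n > 0" by linarith
  thus "FR N k (aop n v p)"
  proof cases
    case 1
    thus ?thesis using assms FR_0 by (auto simp: p aop_neg CR_def zero_fun_def)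
  next
    case 2
    have "FR N k (deriv (v p))" using assms by (intro FR_deriv) (auto simp: CR_def)
    thus ?thesis unfolding 2 aop_zero by (rule FR_cong[rotated]) (simp add: rH_def Hp_iff)
  next
    case 3
    show ?thesis unfolding p aop_pos[OF 3] using assms(1) by (intro FR_cmult) (simp add: CR_def)
  qed
qed

lemma CR_X: "CR N k v \<Longrightarrow> CR N k (pmode l n v)"
  by (induction l arbitrary: n) (auto intro!: CR_isum CR_0 CR_bop)

lemma CR_hb: assumes "v \<in> D w" "CR N k v" "FR N i h" "N > 0" shows "CR N (k + i) (hb h n v)"
  unfolding hb_eq'[OF assms(1) order_refl]
  by (intro CR_sum CR_fn CR_X assms FR_tc)

text \<open>A nonzero mode sees h only through its derivatives, since the power l = 0 has only the
  zero mode. This admits h = \<open>Fp\<close>, a primitive about whose own expansion nothing is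
  known.\<close>

lemma CR_hb1: assumes "v \<in> D w" "CR N k v" "FR N i (deriv h)" "N > 0" "n \<noteq> 0" shows "CR N (k + i) (hb h n v)"
  unfolding hb_eq'[OF assms(1) order_refl]
proof (rule CR_sum)
  fix l
  show "CR N (k + i) (fn (tc h l) * pmode l n v)"
  proof (cases l)
    case 0
    thus ?thesis using assms(5) by (simp add: CR_0)
  next
    case (Suc m)
    have "FR N i (tc (deriv h) m)" by (rule FR_tc[OF assms(3,4)])
    hence "FR N i (\<lambda>\<tau>. 1 / of_nat (Suc m) * tc (deriv h) m \<tau>)" by (rule FR_cmult)
    hence "FR N i (tc h (Suc m))" by (simp add: tc_deriv del: of_nat_Suc)
    thus ?thesis unfolding Suc by (intro CR_fn CR_X assms)
  qed
qed

lemma CR_ah: assumes "v \<in> D w" "CR N k v" "FR N i h" "N > 0" "hol h" shows "CR N (k + i) (ah h n v)"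
  unfolding ah_def
proof (rule CR_isum)
  fix j
  show "CR N (k + i) (if j < 0 then aop j (hb h (n - j) v) else hb h (n - j) (aop j v))"
    using CR_aop[OF CR_hb[OF assms(1-4), of "n - j"] assms(4)]
      CR_hb[OF aop_D[OF assms(1)] CR_aop[OF assms(2,4)] assms(3,4)] by auto
qed

lemma CR_be: assumes "v \<in> D w" "CR N k v" "FR N i h" "N > 0" shows "CR N (k + i) (be h n v)"
  unfolding be_def
proof (rule CR_isum)
  fix j
  show "CR N (k + i) (of_int (- j) * bop j (hb h (n - j) v))"
  proof (cases "j = 0")
    case False
    thus ?thesis by (intro CR_of_int CR_bop CR_hb[OF assms])
  qed (simp add: CR_0)
qed

lemma FR_Fp: "FR N 1 (deriv Fp)"
  by (rule FR_I[OF RN_const[of N 1]]) (simp add: deriv_Fp)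

lemma FR_Gw: "FR N (- 1) Gw"
  by (rule FR_I[OF RN_const[of N 1]]) (simp add: Gw_def power_int_minus inverse_eq_divide)

lemma FR_Pw: assumes "N > 0" shows "FR N (- 1) Pw"
proof (rule FR_I)
  show "RN N (\<lambda>\<tau>. 2 * (phi2 \<tau> * phi2 \<tau>))" by (intro RN_mult RN_const RN_phi2' assms)
qed (simp add: Pw_def Gw_def power_int_minus inverse_eq_divide power2_eq_square)

lemma CR_Aw: "v \<in> D w \<Longrightarrow> CR N k v \<Longrightarrow> N > 0 \<Longrightarrow> CR N (k - 1) (Aw n v)"
  unfolding Aw_def using CR_ah[of v w N k "- 1" Gw n] CR_be[of v w N k "- 1" Pw n] FR_Gw FR_Pw hol_Gw
  by (auto intro: CR_add)

text \<open>The exponents of \<open>Fw\<close> add up to -d from the division, +1 for every b factor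
  and -1 for every a factor; their total is 0 because the degree of the monomial is d.\<close>

lemma CR_Lift:
  assumes f: "RN N f" and N: "N > 0" and p: "p \<in> mons w" "mdeg p = int d"
  shows "RN N (Lift p d f q)"
proof -
  let ?xs = "sorted_list_of_multiset (fst p)" and ?ys = "sorted_list_of_multiset (snd p)"
  have len: "length ?xs = size (fst p)" "length ?ys = size (snd p)"
    by (metis mset_sorted_list_of_multiset size_mset)+
  have pos: "\<forall>y\<in>set ?ys. y > 0" using p by (auto simp: mons_def intro!: gr0I)
  let ?f = "\<lambda>\<tau>. f \<tau> / Fw \<tau> ^ d"
  have hf: "hol ?f" by (rule hol_div_Fw[OF RN_hol[OF f N]])
  have "FR N (- int d) ?f"
    by (rule FR_I[OF f]) (simp add: power_int_minus divide_inverse)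
  hence c: "CR N (- int d) (cst ?f)"
    unfolding CR_def cst_def single_def
    by (auto intro: FR_cong[of ?f] simp: rH_def Hp_iff zero_fun_def FR_0)
  have B: "foldr (\<lambda>n. hb Fp (- int n)) ys (cst ?f) \<in> D (int (sum_list ys)) \<and>
     CR N (- int d + int (length ys)) (foldr (\<lambda>n. hb Fp (- int n)) ys (cst ?f))" if "\<forall>y\<in>set ys. y > 0" for ys
    using that
  proof (induction ys)
    case Nil
    show ?case using cst_D[OF hf] c by simp
  next
    case (Cons y ys)
    let ?v = "foldr (\<lambda>n. hb Fp (- int n)) ys (cst ?f)"
    have IH: "?v \<in> D (int (sum_list ys))" "CR N (- int d + int (length ys)) ?v" and y: "- int y \<noteq> 0" using Cons by auto
    show ?case using hb_D[OF IH(1) hol_Fp, of "- int y"] CR_hb1[OF IH FR_Fp N y]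
      by (simp add: algebra_simps)
  qed
  have A: "foldr (\<lambda>n. Aw (- int n)) xs v \<in> D (w' + int (sum_list xs)) \<and>
     CR N (k - int (length xs)) (foldr (\<lambda>n. Aw (- int n)) xs v)" if "v \<in> D w'" "CR N k v" for v w' k xs
  proof (induction xs)
    case Nil
    thus ?case using that by simp
  next
    case (Cons x xs)
    show ?case using Aw_D[OF conjunct1[OF Cons], of "- int x"] CR_Aw[OF conjunct1[OF Cons] conjunct2[OF Cons] N, of "- int x"]
      by (simp add: algebra_simps)
  qed
  have "CR N (- int d + int (length ?ys) - int (length ?xs)) (Lift p d f)"
    using conjunct2[OF A[OF conjunct1[OF B[OF pos]] conjunct2[OF B[OF pos]]]]
    by (simp add: Lift_def Lw_def lift_op_def Aw_def[abs_def])
  moreover have "- int d + int (length ?ys) - int (length ?xs) = 0" using p(2) by (simp add: len mdeg_def)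
  ultimately have "FR N 0 (Lift p d f q)" by (simp add: CR_def)
  then obtain r where r: "RN N r" "\<And>\<tau>. \<tau> \<in> Hp \<Longrightarrow> Lift p d f q \<tau> = Fw \<tau> powi 0 * r \<tau>" unfolding FR_def by blast
  show ?thesis by (rule RN_cong[OF _ r(1)]) (simp add: r(2))
qed

subsection \<open>Vanishing in negative weight\<close>

lemma iinv_SL2Z: "g \<in> SL2Z \<Longrightarrow> iinv g \<in> SL2Z"
  by (cases g) (auto simp: SL2Z_def iinv_def algebra_simps)

lemma imul_iinv: "g \<in> SL2Z \<Longrightarrow> imul (iinv g) g = (1, 0, 0, 1)"
  by (cases g) (auto simp: SL2Z_def iinv_def imul_def algebra_simps)

lemma mob_one: "mob (to_rmat (1, 0, 0, 1)) \<tau> = \<tau>" and jf_one: "jf (to_rmat (1, 0, 0, 1)) \<tau> = 1"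
  by (simp_all add: mob_def jf_def to_rmat_def)

lemma RN_bounded: assumes "RN N f" "N > 0" "y > 0"
  shows "\<exists>B. \<forall>\<tau>. Im \<tau> \<ge> y \<longrightarrow> norm (f \<tau>) \<le> B"
proof -
  from assms obtain P where P: "P holomorphic_on ball 0 1" "\<And>\<tau>. \<tau> \<in> Hp \<Longrightarrow> f \<tau> = P (qe N \<tau>)"
    by (auto simp: RN_def)
  define r where "r = exp (- 2 * pi * y / real N)"
  have r: "r < 1" using assms by (simp add: r_def)
  have "continuous_on (cball 0 r) P"
    by (rule holomorphic_on_imp_continuous_on[OF holomorphic_on_subset[OF P(1)]]) (use r in auto)
  hence "compact (P ` cball 0 r)" by (rule compact_continuous_image) simp
  then obtain B where B: "\<forall>z\<in>P ` cball 0 r. norm z \<le> B" using compact_imp_bounded bounded_iff by metis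
  have "norm (f \<tau>) \<le> B" if t: "Im \<tau> \<ge> y" for \<tau>
  proof -
    have th: "\<tau> \<in> Hp" using t assms(3) by (simp add: Hp_iff)
    have "norm (qe N \<tau>) \<le> r" unfolding norm_qe r_def using t assms(2) by (simp add: divide_right_mono)
    hence "P (qe N \<tau>) \<in> P ` cball 0 r" by auto
    hence "norm (P (qe N \<tau>)) \<le> B" using B by blast
    thus ?thesis using P(2)[OF th] by simp
  qed
  thus ?thesis by blast
qed

text \<open>Dirichlet approximation of the real part with denominators up to Q of order 1 / sqrt(y),
  where y is the imaginary part. For the bottom row (k, -h) the real part of the automorphy factor
  contributes at most y to the squared norm and the imaginary part at most 4 y, hence 5.\<close>

lemma good_matrix: assumes "\<tau> \<in> Hp" "Im \<tau> \<le> 1"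
  obtains g where "g \<in> SL2Z" "(norm (jf (to_rmat g) \<tau>))\<^sup>2 \<le> 5 * Im \<tau>"
proof -
  let ?y = "Im \<tau>"
  have y: "?y > 0" using assms by (simp add: Hp_iff)
  define s where "s = sqrt ?y"
  have s: "s > 0" "s \<le> 1" "s\<^sup>2 = ?y" using y assms(2) by (auto simp: s_def)
  define Q where "Q = nat \<lceil>1 / s\<rceil>"
  have c1: "\<lceil>1 / s\<rceil> \<ge> 1" using s by (simp add: one_le_ceiling)
  have Q0: "Q > 0" using c1 by (simp add: Q_def)
  have Qr: "real Q = of_int \<lceil>1 / s\<rceil>" using c1 by (simp add: Q_def)
  have Q1: "1 / s \<le> real Q" unfolding Qr by (rule le_of_int_ceiling)
  have "real Q \<le> 1 / s + 1" unfolding Qr by (rule of_int_ceiling_le_add_one)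
  moreover have "1 \<le> 1 / s" using s by simp
  ultimately have "real Q \<le> 1 / s + 1 / s" by linarith
  hence Q2: "real Q \<le> 2 / s" by simp
  obtain h k where hk: "coprime h k" "0 < k" "k \<le> int Q" "\<bar>of_int k * Re \<tau> - of_int h\<bar> < 1 / real Q"
    using Dirichlet_approx_coprime[OF Q0] by blast
  obtain u v where uv: "u * k + v * h = 1" using hk(1) bezout_int[of k h] by (metis coprime_iff_gcd_eq_1 gcd.commute)
  let ?g = "(- v, - u, k, - h)"
  have "?g \<in> SL2Z" using uv by (simp add: SL2Z_def algebra_simps)
  moreover have "(norm (jf (to_rmat ?g) \<tau>))\<^sup>2 \<le> 5 * ?y"
  proof -
    have "(norm (jf (to_rmat ?g) \<tau>))\<^sup>2 = (of_int k * Re \<tau> - of_int h)\<^sup>2 + (of_int k * ?y)\<^sup>2"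
      by (simp add: jf_def to_rmat_def cmod_power2)
    also have "(of_int k * Re \<tau> - of_int h)\<^sup>2 \<le> ?y"
    proof -
      have "1 / real Q \<le> s" using Q1 s Q0 by (simp add: field_simps)
      hence "\<bar>of_int k * Re \<tau> - of_int h\<bar> \<le> s" using hk(4) by linarith
      hence "\<bar>of_int k * Re \<tau> - of_int h\<bar>\<^sup>2 \<le> s\<^sup>2" by (intro power_mono) auto
      thus ?thesis using s(3) by simp
    qed
    also have "(of_int k * ?y)\<^sup>2 \<le> 4 * ?y"
    proof -
      have "of_int k \<le> 2 / s" using hk(3) Q2 by linarith
      hence "of_int k * ?y \<le> 2 / s * ?y" using y by (intro mult_right_mono) auto
      also have "\<dots> = 2 * s" using s by (simp add: s(3)[symmetric] power2_eq_square)
      finally have "(of_int k * ?y)\<^sup>2 \<le> (2 * s)\<^sup>2" using hk(2) y by (intro power_mono) auto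
      thus ?thesis using s(3) by (simp add: power_mult_distrib)
    qed
    finally show ?thesis by simp
  qed
  ultimately show ?thesis by (rule that)
qed

text \<open>For a weight of -2 e the automorphy factors work in favour of f: a point of small height
  y is moved up to height at least 1/5, where all translates of f are uniformly bounded, at the
  price of a factor at most (5 y)^e. So f is small near the real line, and the maximum principle
  carries this to every point.\<close>

lemma negative_weight:
  assumes G: "congruence_subgroup \<Gamma>" and e: "e > 0"
    and inv: "\<And>g \<tau>. g \<in> \<Gamma> \<Longrightarrow> \<tau> \<in> Hp \<Longrightarrow> f (mob (to_rmat g) \<tau>) * jf (to_rmat g) \<tau> ^ (2 * e) = f \<tau>"
    and cusp: "\<And>g. g \<in> SL2Z \<Longrightarrow> \<exists>N>0. RN N (\<lambda>\<tau>. f (mob (to_rmat g) \<tau>) * jf (to_rmat g) \<tau> ^ (2 * e))"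
    and t0: "\<tau>\<^sub>0 \<in> Hp"
  shows "f \<tau>\<^sub>0 = 0"
proof -
  define sl where "sl g \<tau> = f (mob (to_rmat g) \<tau>) * jf (to_rmat g) \<tau> ^ (2 * e)" for g \<tau>
  from G have G_sub: "\<Gamma> \<subseteq> SL2Z" by (simp add: congruence_subgroup_def)
  from G obtain M where M: "M > 0" "principal_cong M \<subseteq> \<Gamma>" by (auto simp: congruence_subgroup_def)
  have sl_mul: "sl (imul x y) \<tau> = sl x (mob (to_rmat y) \<tau>) * jf (to_rmat y) \<tau> ^ (2 * e)"
    if "x \<in> SL2Z" "y \<in> SL2Z" "\<tau> \<in> Hp" for x y \<tau>
    by (simp add: sl_def mob_imul[OF that] jf_imul[OF that(2,3)] power_mult_distrib)
  have sl_G: "sl (imul x y) \<tau> = sl y \<tau>" if "x \<in> \<Gamma>" "y \<in> SL2Z" "\<tau> \<in> Hp" for x y \<tau>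
  proof -
    have "sl x (mob (to_rmat y) \<tau>) = f (mob (to_rmat y) \<tau>)"
      unfolding sl_def by (rule inv[OF that(1) mob_Hp[OF sl2_to_rmat[OF that(2)] that(3)]])
    thus ?thesis using sl_mul[of x y \<tau>] that G_sub by (auto simp: sl_def)
  qed
  \<comment> \<open>Matrices with the same entries mod M differ by an element of the principal
    congruence subgroup, hence of \<open>\<Gamma>\<close>. So only finitely many translates of f
    occur, and their separate bounds become one bound B.\<close>
  define cl where "cl g = (case g of (a, b, c, d) \<Rightarrow> (a mod int M, b mod int M, c mod int M, d mod int M))" for g :: imat
  have cl_eq: "sl x \<tau> = sl y \<tau>" if xy: "x \<in> SL2Z" "y \<in> SL2Z" "cl x = cl y" and t: "\<tau> \<in> Hp" for x y \<tau>
  proof -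
    obtain a b c d a' b' c' d' where e: "x = (a, b, c, d)" "y = (a', b', c', d')" by (metis prod_cases4)
    have dx: "a * d - b * c = 1" and dy: "a' * d' - b' * c' = 1" using xy by (auto simp: SL2Z_def e)
    let ?z = "imul x (iinv y)"
    have cg: "[a = a'] (mod int M)" "[b = b'] (mod int M)" "[c = c'] (mod int M)" "[d = d'] (mod int M)"
      using xy(3) by (auto simp: cl_def e cong_def)
    have z: "?z = (a * d' - b * c', b * a' - a * b', c * d' - d * c', d * a' - c * b')"
      by (simp add: e imul_def iinv_def)
    have "[a * d' - b * c' = a' * d' - b' * c'] (mod int M)" by (intro cong_diff cong_mult cg cong_refl)
    moreover have "[b * a' - a * b' = b' * a' - a' * b'] (mod int M)" by (intro cong_diff cong_mult cg cong_refl)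
    moreover have "[c * d' - d * c' = c' * d' - d' * c'] (mod int M)" by (intro cong_diff cong_mult cg cong_refl)
    moreover have "[d * a' - c * b' = d' * a' - c' * b'] (mod int M)" by (intro cong_diff cong_mult cg cong_refl)
    ultimately have zm: "(a * d' - b * c') mod int M = 1 mod int M" "(b * a' - a * b') mod int M = 0"
      "(c * d' - d * c') mod int M = 0" "(d * a' - c * b') mod int M = 1 mod int M"
      using dy by (simp_all add: cong_def mult.commute)
    have "?z \<in> SL2Z" by (intro imul_SL2Z iinv_SL2Z xy)
    hence "?z \<in> principal_cong M" using zm by (simp add: principal_cong_def z)
    hence zG: "?z \<in> \<Gamma>" using M(2) by blast
    have "imul ?z y = x"
    proof -
      have "(a * d' - b * c') * a' + (b * a' - a * b') * c' = a * (a' * d' - b' * c')" by (simp add: algebra_simps)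
      moreover have "(a * d' - b * c') * b' + (b * a' - a * b') * d' = b * (a' * d' - b' * c')" by (simp add: algebra_simps)
      moreover have "(c * d' - d * c') * a' + (d * a' - c * b') * c' = c * (a' * d' - b' * c')" by (simp add: algebra_simps)
      moreover have "(c * d' - d * c') * b' + (d * a' - c * b') * d' = d * (a' * d' - b' * c')" by (simp add: algebra_simps)
      ultimately have "imul (a * d' - b * c', b * a' - a * b', c * d' - d * c', d * a' - c * b') y = x"
        by (simp add: e imul_def dy)
      thus ?thesis by (simp only: z)
    qed
    thus ?thesis using sl_G[OF zG xy(2) t] by simp
  qed
  have bnd: "\<exists>B. \<forall>\<tau>. Im \<tau> \<ge> 1/5 \<longrightarrow> norm (sl g \<tau>) \<le> B" if gS: "g \<in> SL2Z" for g
  proof -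
    obtain N where "N > 0" "RN N (sl g)" using cusp[OF gS] by (auto simp: sl_def[abs_def])
    thus ?thesis by (intro RN_bounded) auto
  qed
  have fin: "finite (cl ` SL2Z)"
  proof (rule finite_subset)
    show "cl ` SL2Z \<subseteq> {0..<int M} \<times> {0..<int M} \<times> {0..<int M} \<times> {0..<int M}"
      using M(1) by (auto simp: cl_def)
  qed auto
  have "\<forall>k\<in>cl ` SL2Z. \<exists>B. \<forall>g\<in>SL2Z. cl g = k \<longrightarrow> (\<forall>\<tau>. Im \<tau> \<ge> 1/5 \<longrightarrow> norm (sl g \<tau>) \<le> B)"
  proof
    fix k assume "k \<in> cl ` SL2Z"
    then obtain g0 where g0: "g0 \<in> SL2Z" "cl g0 = k" by blast
    obtain B where B: "\<And>\<tau>. Im \<tau> \<ge> 1/5 \<Longrightarrow> norm (sl g0 \<tau>) \<le> B" using bnd[OF g0(1)] by blast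
    have "norm (sl g \<tau>) \<le> B" if "g \<in> SL2Z" "cl g = k" "Im \<tau> \<ge> 1/5" for g \<tau>
    proof -
      have "\<tau> \<in> Hp" using that(3) by (simp add: Hp_iff)
      thus ?thesis using cl_eq[OF that(1) g0(1)] that g0(2) B by simp
    qed
    thus "\<exists>B. \<forall>g\<in>SL2Z. cl g = k \<longrightarrow> (\<forall>\<tau>. Im \<tau> \<ge> 1/5 \<longrightarrow> norm (sl g \<tau>) \<le> B)" by blast
  qed
  then obtain Bf where Bf: "\<And>k g \<tau>. k \<in> cl ` SL2Z \<Longrightarrow> g \<in> SL2Z \<Longrightarrow> cl g = k \<Longrightarrow> Im \<tau> \<ge> 1/5 \<Longrightarrow> norm (sl g \<tau>) \<le> Bf k"
    by (metis (no_types))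
  define B where "B = Max (insert 0 (Bf ` (cl ` SL2Z)))"
  have B0: "B \<ge> 0" unfolding B_def using fin by (intro Max_ge) auto
  have B: "norm (sl g \<tau>) \<le> B" if "g \<in> SL2Z" "Im \<tau> \<ge> 1/5" for g \<tau>
  proof -
    have "norm (sl g \<tau>) \<le> Bf (cl g)" using Bf[of "cl g" g \<tau>] that by blast
    also have "\<dots> \<le> B" unfolding B_def using fin that by (intro Max_ge) auto
    finally show ?thesis .
  qed
  have small: "norm (f \<tau>) \<le> B * (5 * Im \<tau>)" if t: "\<tau> \<in> Hp" "5 * Im \<tau> \<le> 1" for \<tau>
  proof -
    have y: "Im \<tau> > 0" using t by (simp add: Hp_iff)
    have "Im \<tau> \<le> 1" using t(2) y by linarith
    then obtain g where g: "g \<in> SL2Z" "(norm (jf (to_rmat g) \<tau>))\<^sup>2 \<le> 5 * Im \<tau>"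
      using good_matrix[OF t(1)] by blast
    let ?z = "mob (to_rmat g) \<tau>" and ?j = "jf (to_rmat g) \<tau>"
    have s: "sl2 (to_rmat g)" by (rule sl2_to_rmat[OF g(1)])
    have j0: "norm ?j > 0" using jf_nz[OF s t(1)] by simp
    have "Im ?z = Im \<tau> / (norm ?j)\<^sup>2" by (rule Im_mob[OF s t(1)])
    also have "\<dots> \<ge> 1/5" using g(2) j0 by (simp add: field_simps)
    finally have z: "Im ?z \<ge> 1/5" .
    have "f \<tau> = sl (imul (iinv g) g) \<tau>" by (simp add: imul_iinv[OF g(1)] sl_def mob_one jf_one)
    also have "\<dots> = sl (iinv g) ?z * ?j ^ (2 * e)" by (rule sl_mul[OF iinv_SL2Z[OF g(1)] g(1) t(1)])
    finally have "norm (f \<tau>) = norm (sl (iinv g) ?z) * ((norm ?j)\<^sup>2) ^ e"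
      by (simp add: norm_mult norm_power power_mult)
    also have "\<dots> \<le> B * (5 * Im \<tau>)"
    proof (rule mult_mono[OF B[OF iinv_SL2Z[OF g(1)] z]])
      have "((norm ?j)\<^sup>2) ^ e \<le> (5 * Im \<tau>) ^ e" using g(2) by (intro power_mono) auto
      also have "\<dots> \<le> (5 * Im \<tau>) ^ 1" using e t(2) y by (intro power_decreasing) auto
      finally show "((norm ?j)\<^sup>2) ^ e \<le> 5 * Im \<tau>" by simp
    qed (use B0 in auto)
    finally show ?thesis .
  qed
  obtain N where N: "N > 0" "RN N (sl (1, 0, 0, 1))" using cusp[of "(1, 0, 0, 1)"] by (auto simp: SL2Z_def sl_def[abs_def])
  hence "RN N f" by (simp add: sl_def[abs_def] mob_one jf_one)
  then obtain P where P: "P holomorphic_on ball 0 1" "\<And>\<tau>. \<tau> \<in> Hp \<Longrightarrow> f \<tau> = P (qe N \<tau>)" by (auto simp: RN_def)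
  have "norm (f \<tau>\<^sub>0) \<le> B * (5 * y)" if y: "0 < y" "y < Im \<tau>\<^sub>0" "5 * y \<le> 1" for y
  proof -
    \<comment> \<open>The horizontal line of height y becomes a circle of radius r in the disc. The
      expansion at infinity extends f over the centre, so the disc inside contains the given point
      and the modulus is bounded by that on the circle.\<close>
    define r where "r = exp (- 2 * pi * y / real N)"
    have r: "r < 1" "r > 0" using y N by (simp_all add: r_def)
    have "norm (P (qe N \<tau>\<^sub>0)) \<le> B * (5 * y)"
    proof (rule maximum_modulus_frontier[of P "cball 0 r"])
      show "P holomorphic_on interior (cball 0 r)" by (rule holomorphic_on_subset[OF P(1)]) (use r in auto)
      show "continuous_on (closure (cball 0 r)) P"
        by (rule holomorphic_on_imp_continuous_on[OF holomorphic_on_subset[OF P(1)]]) (use r in auto)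
      show "norm (P z) \<le> B * (5 * y)" if "z \<in> frontier (cball 0 r)" for z
      proof -
        have nz: "norm z = r" using that by simp
        hence "z \<noteq> 0" "norm z < 1" using r by auto
        then obtain \<tau> where t: "\<tau> \<in> Hp" "qe N \<tau> = z" using qe_surj[OF N(1), of z] by blast
        have "exp (- 2 * pi * Im \<tau> / real N) = exp (- 2 * pi * y / real N)" using norm_qe[of N \<tau>] t nz by (auto simp: r_def)
        hence "Im \<tau> = y" using N(1) by (auto simp: field_simps)
        thus ?thesis using small[OF t(1)] P(2)[OF t(1)] t(2) y(3) by simp
      qed
      show "qe N \<tau>\<^sub>0 \<in> cball 0 r" using y N by (simp add: norm_qe divide_right_mono r_def)
    qed auto
    thus ?thesis using P(2)[OF t0] by simp
  qed
  note bound = this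
  have y0: "Im \<tau>\<^sub>0 > 0" using t0 by (simp add: Hp_iff)
  have "norm (f \<tau>\<^sub>0) \<le> \<epsilon>" if eps: "\<epsilon> > 0" for \<epsilon>
  proof -
    define y where "y = min (min (Im \<tau>\<^sub>0 / 2) (1/5)) (\<epsilon> / (5 * (B + 1)))"
    have y: "0 < y" "y < Im \<tau>\<^sub>0" "5 * y \<le> 1" "y \<le> \<epsilon> / (5 * (B + 1))" using y0 eps B0 by (auto simp: y_def)
    have "B * (5 * y) \<le> (B + 1) * (5 * y)" using y by (intro mult_right_mono) auto
    also have "\<dots> \<le> \<epsilon>" using y(4) B0 by (simp add: field_simps)
    finally show ?thesis using bound[OF y(1-3)] by linarith
  qed
  hence "norm (f \<tau>\<^sub>0) \<le> 0" by (rule field_le_epsilon[of _ 0, simplified])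
  thus ?thesis by simp
qed

subsection \<open>Counting monomials\<close>

definition pts :: "nat \<Rightarrow> nat \<Rightarrow> nat multiset set" where
  "pts k s = {M. 0 \<notin># M \<and> size M = k \<and> sum_mset M = s}"

lemma finite_pts: "finite (pts k s)"
  by (rule finite_subset[OF _ finite_msets_le[of s]]) (auto simp: pts_def)

text \<open>Partitions into k + 1 parts: either a part 1 is removed, or all parts exceed 1 and each
  is lowered by 1.\<close>

lemma pts_Suc: "card (pts (Suc k) s) = (if s = 0 then 0 else card (pts k (s - 1)))
    + (if s < Suc k then 0 else card (pts (Suc k) (s - Suc k)))"
proof -
  let ?A = "{M \<in> pts (Suc k) s. 1 \<in># M}" and ?B = "{M \<in> pts (Suc k) s. 1 \<notin># M}"
  have U: "pts (Suc k) s = ?A \<union> ?B" by auto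
  have "card (pts (Suc k) s) = card ?A + card ?B"
    by (subst U, rule card_Un_disjoint) (auto simp: finite_pts)
  also have "card ?A = (if s = 0 then 0 else card (pts k (s - 1)))"
  proof (cases "s = 0")
    case True
    have e: "?A = {}" using True by (auto simp: pts_def dest!: multi_member_split)
    show ?thesis unfolding e using True by simp
  next
    case False
    have "?A = add_mset 1 ` pts k (s - 1)"
    proof
      show "?A \<subseteq> add_mset 1 ` pts k (s - 1)"
        by (auto simp: pts_def dest!: multi_member_split)
      show "add_mset 1 ` pts k (s - 1) \<subseteq> ?A" using False by (auto simp: pts_def)
    qed
    thus ?thesis using False by (simp add: card_image inj_on_def)
  qed
  also have "card ?B = (if s < Suc k then 0 else card (pts (Suc k) (s - Suc k)))"
  proof -
    have ge2: "2 \<le> x" if "M \<in> ?B" "x \<in># M" for M x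
    proof -
      have "0 \<notin># M \<and> Suc 0 \<notin># M" using that(1) by (simp add: pts_def)
      hence "x \<noteq> 0" "x \<noteq> Suc 0" using that(2) by (metis, metis)
      thus ?thesis by linarith
    qed
    have sumSuc: "sum_mset (image_mset Suc M) = sum_mset M + size M" for M by (induction M) auto
    have img: "image_mset Suc (image_mset (\<lambda>x. x - 1) M) = M" if "M \<in> ?B" for M
    proof -
      have "image_mset (Suc \<circ> (\<lambda>x. x - 1)) M = image_mset id M"
        by (rule image_mset_cong) (use ge2[OF that] in force)
      thus ?thesis by (simp only: multiset.map_comp multiset.map_id)
    qed
    show ?thesis
    proof (cases "s < Suc k")
      case True
      have e: "?B = {}"
      proof (rule ccontr)
        assume "?B \<noteq> {}"
        then obtain M where "M \<in> ?B" by blast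
        hence "size M \<le> sum_mset M" "size M = Suc k" "sum_mset M = s"
          using size_le_sum_mset[of M] by (auto simp: pts_def)
        thus False using True by linarith
      qed
      show ?thesis unfolding e using True by simp
    next
      case False
      have e: "?B = image_mset Suc ` pts (Suc k) (s - Suc k)"
      proof
        show "?B \<subseteq> image_mset Suc ` pts (Suc k) (s - Suc k)"
        proof
          fix M assume M: "M \<in> ?B"
          let ?M = "image_mset (\<lambda>x. x - 1) M"
          have "sum_mset M = sum_mset ?M + size ?M" using sumSuc[of ?M] img[OF M] by simp
          hence "?M \<in> pts (Suc k) (s - Suc k)" using M ge2[OF M] by (force simp: pts_def)
          thus "M \<in> image_mset Suc ` pts (Suc k) (s - Suc k)" using img[OF M] by (metis imageI)
        qed
        show "image_mset Suc ` pts (Suc k) (s - Suc k) \<subseteq> ?B"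
          using False by (auto simp: pts_def sumSuc)
      qed
      have "inj_on (image_mset Suc) (pts (Suc k) (s - Suc k))"
        by (rule inj_on_subset[OF multiset.inj_map]) (auto simp: inj_on_def)
      thus ?thesis unfolding e using False by (simp add: card_image)
    qed
  qed
  finally show ?thesis .
qed

definition eser :: "nat \<Rightarrow> real fps" where "eser k = Abs_fps (\<lambda>s. real (card (pts k s)))"

lemma eser_eq: "eser k = fps_X ^ k * (\<Prod>i\<in>{1..k}. inverse (1 - fps_X ^ i))"
proof (induction k)
  case 0
  have "pts 0 s = (if s = 0 then {{#}} else {})" for s by (auto simp: pts_def)
  hence "eser 0 = 1" by (auto simp: eser_def fps_eq_iff)
  thus ?case by simp
next
  case (Suc k)
  have u: "(1 - fps_X ^ Suc k :: real fps) $ 0 \<noteq> 0" by simp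
  have "eser (Suc k) = fps_X * eser k + fps_X ^ Suc k * eser (Suc k)"
    by (rule fps_ext) (simp add: eser_def pts_Suc fps_X_power_mult_nth del: power_Suc)
  hence "eser (Suc k) * (1 - fps_X ^ Suc k) = fps_X * eser k" by (simp add: algebra_simps)
  hence "eser (Suc k) * (1 - fps_X ^ Suc k) * inverse (1 - fps_X ^ Suc k) = fps_X * eser k * inverse (1 - fps_X ^ Suc k)"
    by simp
  moreover have "(1 - fps_X ^ Suc k) * inverse (1 - fps_X ^ Suc k) = (1 :: real fps)"
    using u by (subst mult.commute) (rule inverse_mult_eq_1)
  ultimately have "eser (Suc k) = fps_X * eser k * inverse (1 - fps_X ^ Suc k)" by (simp only: mult.assoc mult_1_right)
  thus ?case unfolding Suc by (simp add: prod.nat_ivl_Suc' mult_ac)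
qed

text \<open>The exponent 2 n + m splits as n + (m + n), so \<open>Gser m n\<close> is the product of
  the generating series of partitions into n parts (the a factors) and into m + n parts (the b
  factors); these monomials have degree m.\<close>

lemma Gser_nth: "fps_nth (Gser m n) N = real (card {p \<in> mons (int N). size (fst p) = n \<and> size (snd p) = m + n})"
proof -
  have "Gser m n = eser n * eser (m + n)"
  proof -
    have "2 * n + m = n + (m + n)" by simp
    thus ?thesis by (simp only: Gser_def eser_eq power_add mult_ac)
  qed
  hence "fps_nth (Gser m n) N = (\<Sum>i=0..N. real (card (pts n i)) * real (card (pts (m + n) (N - i))))"
    by (simp add: fps_mult_nth eser_def)
  also have "\<dots> = real (\<Sum>i=0..N. card (pts n i \<times> pts (m + n) (N - i)))" by (simp add: card_cartesian_product)
  also have "(\<Sum>i=0..N. card (pts n i \<times> pts (m + n) (N - i))) = card (\<Union>i\<in>{0..N}. pts n i \<times> pts (m + n) (N - i))"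
    by (rule card_UN_disjoint[symmetric]) (auto simp: finite_pts, auto simp: pts_def)
  also have "(\<Union>i\<in>{0..N}. pts n i \<times> pts (m + n) (N - i)) = {p \<in> mons (int N). size (fst p) = n \<and> size (snd p) = m + n}"
  proof -
    have "p \<in> mons (int N) \<longleftrightarrow> 0 \<notin># fst p \<and> 0 \<notin># snd p \<and> sum_mset (fst p) + sum_mset (snd p) = N" for p
      unfolding mons_def cweight_def by (simp del: of_nat_add of_nat_sum_mset)
    thus ?thesis by (auto simp: pts_def)
  qed
  finally show ?thesis .
qed

subsection \<open>Dimensions\<close>

interpretation fv: vector_space "\<lambda>c (f :: 'x \<Rightarrow> complex) x. c * f x"
  by standard (auto simp: fun_eq_iff algebra_simps pointwise)

lemma cindep_iff: "cindep B \<longleftrightarrow> finite B \<and> \<not> fv.dependent B"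
proof (cases "finite B")
  case True
  have "(\<Sum>b\<in>B. (\<lambda>x. c b * b x)) = 0 \<longleftrightarrow> (\<forall>x. (\<Sum>b\<in>B. c b * b x) = 0)" for c
    by (simp add: fun_eq_iff sum_fun_apply pointwise)
  thus ?thesis using True unfolding cindep_def fv.dependent_finite[OF True] by auto
qed (simp add: cindep_def)

lemma cdim_ge: "B \<subseteq> U \<Longrightarrow> cindep B \<Longrightarrow> enat (card B) \<le> cdim U"
  unfolding cdim_def by (rule Sup_upper) blast

lemma cdim_le: "(\<And>B. B \<subseteq> U \<Longrightarrow> cindep B \<Longrightarrow> enat (card B) \<le> d) \<Longrightarrow> cdim U \<le> d"
  unfolding cdim_def by (rule Sup_least) blast

lemma cdim_attained: assumes "enat n \<le> cdim U" shows "\<exists>B. B \<subseteq> U \<and> cindep B \<and> card B = n"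
proof -
  have "\<exists>B. B \<subseteq> U \<and> cindep B \<and> card B \<ge> n"
  proof (rule ccontr)
    assume neg: "\<not> ?thesis"
    have "cindep ({} :: ('a \<Rightarrow> complex) set)" by (simp add: cindep_def)
    with neg have n0: "n > 0" by (auto intro!: gr0I)
    have "cdim U \<le> enat (n - 1)"
    proof (rule cdim_le)
      fix B assume "B \<subseteq> U" "cindep B"
      hence "card B < n" using neg by (meson not_le)
      thus "enat (card B) \<le> enat (n - 1)" by simp
    qed
    from order_trans[OF assms this] show False using n0 by simp
  qed
  then obtain B where B: "B \<subseteq> U" "cindep B" "card B \<ge> n" by blast
  from obtain_subset_with_card_n[OF B(3)] obtain B' where B': "B' \<subseteq> B" "card B' = n" by metis
  have "cindep B'"
    using B(2) finite_subset[OF B'(1)] fv.independent_mono[OF _ B'(1)] unfolding cindep_iff by blast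
  thus ?thesis using B(1) B' by (intro exI[of _ B']) auto
qed

text \<open>A finite independent set B is traded for a set C in the kernel and a set E in the image.
  With A \<subseteq> B mapping onto a basis E of the span of the image, every b outside A is
  corrected by a combination of A with the same image; the differences form C.\<close>

lemma rank_nullity:
  fixes ell :: "('x \<Rightarrow> complex) \<Rightarrow> 'y \<Rightarrow> complex"
  assumes B: "B \<subseteq> V" "cindep B" and V: "fv.subspace V"
    and lin: "Vector_Spaces.linear (\<lambda>c f x. c * f x) (\<lambda>c f x. c * f x) ell"
  obtains C E where "C \<subseteq> V" "\<And>c. c \<in> C \<Longrightarrow> ell c = 0" "cindep C" "E \<subseteq> ell ` B" "cindep E" "card B = card C + card E"
proof -
  interpret l: Vector_Spaces.linear "\<lambda>c (f :: 'x \<Rightarrow> complex) x. c * f x" "\<lambda>c (f :: 'y \<Rightarrow> complex) x. c * f x" ell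
    by (rule lin)
  have Bf: "finite B" and Bi: "\<not> fv.dependent B" using B(2) by (auto simp: cindep_iff)
  obtain E where E: "E \<subseteq> ell ` B" "\<not> fv.dependent E" "ell ` B \<subseteq> fv.span E"
    using fv.maximal_independent_subset[of "ell ` B"] by blast
  have Ef: "finite E" using E(1) Bf by (meson finite_imageI finite_subset)
  define A where "A = inv_into B ell ` E"
  have A: "A \<subseteq> B" unfolding A_def using E(1) by (auto intro: inv_into_into)
  have lA: "ell ` A = E" unfolding A_def using E(1) by (force simp: image_image f_inv_into_f)
  have cA: "card A = card E" unfolding A_def using E(1) by (intro card_image inj_on_inv_into)
  have "\<forall>b\<in>B. \<exists>s\<in>fv.span A. ell s = ell b"
  proof
    fix b assume "b \<in> B"
    hence "ell b \<in> fv.span (ell ` A)" using E(3) lA by blast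
    thus "\<exists>s\<in>fv.span A. ell s = ell b" unfolding l.span_image by auto
  qed
  then obtain s where s: "\<And>b. b \<in> B \<Longrightarrow> s b \<in> fv.span A" "\<And>b. b \<in> B \<Longrightarrow> ell (s b) = ell b" by metis
  let ?t = "\<lambda>b. b - s b"
  have out: "b \<notin> fv.span (B - {b})" if "b \<in> B" for b using Bi that unfolding fv.dependent_def by blast
  have sA: "fv.span A \<subseteq> fv.span (B - {b})" if "b \<in> B - A" for b
    by (rule fv.span_mono) (use A that in auto)
  have tin: "?t c \<in> fv.span (B - {b})" if "b \<in> B - A" "c \<in> B" "c \<noteq> b" for b c
    using that sA[OF that(1)] s(1)[OF that(2)] by (intro fv.span_diff) (auto intro: fv.span_base)
  have no: False if b: "b \<in> B - A" "?t b \<in> fv.span (B - {b})" for b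
  proof -
    have "s b \<in> fv.span (B - {b})" using s(1) sA[OF b(1)] b(1) by blast
    from fv.span_add[OF b(2) this] have "b \<in> fv.span (B - {b})" by simp
    thus False using out b(1) by blast
  qed
  have inj: "inj_on ?t (B - A)"
  proof (rule inj_onI)
    fix b c assume bc: "b \<in> B - A" "c \<in> B - A" "?t b = ?t c"
    show "b = c"
    proof (rule ccontr)
      assume "b \<noteq> c"
      hence "?t c \<in> fv.span (B - {b})" using tin[OF bc(1), of c] bc(2) by blast
      thus False using no[OF bc(1)] bc(3) by simp
    qed
  qed
  define C where "C = ?t ` (B - A)"
  have "\<not> fv.dependent C"
  proof
    assume "fv.dependent C"
    then obtain b where b: "b \<in> B - A" "?t b \<in> fv.span (C - {?t b})" unfolding fv.dependent_def C_def by blast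
    have "C - {?t b} \<subseteq> fv.span (B - {b})" using tin[OF b(1)] by (auto simp: C_def)
    hence "fv.span (C - {?t b}) \<subseteq> fv.span (B - {b})" using fv.span_minimal fv.subspace_span by blast
    thus False using no b by blast
  qed
  moreover have "finite C" unfolding C_def using Bf by simp
  ultimately have C: "cindep C" by (simp add: cindep_iff)
  have CV: "C \<subseteq> V"
  proof -
    have "fv.span A \<subseteq> V" using A B(1) V by (intro fv.span_minimal) auto
    thus ?thesis unfolding C_def using B(1) s(1) by (auto intro!: fv.subspace_diff[OF V])
  qed
  have lC: "ell c = 0" if "c \<in> C" for c using that s(2) by (auto simp: C_def l.diff)
  have "card B = card C + card E"
    unfolding C_def card_image[OF inj] cA[symmetric] using A Bf by (simp add: card_Diff_subset finite_subset card_mono)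
  with that[OF CV lC C E(1)] E(2) Ef show ?thesis by (auto simp: cindep_iff)
qed

lemma family_indep:
  assumes I: "finite I" and ind: "\<And>c i. (\<And>x. (\<Sum>i\<in>I. c i * L i x) = 0) \<Longrightarrow> i \<in> I \<Longrightarrow> c i = (0::complex)"
  shows "inj_on L I \<and> cindep (L ` I)"
proof -
  have inj: "inj_on L I"
  proof (rule inj_onI, rule ccontr)
    fix i j assume ij: "i \<in> I" "j \<in> I" "L i = L j" "i \<noteq> j"
    let ?c = "\<lambda>k. (if k = i then 1 else 0) - (if k = j then 1 else (0::complex))"
    have "(\<Sum>k\<in>I. ?c k * L k x) = 0" for x
    proof -
      have "(\<Sum>k\<in>I. ?c k * L k x) = (\<Sum>k\<in>I. (if k = i then L k x else 0) - (if k = j then L k x else 0))"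
        by (rule sum.cong) (auto simp: pointwise)
      also have "\<dots> = L i x - L j x" using I ij by (simp add: sum_subtractf sum.delta)
      finally show ?thesis using ij(3) by simp
    qed
    from ind[OF this ij(1)] show False using ij(4) by simp
  qed
  moreover have "cindep (L ` I)"
    unfolding cindep_def
  proof (intro conjI allI impI ballI)
    fix c b assume z: "\<forall>x. (\<Sum>b\<in>L ` I. c b * b x) = 0" and "b \<in> L ` I"
    then obtain i where i: "i \<in> I" "b = L i" by blast
    have "(\<Sum>i\<in>I. c (L i) * L i x) = 0" for x using z by (simp add: sum.reindex[OF inj])
    from ind[of "\<lambda>i. c (L i)", OF this i(1)] show "c b = 0" using i(2) by simp
  qed (use I in simp)
  ultimately show ?thesis by blast
qed

text \<open>A sum of possibly infinite dimensions is tested through finite lower bounds n p. An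
  infinite summand is covered by letting its own n p grow while the others are 0.\<close>

lemma sum_enat_le:
  fixes d :: "'p \<Rightarrow> enat"
  assumes P: "finite P" and le: "\<And>n. (\<And>p. p \<in> P \<Longrightarrow> enat (n p) \<le> d p) \<Longrightarrow> enat (\<Sum>p\<in>P. n p) \<le> Z"
  shows "(\<Sum>p\<in>P. d p) \<le> Z"
proof (cases "\<exists>p0\<in>P. d p0 = \<infinity>")
  case True
  then obtain p0 where p0: "p0 \<in> P" "d p0 = \<infinity>" by blast
  have "enat k \<le> Z" for k
    using le[of "\<lambda>p. if p = p0 then k else 0"] p0 P by (auto simp: sum.delta zero_enat_def[symmetric])
  hence "Z = \<infinity>" by (metis enat_ord_simps(4) not_infinity_eq Suc_ile_eq less_irrefl)
  thus ?thesis by simp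
next
  case False
  hence e: "enat (the_enat (d p)) = d p" if "p \<in> P" for p using that by (metis the_enat.simps not_infinity_eq)
  have "enat (\<Sum>p\<in>P. the_enat (d p)) = (\<Sum>p\<in>P. enat (the_enat (d p)))"
    using P by (induction P rule: finite_induct) (auto simp: zero_enat_def plus_enat_simps(1)[symmetric] simp del: plus_enat_simps)
  also have "\<dots> = (\<Sum>p\<in>P. d p)" by (rule sum.cong) (auto simp: e)
  finally show ?thesis using le[of "\<lambda>p. the_enat (d p)"] e by simp
qed

subsection \<open>Invariant elements and modular forms\<close>

lemma D_iff: "v \<in> D (int N) \<longleftrightarrow> dch_elem v \<and> (\<forall>p. v p \<noteq> (\<lambda>\<tau>. 0) \<longrightarrow> cweight p = N)"
proof
  assume v: "v \<in> D (int N)"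
  have s: "p \<in> mons (int N)" if "v p \<noteq> (\<lambda>\<tau>. 0)" for p
    using D_supp[OF v, of p] that unfolding zero_fun_def by blast
  have c: "v p \<in> Of" for p by (rule D_coeff[OF v])
  have "finite {p. v p \<noteq> (\<lambda>\<tau>. 0)}" by (rule finite_subset[OF _ finite_mons[of "int N"]]) (use s in blast)
  moreover have "0 \<notin># l \<and> 0 \<notin># m" if "v (l, m) \<noteq> (\<lambda>\<tau>. 0)" for l m using s[OF that] by (simp add: mons_def)
  moreover have "cweight p = N" if "v p \<noteq> (\<lambda>\<tau>. 0)" for p using s[OF that] by (simp add: mons_def)
  ultimately show "dch_elem v \<and> (\<forall>p. v p \<noteq> (\<lambda>\<tau>. 0) \<longrightarrow> cweight p = N)"
    using c unfolding dch_elem_def Of_def by blast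
next
  assume r: "dch_elem v \<and> (\<forall>p. v p \<noteq> (\<lambda>\<tau>. 0) \<longrightarrow> cweight p = N)"
  show "v \<in> D (int N)"
  proof (rule D_I)
    fix p
    show "v p \<in> Of" using r unfolding dch_elem_def Of_def by blast
    assume "v p \<noteq> 0"
    hence n: "v p \<noteq> (\<lambda>\<tau>. 0)" unfolding zero_fun_def .
    obtain l m where p: "p = (l, m)" by (cases p)
    have "0 \<notin># l \<and> 0 \<notin># m" using r n unfolding dch_elem_def p by blast
    moreover have "cweight p = N" using r n by blast
    ultimately show "p \<in> mons (int N)" by (simp add: mons_def p)
  qed
qed

lemma Lift_lead:
  assumes f: "hol f" and p: "p \<in> mons w" "mdeg p = int d"
  shows "Lift p d f - single p (rH f) \<in> FD w (int d + 1)" and "Lift p d f \<in> FD w (int d)"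
proof -
  note h = hol_div_Fw[OF f, of d]
  have e: "rH (\<lambda>\<tau>. Gw \<tau> ^ size (fst p) * (deriv Fp \<tau> ^ size (snd p) * (f \<tau> / Fw \<tau> ^ d))) = rH f"
  proof
    fix \<tau>
    have s: "size (snd p) = size (fst p) + d" using p(2) by (simp add: mdeg_def)
    show "rH (\<lambda>\<tau>. Gw \<tau> ^ size (fst p) * (deriv Fp \<tau> ^ size (snd p) * (f \<tau> / Fw \<tau> ^ d))) \<tau> = rH f \<tau>"
    proof (cases "\<tau> \<in> Hp")
      case True
      thus ?thesis using Fw(1)[OF True] unfolding s
        by (simp add: rH_def deriv_Fp Gw_def power_add power_one_over)
    qed (simp add: rH_def Hp_iff)
  qed
  show "Lift p d f - single p (rH f) \<in> FD w (int d + 1)" "Lift p d f \<in> FD w (int d)"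
    using lift_lead[OF hol_Gw hol_Pw hol_Fp h p(1)] unfolding e p(2) Lift_def Lw_def by blast+
qed

text \<open>Lifts are triangular: in degrees up to that of p the only coefficient is f itself, at p.
  This makes lifts of independent forms independent.\<close>

lemma Lift_coeff:
  assumes f: "hol f" and p: "p \<in> mons w" "mdeg p = int d" and q: "mdeg q \<le> int d"
  shows "Lift p d f q = (if q = p then rH f else 0)"
proof -
  have "(Lift p d f - single p (rH f)) q = 0"
    using FD_deg[OF Lift_lead(1)[OF f p], of q] q by linarith
  thus ?thesis by (simp add: minus_apply single_def split: if_splits)
qed

lemma Mk_iff: "f \<in> Mk k \<Gamma> \<longleftrightarrow> f \<in> Of \<and>
    (\<forall>g\<in>\<Gamma>. \<forall>\<tau>\<in>Hp. f (mob (to_rmat g) \<tau>) = jf (to_rmat g) \<tau> ^ k * f \<tau>) \<and>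
    (\<forall>g\<in>SL2Z. \<exists>N>0. RN N (\<lambda>\<tau>. f (mob (to_rmat g) \<tau>) / jf (to_rmat g) \<tau> ^ k))"
proof -
  have 1: "(case g of (a, b, c, d) \<Rightarrow> f (mob (to_rmat g) \<tau>) = (of_int c * \<tau> + of_int d) ^ k * f \<tau>) \<longleftrightarrow>
      f (mob (to_rmat g) \<tau>) = jf (to_rmat g) \<tau> ^ k * f \<tau>" for g \<tau>
    by (cases g) (simp add: jf_def to_rmat_def)
  have 2: "(\<lambda>\<tau>. case g of (a, b, c, d) \<Rightarrow> f (mob (to_rmat g) \<tau>) / (of_int c * \<tau> + of_int d) ^ k) =
      (\<lambda>\<tau>. f (mob (to_rmat g) \<tau>) / jf (to_rmat g) \<tau> ^ k)" for g
    by (cases g) (simp add: jf_def to_rmat_def)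
  have 3: "(\<exists>N>0. hol_expansion N F) \<longleftrightarrow> (\<exists>N>0. RN N F)" for F using hol_expansion_iff by blast
  show ?thesis unfolding Mk_def mem_Collect_eq 1 2 3 Of_def by blast
qed

lemma Lift_mem:
  assumes G: "\<Gamma> \<subseteq> SL2Z" and f: "f \<in> Mk (2 * d) \<Gamma>" and p: "p \<in> mons (int N)" "mdeg p = int d"
  shows "Lift p d f \<in> Dch_Gamma_wt \<Gamma> N"
proof -
  have hf: "hol f" using f by (simp add: Mk_iff Of_def)
  have D: "Lift p d k \<in> D (int N)" if "hol k" for k by (rule FD_D[OF Lift_lead(2)[OF that p]])
  have act: "pi_act (to_rmat g) (Lift p d k) =
      Lift p d (\<lambda>\<tau>. k (mob (to_rmat g) \<tau>) / jf (to_rmat g) \<tau> ^ (2 * d))" if "g \<in> SL2Z" "hol k" for g k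
    using pi_act_eq[OF sl2_to_rmat[OF that(1)] D[OF that(2)]] PIg_Lift[OF that p] by simp
  have inv: "pi_act (to_rmat g) (Lift p d f) = Lift p d f" if g: "g \<in> \<Gamma>" for g
  proof -
    have s: "g \<in> SL2Z" using G g by blast
    have "Lift p d (\<lambda>\<tau>. f (mob (to_rmat g) \<tau>) / jf (to_rmat g) \<tau> ^ (2 * d)) = Lift p d f"
      unfolding Lift_def
    proof (rule Lw_cong)
      fix \<tau> assume t: "\<tau> \<in> Hp"
      have "f (mob (to_rmat g) \<tau>) = jf (to_rmat g) \<tau> ^ (2 * d) * f \<tau>" using f g t unfolding Mk_iff by blast
      thus "f (mob (to_rmat g) \<tau>) / jf (to_rmat g) \<tau> ^ (2 * d) / Fw \<tau> ^ d = f \<tau> / Fw \<tau> ^ d"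
        using jf_nz[OF sl2_to_rmat[OF s] t] by simp
    qed
    thus ?thesis using act[OF s hf] by simp
  qed
  have cusp: "dch_hol_cusps (Lift p d f)" unfolding dch_hol_cusps_def
  proof
    fix \<rho> assume r: "\<rho> \<in> SL2Z"
    define k where "k = (\<lambda>\<tau>. f (mob (to_rmat \<rho>) \<tau>) / jf (to_rmat \<rho>) \<tau> ^ (2 * d))"
    obtain M where M: "M > 0" "RN M k" using f r unfolding Mk_iff k_def by blast
    have hk: "hol k" by (rule RN_hol[OF M(2,1)])
    have e: "pi_act (to_rmat \<rho>) (Lift p d f) = Lift p d k" using act[OF r hf] unfolding k_def .
    have T: "(1, real M, 0, 1) = to_rmat (1, int M, 0, 1)" by (simp add: to_rmat_def)
    have Ts: "(1, int M, 0, 1) \<in> SL2Z" by (simp add: SL2Z_def)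
    have "Lift p d (\<lambda>\<tau>. k (mob (to_rmat (1, int M, 0, 1)) \<tau>) / jf (to_rmat (1, int M, 0, 1)) \<tau> ^ (2 * d)) = Lift p d k"
      unfolding Lift_def
      by (rule Lw_cong) (use RN_periodic[OF M(2,1)] in \<open>simp add: mob_def jf_def to_rmat_def pointwise\<close>)
    hence "pi_act (1, real M, 0, 1) (Lift p d k) = Lift p d k" unfolding T act[OF Ts hk] .
    moreover have "hol_expansion M (Lift p d k q)" for q
      unfolding hol_expansion_iff[OF M(1)] by (rule CR_Lift[OF M(2,1) p])
    ultimately show "\<exists>N>0. pi_act (1, real N, 0, 1) (pi_act (to_rmat \<rho>) (Lift p d f)) = pi_act (to_rmat \<rho>) (Lift p d f)
        \<and> (\<forall>q. hol_expansion N (pi_act (to_rmat \<rho>) (Lift p d f) q))"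
      unfolding e using M(1) by blast
  qed
  show ?thesis unfolding Dch_Gamma_wt_def using D[OF hf] inv cusp unfolding D_iff by blast
qed

lemma PIg_add: "sl2 g \<Longrightarrow> x \<in> D w \<Longrightarrow> y \<in> D w \<Longrightarrow> PIg g (x + y) = PIg g x + PIg g y"
  unfolding PIg_def by (rule coordinate_change.PI_plus[OF coordinate_change_mob])

lemma scale_eq_fn: "v \<in> D w \<Longrightarrow> (\<lambda>p \<tau>. c * v p \<tau>) = fn (\<lambda>_. c) * v"
  using D_coeff[of v w] by (intro ext) (auto simp: times_fun_def fn_apply Of_def not_less)

lemma scale_D: assumes "v \<in> D w" shows "(\<lambda>p \<tau>. c * v p \<tau>) \<in> D w"
proof (rule D_I)
  fix p
  show "(\<lambda>\<tau>. c * v p \<tau>) \<in> Of" using D_coeff[OF assms, of p] by (auto simp: Of_def intro!: holomorphic_intros)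
  assume "(\<lambda>\<tau>. c * v p \<tau>) \<noteq> 0"
  hence "v p \<noteq> 0" by (auto simp: fun_eq_iff pointwise)
  thus "p \<in> mons w" by (rule D_supp[OF assms])
qed

lemma PIg_scale: assumes g: "sl2 g" and v: "v \<in> D w"
  shows "PIg g (\<lambda>p \<tau>. c * v p \<tau>) = (\<lambda>p \<tau>. c * PIg g v p \<tau>)"
proof -
  interpret coordinate_change "hg g" "qg g" "mob g" by (rule coordinate_change_mob[OF g])
  have "PI (hb (\<lambda>_. c) 0 v) = hb (\<lambda>_. c) 0 (PI v)" using PI_hb[OF v, of "\<lambda>_. c" 0] by simp
  thus ?thesis unfolding PIg_def
    by (simp add: hb_const[OF v] hb_const[OF PI_D[OF v]] scale_eq_fn[OF v] scale_eq_fn[OF PI_D[OF v]])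
qed

text \<open>Invariant elements with expansions at all cusps, supported on a set P of monomials.
  Letting P vary allows monomials to be struck out one at a time.\<close>

definition Vg :: "imat set \<Rightarrow> nat \<Rightarrow> mon set \<Rightarrow> dch set" where
  "Vg \<Gamma> N P = {v \<in> D (int N). (\<forall>p. v p \<noteq> 0 \<longrightarrow> p \<in> P) \<and> (\<forall>g\<in>\<Gamma>. PIg (to_rmat g) v = v) \<and>
     (\<forall>\<rho>\<in>SL2Z. \<exists>M>0. \<forall>p. RN M (PIg (to_rmat \<rho>) v p))}"

lemma Dch_Vg: assumes G: "\<Gamma> \<subseteq> SL2Z" shows "Dch_Gamma_wt \<Gamma> N \<subseteq> Vg \<Gamma> N (mons (int N))"
proof
  fix v assume v: "v \<in> Dch_Gamma_wt \<Gamma> N"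
  have D: "v \<in> D (int N)" using v unfolding Dch_Gamma_wt_def D_iff by blast
  have e: "pi_act (to_rmat g) v = PIg (to_rmat g) v" if "g \<in> SL2Z" for g
    by (rule pi_act_eq[OF sl2_to_rmat[OF that] D])
  have "PIg (to_rmat g) v = v" if "g \<in> \<Gamma>" for g
    using v that e[of g] G unfolding Dch_Gamma_wt_def by auto
  moreover have "\<exists>M>0. \<forall>p. RN M (PIg (to_rmat \<rho>) v p)" if r: "\<rho> \<in> SL2Z" for \<rho>
  proof -
    obtain M where "M > 0" "\<forall>p. hol_expansion M (pi_act (to_rmat \<rho>) v p)"
      using v r unfolding Dch_Gamma_wt_def dch_hol_cusps_def by blast
    thus ?thesis unfolding e[OF r] using hol_expansion_iff by blast
  qed
  ultimately show "v \<in> Vg \<Gamma> N (mons (int N))" unfolding Vg_def using D D_supp[OF D] by blast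
qed

text \<open>Vectors are uncurried to scalar functions of a monomial and a point, the form in which
  \<open>cdim\<close> measures them.\<close>

lemma subspace_Vg: assumes G: "\<Gamma> \<subseteq> SL2Z" shows "fv.subspace {F. curry F \<in> Vg \<Gamma> N P}"
proof -
  have s: "sl2 (to_rmat g)" if "g \<in> \<Gamma>" for g using that G sl2_to_rmat by blast
  have PI0: "PIg g 0 = 0" if "sl2 g" for g
    using PIg_add[OF that, of 0 "int N" 0] by simp
  have z: "0 \<in> Vg \<Gamma> N P"
  proof -
    have "0 \<in> D (int N)" using sgp_S[of "int N" "int N"] by (simp add: sgp_def)
    moreover have "PIg (to_rmat g) 0 = 0" if "g \<in> \<Gamma>" for g by (rule PI0[OF s[OF that]])
    moreover have "\<exists>M>0. \<forall>p. RN M (PIg (to_rmat \<rho>) 0 p)" if "\<rho> \<in> SL2Z" for \<rho>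
      unfolding PI0[OF sl2_to_rmat[OF that]]
      by (intro exI[of _ "1::nat"]) (simp add: zero_fun_def RN_const)
    moreover have "(0 :: dch) p = 0" for p by (simp add: pointwise)
    ultimately show ?thesis unfolding Vg_def by blast
  qed
  have a: "x + y \<in> Vg \<Gamma> N P" if x: "x \<in> Vg \<Gamma> N P" and y: "y \<in> Vg \<Gamma> N P" for x y
  proof -
    have D: "x \<in> D (int N)" "y \<in> D (int N)" using x y by (auto simp: Vg_def)
    have "p \<in> P" if "(x + y) p \<noteq> 0" for p
    proof -
      have "x p \<noteq> 0 \<or> y p \<noteq> 0" using that by (auto simp: plus_fun_apply)
      thus ?thesis using x y unfolding Vg_def by blast
    qed
    moreover have "PIg (to_rmat g) (x + y) = x + y" if "g \<in> \<Gamma>" for g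
    proof -
      have "PIg (to_rmat g) x = x" "PIg (to_rmat g) y = y" using x y that unfolding Vg_def by blast+
      thus ?thesis by (simp add: PIg_add[OF s[OF that] D])
    qed
    moreover have "\<exists>M>0. \<forall>p. RN M (PIg (to_rmat \<rho>) (x + y) p)" if r: "\<rho> \<in> SL2Z" for \<rho>
    proof -
      obtain M1 where M1: "M1 > 0" "\<And>p. RN M1 (PIg (to_rmat \<rho>) x p)" using x r unfolding Vg_def by blast
      obtain M2 where M2: "M2 > 0" "\<And>p. RN M2 (PIg (to_rmat \<rho>) y p)" using y r unfolding Vg_def by blast
      have "PIg (to_rmat \<rho>) (x + y) p = (\<lambda>\<tau>. PIg (to_rmat \<rho>) x p \<tau> + PIg (to_rmat \<rho>) y p \<tau>)" for p
        unfolding PIg_add[OF sl2_to_rmat[OF r] D] by (simp add: plus_fun_def)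
      \<comment> \<open>Different elements may have different periods at the same cusp; the product
        of the periods serves both.\<close>
      hence "RN (M1 * M2) (PIg (to_rmat \<rho>) (x + y) p)" for p
        using RN_add[OF RN_scale[OF M1(2) M2(1)] RN_scale'[OF M2(2) M1(1)], of p p] by simp
      moreover have "M1 * M2 > 0" using M1(1) M2(1) by simp
      ultimately show ?thesis by blast
    qed
    ultimately show ?thesis unfolding Vg_def using sgp_add[OF sgp_S D] by blast
  qed
  have sc: "(\<lambda>p \<tau>. c * x p \<tau>) \<in> Vg \<Gamma> N P" if x: "x \<in> Vg \<Gamma> N P" for c x
  proof -
    have D: "x \<in> D (int N)" using x by (auto simp: Vg_def)
    have "p \<in> P" if "(\<lambda>\<tau>. c * x p \<tau>) \<noteq> 0" for p
    proof -
      have "x p \<noteq> 0" using that by (auto simp: fun_eq_iff pointwise)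
      thus ?thesis using x unfolding Vg_def by blast
    qed
    moreover have "PIg (to_rmat g) (\<lambda>p \<tau>. c * x p \<tau>) = (\<lambda>p \<tau>. c * x p \<tau>)" if "g \<in> \<Gamma>" for g
    proof -
      have "PIg (to_rmat g) x = x" using x that unfolding Vg_def by blast
      thus ?thesis by (simp add: PIg_scale[OF s[OF that] D])
    qed
    moreover have "\<exists>M>0. \<forall>p. RN M (PIg (to_rmat \<rho>) (\<lambda>p \<tau>. c * x p \<tau>) p)" if r: "\<rho> \<in> SL2Z" for \<rho>
    proof -
      obtain M where M: "M > 0" "\<And>p. RN M (PIg (to_rmat \<rho>) x p)" using x r unfolding Vg_def by blast
      have "RN M (PIg (to_rmat \<rho>) (\<lambda>p \<tau>. c * x p \<tau>) p)" for p
        unfolding PIg_scale[OF sl2_to_rmat[OF r] D] by (rule RN_mult[OF RN_const M(2)])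
      thus ?thesis using M(1) by blast
    qed
    ultimately show ?thesis unfolding Vg_def using scale_D[OF D] by blast
  qed
  have c0: "curry 0 = (0 :: dch)" by (simp add: fun_eq_iff curry_def pointwise)
  have ca: "curry (F + H) = (curry F + curry H :: dch)" for F H by (simp add: fun_eq_iff curry_def pointwise)
  have cs: "curry (\<lambda>x. c * F x) = (\<lambda>p \<tau>. c * curry F p \<tau>)" for c :: complex and F :: "mon \<times> complex \<Rightarrow> complex"
    by (simp add: fun_eq_iff curry_def)
  show ?thesis
    unfolding fv.subspace_def mem_Collect_eq
  proof (intro conjI ballI allI; (unfold mem_Collect_eq)?)
    show "curry 0 \<in> Vg \<Gamma> N P" unfolding c0 by (rule z)
  next
    fix F H :: "mon \<times> complex \<Rightarrow> complex"
    assume "curry F \<in> Vg \<Gamma> N P" "curry H \<in> Vg \<Gamma> N P"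
    thus "curry (F + H) \<in> Vg \<Gamma> N P" unfolding ca by (rule a)
  next
    fix c and F :: "mon \<times> complex \<Rightarrow> complex"
    assume "curry F \<in> Vg \<Gamma> N P"
    thus "curry (\<lambda>x. c * F x) \<in> Vg \<Gamma> N P" unfolding cs by (rule sc)
  qed
qed

text \<open>A monomial of least degree receives no contribution from the others under the action, so
  its coefficient obeys the exact modular law. For negative degree the weight is negative and the
  coefficient vanishes.\<close>

lemma Vg_lead:
  assumes G: "congruence_subgroup \<Gamma>" and v: "v \<in> Vg \<Gamma> N P" and P: "P \<subseteq> mons (int N)" "p \<in> P"
    and min: "\<And>q. q \<in> P \<Longrightarrow> mdeg p \<le> mdeg q"
  shows "0 \<le> mdeg p \<Longrightarrow> v p \<in> Mk (2 * nat (mdeg p)) \<Gamma>" and "mdeg p < 0 \<Longrightarrow> v p = 0"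
proof -
  have GS: "\<Gamma> \<subseteq> SL2Z" using G by (simp add: congruence_subgroup_def)
  have D: "v \<in> D (int N)" using v by (simp add: Vg_def)
  have F: "v \<in> FD (int N) (mdeg p)"
    by (rule FD_I[OF D], rule min) (use v in \<open>unfold Vg_def, blast\<close>)
  have O: "v p \<in> Of" by (rule D_coeff[OF D])
  have pm: "p \<in> mons (int N)" using P by blast
  have lead: "PIg (to_rmat g) v p \<tau> = v p (mob (to_rmat g) \<tau>) * jf (to_rmat g) \<tau> powi (- 2 * mdeg p)"
    if "g \<in> SL2Z" "\<tau> \<in> Hp" for g \<tau>
    by (rule PIg_lead[OF sl2_to_rmat[OF that(1)] F pm refl that(2)])
  have inv: "v p (mob (to_rmat g) \<tau>) * jf (to_rmat g) \<tau> powi (- 2 * mdeg p) = v p \<tau>" if "g \<in> \<Gamma>" "\<tau> \<in> Hp" for g \<tau>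
  proof -
    have "PIg (to_rmat g) v = v" using v that(1) unfolding Vg_def by blast
    thus ?thesis using lead[of g \<tau>] that GS by auto
  qed
  have cusp: "\<exists>M>0. RN M (\<lambda>\<tau>. v p (mob (to_rmat g) \<tau>) * jf (to_rmat g) \<tau> powi (- 2 * mdeg p))" if g: "g \<in> SL2Z" for g
  proof -
    obtain M where M: "M > 0" "RN M (PIg (to_rmat g) v p)" using v g unfolding Vg_def by blast
    show ?thesis by (rule exI[of _ M], rule conjI[OF M(1) RN_cong[OF lead[OF g] M(2)]])
  qed
  { assume "0 \<le> mdeg p"
    then obtain d where d: "mdeg p = int d" using nonneg_int_cases by blast
    have m: "- 2 * mdeg p = - int (2 * d)" by (simp add: d)
    have pw: "x powi (- 2 * mdeg p) = inverse (x ^ (2 * d))" for x :: complex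
      unfolding m power_int_minus power_int_of_nat ..
    have m: "v p (mob (to_rmat g) \<tau>) = jf (to_rmat g) \<tau> ^ (2 * d) * v p \<tau>" if g: "g \<in> \<Gamma>" "\<tau> \<in> Hp" for g \<tau>
    proof -
      have "jf (to_rmat g) \<tau> \<noteq> 0" by (rule jf_nz[OF sl2_to_rmat]) (use g GS in auto)
      moreover have "v p (mob (to_rmat g) \<tau>) / jf (to_rmat g) \<tau> ^ (2 * d) = v p \<tau>"
        using inv[OF g] unfolding pw divide_inverse .
      ultimately show ?thesis by (simp add: divide_eq_eq mult.commute)
    qed
    have n: "nat (mdeg p) = d" by (simp add: d)
    show "v p \<in> Mk (2 * nat (mdeg p)) \<Gamma>"
      unfolding n Mk_iff divide_inverse using O m cusp[unfolded pw] by (intro conjI ballI)}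
  { assume neg: "mdeg p < 0"
    define e where "e = nat (- mdeg p)"
    have m: "- 2 * mdeg p = int (2 * e)" and e: "e > 0" using neg by (auto simp: e_def)
    have pw: "x powi (- 2 * mdeg p) = x ^ (2 * e)" for x :: complex unfolding m power_int_of_nat ..
    have "v p \<tau> = 0" if "\<tau> \<in> Hp" for \<tau>
      by (rule negative_weight[OF G e _ _ that]) (use inv cusp in \<open>unfold pw, blast+\<close>)
    moreover have "v p \<tau> = 0" if "\<tau> \<notin> Hp" for \<tau> using O that by (simp add: Of_def Hp_iff)
    ultimately show "v p = 0" by (auto simp: fun_eq_iff pointwise) }
qed

definition dimM :: "imat set \<Rightarrow> mon \<Rightarrow> enat" where
  "dimM \<Gamma> p = (if 0 \<le> mdeg p then cdim (Mk (2 * nat (mdeg p)) \<Gamma>) else 0)"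

lemma cindep_0: "cindep B \<Longrightarrow> B \<subseteq> {0} \<Longrightarrow> B = {}"
  unfolding cindep_iff using fv.dependent_zero[of B] by blast

lemma ex_min_mdeg: assumes "finite P" "P \<noteq> {}" shows "\<exists>p\<in>P. \<forall>q\<in>P. mdeg p \<le> mdeg q"
proof (rule bexI[of _ "arg_min_on mdeg P"])
  show "\<forall>q\<in>P. mdeg (arg_min_on mdeg P) \<le> mdeg q" using arg_min_least[OF assms] by blast
qed (rule arg_min_if_finite(1)[OF assms])

text \<open>Taking the coefficient of a monomial p of least degree is a linear map into modular
  forms of weight twice its degree, or to 0. Its kernel consists of elements supported on P without
  p, where the induction hypothesis applies.\<close>

lemma Vg_dim:
  assumes G: "congruence_subgroup \<Gamma>" and "finite P" "P \<subseteq> mons (int N)" "B \<subseteq> {F. curry F \<in> Vg \<Gamma> N P}" "cindep B"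
  shows "enat (card B) \<le> (\<Sum>p\<in>P. dimM \<Gamma> p)"
  using assms(2-)
proof (induction P arbitrary: B rule: finite_psubset_induct)
  case (psubset P)
  have GS: "\<Gamma> \<subseteq> SL2Z" using G by (simp add: congruence_subgroup_def)
  show ?case
  proof (cases "P = {}")
    case True
    have "F = 0" if "F \<in> B" for F
    proof -
      have "curry F p = 0" for p using that psubset.prems(2) True unfolding Vg_def by blast
      hence "F (p, \<tau>) = 0" for p \<tau> by (auto simp: fun_eq_iff curry_def pointwise)
      thus ?thesis by (auto simp: fun_eq_iff pointwise)
    qed
    hence "B = {}" using cindep_0[OF psubset.prems(3)] by blast
    thus ?thesis by (simp add: zero_enat_def[symmetric])
  next
    case False
    from ex_min_mdeg[OF psubset.hyps(1) False]
    obtain p where p: "p \<in> P" and min: "\<And>q. q \<in> P \<Longrightarrow> mdeg p \<le> mdeg q" by (elim bexE) blast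
    define ell where "ell F = (\<lambda>\<tau>. F (p, \<tau>))" for F :: "mon \<times> complex \<Rightarrow> complex"
    have lin: "Vector_Spaces.linear (\<lambda>c f x. c * f x) (\<lambda>c f x. c * f x) ell"
      by unfold_locales (auto simp: ell_def fun_eq_iff algebra_simps pointwise)
    from rank_nullity[OF psubset.prems(2,3) subspace_Vg[OF GS] lin]
    obtain C E where CE: "C \<subseteq> {F. curry F \<in> Vg \<Gamma> N P}" "\<And>c. c \<in> C \<Longrightarrow> ell c = 0" "cindep C"
        "E \<subseteq> ell ` B" "cindep E" "card B = card C + card E" by blast
    have "C \<subseteq> {F. curry F \<in> Vg \<Gamma> N (P - {p})}"
    proof
      fix F assume F: "F \<in> C"
      have "curry F p = 0" using CE(2)[OF F] by (simp add: ell_def curry_def)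
      thus "F \<in> {F. curry F \<in> Vg \<Gamma> N (P - {p})}" using CE(1) F unfolding Vg_def by blast
    qed
    hence C: "enat (card C) \<le> (\<Sum>q\<in>P - {p}. dimM \<Gamma> q)"
      using psubset.IH[of "P - {p}" C] p psubset.prems(1) CE(3) by blast
    have l: "\<exists>v. v \<in> Vg \<Gamma> N P \<and> e = v p" if e: "e \<in> E" for e
    proof -
      obtain F where "F \<in> B" "e = ell F" using CE(4) e by blast
      hence "curry F \<in> Vg \<Gamma> N P \<and> e = curry F p" using psubset.prems(2) by (auto simp: ell_def curry_def)
      thus ?thesis by blast
    qed
    have E: "enat (card E) \<le> dimM \<Gamma> p"
    proof (cases "0 \<le> mdeg p")
      case True
      have "E \<subseteq> Mk (2 * nat (mdeg p)) \<Gamma>"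
        using l Vg_lead(1)[OF G _ psubset.prems(1) p min True] by blast
      thus ?thesis using cdim_ge[OF _ CE(5)] True by (simp add: dimM_def)
    next
      case False
      hence "mdeg p < 0" by simp
      hence "E \<subseteq> {0}" using l Vg_lead(2)[OF G _ psubset.prems(1) p min] by blast
      hence "E = {}" by (rule cindep_0[OF CE(5)])
      thus ?thesis by (simp add: zero_enat_def[symmetric])
    qed
    have "enat (card B) = enat (card E) + enat (card C)" by (simp add: CE(6))
    also have "\<dots> \<le> dimM \<Gamma> p + (\<Sum>q\<in>P - {p}. dimM \<Gamma> q)" by (rule add_mono[OF E C])
    also have "\<dots> = (\<Sum>q\<in>P. dimM \<Gamma> q)" by (rule sum.remove[symmetric]) (use psubset.hyps(1) p in auto)
    finally show ?thesis .
  qed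
qed

lemma case_prod_image: "(\<lambda>v. case_prod v) ` V = {F. curry F \<in> V}"
proof (intro set_eqI iffI)
  fix F assume "F \<in> {F. curry F \<in> V}"
  thus "F \<in> (\<lambda>v. case_prod v) ` V" by (intro image_eqI[of _ _ "curry F"]) auto
qed auto

text \<open>Choose any finite numbers below the dimensions of the spaces of forms, one for each
  monomial, and independent forms in these numbers; their lifts are invariant elements and
  independent.\<close>

lemma cdim_Dch_ge:
  assumes G: "congruence_subgroup \<Gamma>"
  shows "(\<Sum>p\<in>mons (int N). dimM \<Gamma> p) \<le> cdim ((\<lambda>v. case_prod v) ` Dch_Gamma_wt \<Gamma> N)"
proof (rule sum_enat_le[OF finite_mons])
  have GS: "\<Gamma> \<subseteq> SL2Z" using G by (simp add: congruence_subgroup_def)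
  fix n assume n: "\<And>p. p \<in> mons (int N) \<Longrightarrow> enat (n p) \<le> dimM \<Gamma> p"
  let ?P = "{p \<in> mons (int N). 0 \<le> mdeg p}"
  have Pf: "finite ?P" using finite_mons by simp
  have deg: "mdeg p = int (nat (mdeg p))" if "p \<in> ?P" for p using that by simp
  have "\<forall>p\<in>?P. \<exists>B. B \<subseteq> Mk (2 * nat (mdeg p)) \<Gamma> \<and> cindep B \<and> card B = n p"
  proof
    fix p assume "p \<in> ?P"
    hence "enat (n p) \<le> cdim (Mk (2 * nat (mdeg p)) \<Gamma>)" using n[of p] by (simp add: dimM_def)
    thus "\<exists>B. B \<subseteq> Mk (2 * nat (mdeg p)) \<Gamma> \<and> cindep B \<and> card B = n p" by (rule cdim_attained)
  qed
  from bchoice[OF this] obtain B where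
    B: "\<And>p. p \<in> ?P \<Longrightarrow> B p \<subseteq> Mk (2 * nat (mdeg p)) \<Gamma>" "\<And>p. p \<in> ?P \<Longrightarrow> cindep (B p)"
       "\<And>p. p \<in> ?P \<Longrightarrow> card (B p) = n p" by blast
  have Bf: "finite (B p)" if "p \<in> ?P" for p using B(2)[OF that] by (simp add: cindep_def)
  define I where "I = Sigma ?P B"
  define L where "L i = case_prod (Lift (fst i) (nat (mdeg (fst i))) (snd i))" for i
  have fin: "finite I" unfolding I_def using Pf Bf by (intro finite_SigmaI)
  have ind: "c i = 0" if z: "\<And>x. (\<Sum>i\<in>I. c i * L i x) = 0" and i: "i \<in> I" for c i
  proof (rule ccontr)
    assume ci: "c i \<noteq> 0"
    \<comment> \<open>Among the monomials that occur in a relation, one of least degree is examined: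
      by triangularity the relation at its coefficient involves only the forms chosen for
      it.\<close>
    let ?Q = "{p \<in> ?P. \<exists>b\<in>B p. c (p, b) \<noteq> 0}"
    obtain p0 b0 where i': "i = (p0, b0)" by (cases i)
    have "p0 \<in> ?Q" using i ci unfolding i' I_def by auto
    hence Q0: "?Q \<noteq> {}" by blast
    have "finite ?Q" by (rule finite_subset[OF _ Pf]) auto
    from ex_min_mdeg[OF this Q0]
    obtain q where q: "q \<in> ?Q" and min: "\<And>p. p \<in> ?Q \<Longrightarrow> mdeg q \<le> mdeg p" by (elim bexE) blast
    have qP: "q \<in> ?P" using q by blast
    have "(\<Sum>b\<in>B q. c (q, b) * b \<tau>) = 0" for \<tau>
    proof -
      have inner: "(\<Sum>b\<in>B p. c (p, b) * Lift p (nat (mdeg p)) b q \<tau>) = (if p = q then \<Sum>b\<in>B q. c (q, b) * b \<tau> else 0)"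
        if p: "p \<in> ?P" for p
      proof (cases "p \<in> ?Q")
        case True
        have lc: "Lift p (nat (mdeg p)) b q \<tau> = (if q = p then b \<tau> else 0)" if b: "b \<in> B p" for b
        proof -
          have O: "b \<in> Of" using B(1)[OF p] b by (auto simp: Mk_iff)
          hence h: "hol b" by (simp add: Of_def)
          have m: "p \<in> mons (int N)" using p by simp
          have dq: "mdeg q \<le> int (nat (mdeg p))" using min[OF True] by simp
          show ?thesis unfolding Lift_coeff[OF h m deg[OF p] dq] Of_rH[OF O] by (simp add: pointwise)
        qed
        show ?thesis by (auto simp: lc pointwise)
      next
        case False
        hence "c (p, b) = 0" if "b \<in> B p" for b using p that by blast
        moreover have "p \<noteq> q" using False q by blast
        ultimately show ?thesis by (simp add: pointwise)
      qed
      have "0 = (\<Sum>i\<in>I. c i * L i (q, \<tau>))" using z by simp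
      also have "\<dots> = (\<Sum>p\<in>?P. \<Sum>b\<in>B p. c (p, b) * Lift p (nat (mdeg p)) b q \<tau>)"
        unfolding I_def using Pf Bf by (subst sum.Sigma) (auto simp: L_def intro!: sum.cong)
      also have "\<dots> = (\<Sum>p\<in>?P. if p = q then \<Sum>b\<in>B q. c (q, b) * b \<tau> else 0)"
        by (rule sum.cong[OF refl inner])
      also have "\<dots> = (\<Sum>b\<in>B q. c (q, b) * b \<tau>)" unfolding sum.delta[OF Pf] using qP by simp
      finally show ?thesis by simp
    qed
    hence "\<forall>b\<in>B q. c (q, b) = 0" using B(2)[OF qP] unfolding cindep_def by (metis (no_types))
    thus False using q by blast
  qed
  have fi: "inj_on L I \<and> cindep (L ` I)" by (rule family_indep[OF fin]) (rule ind)
  have sub: "L ` I \<subseteq> (\<lambda>v. case_prod v) ` Dch_Gamma_wt \<Gamma> N"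
  proof
    fix F assume "F \<in> L ` I"
    then obtain p b where pb: "p \<in> ?P" "b \<in> B p" "F = case_prod (Lift p (nat (mdeg p)) b)"
      by (auto simp: I_def L_def)
    have "Lift p (nat (mdeg p)) b \<in> Dch_Gamma_wt \<Gamma> N"
      by (rule Lift_mem[OF GS _ _ deg[OF pb(1)]]) (use B(1)[OF pb(1)] pb(1,2) in auto)
    thus "F \<in> (\<lambda>v. case_prod v) ` Dch_Gamma_wt \<Gamma> N" unfolding pb(3) by (rule imageI)
  qed
  have "(\<Sum>p\<in>mons (int N). n p) = (\<Sum>p\<in>?P. n p)"
  proof (rule sum.mono_neutral_right[OF finite_mons])
    show "\<forall>p\<in>mons (int N) - ?P. n p = 0"
    proof
      fix p assume "p \<in> mons (int N) - ?P"
      hence "enat (n p) \<le> 0" using n[of p] by (simp add: dimM_def)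
      thus "n p = 0" by (simp add: zero_enat_def)
    qed
  qed auto
  also have "\<dots> = (\<Sum>p\<in>?P. card (B p))" by (rule sum.cong) (use B(3) in auto)
  also have "\<dots> = card I" unfolding I_def by (rule card_SigmaI[symmetric]) (use Pf Bf in auto)
  also have "\<dots> = card (L ` I)" using fi by (simp add: card_image)
  finally show "enat (\<Sum>p\<in>mons (int N). n p) \<le> cdim ((\<lambda>v. case_prod v) ` Dch_Gamma_wt \<Gamma> N)"
    using cdim_ge[OF sub] fi by simp
qed

lemma cdim_Dch:
  assumes G: "congruence_subgroup \<Gamma>"
  shows "cdim ((\<lambda>v. case_prod v) ` Dch_Gamma_wt \<Gamma> N) = (\<Sum>p\<in>mons (int N). dimM \<Gamma> p)"
proof (rule antisym[OF cdim_le cdim_Dch_ge[OF G]])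
  fix B assume B: "B \<subseteq> (\<lambda>v. case_prod v) ` Dch_Gamma_wt \<Gamma> N" "cindep B"
  have "\<Gamma> \<subseteq> SL2Z" using G by (simp add: congruence_subgroup_def)
  hence "B \<subseteq> {F. curry F \<in> Vg \<Gamma> N (mons (int N))}" using B(1) Dch_Vg[of \<Gamma> N] unfolding case_prod_image by blast
  thus "enat (card B) \<le> (\<Sum>p\<in>mons (int N). dimM \<Gamma> p)" by (rule Vg_dim[OF G finite_mons order_refl _ B(2)])
qed

lemma ereal_of_enat_sum: "ereal_of_enat (\<Sum>x\<in>A. f x) = (\<Sum>x\<in>A. ereal_of_enat (f x))"
  by (induction A rule: infinite_finite_induct) (auto simp: ereal_of_enat_add)

lemma ereal_sum_const: "finite A \<Longrightarrow> 0 \<le> c \<Longrightarrow> (\<Sum>x\<in>A. c) = c * ereal (real (card A))"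
proof (induction A rule: finite_induct)
  case (insert x A)
  have "ereal (real (card (insert x A))) = 1 + ereal (real (card A))" using insert(1,2) by (simp add: one_ereal_def)
  moreover have "(\<Sum>y\<in>insert x A. c) = c + c * ereal (real (card A))" using insert by simp
  moreover have "c * (1 + ereal (real (card A))) = c + c * ereal (real (card A))" by (subst ereal_right_distrib) auto
  ultimately show ?case by simp
qed simp

theorem theorem1p1:
  fixes \<Gamma> :: "imat set"
  assumes "congruence_subgroup \<Gamma>"
  shows "\<forall>N. ereal_of_enat (cdim ((\<lambda>v. case_prod v) ` Dch_Gamma_wt \<Gamma> N))
           = (\<Sum>m\<le>N. \<Sum>n\<le>N. ereal_of_enat (cdim (Mk (2 * m) \<Gamma>)) * ereal (fps_nth (Gser m n) N))"
proof
  fix N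
  let ?P = "{p \<in> mons (int N). 0 \<le> mdeg p}"
  let ?c = "\<lambda>m. ereal_of_enat (cdim (Mk (2 * m) \<Gamma>))"
  let ?key = "\<lambda>p. (nat (mdeg p), size (fst p))"
  have Pf: "finite ?P" using finite_mons by simp
  have "ereal_of_enat (cdim ((\<lambda>v. case_prod v) ` Dch_Gamma_wt \<Gamma> N)) = (\<Sum>p\<in>mons (int N). ereal_of_enat (dimM \<Gamma> p))"
    unfolding cdim_Dch[OF assms] ereal_of_enat_sum ..
  also have "\<dots> = (\<Sum>p\<in>?P. ereal_of_enat (dimM \<Gamma> p))"
    by (rule sum.mono_neutral_right[OF finite_mons]) (auto simp: dimM_def)
  also have "\<dots> = (\<Sum>p\<in>?P. ?c (nat (mdeg p)))" by (rule sum.cong) (auto simp: dimM_def)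
  also have "\<dots> = (\<Sum>y\<in>{..N} \<times> {..N}. \<Sum>p\<in>{p \<in> ?P. ?key p = y}. ?c (nat (mdeg p)))"
  \<comment> \<open>Grouping by degree m and number n of a factors. All parts are positive, so
    neither index exceeds the weight N, which is why the finite range of the double sum is
    complete.\<close>
  proof (rule sum.group[OF Pf, symmetric])
    show "?key ` ?P \<subseteq> {..N} \<times> {..N}"
    proof (rule image_subsetI)
      fix p assume p: "p \<in> ?P"
      have "size (fst p) \<le> sum_mset (fst p)" "size (snd p) \<le> sum_mset (snd p)"
        using p by (auto simp: mons_def intro: size_le_sum_mset)
      moreover have "sum_mset (fst p) + sum_mset (snd p) = N" using p unfolding mons_def cweight_def by (simp del: of_nat_add of_nat_sum_mset)
      ultimately show "?key p \<in> {..N} \<times> {..N}" by (simp add: mdeg_def)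
    qed
  qed simp
  also have "\<dots> = (\<Sum>m\<le>N. \<Sum>n\<le>N. \<Sum>p\<in>{p \<in> ?P. ?key p = (m, n)}. ?c (nat (mdeg p)))"
    by (simp only: sum.cartesian_product split_def prod.collapse)
  also have "\<dots> = (\<Sum>m\<le>N. \<Sum>n\<le>N. ?c m * ereal (fps_nth (Gser m n) N))"
  proof (intro sum.cong refl)
    fix m n
    have e: "{p \<in> ?P. ?key p = (m, n)} = {p \<in> mons (int N). size (fst p) = n \<and> size (snd p) = m + n}"
      by (auto simp: mdeg_def)
    have "(\<Sum>p\<in>{p \<in> ?P. ?key p = (m, n)}. ?c (nat (mdeg p))) = (\<Sum>p\<in>{p \<in> ?P. ?key p = (m, n)}. ?c m)"
    proof (rule sum.cong[OF refl])
      fix p assume "p \<in> {p \<in> ?P. ?key p = (m, n)}"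
      hence "nat (mdeg p) = m" by simp
      thus "?c (nat (mdeg p)) = ?c m" by (simp only:)
    qed
    also have "\<dots> = ?c m * ereal (real (card {p \<in> ?P. ?key p = (m, n)}))"
      by (rule ereal_sum_const, rule finite_subset[OF _ Pf]) (blast, simp)
    finally show "(\<Sum>p\<in>{p \<in> ?P. ?key p = (m, n)}. ?c (nat (mdeg p))) = ?c m * ereal (fps_nth (Gser m n) N)"
      unfolding Gser_nth e .
  qed
  finally show "ereal_of_enat (cdim ((\<lambda>v. case_prod v) ` Dch_Gamma_wt \<Gamma> N)) =
      (\<Sum>m\<le>N. \<Sum>n\<le>N. ?c m * ereal (fps_nth (Gser m n) N))" .
qed

end
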